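(* Let $n\ge 1$, $-1<p\le q$, $0<\lambda<\Lambda$, $\alpha\in(0,1]$, $C_0>0$, $C_f>0$, and let $F=F(M,z,x)$ and $f=f(x,z)$ satisfy the structural assumptions (A1), (A2), (A3) and (A4) listed in the context on the domain $\Omega=B_1\subset\mathbb{R}^n$. Let $u\in C(B_1)$ be a viscosity solution of $$F(D^2u,Du,x)=f(x,Du)\quad\text{in } B_1.$$ (i) If $q-p<\alpha$, then $u\in \mathrm{Lip}(B_{1/2})$ and $$\|u\|_{\mathrm{Lip}(B_{1/2})}\le C\,(\|u\|_{L^\infty(B_1)}+1)^\theta,$$ where $\theta=\theta(q-p,\alpha)\ge 1$ and $C=C(n,\lambda,\Lambda,p,q,\alpha,C_0,C_f)>0$ depend only on the indicated quantities. (ii) If, moreover, $u\in C^\beta(B_1)$ for some $\beta\in(0,1)$ and $$q-p<\min\left\{1+\frac{\beta}{2(1-\beta)},\ \frac{\alpha}{1-\beta}\right\}$$ (this condition replacing $q-p<\alpha$), then $u\in \mathrm{Lip}(B_{1/2})$ and $$\|u\|_{\mathrm{Lip}(B_{1/2})}\le C\,(\|u\|_{C^\beta(B_1)}+1)^\theta,$$ where $\theta=\theta(q-p,\alpha,\beta)\ge 1$ and $C=C(n,\lambda,\Lambda,p,q,\alpha,\beta,C_0,C_f)>0$ depend only on the indicated quantities.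
   Context: Notation. $B_r=\{x\in\mathbb{R}^n:|x|<r\}$; $S(n)$ is the space of real symmetric $n\times n$ matrices with norm $\|\cdot\|$. For $0<\lambda\le\Lambda$ and $M\in S(n)$ with eigenvalues $e_i(M)$, the Pucci operators are $$\mathcal{M}^+_{\lambda,\Lambda}(M)=\lambda\sum_{e_i(M)<0}e_i(M)+\Lambda\sum_{e_i(M)>0}e_i(M),\qquad \mathcal{M}^-_{\lambda,\Lambda}(M)=\Lambda\sum_{e_i(M)<0}e_i(M)+\lambda\sum_{e_i(M)>0}e_i(M).$$ $\|\cdot\|_{\mathrm{Lip}}$ and $\|\cdot\|_{C^\beta}$ are the usual full norms (sup norm plus Lipschitz, resp. $\beta$-Hölder, seminorm). Structural assumptions on a domain $\Omega\subset\mathbb{R}^n$. Here $F:S(n)\times\mathbb{R}^n\times\Omega\to\mathbb{R}$, and the following hold for all $x,y\in\Omega$, all $z,w\in\mathbb{R}^n$ with $|z|,|w|\ge C_0$, and all $M,N\in S(n)$: (A1) $\mathcal{M}^-_{\lambda|z|^p,\Lambda(|z|^p+|z|^q)}(N)\le F(M+N,z,x)-F(M,z,x)\le \mathcal{M}^+_{\lambda|z|^p,\Lambda(|z|^p+|z|^q)}(N)$. (A2) $|F(M,z,x)-F(M,w,x)|\le\Lambda|z-w|(|z|^{q-1}+|w|^{q-1})(\|M\|+1)$ whenever $\tfrac12|w|\le|z|\le2|w|$. (A3) $|F(M,z,x)-F(M,z,y)|\le\Lambda|x-y|^\alpha|z|^q(\|M\|+1)$. (A4) $F(0,z,x)=0$,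 and $f\in C(\Omega\times\mathbb{R}^n)$ with $|f(x,z)|\le C_f(1+|z|^{q+1})$. Viscosity solutions. A continuous function $u$ satisfies $F(D^2u,Du,x)\le f(x,Du)$ (resp. $\ge$) in $\Omega$ in the viscosity sense if for every $x_0\in\Omega$ and every $C^2$ test function $\psi$ such that $u-\psi$ has a local minimum (resp. maximum) at $x_0$, one has $F(D^2\psi(x_0),D\psi(x_0),x_0)\le f(x_0,D\psi(x_0))$ (resp. $\ge$). A viscosity solution of the equation satisfies both inequalities. *)

theory Defs
  imports "HOL-Analysis.Analysis" "Jordan_Normal_Form.Char_Poly"
begin

text \<open>
  The exponent in the estimates must not depend on the dimension, so the dimension has to be an
  ordinary natural number bound inside the statement rather than a type.  Points of
  \<open>\<real>\<^sup>n\<close> are therefore the elements of the carrier of \<^const>\<open>Euclidean_space\<close> \<open>n\<close>, that is,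
  functions \<open>nat \<Rightarrow> real\<close> vanishing at all indices \<open>i \<ge> n\<close>; matrices are explicit-dimension matrices.

  Continuity on subsets of this carrier is \<^const>\<open>continuous_on\<close> for the product topology of
  \<open>nat \<Rightarrow> real\<close>, which there is the Euclidean one (lemma \<open>continuous_on_Rn_iff\<close>
  below).  The metric-space instance of \<open>nat \<Rightarrow> real\<close> is not the Euclidean metric and is
  never used: lengths and distances are always expressed by \<open>vnorm\<close>.
\<close>

type_synonym point = "nat \<Rightarrow> real"

abbreviation Rn :: "nat \<Rightarrow> point set" where
  "Rn n \<equiv> topspace (Euclidean_space n)"

definition vnorm :: "nat \<Rightarrow> point \<Rightarrow> real" where
  "vnorm n z = L2_set z {..<n}"

definition B :: "nat \<Rightarrow> real \<Rightarrow> point set" where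
  "B n r = {x \<in> Rn n. vnorm n x < r}"

lemma continuous_on_Rn_iff:
  fixes u :: "point \<Rightarrow> 'b :: metric_space"
  assumes "S \<subseteq> Rn n"
  shows "continuous_on S u \<longleftrightarrow>
    (\<forall>x\<in>S. \<forall>e>0. \<exists>d>0. \<forall>y\<in>S. vnorm n (y - x) < d \<longrightarrow> dist (u y) (u x) < e)"
proof -
  have ev: "eventually P (at x within S) \<longleftrightarrow>
      (\<exists>d>0. \<forall>y\<in>S. y \<noteq> x \<and> vnorm n (y - x) < d \<longrightarrow> P y)" (is "_ \<longleftrightarrow> ?R")
    if x: "x \<in> S" for P x
  proof
    assume "eventually P (at x within S)"
    then obtain U where U: "open U" "x \<in> U" "\<forall>y\<in>U. y \<noteq> x \<longrightarrow> y \<in> S \<longrightarrow> P y"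
      unfolding eventually_at_topological by blast
    obtain X where X: "x \<in> (\<Pi>\<^sub>E i\<in>UNIV. X i)" "\<And>i. open (X i)" "(\<Pi>\<^sub>E i\<in>UNIV. X i) \<subseteq> U"
      using product_topology_open_contains_basis[of "\<lambda>i. euclidean" UNIV U x] U
      unfolding open_fun_def by auto
    have "\<forall>i. \<exists>e>0. \<forall>t. dist t (x i) < e \<longrightarrow> t \<in> X i"
      using X by (auto simp: open_dist PiE_iff)
    then obtain e where e: "\<And>i. e i > 0" "\<And>i t. dist t (x i) < e i \<Longrightarrow> t \<in> X i"
      by metis
    define d where "d = Min (insert 1 (e ` {..<n}))"
    have d: "d > 0" "\<And>i. i < n \<Longrightarrow> d \<le> e i"
      unfolding d_def using e by (auto simp: Min_le_iff)
    have "P y" if y: "y \<in> S" "y \<noteq> x" "vnorm n (y - x) < d" for y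
    proof -
      have "y i \<in> X i" for i
      proof (cases "i < n")
        case True
        have "\<bar>y i - x i\<bar> \<le> L2_set (\<lambda>i. \<bar>(y - x) i\<bar>) {..<n}"
          using member_le_L2_set[of "{..<n}" i "\<lambda>i. \<bar>(y - x) i\<bar>"] True by simp
        also have "\<dots> = vnorm n (y - x)" by (simp add: vnorm_def L2_set_def)
        finally have "dist (y i) (x i) < e i"
          using d(2)[OF True] y by (simp add: dist_real_def)
        then show ?thesis by (rule e(2))
      next
        case False
        have "x \<in> Rn n" "y \<in> Rn n" using x y assms by auto
        then have "y i = x i" using False by (simp add: topspace_Euclidean_space)
        then show ?thesis using e by simp
      qed
      then have "y \<in> U" using X by (auto simp: PiE_iff)
      then show ?thesis using U y by blast
    qed
    then show ?R using d(1) by blast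
  next
    assume ?R
    then obtain d where d: "d > 0" "\<forall>y\<in>S. y \<noteq> x \<and> vnorm n (y - x) < d \<longrightarrow> P y" by blast
    have "continuous_on UNIV (\<lambda>y. vnorm n (y - x))"
      unfolding vnorm_def L2_set_def fun_diff_def
      by (intro continuous_intros continuous_on_product_coordinates)
    then have "open {y. vnorm n (y - x) < d}"
      by (intro open_Collect_less continuous_intros)
    moreover have "vnorm n (x - x) < d" using d by (simp add: vnorm_def L2_set_def)
    ultimately show "eventually P (at x within S)"
      unfolding eventually_at_topological using d by (intro exI[of _ "{y. vnorm n (y - x) < d}"]) auto
  qed
  show ?thesis
    unfolding continuous_on_def tendsto_iff
    by (intro ball_cong refl) (simp add: ev, metis dist_self)
qed

text \<open>Symmetric matrices, the operator norm and the Pucci operators.\<close>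

definition Sym :: "nat \<Rightarrow> real mat set" where
  "Sym n = {M \<in> carrier_mat n n. transpose_mat M = M}"

definition mnorm :: "nat \<Rightarrow> real mat \<Rightarrow> real" where
  "mnorm n M =
    (SUP v\<in>{v \<in> Rn n. vnorm n v \<le> 1}. vnorm n (\<lambda>i. if i < n then \<Sum>j<n. M $$ (i, j) * v j else 0))"

text \<open>Eigenvalues repeated according to algebraic multiplicity; all of them are real for
  symmetric matrices.\<close>

definition eigs :: "real mat \<Rightarrow> real multiset" where
  "eigs M = proots (char_poly M)"

definition pucci_max :: "real \<Rightarrow> real \<Rightarrow> real mat \<Rightarrow> real" where
  "pucci_max lam Lam M =
    lam * (\<Sum>e\<in>#filter_mset (\<lambda>e. e < 0) (eigs M). e) + Lam * (\<Sum>e\<in>#filter_mset (\<lambda>e. e > 0) (eigs M). e)"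

definition pucci_min :: "real \<Rightarrow> real \<Rightarrow> real mat \<Rightarrow> real" where
  "pucci_min lam Lam M =
    Lam * (\<Sum>e\<in>#filter_mset (\<lambda>e. e < 0) (eigs M). e) + lam * (\<Sum>e\<in>#filter_mset (\<lambda>e. e > 0) (eigs M). e)"

text \<open>
  Structural assumptions.  The arguments of \<open>F\<close> are \<open>M\<close>, \<open>z\<close>, \<open>x\<close> in this
  order, those of \<open>f\<close> are \<open>x\<close>, \<open>z\<close>.  As in the source, every
  pointwise condition, including the ones in \<open>A4\<close>, is required only for gradient
  variables of length at least \<open>C0\<close>.
\<close>

definition A1 :: "nat \<Rightarrow> point set \<Rightarrow> real \<Rightarrow> real \<Rightarrow> real \<Rightarrow> real \<Rightarrow> real
    \<Rightarrow> (real mat \<Rightarrow> point \<Rightarrow> point \<Rightarrow> real) \<Rightarrow> bool" where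
  "A1 n \<Omega> lam Lam p q C0 F \<longleftrightarrow>
    (\<forall>x\<in>\<Omega>. \<forall>z\<in>Rn n. vnorm n z \<ge> C0 \<longrightarrow> (\<forall>M\<in>Sym n. \<forall>N\<in>Sym n.
      pucci_min (lam * vnorm n z powr p) (Lam * (vnorm n z powr p + vnorm n z powr q)) N
        \<le> F (M + N) z x - F M z x \<and>
      F (M + N) z x - F M z x
        \<le> pucci_max (lam * vnorm n z powr p) (Lam * (vnorm n z powr p + vnorm n z powr q)) N))"

definition A2 :: "nat \<Rightarrow> point set \<Rightarrow> real \<Rightarrow> real \<Rightarrow> real
    \<Rightarrow> (real mat \<Rightarrow> point \<Rightarrow> point \<Rightarrow> real) \<Rightarrow> bool" where
  "A2 n \<Omega> Lam q C0 F \<longleftrightarrow>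
    (\<forall>x\<in>\<Omega>. \<forall>z\<in>Rn n. \<forall>w\<in>Rn n. vnorm n z \<ge> C0 \<and> vnorm n w \<ge> C0 \<and>
        1/2 * vnorm n w \<le> vnorm n z \<and> vnorm n z \<le> 2 * vnorm n w \<longrightarrow>
      (\<forall>M\<in>Sym n. \<bar>F M z x - F M w x\<bar>
        \<le> Lam * vnorm n (z - w) * (vnorm n z powr (q - 1) + vnorm n w powr (q - 1)) * (mnorm n M + 1)))"

definition A3 :: "nat \<Rightarrow> point set \<Rightarrow> real \<Rightarrow> real \<Rightarrow> real \<Rightarrow> real
    \<Rightarrow> (real mat \<Rightarrow> point \<Rightarrow> point \<Rightarrow> real) \<Rightarrow> bool" where
  "A3 n \<Omega> Lam q \<alpha> C0 F \<longleftrightarrow>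
    (\<forall>x\<in>\<Omega>. \<forall>y\<in>\<Omega>. \<forall>z\<in>Rn n. vnorm n z \<ge> C0 \<longrightarrow> (\<forall>M\<in>Sym n.
      \<bar>F M z x - F M z y\<bar> \<le> Lam * vnorm n (x - y) powr \<alpha> * vnorm n z powr q * (mnorm n M + 1)))"

definition A4 :: "nat \<Rightarrow> point set \<Rightarrow> real \<Rightarrow> real \<Rightarrow> real
    \<Rightarrow> (real mat \<Rightarrow> point \<Rightarrow> point \<Rightarrow> real) \<Rightarrow> (point \<Rightarrow> point \<Rightarrow> real) \<Rightarrow> bool" where
  "A4 n \<Omega> q C0 Cf F f \<longleftrightarrow>
    (\<forall>x\<in>\<Omega>. \<forall>z\<in>Rn n. vnorm n z \<ge> C0 \<longrightarrow> F (0\<^sub>m n n) z x = 0) \<and>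
    continuous_on (\<Omega> \<times> Rn n) (\<lambda>(x, z). f x z) \<and>
    (\<forall>x\<in>\<Omega>. \<forall>z\<in>Rn n. vnorm n z \<ge> C0 \<longrightarrow> \<bar>f x z\<bar> \<le> Cf * (1 + vnorm n z powr (q + 1)))"

definition structural :: "nat \<Rightarrow> point set \<Rightarrow> real \<Rightarrow> real \<Rightarrow> real \<Rightarrow> real \<Rightarrow> real \<Rightarrow> real \<Rightarrow> real
    \<Rightarrow> (real mat \<Rightarrow> point \<Rightarrow> point \<Rightarrow> real) \<Rightarrow> (point \<Rightarrow> point \<Rightarrow> real) \<Rightarrow> bool" where
  "structural n \<Omega> lam Lam p q \<alpha> C0 Cf F f \<longleftrightarrow>
    A1 n \<Omega> lam Lam p q C0 F \<and> A2 n \<Omega> Lam q C0 F \<and> A3 n \<Omega> Lam q \<alpha> C0 F \<and> A4 n \<Omega> q C0 Cf F f"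

text \<open>
  \<open>C\<^sup>2\<close> functions on a (relatively) open subset of \<open>\<real>\<^sup>n\<close>: all partial derivatives up to
  order two exist and are continuous.
\<close>

definition partial :: "nat \<Rightarrow> (point \<Rightarrow> real) \<Rightarrow> point \<Rightarrow> real" where
  "partial i \<psi> x = deriv (\<lambda>t. \<psi> (x(i := t))) (x i)"

definition C1_on :: "nat \<Rightarrow> point set \<Rightarrow> (point \<Rightarrow> real) \<Rightarrow> bool" where
  "C1_on n \<Omega> \<psi> \<longleftrightarrow> continuous_on \<Omega> \<psi> \<and>
    (\<forall>i<n. (\<forall>x\<in>\<Omega>. (\<lambda>t. \<psi> (x(i := t))) differentiable (at (x i))) \<and> continuous_on \<Omega> (partial i \<psi>))"

definition C2_on :: "nat \<Rightarrow> point set \<Rightarrow> (point \<Rightarrow> real) \<Rightarrow> bool" where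
  "C2_on n \<Omega> \<psi> \<longleftrightarrow> C1_on n \<Omega> \<psi> \<and> (\<forall>i<n. C1_on n \<Omega> (partial i \<psi>))"

definition grad :: "nat \<Rightarrow> (point \<Rightarrow> real) \<Rightarrow> point \<Rightarrow> point" where
  "grad n \<psi> x = (\<lambda>i. if i < n then partial i \<psi> x else 0)"

definition hess :: "nat \<Rightarrow> (point \<Rightarrow> real) \<Rightarrow> point \<Rightarrow> real mat" where
  "hess n \<psi> x = Matrix.mat n n (\<lambda>(i, j). partial i (partial j \<psi>) x)"

definition local_min :: "nat \<Rightarrow> point set \<Rightarrow> (point \<Rightarrow> real) \<Rightarrow> point \<Rightarrow> bool" where
  "local_min n \<Omega> g x0 \<longleftrightarrow> (\<exists>r>0. \<forall>x\<in>\<Omega>. vnorm n (x - x0) < r \<longrightarrow> g x0 \<le> g x)"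

definition local_max :: "nat \<Rightarrow> point set \<Rightarrow> (point \<Rightarrow> real) \<Rightarrow> point \<Rightarrow> bool" where
  "local_max n \<Omega> g x0 \<longleftrightarrow> (\<exists>r>0. \<forall>x\<in>\<Omega>. vnorm n (x - x0) < r \<longrightarrow> g x \<le> g x0)"

text \<open>\<open>visc_le\<close> and \<open>visc_ge\<close> are the inequalities \<open>F(D\<^sup>2u, Du, x) \<le> f(x, Du)\<close> and
  \<open>F(D\<^sup>2u, Du, x) \<ge> f(x, Du)\<close> in the viscosity sense.\<close>

definition visc_le :: "nat \<Rightarrow> point set \<Rightarrow> (real mat \<Rightarrow> point \<Rightarrow> point \<Rightarrow> real)
    \<Rightarrow> (point \<Rightarrow> point \<Rightarrow> real) \<Rightarrow> (point \<Rightarrow> real) \<Rightarrow> bool" where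
  "visc_le n \<Omega> F f u \<longleftrightarrow> continuous_on \<Omega> u \<and>
    (\<forall>x0\<in>\<Omega>. \<forall>\<psi>. C2_on n \<Omega> \<psi> \<and> local_min n \<Omega> (\<lambda>x. u x - \<psi> x) x0 \<longrightarrow>
      F (hess n \<psi> x0) (grad n \<psi> x0) x0 \<le> f x0 (grad n \<psi> x0))"

definition visc_ge :: "nat \<Rightarrow> point set \<Rightarrow> (real mat \<Rightarrow> point \<Rightarrow> point \<Rightarrow> real)
    \<Rightarrow> (point \<Rightarrow> point \<Rightarrow> real) \<Rightarrow> (point \<Rightarrow> real) \<Rightarrow> bool" where
  "visc_ge n \<Omega> F f u \<longleftrightarrow> continuous_on \<Omega> u \<and>
    (\<forall>x0\<in>\<Omega>. \<forall>\<psi>. C2_on n \<Omega> \<psi> \<and> local_max n \<Omega> (\<lambda>x. u x - \<psi> x) x0 \<longrightarrow>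
      F (hess n \<psi> x0) (grad n \<psi> x0) x0 \<ge> f x0 (grad n \<psi> x0))"

definition visc_solution :: "nat \<Rightarrow> point set \<Rightarrow> (real mat \<Rightarrow> point \<Rightarrow> point \<Rightarrow> real)
    \<Rightarrow> (point \<Rightarrow> point \<Rightarrow> real) \<Rightarrow> (point \<Rightarrow> real) \<Rightarrow> bool" where
  "visc_solution n \<Omega> F f u \<longleftrightarrow> visc_le n \<Omega> F f u \<and> visc_ge n \<Omega> F f u"

text \<open>
  Function spaces.  \<open>sup_norm\<close> is the \<open>L\<^sup>\<infinity>\<close> norm of a continuous function on
  an open set.  The real-valued norms below are meaningful only for functions for which the
  corresponding suprema are finite, i.e. bounded functions resp. members of \<open>holder_space\<close>.
  \<open>Lip\<close> is the case of exponent \<open>1\<close>.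
\<close>

definition sup_norm :: "point set \<Rightarrow> (point \<Rightarrow> real) \<Rightarrow> real" where
  "sup_norm S u = (SUP x\<in>S. \<bar>u x\<bar>)"

definition holder_quotients :: "nat \<Rightarrow> real \<Rightarrow> point set \<Rightarrow> (point \<Rightarrow> real) \<Rightarrow> real set" where
  "holder_quotients n \<beta> S u =
    {\<bar>u x - u y\<bar> / vnorm n (x - y) powr \<beta> | x y. x \<in> S \<and> y \<in> S \<and> x \<noteq> y}"

definition holder_space :: "nat \<Rightarrow> real \<Rightarrow> point set \<Rightarrow> (point \<Rightarrow> real) set" where
  "holder_space n \<beta> S = {u. bounded (u ` S) \<and> bdd_above (holder_quotients n \<beta> S u)}"

definition holder_norm :: "nat \<Rightarrow> real \<Rightarrow> point set \<Rightarrow> (point \<Rightarrow> real) \<Rightarrow> real" where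
  "holder_norm n \<beta> S u = sup_norm S u + Sup (holder_quotients n \<beta> S u)"

abbreviation Lip :: "nat \<Rightarrow> point set \<Rightarrow> (point \<Rightarrow> real) set" where
  "Lip n S \<equiv> holder_space n 1 S"

abbreviation Lip_norm :: "nat \<Rightarrow> point set \<Rightarrow> (point \<Rightarrow> real) \<Rightarrow> real" where
  "Lip_norm n S u \<equiv> holder_norm n 1 S u"

end

theory Submission
  imports Defs "HOL-Library.Function_Algebras"
begin

text \<open>The proof doubles the variables, after Ishii and Lions.  If \<open>u x0 - u y0\<close> exceeds \<open>L * \<omega> \<bar>x0 - y0\<bar>\<close> for a
  concave profile \<open>\<omega>\<close> and a large \<open>L\<close>, maximise \<open>u x - u y - L * \<omega> \<bar>x - y\<bar> - K * \<bar>x - x0\<bar>\<^sup>2\<close>.  At a maximum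
  point, with distance \<open>\<delta>\<close> and slope \<open>a = L * \<omega>' \<delta>\<close>, the equation is tested at \<open>x\<close> and at \<open>y\<close> with gradients
  of length about \<open>a\<close> and with matrices \<open>X\<close> and \<open>Y\<close> such that \<open>X - Y\<close> is nearly nonpositive and is at most
  \<open>4 * L * \<omega>'' \<delta>\<close> in the direction of \<open>x - y\<close>, up to the penalisation.  Ellipticity has a lower constant of
  order \<open>a powr p\<close>, and the remaining terms carry the factor \<open>a powr q\<close>; hence \<open>concavity_bound\<close>: with
  \<open>d = q - p\<close>, the concavity \<open>- L * \<omega>'' \<delta>\<close> is at most a constant times
  \<open>a powr d * (K + a + (2 * K * \<bar>x - x0\<bar> / a + \<delta> powr \<alpha>) * a / \<delta>)\<close>.

  The profile \<open>\<omega> \<delta> = \<delta> powr (1 / 2)\<close> has concavity comparable with \<open>a / \<delta>\<close>; if \<open>d < \<alpha>\<close>, this contradicts the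
  bound for large \<open>L\<close>, and no modulus of continuity has to be known beforehand
  (\<open>Hoelder_half_estimate\<close>).  For the profile \<open>\<omega> \<delta> = \<delta> - \<delta> powr (1 + \<gamma>) / 4\<close> a Hoelder bound with
  exponent \<open>\<beta>\<close> makes \<open>\<delta>\<close> small, of order \<open>a powr (- 1 / (1 - \<beta>))\<close>, and also the penalisation gradient, of order
  \<open>\<delta> powr (\<beta> / 2)\<close>.  The two conditions on \<open>d\<close> in the second part say that the \<open>\<delta> powr \<alpha>\<close> term and the
  penalisation term are then of lower order for a small \<open>\<gamma>\<close> (\<open>Lipschitz_estimate\<close>).  The first part follows
  from the second estimate with \<open>\<beta> = 1 / 2\<close>.

  The matrices \<open>X\<close> and \<open>Y\<close> come from a theorem on sums (\<open>approximate_jets\<close>), proved here without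
  Alexandrov's theorem and without measure theory.  Regularisation reduces it to functions \<open>W\<close> with
  Lipschitz gradient (\<open>C11_regularisation\<close>), for which a point is needed where a linear function of small slope
  touches \<open>W\<close> from above and where \<open>W\<close> is nearly quadratic on some small ball
  (\<open>nearly_quadratic_contact_point\<close>).  Average \<open>W\<close> over lattice cubes of sides \<open>(2 * m + 1) ^ j\<close>: the second
  differences at scale \<open>j + 1\<close> are averages of those at scale \<open>j\<close>, so their energy decreases, and among many
  scales there is one where it hardly changes (\<open>few_bad_points\<close>).  There the second differences are nearly
  constant around most lattice points, so that \<open>W\<close> is nearly quadratic (\<open>flat_imp_quadratic\<close>).  On the other hand,
  distinct slopes have contact points at a distance comparable to that of the slopes, so the contact points
  meet a fixed proportion of all lattice cells, and one of them lies in a good cell.\<close>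

section \<open>Euclidean geometry of \<open>Rn n\<close>\<close>

definition vdot :: "nat \<Rightarrow> point \<Rightarrow> point \<Rightarrow> real" where
  "vdot n x y = (\<Sum>i<n. x i * y i)"

definition vscale :: "real \<Rightarrow> point \<Rightarrow> point" where
  "vscale c x = (\<lambda>i. c * x i)"

lemma Rn_iff: "x \<in> Rn n \<longleftrightarrow> (\<forall>i\<ge>n. x i = 0)"
  by (simp add: topspace_Euclidean_space)

lemma Rn_closed [simp, intro]:
  shows "0 \<in> Rn n"
    and "x \<in> Rn n \<Longrightarrow> y \<in> Rn n \<Longrightarrow> x + y \<in> Rn n"
    and "x \<in> Rn n \<Longrightarrow> y \<in> Rn n \<Longrightarrow> x - y \<in> Rn n"
    and "x \<in> Rn n \<Longrightarrow> - x \<in> Rn n"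
    and "x \<in> Rn n \<Longrightarrow> vscale c x \<in> Rn n"
  by (auto simp: Rn_iff vscale_def)

lemma vscale_apply [simp]: "vscale c x i = c * x i"
  by (simp add: vscale_def)

lemma vscale_simps [simp]: "vscale 1 x = x" "vscale 0 x = 0" "vscale c 0 = 0"
    "vscale a (vscale b x) = vscale (a * b) x" "vscale (- 1) x = - x"
  by (auto simp: fun_eq_iff)

lemma vdot_simps:
  shows "vdot n (x + y) z = vdot n x z + vdot n y z"
    and "vdot n z (x + y) = vdot n z x + vdot n z y"
    and "vdot n (x - y) z = vdot n x z - vdot n y z"
    and "vdot n z (x - y) = vdot n z x - vdot n z y"
    and "vdot n (- x) z = - vdot n x z"
    and "vdot n z (- x) = - vdot n z x"
    and "vdot n (vscale c x) z = c * vdot n x z"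
    and "vdot n z (vscale c x) = c * vdot n z x"
    and "vdot n 0 z = 0"
    and "vdot n z 0 = 0"
  by (auto simp: vdot_def algebra_simps sum.distrib sum_subtractf sum_negf sum_distrib_left)

lemma vdot_commute: "vdot n x y = vdot n y x"
  by (simp add: vdot_def mult.commute)

lemma vnorm_sq: "(vnorm n x)\<^sup>2 = vdot n x x"
  by (simp add: vnorm_def L2_set_def vdot_def power2_eq_square sum_nonneg)

lemma vnorm_sq_add: "(vnorm n (x + y))\<^sup>2 = (vnorm n x)\<^sup>2 + 2 * vdot n x y + (vnorm n y)\<^sup>2"
  by (simp add: vnorm_sq vdot_simps vdot_commute)

lemma vnorm_ge_0 [simp]: "0 \<le> vnorm n x"
  by (simp add: vnorm_def)

lemma vnorm_0 [simp]: "vnorm n 0 = 0"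
  by (simp add: vnorm_def L2_set_def)

lemma vnorm_triangle: "vnorm n (x + y) \<le> vnorm n x + vnorm n y"
  unfolding vnorm_def plus_fun_def by (rule L2_set_triangle_ineq)

lemma vnorm_minus [simp]: "vnorm n (- x) = vnorm n x"
  by (simp add: vnorm_def L2_set_def)

lemma vnorm_commute: "vnorm n (x - y) = vnorm n (y - x)"
  by (simp add: vnorm_def L2_set_def power2_commute)

lemma vnorm_triangle_minus: "vnorm n (x - y) \<le> vnorm n x + vnorm n y"
  using vnorm_triangle[of n x "- y"] by simp

lemma vnorm_triangle_diff: "vnorm n x \<le> vnorm n (x - y) + vnorm n y"
  using vnorm_triangle[of n "x - y" y] by simp

lemma vnorm_scale [simp]: "vnorm n (vscale c x) = \<bar>c\<bar> * vnorm n x"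
proof -
  have "(vnorm n (vscale c x))\<^sup>2 = (\<bar>c\<bar> * vnorm n x)\<^sup>2"
    unfolding power_mult_distrib vnorm_sq vdot_simps by (simp add: power2_eq_square)
  then show ?thesis by (simp add: power2_eq_iff_nonneg)
qed

lemma vdot_le: "\<bar>vdot n x y\<bar> \<le> vnorm n x * vnorm n y"
proof -
  have "\<bar>vdot n x y\<bar> \<le> (\<Sum>i<n. \<bar>x i\<bar> * \<bar>y i\<bar>)"
    unfolding vdot_def by (rule order_trans[OF sum_abs]) (simp add: abs_mult)
  also have "\<dots> \<le> vnorm n x * vnorm n y"
    unfolding vnorm_def by (rule L2_set_mult_ineq)
  finally show ?thesis .
qed

lemma vnorm_coord: "i < n \<Longrightarrow> \<bar>x i\<bar> \<le> vnorm n x"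
proof -
  assume "i < n"
  then have "\<bar>x i\<bar> \<le> L2_set (\<lambda>i. \<bar>x i\<bar>) {..<n}"
    using member_le_L2_set[of "{..<n}" i "\<lambda>i. \<bar>x i\<bar>"] by simp
  then show ?thesis by (simp add: vnorm_def L2_set_def)
qed

lemma vnorm_le_bound:
  assumes "\<And>i. i < n \<Longrightarrow> \<bar>x i\<bar> \<le> c"
  shows "vnorm n x \<le> real n * c"
proof -
  have "vnorm n x \<le> (\<Sum>i<n. \<bar>x i\<bar>)"
    unfolding vnorm_def by (rule L2_set_le_sum_abs)
  also have "\<dots> \<le> (\<Sum>i<n. c)"
    by (rule sum_mono) (use assms in auto)
  finally show ?thesis by simp
qed

lemma vnorm_eq_0:
  assumes "x \<in> Rn n"
  shows "vnorm n x = 0 \<longleftrightarrow> x = 0"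
proof
  assume *: "vnorm n x = 0"
  have "x i = 0" for i
    using vnorm_coord[of i n x] * assms by (cases "i < n") (auto simp: Rn_iff)
  then show "x = 0" by (simp add: fun_eq_iff)
qed simp

lemma vnorm_parallelogram:
  "(vnorm n (x + y))\<^sup>2 + (vnorm n (x - y))\<^sup>2 = 2 * (vnorm n x)\<^sup>2 + 2 * (vnorm n y)\<^sup>2"
  by (simp add: vnorm_sq vdot_simps)

lemma vnorm_sq_add_le: "(vnorm n (x + y))\<^sup>2 \<le> 2 * (vnorm n x)\<^sup>2 + 2 * (vnorm n y)\<^sup>2"
  using vnorm_parallelogram[of n x y] zero_le_power2[of "vnorm n (x - y)"] zero_le_power2[of "vnorm n (x + y)"] by linarith

lemma vnorm_sq_diff_le: "(vnorm n (x - y))\<^sup>2 \<le> 2 * (vnorm n x)\<^sup>2 + 2 * (vnorm n y)\<^sup>2"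
  using vnorm_parallelogram[of n x y] zero_le_power2[of "vnorm n (x - y)"] zero_le_power2[of "vnorm n (x + y)"] by linarith

lemma continuous_on_coord: "continuous_on S (\<lambda>x::point. x i)"
  by (rule continuous_on_subset[OF continuous_on_product_coordinates subset_UNIV])

lemma continuous_on_vnorm: "continuous_on S (\<lambda>x. vnorm n (x - a))"
  unfolding vnorm_def L2_set_def fun_diff_def
  by (intro continuous_intros continuous_on_coord)

lemma continuous_on_vdot: "continuous_on S (\<lambda>x. vdot n p (x - a))"
  unfolding vdot_def fun_diff_def
  by (intro continuous_intros continuous_on_coord)

definition cB :: "nat \<Rightarrow> point \<Rightarrow> real \<Rightarrow> point set" where
  "cB n a r = {x \<in> Rn n. vnorm n (x - a) \<le> r}"

text \<open>Tychonoff's theorem for a box, of which the ball is a closed subset.\<close>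

lemma compact_cB: "compact (cB n a r)"
proof -
  define S where "S = (\<lambda>i. if i < n then {a i - \<bar>r\<bar> .. a i + \<bar>r\<bar>} else {0::real})"
  have "compactin (product_topology (\<lambda>i. euclidean) UNIV) (PiE UNIV S)"
    by (subst compactin_PiE) (auto simp: S_def)
  then have c: "compact (PiE UNIV S)"
    by (simp add: euclidean_product_topology)
  have "closed {x. vnorm n (x - a) \<le> r}"
    by (intro closed_Collect_le continuous_on_vnorm continuous_on_const)
  then have "compact (PiE UNIV S \<inter> {x. vnorm n (x - a) \<le> r})"
    by (rule compact_Int_closed[OF c])
  also have "PiE UNIV S \<inter> {x. vnorm n (x - a) \<le> r} = cB n a r"
  proof (intro equalityI subsetI)
    fix x assume x: "x \<in> PiE UNIV S \<inter> {x. vnorm n (x - a) \<le> r}"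
    then have "x i \<in> S i" for i by auto
    then have "x i = 0" if "i \<ge> n" for i
      using that by (metis S_def not_less singletonD)
    then show "x \<in> cB n a r" using x by (auto simp: cB_def Rn_iff)
  next
    fix x assume x: "x \<in> cB n a r"
    have "x i \<in> S i" for i
    proof (cases "i < n")
      case True
      have "\<bar>(x - a) i\<bar> \<le> r" using vnorm_coord[OF True, of "x - a"] x by (simp add: cB_def)
      then show ?thesis using True by (auto simp: S_def abs_le_iff)
    qed (use x in \<open>auto simp: S_def cB_def Rn_iff\<close>)
    then show "x \<in> PiE UNIV S \<inter> {x. vnorm n (x - a) \<le> r}"
      using x by (auto simp: cB_def)
  qed
  finally show ?thesis .
qed

text \<open>Quadratic forms, with the coefficient matrix given as a function.\<close>

definition qf :: "nat \<Rightarrow> (nat \<Rightarrow> nat \<Rightarrow> real) \<Rightarrow> point \<Rightarrow> real" where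
  "qf n H z = (\<Sum>a<n. \<Sum>c<n. H a c * z a * z c)"

lemma qf_scale: "qf n H (vscale t z) = t\<^sup>2 * qf n H z"
  by (simp add: qf_def sum_distrib_left power2_eq_square algebra_simps)

lemma qf_minus [simp]: "qf n H (- z) = qf n H z" and qf_0 [simp]: "qf n H 0 = 0"
  by (simp_all add: qf_def)

section \<open>Second differences of lattice functions at many scales\<close>

definition lbox :: "nat \<Rightarrow> int \<Rightarrow> (nat \<Rightarrow> int) set" where
  "lbox N r = {k. (\<forall>i<N. \<bar>k i\<bar> \<le> r) \<and> (\<forall>i\<ge>N. k i = 0)}"

definition unit_shift :: "nat \<Rightarrow> int \<Rightarrow> nat \<Rightarrow> int" where
  "unit_shift a s = (\<lambda>i. if i = a then s else 0)"

definition iscale :: "int \<Rightarrow> (nat \<Rightarrow> int) \<Rightarrow> nat \<Rightarrow> int" where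
  "iscale s k = (\<lambda>i. s * k i)"

lemma card_lbox:
  assumes "r \<ge> 0"
  shows "finite (lbox N r)" and "card (lbox N r) = nat (2 * r + 1) ^ N"
proof -
  define P where "P = PiE {..<N} (\<lambda>_. {-r..r})"
  have bij: "bij_betw (\<lambda>f. \<lambda>i. if i < N then f i else 0) P (lbox N r)"
  proof (rule bij_betwI[where g = "\<lambda>k. restrict k {..<N}"])
    show "(\<lambda>f i. if i < N then f i else 0) \<in> P \<rightarrow> lbox N r"
      by (force simp: P_def lbox_def PiE_iff abs_le_iff)
    show "(\<lambda>k. restrict k {..<N}) \<in> lbox N r \<rightarrow> P"
      by (force simp: P_def lbox_def PiE_iff abs_le_iff)
    show "restrict (\<lambda>i. if i < N then f i else 0) {..<N} = f" if "f \<in> P" for f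
      using that by (auto simp: P_def fun_eq_iff PiE_iff extensional_def restrict_def)
    show "(\<lambda>i. if i < N then restrict k {..<N} i else 0) = k" if "k \<in> lbox N r" for k
      using that by (auto simp: lbox_def fun_eq_iff)
  qed
  have fP: "finite P" unfolding P_def by (rule finite_PiE) auto
  then show "finite (lbox N r)" using bij_betw_finite[OF bij] by simp
  have "card P = nat (2 * r + 1) ^ N"
    unfolding P_def using assms by (simp add: card_PiE algebra_simps)
  then show "card (lbox N r) = nat (2 * r + 1) ^ N"
    using bij_betw_same_card[OF bij] by simp
qed

lemma zero_in_lbox: "r \<ge> 0 \<Longrightarrow> 0 \<in> lbox N r"
  by (simp add: lbox_def)

definition fdiff :: "int \<Rightarrow> nat \<Rightarrow> ((nat \<Rightarrow> int) \<Rightarrow> real) \<Rightarrow> (nat \<Rightarrow> int) \<Rightarrow> real" where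
  "fdiff s a w k = w (k + unit_shift a s) - w k"

definition sdiff :: "int \<Rightarrow> nat \<Rightarrow> nat \<Rightarrow> ((nat \<Rightarrow> int) \<Rightarrow> real) \<Rightarrow> (nat \<Rightarrow> int) \<Rightarrow> real" where
  "sdiff s a c w k = fdiff s a (fdiff s c w) k / (of_int s)\<^sup>2"

lemma unit_shift_add: "unit_shift a s + unit_shift a t = unit_shift a (s + t)"
  and unit_shift_0 [simp]: "unit_shift a 0 = 0"
  by (auto simp: unit_shift_def fun_eq_iff)

lemma fdiff_multiple: "fdiff (int b * s) a w k = (\<Sum>t<b. fdiff s a w (k + unit_shift a (int t * s)))"
proof (induction b)
  case (Suc b)
  have "fdiff (int (Suc b) * s) a w k
      = fdiff (int b * s) a w k + fdiff s a w (k + unit_shift a (int b * s))"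
  proof -
    have "int (Suc b) * s = int b * s + s" by (simp add: algebra_simps)
    then have "k + unit_shift a (int (Suc b) * s) = k + unit_shift a (int b * s) + unit_shift a s"
      by (simp only: add.assoc unit_shift_add)
    then show ?thesis by (simp only: fdiff_def)
  qed
  then show ?case by (simp only: Suc sum.lessThan_Suc)
qed (simp add: fdiff_def)

lemma fdiff_sum: "fdiff s a (\<lambda>k. \<Sum>i\<in>I. w i k) k = (\<Sum>i\<in>I. fdiff s a (w i) k)"
  by (simp add: fdiff_def sum_subtractf)

lemma fdiff_divide: "fdiff s a (\<lambda>k. w k / x) k = fdiff s a w k / x"
  by (simp add: fdiff_def diff_divide_distrib)

lemma fdiff_shift: "fdiff s a (\<lambda>k. w (k + v)) k = fdiff s a w (k + v)"
  by (simp add: fdiff_def add_ac)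

text \<open>A difference with step \<open>b * s\<close> is a sum of \<open>b\<close> differences with step \<open>s\<close>; after division by
  the squared step a sum becomes an average.\<close>

lemma sdiff_multiple:
  assumes "b > 0"
  shows "sdiff (int b * s) a c w k
    = (\<Sum>t<b. \<Sum>t'<b. sdiff s a c w (k + unit_shift a (int t * s) + unit_shift c (int t' * s))) / (real b)\<^sup>2"
proof -
  have "fdiff (int b * s) a (fdiff (int b * s) c w) k
     = (\<Sum>t<b. fdiff s a (\<lambda>k. \<Sum>t'<b. fdiff s c w (k + unit_shift c (int t' * s))) (k + unit_shift a (int t * s)))"
    by (simp only: fdiff_multiple[of b s c, abs_def] fdiff_multiple[of b s a])
  also have "\<dots> = (\<Sum>t<b. \<Sum>t'<b. fdiff s a (fdiff s c w) (k + unit_shift a (int t * s) + unit_shift c (int t' * s)))"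
    by (simp only: fdiff_sum fdiff_shift)
  finally show ?thesis
    by (simp add: sdiff_def sum_divide_distrib power_mult_distrib mult.commute)
qed

lemma sdiff_bilinear:
  "sdiff s a c (\<lambda>k. (\<Sum>i\<in>I. w i k) / x) k = (\<Sum>i\<in>I. sdiff s a c (w i) k) / x"
proof -
  have "fdiff s c (\<lambda>k. (\<Sum>i\<in>I. w i k) / x) = (\<lambda>k. (\<Sum>i\<in>I. fdiff s c (w i) k) / x)"
    by (rule ext) (simp only: fdiff_sum fdiff_divide)
  then have "fdiff s a (fdiff s c (\<lambda>k. (\<Sum>i\<in>I. w i k) / x)) k = (\<Sum>i\<in>I. fdiff s a (fdiff s c (w i)) k) / x"
    by (simp only: fdiff_sum fdiff_divide)
  then show ?thesis by (simp add: sdiff_def sum_divide_distrib mult.commute)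
qed

lemma sdiff_shift: "sdiff s a c (\<lambda>k. w (k + v)) k = sdiff s a c w (k + v)"
proof -
  have "fdiff s c (\<lambda>k. w (k + v)) = (\<lambda>k. fdiff s c w (k + v))"
    by (rule ext) (rule fdiff_shift)
  then show ?thesis by (simp only: sdiff_def fdiff_shift)
qed

text \<open>Averages over cubes of side \<open>(2 * m + 1) ^ j\<close>, built up scale by scale.\<close>

fun lavg :: "nat \<Rightarrow> nat \<Rightarrow> nat \<Rightarrow> ((nat \<Rightarrow> int) \<Rightarrow> real) \<Rightarrow> (nat \<Rightarrow> int) \<Rightarrow> real" where
  "lavg N m 0 w = w"
| "lavg N m (Suc j) w = (\<lambda>k. (\<Sum>e\<in>lbox N (int m). lavg N m j w (k + iscale ((2 * int m + 1) ^ j) e))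
      / real (card (lbox N (int m))))"

text \<open>The second difference with step \<open>(2 * m + 1) ^ j\<close> of the average over cubes of the same side.  As
  \<open>j\<close> grows, these form a sequence of successive averages, with the energy identity of a martingale.\<close>

definition hdiff :: "nat \<Rightarrow> nat \<Rightarrow> nat \<Rightarrow> nat \<Rightarrow> nat \<Rightarrow> ((nat \<Rightarrow> int) \<Rightarrow> real) \<Rightarrow> (nat \<Rightarrow> int) \<Rightarrow> real" where
  "hdiff N m j a c w = sdiff ((2 * int m + 1) ^ j) a c (lavg N m j w)"

definition shifts :: "nat \<Rightarrow> nat \<Rightarrow> ((nat \<Rightarrow> int) \<times> nat \<times> nat) set" where
  "shifts N m = lbox N (int m) \<times> {..<2 * m + 1} \<times> {..<2 * m + 1}"

definition shift_vec :: "nat \<Rightarrow> nat \<Rightarrow> nat \<Rightarrow> nat \<Rightarrow> (nat \<Rightarrow> int) \<times> nat \<times> nat \<Rightarrow> nat \<Rightarrow> int" where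
  "shift_vec m j a c = (\<lambda>(e, t, t'). iscale ((2 * int m + 1) ^ j) e
     + unit_shift a (int t * (2 * int m + 1) ^ j) + unit_shift c (int t' * (2 * int m + 1) ^ j))"

lemma card_shifts: "finite (shifts N m)" "card (shifts N m) = card (lbox N (int m)) * (2 * m + 1)\<^sup>2"
  by (auto simp: shifts_def card_lbox(1) power2_eq_square card_cartesian_product simp del: power_Suc)

text \<open>The second differences at one scale are averages of those at the previous scale.\<close>

lemma hdiff_Suc:
  "hdiff N m (Suc j) a c w k
    = (\<Sum>v\<in>shifts N m. hdiff N m j a c w (k + shift_vec m j a c v)) / real (card (shifts N m))"
proof -
  define b where "b = 2 * m + 1"
  define s where "s = (2 * int m + 1) ^ j"
  let ?E = "lbox N (int m)"
  have "hdiff N m (Suc j) a c w k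
      = sdiff (int b * s) a c (\<lambda>k. (\<Sum>e\<in>?E. lavg N m j w (k + iscale s e)) / real (card ?E)) k"
    by (simp add: hdiff_def b_def s_def algebra_simps)
  also have "\<dots> = (\<Sum>e\<in>?E. sdiff (int b * s) a c (lavg N m j w) (k + iscale s e)) / real (card ?E)"
    by (simp only: sdiff_bilinear sdiff_shift)
  also have "\<dots> = (\<Sum>e\<in>?E. (\<Sum>t<b. \<Sum>t'<b. sdiff s a c (lavg N m j w)
      (k + iscale s e + unit_shift a (int t * s) + unit_shift c (int t' * s))) / (real b)\<^sup>2) / real (card ?E)"
    by (subst sdiff_multiple) (simp_all add: b_def)
  also have "\<dots> = (\<Sum>e\<in>?E. \<Sum>t<b. \<Sum>t'<b. hdiff N m j a c w (k + shift_vec m j a c (e, t, t')))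
      / real (card (shifts N m))"
    by (simp add: hdiff_def s_def b_def shift_vec_def card_shifts sum_divide_distrib add.assoc
        del: of_nat_add of_nat_Suc) (simp add: mult.commute)
  also have "\<dots> = (\<Sum>v\<in>shifts N m. hdiff N m j a c w (k + shift_vec m j a c v)) / real (card (shifts N m))"
    unfolding shifts_def b_def[symmetric] sum.cartesian_product by (simp add: case_prod_unfold)
  finally show ?thesis .
qed

lemma variance_identity:
  fixes x :: "'a \<Rightarrow> real"
  assumes "finite V" "V \<noteq> {}"
  defines "A \<equiv> (\<Sum>v\<in>V. x v) / real (card V)"
  shows "(\<Sum>v\<in>V. (x v - A)\<^sup>2) = (\<Sum>v\<in>V. (x v)\<^sup>2) - real (card V) * A\<^sup>2"
proof -
  have c: "real (card V) > 0" using assms by (simp add: card_gt_0_iff)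
  then have s: "(\<Sum>v\<in>V. x v) = real (card V) * A" by (simp add: A_def)
  have "(\<Sum>v\<in>V. (x v - A)\<^sup>2) = (\<Sum>v\<in>V. (x v)\<^sup>2 - 2 * A * x v + A\<^sup>2)"
    by (rule sum.cong) (auto simp: power2_diff)
  also have "\<dots> = (\<Sum>v\<in>V. (x v)\<^sup>2) - 2 * A * (\<Sum>v\<in>V. x v) + real (card V) * A\<^sup>2"
    by (simp add: sum.distrib sum_subtractf sum_distrib_left)
  finally show ?thesis by (simp add: s power2_eq_square algebra_simps)
qed

text \<open>Passing to averages lowers the energy by the mean square deviation from the averages.\<close>

lemma energy_step:
  fixes g g' :: "(nat \<Rightarrow> int) \<Rightarrow> real"
  assumes V: "finite V" "V \<noteq> {}" and S: "finite S"
    and sub: "\<And>k v. k \<in> S' \<Longrightarrow> v \<in> V \<Longrightarrow> k + sh v \<in> S"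
    and avg: "\<And>k. k \<in> S' \<Longrightarrow> g' k = (\<Sum>v\<in>V. g (k + sh v)) / real (card V)"
  shows "(\<Sum>k\<in>S'. \<Sum>v\<in>V. (g (k + sh v) - g' k)\<^sup>2)
    \<le> real (card V) * ((\<Sum>k\<in>S. (g k)\<^sup>2) - (\<Sum>k\<in>S'. (g' k)\<^sup>2))"
proof -
  have "(\<Sum>k\<in>S'. \<Sum>v\<in>V. (g (k + sh v) - g' k)\<^sup>2)
      = (\<Sum>k\<in>S'. (\<Sum>v\<in>V. (g (k + sh v))\<^sup>2) - real (card V) * (g' k)\<^sup>2)"
  proof (rule sum.cong[OF refl])
    fix k assume k: "k \<in> S'"
    show "(\<Sum>v\<in>V. (g (k + sh v) - g' k)\<^sup>2) = (\<Sum>v\<in>V. (g (k + sh v))\<^sup>2) - real (card V) * (g' k)\<^sup>2"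
      unfolding avg[OF k] by (rule variance_identity[OF V])
  qed
  also have "\<dots> = (\<Sum>v\<in>V. \<Sum>k\<in>S'. (g (k + sh v))\<^sup>2) - real (card V) * (\<Sum>k\<in>S'. (g' k)\<^sup>2)"
    by (simp add: sum_subtractf sum_distrib_left sum.swap[of _ S'])
  also have "(\<Sum>v\<in>V. \<Sum>k\<in>S'. (g (k + sh v))\<^sup>2) \<le> (\<Sum>v\<in>V. \<Sum>k\<in>S. (g k)\<^sup>2)"
  proof (rule sum_mono)
    fix v assume v: "v \<in> V"
    have "(\<Sum>k\<in>S'. (g (k + sh v))\<^sup>2) = (\<Sum>k\<in>(\<lambda>k. k + sh v) ` S'. (g k)\<^sup>2)"
      by (subst sum.reindex) (auto intro: inj_onI)
    also have "\<dots> \<le> (\<Sum>k\<in>S. (g k)\<^sup>2)"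
      by (rule sum_mono2) (use S sub v in auto)
    finally show "(\<Sum>k\<in>S'. (g (k + sh v))\<^sup>2) \<le> (\<Sum>k\<in>S. (g k)\<^sup>2)" .
  qed
  finally show ?thesis by (simp add: algebra_simps)
qed

text \<open>The second differences of scale \<open>j\<close> are nearly constant on a cube of \<open>2 * m + 1\<close> points per side.\<close>

definition flat_at :: "nat \<Rightarrow> nat \<Rightarrow> nat \<Rightarrow> real \<Rightarrow> ((nat \<Rightarrow> int) \<Rightarrow> real) \<Rightarrow> (nat \<Rightarrow> int) \<Rightarrow> bool" where
  "flat_at N m j \<tau> w k \<longleftrightarrow> (\<forall>a<N. \<forall>c<N. \<forall>e\<in>lbox N (int m).
     \<bar>hdiff N m j a c w (k + iscale ((2 * int m + 1) ^ j) e) - hdiff N m (Suc j) a c w k\<bar> \<le> \<tau>)"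

text \<open>The energies of the successive scales decrease, and their decrements add up to at most the energy
  at scale \<open>0\<close>.  So one of \<open>J\<close> scales has a decrement of at most one \<open>J\<close>-th of it, and every bad point
  contributes at least a fixed multiple of \<open>\<tau>\<^sup>2\<close> to it.  The box has to be enlarged because the averages look outside it.\<close>

lemma few_bad_points:
  fixes w :: "(nat \<Rightarrow> int) \<Rightarrow> real"
  assumes J: "J > 0" and R: "R \<ge> 0" and \<tau>: "\<tau> > 0"
    and bound: "\<And>a c k. a < N \<Longrightarrow> c < N \<Longrightarrow> (\<forall>i\<ge>N. k i = 0) \<Longrightarrow> \<bar>sdiff 1 a c w k\<bar> \<le> C"
  shows "\<exists>j<J. \<tau>\<^sup>2 * real J * real (card {k \<in> lbox N R. \<not> flat_at N m j \<tau> w k})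
    \<le> (real N)\<^sup>2 * real (card (shifts N m)) * C\<^sup>2
        * real (card (lbox N (R + int J * (3 * (2 * int m + 1) ^ J))))"
proof -
  define b where "b = 2 * int m + 1"
  have b1: "b \<ge> 1" by (simp add: b_def)
  define M where "M = 3 * b ^ J"
  define S where "S = (\<lambda>j. lbox N (R + int (J - j) * M))"
  define V where "V = shifts N m"
  define g where "g = (\<lambda>(a, c) j. hdiff N m j a c w)"
  define E where "E = (\<lambda>x j. \<Sum>k\<in>S j. (g x j k)\<^sup>2)"
  define D where "D = (\<lambda>x j. \<Sum>k\<in>S (Suc j). \<Sum>v\<in>V. (g x j (k + shift_vec m j (fst x) (snd x) v) - g x (Suc j) k)\<^sup>2)"
  define I where "I = {..<N} \<times> {..<N}"
  define Bad where "Bad = (\<lambda>j. {k \<in> lbox N R. \<not> flat_at N m j \<tau> w k})"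
  have M0: "M \<ge> 0" using b1 by (simp add: M_def)
  have fS: "finite (S j)" for j using R M0 by (simp add: S_def card_lbox)
  have V0: "finite V" "V \<noteq> {}"
    using zero_in_lbox[of "int m" N] by (auto simp: V_def card_shifts) (auto simp: shifts_def)
  have cV: "real (card V) > 0" using V0 by (simp add: card_gt_0_iff)
  have step: "D x j \<le> real (card V) * (E x j - E x (Suc j))" if "j < J" "x \<in> I" for x j
  proof -
    have "fst x < N" "snd x < N" using that by (auto simp: I_def)
    then obtain a c where x: "x = (a, c)" "a < N" "c < N" by (metis prod.collapse)
    show ?thesis unfolding D_def E_def
    proof (rule energy_step[OF V0 fS])
      fix k v assume k: "k \<in> S (Suc j)" and v: "v \<in> V"
      obtain e t t' where v': "v = (e, t, t')" by (cases v) auto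
      have e: "e \<in> lbox N (int m)" "int t \<le> 2 * int m" "int t' \<le> 2 * int m"
        using v by (auto simp: v' V_def shifts_def)
      have "b ^ j * b \<le> b ^ J"
        using that(1) b1 power_increasing[of "Suc j" J b] by (simp add: mult.commute)
      have bj: "b ^ j \<ge> 0" using b1 by simp
      have sh: "\<bar>shift_vec m j a c v i\<bar> \<le> M" if "i < N" for i
      proof -
        have "\<bar>e i\<bar> \<le> int m" using e that by (auto simp: lbox_def)
        then have 1: "\<bar>b ^ j * e i\<bar> \<le> b ^ j * int m"
          using bj by (simp add: abs_mult mult_left_mono)
        have 2: "\<bar>unit_shift a (int t * b ^ j) i\<bar> \<le> b ^ j * (2 * int m)" for a
          using e bj mult_left_mono[OF e(2) bj] by (auto simp: unit_shift_def abs_mult mult.commute)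
        have 3: "\<bar>unit_shift c (int t' * b ^ j) i\<bar> \<le> b ^ j * (2 * int m)"
          using e bj mult_left_mono[OF e(3) bj] by (auto simp: unit_shift_def abs_mult mult.commute)
        have "\<bar>shift_vec m j a c v i\<bar> \<le> b ^ j * int m + b ^ j * (2 * int m) + b ^ j * (2 * int m)"
        proof -
          have "shift_vec m j a c v i = b ^ j * e i + unit_shift a (int t * b ^ j) i + unit_shift c (int t' * b ^ j) i"
            by (simp add: shift_vec_def v' iscale_def b_def)
          then show ?thesis using 1 2[of a] 3 by linarith
        qed
        also have "\<dots> \<le> 3 * (b ^ j * b)" using bj by (simp add: b_def algebra_simps)
        finally show ?thesis using \<open>b ^ j * b \<le> b ^ J\<close> by (simp add: M_def)
      qed
      have z: "shift_vec m j a c v i = 0" if "i \<ge> N" for i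
        using e that x by (auto simp: shift_vec_def v' iscale_def unit_shift_def lbox_def)
      have eq: "int (J - j) = int (J - Suc j) + 1" using that(1) by simp
      have "\<bar>(k + shift_vec m j a c v) i\<bar> \<le> R + int (J - j) * M" if "i < N" for i
      proof -
        have "\<bar>k i\<bar> \<le> R + int (J - Suc j) * M" using k that by (auto simp: S_def lbox_def)
        then show ?thesis using sh[OF that] unfolding eq by (simp add: algebra_simps)
      qed
      then show "k + shift_vec m j (fst x) (snd x) v \<in> S j"
        using z k by (simp add: S_def lbox_def x)
    next
      fix k assume "k \<in> S (Suc j)"
      show "g x (Suc j) k = (\<Sum>v\<in>V. g x j (k + shift_vec m j (fst x) (snd x) v)) / real (card V)"
        by (simp add: g_def x V_def hdiff_Suc)
    qed
  qed
  have E0: "E x 0 \<le> C\<^sup>2 * real (card (S 0))" if x: "x \<in> I" for x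
  proof -
    have "E x 0 \<le> (\<Sum>k\<in>S 0. C\<^sup>2)" unfolding E_def
    proof (rule sum_mono)
      fix k assume "k \<in> S 0"
      then have "\<forall>i\<ge>N. k i = 0" by (auto simp: S_def lbox_def)
      then have "\<bar>g x 0 k\<bar> \<le> C"
        using bound x by (auto simp: g_def hdiff_def I_def)
      then have "\<bar>g x 0 k\<bar>\<^sup>2 \<le> C\<^sup>2" by (rule power_mono) simp
      then show "(g x 0 k)\<^sup>2 \<le> C\<^sup>2" by simp
    qed
    then show ?thesis by (simp add: mult.commute)
  qed
  have En: "E x j \<ge> 0" for x j unfolding E_def by (rule sum_nonneg) simp
  have tot: "(\<Sum>j<J. D x j) \<le> real (card V) * (C\<^sup>2 * real (card (S 0)))" if x: "x \<in> I" for x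
  proof -
    have "(\<Sum>j<J. D x j) \<le> (\<Sum>j<J. real (card V) * (E x j - E x (Suc j)))"
      by (rule sum_mono) (use step x in auto)
    also have "\<dots> = real (card V) * (E x 0 - E x J)"
      by (simp add: sum_distrib_left[symmetric] sum_lessThan_telescope')
    also have "\<dots> \<le> real (card V) * (C\<^sup>2 * real (card (S 0)))"
      using cV E0[OF x] En[of x J] by (intro mult_left_mono) auto
    finally show ?thesis .
  qed
  define K where "K = (real N)\<^sup>2 * real (card V) * C\<^sup>2 * real (card (S 0))"
  have "(\<Sum>j<J. \<Sum>x\<in>I. D x j) = (\<Sum>x\<in>I. \<Sum>j<J. D x j)" by (rule sum.swap)
  also have "\<dots> \<le> (\<Sum>x\<in>I. real (card V) * (C\<^sup>2 * real (card (S 0))))"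
    by (rule sum_mono) (use tot in auto)
  also have "\<dots> = K" by (simp add: I_def K_def power2_eq_square)
  finally have total: "(\<Sum>j<J. \<Sum>x\<in>I. D x j) \<le> K" .
  have "\<exists>j<J. (\<Sum>x\<in>I. D x j) * real J \<le> K"
  proof (rule ccontr)
    assume "\<not> ?thesis"
    then have "K / real J < (\<Sum>x\<in>I. D x j)" if "j < J" for j
      using that J by (auto simp: field_simps not_le)
    then have "(\<Sum>j<J. K / real J) < (\<Sum>j<J. \<Sum>x\<in>I. D x j)"
      using J by (intro sum_strict_mono) auto
    then show False using total J by simp
  qed
  then obtain j where j: "j < J" "(\<Sum>x\<in>I. D x j) * real J \<le> K" by blast
  have SR: "lbox N R \<subseteq> S (Suc j)"
  proof
    fix k assume "k \<in> lbox N R"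
    moreover have "0 \<le> int (J - Suc j) * M" using M0 by simp
    ultimately show "k \<in> S (Suc j)" unfolding S_def lbox_def by fastforce
  qed
  have fB: "finite (Bad j)" using card_lbox(1)[OF R] by (simp add: Bad_def)
  have "\<tau>\<^sup>2 * real (card (Bad j)) = (\<Sum>k\<in>Bad j. \<tau>\<^sup>2)" by simp
  also have "\<dots> \<le> (\<Sum>k\<in>Bad j. \<Sum>x\<in>I. \<Sum>v\<in>V. (g x j (k + shift_vec m j (fst x) (snd x) v) - g x (Suc j) k)\<^sup>2)"
  proof (rule sum_mono)
    fix k assume "k \<in> Bad j"
    then obtain a c e where ace: "a < N" "c < N" "e \<in> lbox N (int m)"
      "\<tau> < \<bar>hdiff N m j a c w (k + iscale ((2 * int m + 1) ^ j) e) - hdiff N m (Suc j) a c w k\<bar>"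
      by (auto simp: Bad_def flat_at_def not_le)
    let ?f = "\<lambda>x v. (g x j (k + shift_vec m j (fst x) (snd x) v) - g x (Suc j) k)\<^sup>2"
    have "\<tau>\<^sup>2 \<le> \<bar>hdiff N m j a c w (k + iscale ((2 * int m + 1) ^ j) e) - hdiff N m (Suc j) a c w k\<bar>\<^sup>2"
      using ace \<tau> by (intro power_mono) auto
    also have "\<dots> = ?f (a, c) (e, 0, 0)" by (simp add: g_def shift_vec_def)
    also have "\<dots> \<le> (\<Sum>v\<in>V. ?f (a, c) v)"
      by (rule member_le_sum) (use V0 ace in \<open>auto simp: V_def shifts_def\<close>)
    also have "\<dots> \<le> (\<Sum>x\<in>I. \<Sum>v\<in>V. ?f x v)"
      by (rule member_le_sum[where f = "\<lambda>x. \<Sum>v\<in>V. ?f x v"])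
         (use ace in \<open>auto simp: I_def intro!: sum_nonneg\<close>)
    finally show "\<tau>\<^sup>2 \<le> (\<Sum>x\<in>I. \<Sum>v\<in>V. ?f x v)" .
  qed
  also have "\<dots> \<le> (\<Sum>k\<in>S (Suc j). \<Sum>x\<in>I. \<Sum>v\<in>V. (g x j (k + shift_vec m j (fst x) (snd x) v) - g x (Suc j) k)\<^sup>2)"
    by (rule sum_mono2) (use fS SR in \<open>auto simp: Bad_def intro!: sum_nonneg\<close>)
  also have "\<dots> = (\<Sum>x\<in>I. D x j)" unfolding D_def by (rule sum.swap)
  finally have d: "\<tau>\<^sup>2 * real (card (Bad j)) \<le> (\<Sum>x\<in>I. D x j)" .
  have "\<tau>\<^sup>2 * real J * real (card (Bad j)) = \<tau>\<^sup>2 * real (card (Bad j)) * real J" by simp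
  also have "\<dots> \<le> (\<Sum>x\<in>I. D x j) * real J" by (rule mult_right_mono[OF d]) simp
  also have "\<dots> \<le> K" by (rule j(2))
  finally have "\<tau>\<^sup>2 * real J * real (card (Bad j)) \<le> K" .
  then show ?thesis
    using j(1) by (intro exI[of _ j]) (simp add: Bad_def K_def V_def S_def M_def b_def)
qed

section \<open>Functions with Lipschitz gradient are nearly quadratic at most places and scales\<close>

definition bf :: "nat \<Rightarrow> (nat \<Rightarrow> nat \<Rightarrow> real) \<Rightarrow> point \<Rightarrow> point \<Rightarrow> real" where
  "bf n H x y = (\<Sum>a<n. \<Sum>c<n. H a c * x a * y c)"

lemma qf_bf: "qf n H x = bf n H x x" by (simp add: qf_def bf_def)

lemma bf_simps:
  "bf n H (x + y) z = bf n H x z + bf n H y z" "bf n H z (x + y) = bf n H z x + bf n H z y"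
  "bf n H (x - y) z = bf n H x z - bf n H y z" "bf n H z (x - y) = bf n H z x - bf n H z y"
  "bf n H (- x) z = - bf n H x z" "bf n H z (- x) = - bf n H z x"
  "bf n H (vscale t x) z = t * bf n H x z" "bf n H z (vscale t x) = t * bf n H z x"
  "bf n H 0 z = 0" "bf n H z 0 = 0"
  by (simp_all add: bf_def ring_distribs sum.distrib sum_subtractf sum_negf sum_distrib_left mult_ac)

lemma bf_bound:
  assumes "\<And>a c. a < n \<Longrightarrow> c < n \<Longrightarrow> \<bar>H a c\<bar> \<le> M"
    and "\<And>a. a < n \<Longrightarrow> \<bar>x a\<bar> \<le> s" "\<And>a. a < n \<Longrightarrow> \<bar>y a\<bar> \<le> t" "M \<ge> 0" "s \<ge> 0" "t \<ge> 0"
  shows "\<bar>bf n H x y\<bar> \<le> (real n)\<^sup>2 * M * s * t"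
proof -
  have "\<bar>bf n H x y\<bar> \<le> (\<Sum>a<n. \<bar>\<Sum>c<n. H a c * x a * y c\<bar>)"
    unfolding bf_def by (rule sum_abs)
  also have "\<dots> \<le> (\<Sum>a<n. \<Sum>c<n. \<bar>H a c * x a * y c\<bar>)" by (intro sum_mono sum_abs)
  also have "\<dots> \<le> (\<Sum>a<n. \<Sum>c<n. M * s * t)"
    unfolding abs_mult by (intro sum_mono mult_mono) (use assms in auto)
  also have "\<dots> = (real n)\<^sup>2 * M * s * t" by (simp add: power2_eq_square)
  finally show ?thesis .
qed

lemma qf_bound:
  assumes "\<And>a c. a < n \<Longrightarrow> c < n \<Longrightarrow> \<bar>H a c\<bar> \<le> M" "M \<ge> 0"
  shows "\<bar>qf n H x\<bar> \<le> (real n)\<^sup>2 * M * (vnorm n x)\<^sup>2"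
  using bf_bound[of n H M x "vnorm n x" x "vnorm n x", OF assms(1)] assms(2)
  by (simp add: qf_bf vnorm_coord power2_eq_square mult.assoc)

subsection \<open>Discrete Taylor expansion\<close>

text \<open>Lattice points as vectors, and quadratic forms on them: the second difference of a quadratic form
  is constant, which is what the discrete Taylor expansion compares with.\<close>

definition rv :: "(nat \<Rightarrow> int) \<Rightarrow> point" where "rv k = (\<lambda>i. real_of_int (k i))"

lemma rv_simps: "rv (x + y) = rv x + rv y" "rv 0 = 0" "rv (iscale s x) = vscale (real_of_int s) (rv x)"
  by (auto simp: rv_def fun_eq_iff iscale_def)

lemma rv_apply [simp]: "rv k i = real_of_int (k i)" by (simp add: rv_def)

lemma bf_unit:
  assumes "a < n" "c < n"
  shows "bf n H (rv (unit_shift a s)) (rv (unit_shift c t)) = H a c * s * t"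
proof -
  have "bf n H (rv (unit_shift a s)) (rv (unit_shift c t))
      = (\<Sum>a'<n. \<Sum>c'<n. if c' = c then (if a' = a then H a c * s * t else 0) else 0)"
    unfolding bf_def by (intro sum.cong refl) (simp add: unit_shift_def)
  then show ?thesis using assms by simp
qed

definition l1 :: "nat \<Rightarrow> (nat \<Rightarrow> int) \<Rightarrow> int" where "l1 N e = (\<Sum>i<N. \<bar>e i\<bar>)"

lemma l1_le: "e \<in> lbox N r \<Longrightarrow> l1 N e \<le> int N * r"
  using sum_mono[of "{..<N}" "\<lambda>i. \<bar>e i\<bar>" "\<lambda>_. r"] by (auto simp: l1_def lbox_def)

text \<open>A monotone lattice path from the origin stays in the cube.\<close>

lemma lattice_path:
  fixes f :: "(nat \<Rightarrow> int) \<Rightarrow> real"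
  assumes step: "\<And>c e. c < N \<Longrightarrow> e \<in> lbox N r \<Longrightarrow> \<bar>fdiff 1 c f e - g c\<bar> \<le> K"
    and "e \<in> lbox N r"
  shows "\<bar>f e - f 0 - (\<Sum>c<N. g c * real_of_int (e c))\<bar> \<le> K * real_of_int (l1 N e)"
  using assms(2)
proof (induction "nat (l1 N e)" arbitrary: e)
  case 0
  moreover have "0 \<le> l1 N e" unfolding l1_def by (rule sum_nonneg) simp
  ultimately have "l1 N e = 0" by simp
  then have "e i = 0" if "i < N" for i using that by (simp add: l1_def sum_nonneg_eq_0_iff)
  then have "e = 0" using 0(2) by (auto simp: lbox_def fun_eq_iff not_less[symmetric])
  then show ?case by (simp add: l1_def)
next
  case (Suc l)
  have "\<exists>c<N. e c \<noteq> 0"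
  proof (rule ccontr)
    assume "\<not> ?thesis"
    then have "l1 N e = 0" by (auto simp: l1_def)
    then show False using Suc(2) by simp
  qed
  then obtain c where c: "c < N" "e c \<noteq> 0" by blast
  define u where "u = unit_shift c (sgn (e c))"
  define e' where "e' = e - u"
  have e: "e = e' + u" by (simp add: e'_def)
  have coord: "e' i = (if i = c then e c - sgn (e c) else e i)" for i
    by (simp add: e'_def u_def unit_shift_def)
  have abs: "\<bar>e' i\<bar> = (if i = c then \<bar>e c\<bar> - 1 else \<bar>e i\<bar>)" for i
    using c by (auto simp: coord sgn_if)
  have mem: "e' \<in> lbox N r" using Suc(3) c abs by (fastforce simp: lbox_def coord)
  have split: "(\<Sum>i<N. h i) = h c + (\<Sum>i\<in>{..<N} - {c}. h i)" for h :: "nat \<Rightarrow> 'b::comm_monoid_add"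
    using c by (simp add: sum.remove)
  have l1: "l1 N e = l1 N e' + 1" unfolding l1_def split using abs by simp
  have lin: "(\<Sum>i<N. g i * real_of_int (e i)) = (\<Sum>i<N. g i * real_of_int (e' i)) + g c * sgn (e c)"
    unfolding split by (simp add: coord algebra_simps)
  have "\<bar>f e - f e' - g c * sgn (e c)\<bar> \<le> K"
  proof (cases "e c > 0")
    case True
    then have "e' + unit_shift c 1 = e" by (simp add: e'_def u_def)
    then have "fdiff 1 c f e' = f e - f e'" by (simp add: fdiff_def)
    then show ?thesis using step[OF c(1) mem] True by simp
  next
    case False
    then have "e + unit_shift c 1 = e'" using c by (simp add: e'_def u_def fun_eq_iff unit_shift_def)
    then have "fdiff 1 c f e = f e' - f e" by (simp add: fdiff_def)
    then show ?thesis using step[OF c(1) Suc(3)] False c by (simp add: abs_minus_commute)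
  qed
  moreover have "\<bar>f e' - f 0 - (\<Sum>c<N. g c * real_of_int (e' c))\<bar> \<le> K * real_of_int (l1 N e')"
    using Suc(1)[of e'] Suc(2) l1 mem by simp
  ultimately show ?case unfolding lin l1 by (simp add: algebra_simps)
qed

text \<open>Subtracting the quadratic form leaves a function with small second differences; summing them along
  lattice paths twice bounds its first differences and then its values.  The path has length at most
  \<open>N * m\<close>.\<close>

lemma discrete_taylor:
  fixes U :: "(nat \<Rightarrow> int) \<Rightarrow> real"
  assumes H: "\<And>a c. a < N \<Longrightarrow> c < N \<Longrightarrow> H a c = H c a" and t: "t \<ge> 0"
    and U: "\<And>a c e. a < N \<Longrightarrow> c < N \<Longrightarrow> e \<in> lbox N (int m) \<Longrightarrow> \<bar>fdiff 1 a (fdiff 1 c U) e - H a c\<bar> \<le> t"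
  shows "\<exists>d. \<forall>e\<in>lbox N (int m). \<bar>U e - U 0 - (\<Sum>a<N. d a * real_of_int (e a)) - qf N H (rv e) / 2\<bar>
    \<le> t * (real N * real m)\<^sup>2"
proof -
  define V where "V = (\<lambda>e. U e - qf N H (rv e) / 2)"
  define L where "L = real N * real m"
  have L: "real_of_int (l1 N e) \<le> L" if "e \<in> lbox N (int m)" for e
  proof -
    have "real_of_int (l1 N e) \<le> real_of_int (int N * int m)"
      using l1_le[OF that] by (simp only: of_int_le_iff)
    then show ?thesis by (simp add: L_def)
  qed
  have dd: "fdiff 1 a (fdiff 1 c V) e = fdiff 1 a (fdiff 1 c U) e - H a c" if "a < N" "c < N" for a c e
    using bf_unit[OF that, of H 1 1] bf_unit[OF that(2,1), of H 1 1] H[OF that]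
    by (simp add: fdiff_def V_def qf_bf rv_simps bf_simps algebra_simps add_divide_distrib)
  have 1: "\<bar>fdiff 1 a V e - fdiff 1 a V 0\<bar> \<le> t * L" if "a < N" "e \<in> lbox N (int m)" for a e
  proof -
    have "\<bar>fdiff 1 a V e - fdiff 1 a V 0 - (\<Sum>c<N. 0 * real_of_int (e c))\<bar> \<le> t * real_of_int (l1 N e)"
      by (rule lattice_path[where r = "int m"]) (use that U dd in auto)
    also have "\<dots> \<le> t * L" using t L[OF that(2)] by (intro mult_left_mono)
    finally show ?thesis by simp
  qed
  have "\<bar>V e - V 0 - (\<Sum>a<N. fdiff 1 a V 0 * real_of_int (e a))\<bar> \<le> t * L\<^sup>2" if "e \<in> lbox N (int m)" for e
  proof -
    have "\<bar>V e - V 0 - (\<Sum>a<N. fdiff 1 a V 0 * real_of_int (e a))\<bar> \<le> t * L * real_of_int (l1 N e)"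
      by (rule lattice_path[where r = "int m"]) (use that 1 in auto)
    also have "\<dots> \<le> t * L * L" using t L[OF that] by (intro mult_left_mono) (auto simp: L_def)
    finally show ?thesis by (simp add: power2_eq_square)
  qed
  then show ?thesis
    by (intro exI[of _ "\<lambda>a. fdiff 1 a V 0"]) (simp add: L_def V_def rv_simps algebra_simps)
qed

subsection \<open>Functions with Lipschitz gradient\<close>

text \<open>\<open>G\<close> is the gradient of \<open>W\<close>: the inequality says that \<open>W\<close> is differentiable with Lipschitz gradient.
  The gradient is carried along as a function, so that no derivative on the carrier is needed.\<close>

definition C11 :: "nat \<Rightarrow> (point \<Rightarrow> real) \<Rightarrow> (point \<Rightarrow> point) \<Rightarrow> real \<Rightarrow> bool" where
  "C11 N W G C \<longleftrightarrow> (\<forall>z\<in>Rn N. G z \<in> Rn N) \<and>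
    (\<forall>z\<in>Rn N. \<forall>y\<in>Rn N. \<bar>W (z + y) - W z - vdot N (G z) y\<bar> \<le> C * (vnorm N y)\<^sup>2)"

lemma C11D: "C11 N W G C \<Longrightarrow> z \<in> Rn N \<Longrightarrow> y \<in> Rn N \<Longrightarrow> \<bar>W (z + y) - W z - vdot N (G z) y\<bar> \<le> C * (vnorm N y)\<^sup>2"
  and C11_Rn: "C11 N W G C \<Longrightarrow> z \<in> Rn N \<Longrightarrow> G z \<in> Rn N"
  by (auto simp: C11_def)

text \<open>Expand \<open>W\<close> at \<open>z\<close> and at \<open>z'\<close> for the same third point, in the direction of \<open>G z' - G z\<close> and with a
  step as long as \<open>z' - z\<close>.\<close>

lemma C11_gradient_Lipschitz:
  assumes W: "C11 N W G C" and "C \<ge> 0" and z: "z \<in> Rn N" "z' \<in> Rn N"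
  shows "vnorm N (G z' - G z) \<le> 6 * C * vnorm N (z' - z)"
proof (cases "vnorm N (G z' - G z) = 0")
  case False
  define d where "d = z' - z"
  define g where "g = G z' - G z"
  define x where "x = vnorm N g"
  have x0: "x > 0" using False by (simp add: x_def g_def less_le)
  have mem: "d \<in> Rn N" "g \<in> Rn N" using z C11_Rn[OF W] by (auto simp: d_def g_def)
  define y where "y = vscale (vnorm N d / x) g"
  have y: "y \<in> Rn N" "vnorm N y = vnorm N d" using mem x0 by (auto simp: y_def x_def)
  have gy: "vdot N g y = x * vnorm N d"
    using x0 by (simp add: y_def vdot_simps vnorm_sq[symmetric] x_def[symmetric] power2_eq_square)
  have z': "z' = z + d" by (simp add: d_def)
  have "vdot N g y = (W (z + (d + y)) - W z - vdot N (G z) (d + y)) - (W (z + d) - W z - vdot N (G z) d)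
      - (W (z' + y) - W z' - vdot N (G z') y)"
    by (simp add: z' g_def vdot_simps add.assoc)
  also have "\<dots> \<le> C * (vnorm N (d + y))\<^sup>2 + C * (vnorm N d)\<^sup>2 + C * (vnorm N y)\<^sup>2"
  proof -
    have "\<bar>W (z + (d + y)) - W z - vdot N (G z) (d + y)\<bar> \<le> C * (vnorm N (d + y))\<^sup>2"
      "\<bar>W (z + d) - W z - vdot N (G z) d\<bar> \<le> C * (vnorm N d)\<^sup>2"
      "\<bar>W (z' + y) - W z' - vdot N (G z') y\<bar> \<le> C * (vnorm N y)\<^sup>2"
      using mem y(1) z by (auto intro!: C11D[OF W])
    then show ?thesis unfolding abs_le_iff by linarith
  qed
  also have "\<dots> \<le> C * (2 * (vnorm N d)\<^sup>2 + 2 * (vnorm N y)\<^sup>2) + C * (vnorm N d)\<^sup>2 + C * (vnorm N y)\<^sup>2"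
    using assms vnorm_sq_add_le by (intro add_right_mono mult_left_mono) auto
  also have "\<dots> = 6 * C * (vnorm N d)\<^sup>2" by (simp add: y algebra_simps)
  finally have "x * vnorm N d \<le> 6 * C * vnorm N d * vnorm N d" by (simp add: gy power2_eq_square)
  moreover have "vnorm N d \<noteq> 0"
  proof
    assume "vnorm N d = 0"
    then have "z' = z" using vnorm_eq_0[OF mem(1)] by (simp add: d_def)
    then show False using x0 by (simp add: x_def g_def)
  qed
  then have "vnorm N d > 0" using vnorm_ge_0[of N d] by linarith
  ultimately have "x \<le> 6 * C * vnorm N d" by simp
  then show ?thesis by (simp add: x_def g_def d_def)
qed (use assms in simp)

lemma C11_minus_linear:
  assumes "C11 N W G C" "p \<in> Rn N"
  shows "C11 N (\<lambda>z. W z - vdot N p z) (\<lambda>z. G z - p) C"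
  using assms by (auto simp: C11_def vdot_simps algebra_simps)

lemma C11_osc:
  assumes W: "C11 N T G C" and C: "C \<ge> 0" and G: "G o' = 0"
    and z: "o' \<in> Rn N" "z \<in> Rn N" "z' \<in> Rn N" and l: "vnorm N (z - o') \<le> l" "vnorm N (z' - o') \<le> l"
  shows "\<bar>T z' - T z\<bar> \<le> 8 * C * l * vnorm N (z' - z)"
proof -
  define d where "d = vnorm N (z' - z)"
  have d2: "d \<le> 2 * l" using vnorm_triangle_minus[of N "z' - o'" "z - o'"] l by (simp add: d_def)
  have d0: "d \<ge> 0" by (simp add: d_def)
  have "vnorm N (G z) \<le> 6 * C * l"
  proof -
    have "vnorm N (G z - G o') \<le> 6 * C * vnorm N (z - o')"
      by (rule C11_gradient_Lipschitz[OF W C z(1,2)])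
    also have "\<dots> \<le> 6 * C * l" using C l by (intro mult_left_mono) auto
    finally show ?thesis by (simp add: G)
  qed
  then have 1: "vnorm N (G z) * d \<le> 6 * C * l * d" using d0 by (rule mult_right_mono)
  have 2: "\<bar>vdot N (G z) (z' - z)\<bar> \<le> vnorm N (G z) * d" unfolding d_def by (rule vdot_le)
  have 3: "\<bar>T z' - T z - vdot N (G z) (z' - z)\<bar> \<le> C * d\<^sup>2"
    using C11D[OF W z(2), of "z' - z"] z by (simp add: d_def)
  have "C * d\<^sup>2 \<le> C * (2 * l * d)"
    unfolding power2_eq_square using d2 d0 C by (intro mult_left_mono mult_right_mono) auto
  then show ?thesis using 1 2 3 by (simp add: d_def algebra_simps)
qed

lemma avg_abs_le:
  fixes f :: "'a \<Rightarrow> real"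
  assumes "finite S" "S \<noteq> {}" "\<And>v. v \<in> S \<Longrightarrow> \<bar>f v - x\<bar> \<le> K"
  shows "\<bar>(\<Sum>v\<in>S. f v) / real (card S) - x\<bar> \<le> K"
proof -
  have c: "real (card S) > 0" using assms by (simp add: card_gt_0_iff)
  have "(\<Sum>v\<in>S. f v) / real (card S) - x = (\<Sum>v\<in>S. f v - x) / real (card S)"
    using c by (simp add: sum_subtractf field_simps)
  also have "\<bar>\<dots>\<bar> \<le> (\<Sum>v\<in>S. K) / real (card S)"
    unfolding abs_divide using c
    by (intro divide_mono order_trans[OF sum_abs] sum_mono) (use assms in auto)
  finally show ?thesis using c by simp
qed

lemma lbox_int: "finite (lbox N (int m))" "lbox N (int m) \<noteq> {}"
  using card_lbox(1)[of "int m" N] zero_in_lbox[of "int m" N] by auto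

lemma lavg_between:
  assumes "\<And>v. v \<in> lbox N ((2 * int m + 1) ^ j) \<Longrightarrow> \<bar>w (k + v) - x\<bar> \<le> K"
  shows "\<bar>lavg N m j w k - x\<bar> \<le> K"
  using assms
proof (induction j arbitrary: k)
  case 0
  then show ?case using 0[of 0] by (simp add: lbox_def)
next
  case (Suc j)
  define s where "s = (2 * int m + 1) ^ j"
  have s: "s \<ge> 0" by (simp add: s_def)
  have "\<bar>lavg N m j w (k + iscale s e) - x\<bar> \<le> K" if e: "e \<in> lbox N (int m)" for e
  proof (rule Suc.IH)
    fix v assume v: "v \<in> lbox N ((2 * int m + 1) ^ j)"
    have "\<bar>(iscale s e + v) i\<bar> \<le> s * (2 * int m + 1)" if "i < N" for i
    proof -
      have "\<bar>s * e i\<bar> \<le> s * int m"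
        unfolding abs_mult using e that s by (intro mult_mono) (auto simp: lbox_def)
      moreover have "\<bar>v i\<bar> \<le> s" using v that by (auto simp: lbox_def s_def)
      moreover have "0 \<le> s * int m" using s by simp
      ultimately show ?thesis by (simp add: iscale_def algebra_simps)
    qed
    moreover have "(iscale s e + v) i = 0" if "i \<ge> N" for i
      using e v that by (simp add: lbox_def iscale_def)
    ultimately have "iscale s e + v \<in> lbox N ((2 * int m + 1) ^ Suc j)"
      unfolding lbox_def by (simp add: s_def mult.commute)
    from Suc.prems[OF this] show "\<bar>w (k + iscale s e + v) - x\<bar> \<le> K" by (simp only: add.assoc)
  qed
  then show ?case
    unfolding lavg.simps s_def by (intro avg_abs_le lbox_int)
qed

lemma sdiff_lavg_bound:
  assumes "\<And>k. (\<forall>i\<ge>N. k i = 0) \<Longrightarrow> \<bar>sdiff s a c w k\<bar> \<le> K" and "\<forall>i\<ge>N. k i = 0"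
  shows "\<bar>sdiff s a c (lavg N m j w) k\<bar> \<le> K"
  using assms(2)
proof (induction j arbitrary: k)
  case (Suc j)
  have "\<bar>(\<Sum>e\<in>lbox N (int m). sdiff s a c (lavg N m j w) (k + iscale ((2 * int m + 1) ^ j) e))
      / real (card (lbox N (int m))) - 0\<bar> \<le> K"
    by (intro avg_abs_le lbox_int) (use Suc in \<open>auto simp: lbox_def iscale_def\<close>)
  then show ?case unfolding lavg.simps sdiff_bilinear sdiff_shift by simp
qed (use assms in simp)

lemma sdiff_commute: "sdiff s a c w k = sdiff s c a w k"
  by (simp add: sdiff_def fdiff_def add_ac)

lemma vnorm_unit: "a < N \<Longrightarrow> vnorm N (rv (unit_shift a s)) = \<bar>real_of_int s\<bar>"
proof -
  assume "a < N"
  have "(\<Sum>i<N. (rv (unit_shift a s) i)\<^sup>2) = (\<Sum>i<N. if i = a then (real_of_int s)\<^sup>2 else 0)"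
    by (rule sum.cong) (auto simp: unit_shift_def)
  then show ?thesis using \<open>a < N\<close> by (simp add: vnorm_def L2_set_def)
qed

lemma rv_Rn: "(\<forall>i\<ge>N. k i = 0) \<Longrightarrow> rv k \<in> Rn N"
  by (simp add: Rn_iff)

lemma C11_sdiff_bound:
  assumes T: "C11 N T G C" and C: "C \<ge> 0" and h: "h > 0" and s: "s > 0" and ac: "a < N" "c < N"
    and k: "\<forall>i\<ge>N. k i = 0"
  shows "\<bar>sdiff s a c (\<lambda>k. T (vscale h (rv k)) / h\<^sup>2) k\<bar> \<le> 6 * C"
proof -
  define x where "x = vscale h (rv (unit_shift a s))"
  define y where "y = vscale h (rv (unit_shift c s))"
  define z where "z = vscale h (rv k)"
  define l where "l = h * real_of_int s"
  have l0: "l > 0" using h s by (simp add: l_def)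
  have nrm: "vnorm N x = l" "vnorm N y = l"
    using h s ac by (simp_all add: x_def y_def l_def vnorm_unit)
  have mem: "x \<in> Rn N" "y \<in> Rn N" "z \<in> Rn N"
    using k ac unfolding x_def y_def z_def by (auto intro!: Rn_closed rv_Rn simp: unit_shift_def)
  have scale: "vscale h (rv (u + v)) = vscale h (rv u) + vscale h (rv v)" for u v
    by (auto simp: fun_eq_iff rv_def algebra_simps)
  have "sdiff s a c (\<lambda>k. T (vscale h (rv k)) / h\<^sup>2) k = (T (z + (x + y)) - T (z + x) - T (z + y) + T z) / l\<^sup>2"
    by (simp add: sdiff_def fdiff_def scale x_def[symmetric] y_def[symmetric] z_def[symmetric] l_def
        power_mult_distrib add_divide_distrib diff_divide_distrib add.assoc)
  moreover have "\<bar>T (z + (x + y)) - T (z + x) - T (z + y) + T z\<bar> \<le> 6 * C * l\<^sup>2"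
  proof -
    have 1: "\<bar>T (z + (x + y)) - T z - vdot N (G z) (x + y)\<bar> \<le> C * (vnorm N (x + y))\<^sup>2"
      "\<bar>T (z + x) - T z - vdot N (G z) x\<bar> \<le> C * (vnorm N x)\<^sup>2"
      "\<bar>T (z + y) - T z - vdot N (G z) y\<bar> \<le> C * (vnorm N y)\<^sup>2"
      using mem by (auto intro!: C11D[OF T])
    have 2: "C * (vnorm N (x + y))\<^sup>2 \<le> C * (4 * l\<^sup>2)"
      using vnorm_sq_add_le[of N x y] C by (intro mult_left_mono) (auto simp: nrm)
    show ?thesis using 1 2 unfolding nrm vdot_simps by (simp add: abs_le_iff algebra_simps)
  qed
  ultimately show ?thesis using l0 by (simp add: abs_divide pos_divide_le_eq)
qed

text \<open>Where the second differences at one scale are nearly constant, the function is nearly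
  quadratic at that scale.  The error decomposes into the oscillation \<open>\<tau>\<close> of the second differences
  and a discretisation error of relative size \<open>1 / m\<close>.\<close>

lemma flat_imp_quadratic:
  fixes h C \<tau> :: real and m j :: nat
  assumes N: "N \<ge> 1" and T: "C11 N T G C" and C: "C > 0" and G0: "G z0 = 0" and z0: "z0 \<in> Rn N"
    and h: "h > 0" and m: "m \<ge> 2" and \<tau>: "0 < \<tau>" "\<tau> \<le> C"
    and k: "\<forall>i\<ge>N. k i = 0" and near: "\<And>i. i < N \<Longrightarrow> \<bar>z0 i - h * real_of_int (k i)\<bar> \<le> h"
    and flat: "flat_at N m j \<tau> (\<lambda>k. T (vscale h (rv k)) / h\<^sup>2) k"
  defines "r \<equiv> (real m - 1) * ((2 * real m + 1) ^ j * h)"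
  shows "\<exists>d H. d \<in> Rn N \<and> vnorm N d \<le> 72 * C * real N ^ 3 * r \<and> (\<forall>a c. H a c = H c a)
    \<and> (\<forall>a<N. \<forall>c<N. \<bar>H a c\<bar> \<le> 6 * C)
    \<and> (\<forall>y\<in>Rn N. vnorm N y \<le> r \<longrightarrow>
        \<bar>T (z0 + y) - T z0 - vdot N d y - qf N H y / 2\<bar>
          \<le> (720 * C * real N ^ 3 / real m + 8 * \<tau> * (real N)\<^sup>2) * r\<^sup>2)"
proof -
  define s where "s = (2 * int m + 1) ^ j"
  define w where "w = (\<lambda>k. T (vscale h (rv k)) / h\<^sup>2)"
  define \<sigma> where "\<sigma> = (2 * real m + 1) ^ j * h"
  define n where "n = real N"
  define M where "M = real m"
  have n1: "n \<ge> 1" using N by (simp add: n_def)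
  have M2: "M \<ge> 2" using m by (simp add: M_def)
  have s1: "s \<ge> 1" by (simp add: s_def)
  have s\<sigma>: "real_of_int s * h = \<sigma>" by (simp add: s_def \<sigma>_def)
  have h\<sigma>: "h \<le> \<sigma>" using s1 h unfolding s\<sigma>[symmetric] by simp
  have \<sigma>0: "\<sigma> > 0" using h h\<sigma> by simp
  have r: "r = (M - 1) * \<sigma>" by (simp add: r_def \<sigma>_def M_def)
  define H where "H = (\<lambda>a c. hdiff N m (Suc j) a c w k)"
  have Hsym: "H a c = H c a" for a c by (simp add: H_def hdiff_def sdiff_commute)
  have Hb: "\<bar>H a c\<bar> \<le> 6 * C" if "a < N" "c < N" for a c
    unfolding H_def hdiff_def w_def
    by (rule sdiff_lavg_bound[OF C11_sdiff_bound[OF T]]) (use C h k that in auto)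
  define U where "U = (\<lambda>e. h\<^sup>2 * lavg N m j w (k + iscale s e))"
  have shift: "iscale s (e + e') = iscale s e + iscale s e'" for e e'
    by (simp add: iscale_def fun_eq_iff algebra_simps)
  have unit: "iscale s (unit_shift a 1) = unit_shift a s" for a
    by (simp add: iscale_def unit_shift_def fun_eq_iff)
  \<comment> \<open>The lattice function \<open>U\<close> has second differences close to \<open>\<sigma>\<^sup>2 * H\<close>.\<close>
  have ddU: "\<bar>fdiff 1 a (fdiff 1 c U) e - \<sigma>\<^sup>2 * H a c\<bar> \<le> \<sigma>\<^sup>2 * \<tau>"
    if "a < N" "c < N" "e \<in> lbox N (int m)" for a c e
  proof -
    have "fdiff 1 a (fdiff 1 c U) e = \<sigma>\<^sup>2 * hdiff N m j a c w (k + iscale s e)"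
    proof -
      have "hdiff N m j a c w x = sdiff s a c (lavg N m j w) x" for x by (simp add: hdiff_def s_def)
      moreover have "real_of_int s \<noteq> 0" using s1 by simp
      ultimately show ?thesis
        by (simp add: fdiff_def U_def shift unit sdiff_def s\<sigma>[symmetric] add.assoc power_mult_distrib
            right_diff_distrib[symmetric])
    qed
    then have "fdiff 1 a (fdiff 1 c U) e - \<sigma>\<^sup>2 * H a c = \<sigma>\<^sup>2 * (hdiff N m j a c w (k + iscale s e) - H a c)"
      by (simp add: algebra_simps)
    also have "\<bar>\<dots>\<bar> \<le> \<sigma>\<^sup>2 * \<tau>"
      using flat that unfolding abs_mult flat_at_def w_def[symmetric] H_def s_def[symmetric]
      by (intro mult_mono) auto
    finally show ?thesis .
  qed
  have "\<exists>d. \<forall>e\<in>lbox N (int m).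
      \<bar>U e - U 0 - (\<Sum>a<N. d a * real_of_int (e a)) - qf N (\<lambda>a c. \<sigma>\<^sup>2 * H a c) (rv e) / 2\<bar> \<le> \<sigma>\<^sup>2 * \<tau> * (real N * real m)\<^sup>2"
    by (rule discrete_taylor) (use ddU Hsym \<tau> in auto)
  then obtain D where D: "\<And>e. e \<in> lbox N (int m) \<Longrightarrow>
      \<bar>U e - U 0 - (\<Sum>a<N. D a * real_of_int (e a)) - qf N (\<lambda>a c. \<sigma>\<^sup>2 * H a c) (rv e) / 2\<bar> \<le> \<sigma>\<^sup>2 * \<tau> * (n * M)\<^sup>2"
    unfolding n_def M_def by blast
  have qfs: "qf N (\<lambda>a c. \<sigma>\<^sup>2 * H a c) x = qf N H (vscale \<sigma> x)" for x
    by (simp add: qf_scale) (simp add: qf_def sum_distrib_left mult.assoc)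
  define l where "l = 2 * n * M * \<sigma>"
  define P where "P = (\<lambda>e. vscale h (rv (k + iscale s e)))"
  have Pc: "P e i = h * real_of_int (k i) + \<sigma> * real_of_int (e i)" for e i
    by (simp add: P_def iscale_def s\<sigma>[symmetric] algebra_simps)
  have PR: "P e \<in> Rn N" if "e \<in> lbox N R" for e R
    using that k by (auto simp: Rn_iff Pc lbox_def)
  have near_l: "vnorm N (z - z0) \<le> l" if "\<And>i. i < N \<Longrightarrow> \<bar>z i - z0 i\<bar> \<le> (M + 2) * \<sigma>" for z
  proof -
    have "vnorm N (z - z0) \<le> n * ((M + 2) * \<sigma>)"
      unfolding n_def by (rule vnorm_le_bound) (use that in auto)
    also have "\<dots> \<le> n * (2 * M * \<sigma>)" using n1 M2 \<sigma>0 by (intro mult_left_mono mult_right_mono) auto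
    finally show ?thesis by (simp add: l_def mult_ac)
  qed
  have e\<sigma>: "\<bar>\<sigma> * real_of_int (e i)\<bar> \<le> M * \<sigma>" if "e \<in> lbox N (int m)" "i < N" for e i
  proof -
    have "\<bar>e i\<bar> \<le> int m" using that by (auto simp: lbox_def)
    then have "\<bar>real_of_int (e i)\<bar> \<le> M" unfolding M_def by linarith
    then show ?thesis using \<sigma>0 by (simp add: abs_mult mult.commute)
  qed
  have osc: "\<bar>T z' - T z\<bar> \<le> 8 * C * l * vnorm N (z' - z)"
    if "z \<in> Rn N" "z' \<in> Rn N" "vnorm N (z - z0) \<le> l" "vnorm N (z' - z0) \<le> l" for z z'
    by (rule C11_osc[OF T _ G0 z0]) (use that C in auto)
  have l0: "l \<ge> 0" using n1 M2 \<sigma>0 by (simp add: l_def)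
  have cl: "8 * C * l \<ge> 0" using C l0 by simp
  \<comment> \<open>Averaging over cubes of side \<open>\<sigma>\<close> moves the values only a little.\<close>
  have UT: "\<bar>U e - T (P e)\<bar> \<le> 8 * C * l * (n * \<sigma>)" if e: "e \<in> lbox N (int m)" for e
  proof -
    have "\<bar>lavg N m j w (k + iscale s e) - T (P e) / h\<^sup>2\<bar> \<le> 8 * C * l * (n * \<sigma>) / h\<^sup>2"
    proof (rule lavg_between)
      fix v assume v: "v \<in> lbox N ((2 * int m + 1) ^ j)"
      define z where "z = vscale h (rv (k + iscale s e + v))"
      have zc: "z i = P e i + h * real_of_int (v i)" for i
        by (simp add: z_def P_def algebra_simps)
      have vb: "\<bar>h * real_of_int (v i)\<bar> \<le> \<sigma>" if "i < N" for i
      proof -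
        have "\<bar>v i\<bar> \<le> s" using v that by (auto simp: lbox_def s_def)
        then have "\<bar>real_of_int (v i)\<bar> \<le> real_of_int s" by linarith
        then show ?thesis using h unfolding s\<sigma>[symmetric] by (simp add: abs_mult mult.commute)
      qed
      have zR: "z \<in> Rn N" using PR[OF e] v by (auto simp: Rn_iff zc lbox_def)
      have "\<bar>T z - T (P e)\<bar> \<le> 8 * C * l * vnorm N (z - P e)"
      proof (rule osc[OF PR[OF e] zR])
        show "vnorm N (P e - z0) \<le> l"
        proof (rule near_l)
          fix i assume i: "i < N"
          show "\<bar>P e i - z0 i\<bar> \<le> (M + 2) * \<sigma>"
            using near[OF i] e\<sigma>[OF e i] h\<sigma> \<sigma>0 unfolding Pc by (simp add: algebra_simps)
        qed
        show "vnorm N (z - z0) \<le> l"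
        proof (rule near_l)
          fix i assume i: "i < N"
          show "\<bar>z i - z0 i\<bar> \<le> (M + 2) * \<sigma>"
            using near[OF i] e\<sigma>[OF e i] h\<sigma> vb[OF i] unfolding zc Pc by (simp add: algebra_simps)
        qed
      qed
      also have "\<dots> \<le> 8 * C * l * (n * \<sigma>)"
        unfolding n_def by (intro mult_left_mono[OF _ cl] vnorm_le_bound) (use vb in \<open>auto simp: zc\<close>)
      finally have "\<bar>T z - T (P e)\<bar> / h\<^sup>2 \<le> 8 * C * l * (n * \<sigma>) / h\<^sup>2" by (intro divide_right_mono) auto
      then show "\<bar>w (k + iscale s e + v) - T (P e) / h\<^sup>2\<bar> \<le> 8 * C * l * (n * \<sigma>) / h\<^sup>2"
        by (simp add: w_def z_def diff_divide_distrib[symmetric] abs_divide)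
    qed
    then have "h\<^sup>2 * \<bar>lavg N m j w (k + iscale s e) - T (P e) / h\<^sup>2\<bar> \<le> 8 * C * l * (n * \<sigma>)"
      using h by (simp add: pos_le_divide_eq mult.commute)
    moreover have "U e - T (P e) = h\<^sup>2 * (lavg N m j w (k + iscale s e) - T (P e) / h\<^sup>2)"
      using h by (simp add: U_def algebra_simps)
    ultimately show ?thesis by (simp only: abs_mult) simp
  qed
  have zero: "0 \<in> lbox N (int m)" by (simp add: zero_in_lbox)
  have P_near: "vnorm N (P e - z0) \<le> l" if e: "e \<in> lbox N (int m)" for e
  proof (rule near_l)
    fix i assume i: "i < N"
    show "\<bar>P e i - z0 i\<bar> \<le> (M + 2) * \<sigma>"
      using near[OF i] e\<sigma>[OF e i] h\<sigma> \<sigma>0 unfolding Pc by (simp add: algebra_simps)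
  qed
  have Db: "\<bar>D a\<bar> \<le> 36 * C * n\<^sup>2 * M * \<sigma>\<^sup>2" if a: "a < N" for a
  proof -
    define e where "e = unit_shift a (int m)"
    have e: "e \<in> lbox N (int m)" using a by (auto simp: e_def lbox_def unit_shift_def)
    have "(\<Sum>c<N. D c * real_of_int (e c)) = (\<Sum>c<N. if c = a then D a * M else 0)"
      by (rule sum.cong) (auto simp: e_def unit_shift_def M_def)
    then have De: "(\<Sum>c<N. D c * real_of_int (e c)) = D a * M" using a by simp
    have q: "qf N (\<lambda>a c. \<sigma>\<^sup>2 * H a c) (rv e) = \<sigma>\<^sup>2 * H a a * M * M"
      unfolding qf_bf e_def by (subst bf_unit) (use a in \<open>auto simp: M_def\<close>)
    have "\<bar>T (P e) - T (P 0)\<bar> \<le> 8 * C * l * vnorm N (P e - P 0)"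
      by (rule osc) (use PR e zero P_near in auto)
    also have "\<dots> \<le> 8 * C * l * (n * (M * \<sigma>))"
      unfolding n_def by (intro mult_left_mono[OF _ cl] vnorm_le_bound) (use e\<sigma>[OF e] in \<open>auto simp: Pc\<close>)
    finally have 1: "\<bar>T (P e) - T (P 0)\<bar> \<le> 8 * C * l * (n * (M * \<sigma>))" .
    have 2: "8 * C * l * (n * \<sigma>) * 2 \<le> 8 * C * l * (n * (M * \<sigma>))"
      using M2 n1 \<sigma>0 mult_left_mono[OF _ cl, of "2 * (n * \<sigma>)" "n * (M * \<sigma>)"] by simp
    have "\<bar>U e - U 0\<bar> \<le> 2 * (8 * C * l * (n * (M * \<sigma>)))"
      using 1 2 UT[OF e] UT[OF zero] by linarith
    also have "\<dots> = 32 * C * n\<^sup>2 * M\<^sup>2 * \<sigma>\<^sup>2" by (simp add: l_def power2_eq_square)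
    finally have 3: "\<bar>U e - U 0\<bar> \<le> 32 * C * n\<^sup>2 * M\<^sup>2 * \<sigma>\<^sup>2" .
    have n2: "1 \<le> n\<^sup>2" using n1 by simp
    have "\<bar>\<sigma>\<^sup>2 * H a a * M * M / 2\<bar> = \<bar>H a a\<bar> * (\<sigma>\<^sup>2 * M * M / 2)"
      using M2 by (simp add: abs_mult)
    also have "\<dots> \<le> 6 * C * (\<sigma>\<^sup>2 * M * M / 2)"
      using Hb[OF a a] M2 by (intro mult_right_mono) auto
    also have "\<dots> = 3 * C * 1 * M\<^sup>2 * \<sigma>\<^sup>2" by (simp add: power2_eq_square)
    also have "\<dots> \<le> 3 * C * n\<^sup>2 * M\<^sup>2 * \<sigma>\<^sup>2"
      using n2 C by (intro mult_right_mono mult_left_mono) auto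
    finally have 4: "\<bar>\<sigma>\<^sup>2 * H a a * M * M / 2\<bar> \<le> 3 * C * n\<^sup>2 * M\<^sup>2 * \<sigma>\<^sup>2" .
    have "\<sigma>\<^sup>2 * \<tau> * (n * M)\<^sup>2 \<le> \<sigma>\<^sup>2 * C * (n * M)\<^sup>2"
      using \<tau> by (intro mult_right_mono mult_left_mono) auto
    then have 5: "\<sigma>\<^sup>2 * \<tau> * (n * M)\<^sup>2 \<le> C * n\<^sup>2 * M\<^sup>2 * \<sigma>\<^sup>2" by (simp add: power_mult_distrib mult_ac)
    have "\<bar>D a * M\<bar> \<le> 36 * C * n\<^sup>2 * M\<^sup>2 * \<sigma>\<^sup>2"
      using D[OF e] 3 4 5 unfolding De q by linarith
    then have "\<bar>D a\<bar> * M \<le> (36 * C * n\<^sup>2 * M * \<sigma>\<^sup>2) * M"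
      using M2 by (simp add: abs_mult power2_eq_square mult_ac)
    then show ?thesis using M2 by (simp add: mult_ac)
  qed
  define d where "d = (\<lambda>i. if i < N then D i / \<sigma> else 0)"
  define Err where "Err = 90 * C * n ^ 3 * M * \<sigma>\<^sup>2 + \<tau> * n\<^sup>2 * M\<^sup>2 * \<sigma>\<^sup>2"
  have main: "\<bar>T (z0 + y) - U 0 - vdot N d y - qf N H y / 2\<bar> \<le> Err" if y: "y \<in> Rn N" "vnorm N y \<le> r" for y
  proof -
    define e where "e = (\<lambda>i. if i < N then \<lfloor>y i / \<sigma>\<rfloor> else 0)"
    have yr: "\<bar>y i\<bar> \<le> (M - 1) * \<sigma>" if "i < N" for i
      using vnorm_coord[OF that, of y] y r by simp
    have eb: "\<bar>y i - \<sigma> * real_of_int (e i)\<bar> \<le> \<sigma>" "\<bar>e i\<bar> \<le> int m" if i: "i < N" for i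
    proof -
      have f: "real_of_int (e i) \<le> y i / \<sigma>" "y i / \<sigma> < real_of_int (e i) + 1"
        using i by (auto simp: e_def)
      have "\<sigma> * real_of_int (e i) \<le> y i" "y i < \<sigma> * real_of_int (e i) + \<sigma>"
        using f \<sigma>0 by (auto simp: field_simps)
      then show "\<bar>y i - \<sigma> * real_of_int (e i)\<bar> \<le> \<sigma>" by simp
      have "\<bar>y i / \<sigma>\<bar> \<le> M - 1" using yr[OF i] \<sigma>0 by (simp add: field_simps)
      then have "real_of_int (e i) \<le> M" "- M \<le> real_of_int (e i)" using f by linarith+
      then show "\<bar>e i\<bar> \<le> int m" unfolding M_def by linarith
    qed
    have e: "e \<in> lbox N (int m)" using eb by (auto simp: lbox_def e_def)
    have zy: "vnorm N (z0 + y - z0) \<le> l"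
    proof (rule near_l)
      fix i assume i: "i < N"
      have "(M - 1) * \<sigma> \<le> (M + 2) * \<sigma>" using \<sigma>0 by simp
      then show "\<bar>(z0 + y) i - z0 i\<bar> \<le> (M + 2) * \<sigma>" using yr[OF i] by simp
    qed
    have "\<bar>T (z0 + y) - T (P e)\<bar> \<le> 8 * C * l * vnorm N (z0 + y - P e)"
      by (rule osc) (use z0 y PR[OF e] P_near[OF e] zy in auto)
    also have "\<dots> \<le> 8 * C * l * (n * (2 * \<sigma>))"
      unfolding n_def
    proof (intro mult_left_mono[OF _ cl] vnorm_le_bound)
      fix i assume i: "i < N"
      have "(z0 + y - P e) i = (z0 i - h * real_of_int (k i)) + (y i - \<sigma> * real_of_int (e i))"
        by (simp add: Pc)
      then show "\<bar>(z0 + y - P e) i\<bar> \<le> 2 * \<sigma>" using near[OF i] eb(1)[OF i] h\<sigma> by linarith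
    qed
    also have "\<dots> = 32 * C * n\<^sup>2 * M * \<sigma>\<^sup>2" by (simp add: l_def power2_eq_square)
    finally have 1: "\<bar>T (z0 + y) - T (P e)\<bar> \<le> 32 * C * n\<^sup>2 * M * \<sigma>\<^sup>2" .
    have 2: "\<bar>U e - T (P e)\<bar> \<le> 16 * C * n\<^sup>2 * M * \<sigma>\<^sup>2"
      using UT[OF e] by (simp add: l_def power2_eq_square mult_ac)
    have 3: "\<bar>U e - U 0 - (\<Sum>a<N. D a * real_of_int (e a)) - qf N H (vscale \<sigma> (rv e)) / 2\<bar> \<le> \<tau> * n\<^sup>2 * M\<^sup>2 * \<sigma>\<^sup>2"
      using D[OF e] unfolding qfs by (simp add: power_mult_distrib mult_ac)
    have "(\<Sum>a<N. D a * real_of_int (e a)) - vdot N d y = (\<Sum>a<N. d a * (\<sigma> * real_of_int (e a) - y a))"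
      unfolding vdot_def sum_subtractf[symmetric]
      by (rule sum.cong) (use \<sigma>0 in \<open>auto simp: d_def field_simps\<close>)
    also have "\<bar>\<dots>\<bar> \<le> (\<Sum>a<N. 36 * C * n\<^sup>2 * M * \<sigma>\<^sup>2 / \<sigma> * \<sigma>)"
    proof (rule order_trans[OF sum_abs], rule sum_mono)
      fix a assume "a \<in> {..<N}"
      then have a: "a < N" by simp
      show "\<bar>d a * (\<sigma> * real_of_int (e a) - y a)\<bar> \<le> 36 * C * n\<^sup>2 * M * \<sigma>\<^sup>2 / \<sigma> * \<sigma>"
        unfolding abs_mult
      proof (rule mult_mono)
        show "\<bar>d a\<bar> \<le> 36 * C * n\<^sup>2 * M * \<sigma>\<^sup>2 / \<sigma>"
          using Db[OF a] \<sigma>0 a by (simp add: d_def abs_divide divide_right_mono)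
        show "\<bar>\<sigma> * real_of_int (e a) - y a\<bar> \<le> \<sigma>" using eb(1)[OF a] by (simp add: abs_minus_commute)
      qed (use C n1 M2 \<sigma>0 in auto)
    qed
    also have "\<dots> = 36 * C * n ^ 3 * M * \<sigma>\<^sup>2"
      using \<sigma>0 by (simp add: n_def power2_eq_square power3_eq_cube)
    finally have 4: "\<bar>(\<Sum>a<N. D a * real_of_int (e a)) - vdot N d y\<bar> \<le> 36 * C * n ^ 3 * M * \<sigma>\<^sup>2" .
    define x where "x = vscale \<sigma> (rv e)"
    have xb: "\<bar>x i\<bar> \<le> M * \<sigma>" "\<bar>y i\<bar> \<le> M * \<sigma>" "\<bar>(x - y) i\<bar> \<le> \<sigma>" if i: "i < N" for i
    proof -
      show "\<bar>x i\<bar> \<le> M * \<sigma>" using e\<sigma>[OF e i] by (simp add: x_def)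
      have "(M - 1) * \<sigma> \<le> M * \<sigma>" using \<sigma>0 by simp
      then show "\<bar>y i\<bar> \<le> M * \<sigma>" using yr[OF i] by simp
      show "\<bar>(x - y) i\<bar> \<le> \<sigma>" using eb(1)[OF i] by (simp add: x_def abs_minus_commute)
    qed
    have "qf N H x - qf N H y = bf N H (x - y) x + bf N H y (x - y)"
      by (simp add: qf_bf bf_simps)
    also have "\<bar>\<dots>\<bar> \<le> n\<^sup>2 * (6 * C) * \<sigma> * (M * \<sigma>) + n\<^sup>2 * (6 * C) * (M * \<sigma>) * \<sigma>"
      unfolding n_def
      by (intro order_trans[OF abs_triangle_ineq] add_mono bf_bound) (use xb Hb C M2 \<sigma>0 in auto)
    finally have 5: "\<bar>qf N H x - qf N H y\<bar> \<le> 12 * C * n\<^sup>2 * M * \<sigma>\<^sup>2"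
      by (simp add: power2_eq_square algebra_simps)
    have "n\<^sup>2 * 1 \<le> n\<^sup>2 * n" using n1 by (intro mult_left_mono) auto
    then have "(54 * C * M * \<sigma>\<^sup>2) * n\<^sup>2 \<le> (54 * C * M * \<sigma>\<^sup>2) * n ^ 3"
      using C M2 by (intro mult_left_mono) (auto simp: power2_eq_square power3_eq_cube)
    then have 6: "54 * C * n\<^sup>2 * M * \<sigma>\<^sup>2 \<le> 54 * C * n ^ 3 * M * \<sigma>\<^sup>2" by (simp add: mult_ac)
    show ?thesis
      using 1 2 3 4 5 6 unfolding Err_def x_def[symmetric] abs_le_iff by argo
  qed
  have r0: "r \<ge> 0" using M2 \<sigma>0 by (simp add: r)
  have Mr: "M * \<sigma> \<le> 2 * r" using M2 \<sigma>0 by (simp add: r algebra_simps)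
  have Err2: "2 * Err \<le> (720 * C * n ^ 3 / M + 8 * \<tau> * n\<^sup>2) * r\<^sup>2"
  proof -
    have "(M * \<sigma>)\<^sup>2 \<le> (2 * r)\<^sup>2" using Mr M2 \<sigma>0 by (intro power_mono) auto
    then have "2 * (90 * C * n ^ 3 / M + \<tau> * n\<^sup>2) * (M * \<sigma>)\<^sup>2 \<le> 2 * (90 * C * n ^ 3 / M + \<tau> * n\<^sup>2) * (2 * r)\<^sup>2"
      using C M2 \<tau> n1 by (intro mult_left_mono) auto
    moreover have "2 * Err = 2 * (90 * C * n ^ 3 / M + \<tau> * n\<^sup>2) * (M * \<sigma>)\<^sup>2"
      using M2 by (simp add: Err_def field_simps power2_eq_square)
    ultimately show ?thesis by (simp add: power_mult_distrib algebra_simps)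
  qed
  have "\<bar>T (z0 + y) - T z0 - vdot N d y - qf N H y / 2\<bar> \<le> (720 * C * n ^ 3 / M + 8 * \<tau> * n\<^sup>2) * r\<^sup>2"
    if "y \<in> Rn N" "vnorm N y \<le> r" for y
    using main[OF that] main[of 0] r0 Err2 by (simp add: vdot_simps)
  moreover have "vnorm N d \<le> 72 * C * n ^ 3 * r"
  proof -
    have "vnorm N d \<le> n * (36 * C * n\<^sup>2 * M * \<sigma>)"
      unfolding n_def
    proof (rule vnorm_le_bound)
      fix i assume i: "i < N"
      have "\<bar>d i\<bar> = \<bar>D i\<bar> / \<sigma>" using i \<sigma>0 by (simp add: d_def abs_divide)
      also have "\<dots> \<le> 36 * C * n\<^sup>2 * M * \<sigma>\<^sup>2 / \<sigma>" using Db[OF i] \<sigma>0 by (intro divide_right_mono) auto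
      finally show "\<bar>d i\<bar> \<le> 36 * C * (real N)\<^sup>2 * M * \<sigma>" using \<sigma>0 by (simp add: n_def power2_eq_square)
    qed
    also have "\<dots> = 36 * C * n ^ 3 * (M * \<sigma>)" by (simp add: power2_eq_square power3_eq_cube)
    also have "\<dots> \<le> 36 * C * n ^ 3 * (2 * r)" using Mr C n1 by (intro mult_left_mono) auto
    finally show ?thesis by simp
  qed
  moreover have "d \<in> Rn N" by (simp add: d_def Rn_iff)
  ultimately show ?thesis
    using Hsym Hb unfolding n_def M_def by (intro exI[of _ d] exI[of _ H]) auto
qed

lemma lavg_diff: "lavg N m j (\<lambda>k. f k - g k) k = lavg N m j f k - lavg N m j g k"
  by (induction j arbitrary: k) (simp_all add: sum_subtractf diff_divide_distrib)

lemma flat_at_minus_linear: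
  assumes p: "p \<in> Rn N" and h: "h > 0" and k: "\<forall>i\<ge>N. k i = 0"
  shows "flat_at N m j \<tau> (\<lambda>k. (W (vscale h (rv k)) - vdot N p (vscale h (rv k))) / h\<^sup>2) k
    \<longleftrightarrow> flat_at N m j \<tau> (\<lambda>k. W (vscale h (rv k)) / h\<^sup>2) k"
proof -
  have lin: "C11 N (vdot N p) (\<lambda>_. p) 0" using p by (simp add: C11_def vdot_simps)
  have "hdiff N m j a c (\<lambda>k. (W (vscale h (rv k)) - vdot N p (vscale h (rv k))) / h\<^sup>2) k
      = hdiff N m j a c (\<lambda>k. W (vscale h (rv k)) / h\<^sup>2) k"
    if "a < N" "c < N" "\<forall>i\<ge>N. k i = 0" for a c j k
  proof -
    define s where "s = (2 * int m + 1) ^ j"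
    have "\<bar>sdiff s a c (lavg N m j (\<lambda>k. vdot N p (vscale h (rv k)) / h\<^sup>2)) k\<bar> \<le> 6 * 0"
      by (rule sdiff_lavg_bound[OF C11_sdiff_bound[OF lin]]) (use h that in \<open>auto simp: s_def\<close>)
    then show ?thesis
      by (simp add: hdiff_def s_def[symmetric] diff_divide_distrib sdiff_def fdiff_def lavg_diff
          add_divide_distrib)
  qed
  then show ?thesis using k by (auto simp: flat_at_def iscale_def lbox_def)
qed

lemma C11_continuous:
  assumes W: "C11 N W G C" and C: "C \<ge> 0" and S: "S \<subseteq> Rn N"
  shows "continuous_on S W"
  unfolding continuous_on_Rn_iff[OF S]
proof (intro ballI allI impI)
  fix x e :: _ assume x: "x \<in> S" and e: "(e::real) > 0"
  define K where "K = vnorm N (G x) + C + 1"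
  have K: "K > 0" using C vnorm_ge_0[of N "G x"] unfolding K_def by linarith
  show "\<exists>d>0. \<forall>y\<in>S. vnorm N (y - x) < d \<longrightarrow> dist (W y) (W x) < e"
  proof (intro exI[of _ "min 1 (e / K)"] conjI ballI impI)
    fix y assume y: "y \<in> S" "vnorm N (y - x) < min 1 (e / K)"
    define t where "t = vnorm N (y - x)"
    have t: "0 \<le> t" "t \<le> 1" "t * K < e" using y K by (auto simp: t_def field_simps)
    have mem: "x \<in> Rn N" "y - x \<in> Rn N" using x y S by auto
    have "\<bar>W y - W x - vdot N (G x) (y - x)\<bar> \<le> C * t\<^sup>2"
      using C11D[OF W mem] by (simp add: t_def)
    moreover have "C * t\<^sup>2 \<le> C * t"
      using t C by (intro mult_left_mono) (auto simp: power2_eq_square mult_left_le)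
    moreover have "\<bar>vdot N (G x) (y - x)\<bar> \<le> vnorm N (G x) * t" unfolding t_def by (rule vdot_le)
    moreover have "vnorm N (G x) * t + C * t \<le> t * K" using t by (simp add: K_def algebra_simps)
    ultimately show "dist (W y) (W x) < e" using t by (simp add: dist_real_def)
  qed (use e K in auto)
qed

text \<open>If the slopes differed, a short step in the direction of \<open>G z - p\<close> would increase \<open>W\<close> by a first-order
  amount against a second-order error.\<close>

lemma C11_interior_max:
  assumes W: "C11 N W G C" and C: "C > 0" and z: "z \<in> Rn N" and p: "p \<in> Rn N" and r: "r > 0"
    and max: "\<And>y. y \<in> Rn N \<Longrightarrow> vnorm N y \<le> r \<Longrightarrow> W (z + y) \<le> W z + vdot N p y"
  shows "G z = p"
proof (rule ccontr)
  define g where "g = G z - p"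
  assume "G z \<noteq> p"
  then have "g \<noteq> 0" by (simp add: g_def)
  have gR: "g \<in> Rn N" using C11_Rn[OF W z] p by (auto simp: g_def)
  then have g0: "vnorm N g > 0" using vnorm_eq_0[OF gR] \<open>g \<noteq> 0\<close> vnorm_ge_0[of N g] by linarith
  define t where "t = min (r / vnorm N g) (1 / (2 * C))"
  have t: "t > 0" "t * vnorm N g \<le> r" "C * t \<le> 1 / 2"
    using g0 C r by (auto simp: t_def min_def field_simps)
  define y where "y = vscale t g"
  have y: "y \<in> Rn N" "vnorm N y \<le> r" using gR t g0 by (auto simp: y_def)
  have 1: "\<bar>W (z + y) - W z - vdot N (G z) y\<bar> \<le> C * (vnorm N y)\<^sup>2" by (rule C11D[OF W z y(1)])
  have 2: "vdot N (G z) y - vdot N p y = t * (vnorm N g)\<^sup>2"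
    unfolding vnorm_sq vdot_simps(3)[symmetric] by (simp add: y_def vdot_simps g_def)
  have "C * (vnorm N y)\<^sup>2 = C * t * (t * (vnorm N g)\<^sup>2)"
    by (simp add: y_def power2_eq_square)
  also have "\<dots> \<le> 1 / 2 * (t * (vnorm N g)\<^sup>2)" using t by (intro mult_right_mono) auto
  finally have 3: "C * (vnorm N y)\<^sup>2 \<le> 1 / 2 * (t * (vnorm N g)\<^sup>2)" .
  have "t * (vnorm N g)\<^sup>2 > 0" using t g0 by simp
  with 3 have "C * (vnorm N y)\<^sup>2 < t * (vnorm N g)\<^sup>2" by linarith
  then show False using 1 2 max[OF y] by linarith
qed

text \<open>The maximum of \<open>W\<close> over the ball persists under small linear perturbations, and distinct
  slopes have contact points at a distance from each other comparable to the distance of the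
  slopes.  Hence the contact points fill a fixed proportion of the cells of any fine lattice; the
  exceptional cells, where \<open>W\<close> is not nearly quadratic, are fewer.\<close>

theorem nearly_quadratic_contact_point:
  assumes N: "N \<ge> 1" and W: "C11 N W G C" and C: "C > 0" and \<rho>: "\<rho> > 0" and \<kappa>: "\<kappa> > 0" and \<tau>: "\<tau> > 0"
    and ann': "\<forall>z\<in>Rn N. \<rho> / 2 \<le> vnorm N z \<longrightarrow> vnorm N z \<le> \<rho> \<longrightarrow> W z \<le> W 0 - \<kappa>"
  shows "\<exists>z0 p d H r. z0 \<in> Rn N \<and> p \<in> Rn N \<and> d \<in> Rn N \<and> vnorm N z0 < \<rho> / 2
    \<and> (\<forall>z\<in>Rn N. vnorm N z \<le> \<rho> \<longrightarrow> W z \<le> W z0 + vdot N p (z - z0))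
    \<and> vnorm N p \<le> \<tau> \<and> vnorm N (d - p) \<le> \<tau> \<and> 0 < r \<and> r \<le> \<tau>
    \<and> (\<forall>a c. H a c = H c a) \<and> (\<forall>a<N. \<forall>c<N. \<bar>H a c\<bar> \<le> 6 * C)
    \<and> (\<forall>y\<in>Rn N. vnorm N y \<le> r \<longrightarrow> \<bar>W (z0 + y) - W z0 - vdot N d y - qf N H y / 2\<bar> \<le> \<tau> * r\<^sup>2)
    \<and> (\<forall>y\<in>Rn N. qf N H y \<le> \<tau> * (vnorm N y)\<^sup>2)"
proof -
  note ann = ann'[rule_format]
  define n where "n = real N"
  have n1: "n \<ge> 1" using N by (simp add: n_def)
  define \<delta> where "\<delta> = min \<tau> (\<kappa> / (2 * \<rho>))"
  have \<delta>: "\<delta> > 0" "\<delta> \<le> \<tau>" "\<delta> * \<rho> \<le> \<kappa> / 2"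
    using \<tau> \<kappa> \<rho> by (auto simp: \<delta>_def min_def field_simps)
  \<comment> \<open>Contact points.\<close>
  have "\<exists>z. z \<in> Rn N \<and> vnorm N z < \<rho> / 2 \<and> G z = p
      \<and> (\<forall>z'\<in>Rn N. vnorm N z' \<le> \<rho> \<longrightarrow> W z' \<le> W z + vdot N p (z' - z))"
    if p: "p \<in> Rn N" "vnorm N p \<le> \<delta>" for p
  proof -
    have "continuous_on (cB N 0 \<rho>) (\<lambda>z. W z - vdot N p z)"
      by (rule C11_continuous[OF C11_minus_linear[OF W p(1)]]) (use C in \<open>auto simp: cB_def\<close>)
    moreover have "0 \<in> cB N 0 \<rho>" using \<rho> by (simp add: cB_def)
    ultimately obtain z where z: "z \<in> cB N 0 \<rho>"
      and max: "\<And>z'. z' \<in> cB N 0 \<rho> \<Longrightarrow> W z' - vdot N p z' \<le> W z - vdot N p z"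
      using continuous_attains_sup[OF compact_cB, of N 0 \<rho> "\<lambda>z. W z - vdot N p z"] by blast
    have zR: "z \<in> Rn N" "vnorm N z \<le> \<rho>" using z by (auto simp: cB_def)
    have "vnorm N z < \<rho> / 2"
    proof (rule ccontr)
      assume "\<not> ?thesis"
      then have "W z \<le> W 0 - \<kappa>" using ann[OF zR(1)] zR by simp
      moreover have "\<bar>vdot N p z\<bar> \<le> \<delta> * \<rho>"
        by (rule order_trans[OF vdot_le]) (use p zR \<delta> in \<open>auto intro!: mult_mono\<close>)
      moreover have "W 0 - vdot N p 0 \<le> W z - vdot N p z" using max \<open>0 \<in> cB N 0 \<rho>\<close> by blast
      ultimately show False using \<delta> \<kappa> by (simp add: vdot_simps)
    qed
    moreover have "G z = p"
    proof (rule C11_interior_max[OF W C zR(1) p(1), of "\<rho> / 2"])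
      fix y assume y: "y \<in> Rn N" "vnorm N y \<le> \<rho> / 2"
      then have "z + y \<in> cB N 0 \<rho>" using vnorm_triangle[of N z y] calculation zR by (simp add: cB_def)
      then show "W (z + y) \<le> W z + vdot N p y" using max[of "z + y"] by (simp add: vdot_simps)
    qed (use \<rho> in simp)
    moreover have "W z' \<le> W z + vdot N p (z' - z)" if "z' \<in> Rn N" "vnorm N z' \<le> \<rho>" for z'
      using max[of z'] that by (simp add: cB_def vdot_simps)
    ultimately show ?thesis using zR by blast
  qed
  then obtain Z where Z: "\<And>p. p \<in> Rn N \<Longrightarrow> vnorm N p \<le> \<delta> \<Longrightarrow> Z p \<in> Rn N \<and> vnorm N (Z p) < \<rho> / 2 \<and> G (Z p) = p
      \<and> (\<forall>z'\<in>Rn N. vnorm N z' \<le> \<rho> \<longrightarrow> W z' \<le> W (Z p) + vdot N p (z' - Z p))"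
    by metis
  \<comment> \<open>Choice of the parameters: first \<open>m\<close>, then the number \<open>J\<close> of scales, then the finest step \<open>h\<close>.\<close>
  define \<tau>0 where "\<tau>0 = min C (\<tau> / (32 * n\<^sup>2))"
  have \<tau>0: "0 < \<tau>0" "\<tau>0 \<le> C" "8 * \<tau>0 * n\<^sup>2 \<le> \<tau> / 4"
    using C \<tau> n1 by (auto simp: \<tau>0_def min_def field_simps)
  obtain m0 :: nat where m0: "2880 * C * n ^ 3 / \<tau> \<le> real m0" using real_arch_simple by blast
  define m where "m = max 2 m0"
  have m: "m \<ge> 2" "2880 * C * n ^ 3 / \<tau> \<le> real m" using m0 by (auto simp: m_def)
  have err: "720 * C * n ^ 3 / real m + 8 * \<tau>0 * n\<^sup>2 \<le> \<tau> / 2"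
  proof -
    have "720 * C * n ^ 3 / real m \<le> \<tau> / 4" using m \<tau> by (simp add: field_simps)
    then show ?thesis using \<tau>0 by simp
  qed
  define q where "q = \<delta> / (7 * C * n\<^sup>2)"
  have q0: "q > 0" using \<delta> C n1 by (simp add: q_def)
  define A where "A = n\<^sup>2 * real (card (shifts N m)) * (6 * C)\<^sup>2 * (3 * \<rho>) ^ N"
  obtain J :: nat where J: "A / (\<tau>0\<^sup>2 * q ^ N) < real J" using reals_Archimedean2 by blast
  have A0: "A \<ge> 0" using \<rho> by (simp add: A_def)
  have "0 \<le> A / (\<tau>0\<^sup>2 * q ^ N)" using A0 q0 by (intro divide_nonneg_nonneg) auto
  then have J0: "J > 0" using J by (cases J) auto
  have J1: "A < \<tau>0\<^sup>2 * real J * q ^ N" using J \<tau>0 q0 by (simp add: field_simps)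
  define b where "b = 2 * real m + 1"
  have b1: "b \<ge> 1" by (simp add: b_def)
  define X where "X = 5 + 6 * real J * b ^ J + real m * b ^ J * (1 + 72 * C * n ^ 3)"
  have X: "X \<ge> 5 + 6 * real J * b ^ J" "X \<ge> real m * b ^ J" "X \<ge> 72 * C * n ^ 3 * (real m * b ^ J)" "X > 0"
  proof -
    have "0 \<le> real m * b ^ J" "0 \<le> 6 * real J * b ^ J" "0 \<le> real m * b ^ J * (72 * C * n ^ 3)"
      using b1 C n1 by auto
    then show "X \<ge> 5 + 6 * real J * b ^ J" "X \<ge> real m * b ^ J" "X \<ge> 72 * C * n ^ 3 * (real m * b ^ J)" "X > 0"
      by (auto simp: X_def algebra_simps)
  qed
  define h where "h = min (\<rho> / 2) \<tau> / X"
  have h0: "h > 0" using \<rho> \<tau> X by (simp add: h_def)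
  have hX: "X * h = min (\<rho> / 2) \<tau>" using X by (simp add: h_def)
  have hb: "x * h \<le> min (\<rho> / 2) \<tau>" if "x \<le> X" for x
    using mult_right_mono[OF that, of h] h0 hX by simp
  \<comment> \<open>The slopes form a lattice of step \<open>s\<close>, large enough that contact points of distinct slopes, whose
    gradients differ by at least \<open>s\<close>, lie in distinct cells of side \<open>h\<close>.\<close>
  define s where "s = 7 * C * n * h"
  have s0: "s > 0" using C n1 h0 by (simp add: s_def)
  define L where "L = \<lfloor>\<delta> / (s * n)\<rfloor>"
  have L0: "L \<ge> 0" using \<delta> s0 n1 by (simp add: L_def)
  define p where "p = (\<lambda>l. vscale s (rv l))"
  have pR: "p l \<in> Rn N" and pn: "vnorm N (p l) \<le> \<delta>" if l: "l \<in> lbox N L" for l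
  proof -
    show "p l \<in> Rn N" using l unfolding p_def by (auto intro!: Rn_closed rv_Rn simp: lbox_def)
    have "vnorm N (p l) \<le> n * (s * real_of_int L)"
      unfolding n_def
    proof (rule vnorm_le_bound)
      fix i assume "i < N"
      then have "\<bar>l i\<bar> \<le> L" using l by (auto simp: lbox_def)
      then have "\<bar>real_of_int (l i)\<bar> \<le> real_of_int L" by linarith
      then show "\<bar>p l i\<bar> \<le> s * real_of_int L" using s0 by (simp add: p_def abs_mult)
    qed
    also have "\<dots> \<le> n * (s * (\<delta> / (s * n)))"
      unfolding L_def using n1 s0 by (intro mult_left_mono of_int_floor_le) auto
    also have "\<dots> = \<delta>" using n1 s0 by simp
    finally show "vnorm N (p l) \<le> \<delta>" .
  qed
  define cell where "cell = (\<lambda>l i. if i < N then \<lfloor>Z (p l) i / h\<rfloor> else 0)"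
  have cell_near: "\<bar>Z (p l) i - h * real_of_int (cell l i)\<bar> \<le> h" if "i < N" for l i
  proof -
    have f: "real_of_int (cell l i) \<le> Z (p l) i / h" "Z (p l) i / h < real_of_int (cell l i) + 1"
      using that by (auto simp: cell_def)
    have "h * real_of_int (cell l i) \<le> Z (p l) i" "Z (p l) i < h * real_of_int (cell l i) + h"
      using f h0 by (auto simp: field_simps)
    then show ?thesis by simp
  qed
  define R where "R = \<lceil>\<rho> / h\<rceil> + 1"
  have cellR: "cell l \<in> lbox N R" if l: "l \<in> lbox N L" for l
  proof -
    have "\<bar>cell l i\<bar> \<le> R" if "i < N" for i
    proof -
      have "\<bar>Z (p l) i\<bar> \<le> \<rho>" using vnorm_coord[OF that, of "Z (p l)"] Z[OF pR[OF l] pn[OF l]] \<rho> by linarith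
      then have "\<bar>Z (p l) i / h\<bar> \<le> \<rho> / h" using h0 by (simp add: divide_right_mono)
      then have "\<bar>Z (p l) i / h\<bar> \<le> real_of_int \<lceil>\<rho> / h\<rceil>" by linarith
      then have "\<lfloor>Z (p l) i / h\<rfloor> \<le> \<lceil>\<rho> / h\<rceil> + 1" "- (\<lceil>\<rho> / h\<rceil> + 1) \<le> \<lfloor>Z (p l) i / h\<rfloor>"
        by linarith+
      then show ?thesis using that unfolding cell_def R_def by (simp add: abs_le_iff)
    qed
    then show ?thesis by (simp add: lbox_def cell_def)
  qed
  have inj: "inj_on cell (lbox N L)"
  proof (rule inj_onI)
    fix l l' assume l: "l \<in> lbox N L" "l' \<in> lbox N L" and eq: "cell l = cell l'"
    have ZR: "Z (p l) \<in> Rn N" "Z (p l') \<in> Rn N" "G (Z (p l)) = p l" "G (Z (p l')) = p l'"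
      using Z pR pn l by auto
    have "vnorm N (Z (p l) - Z (p l')) \<le> n * h"
      unfolding n_def
    proof (rule vnorm_le_bound)
      fix i assume i: "i < N"
      have f: "\<lfloor>Z (p l) i / h\<rfloor> = \<lfloor>Z (p l') i / h\<rfloor>" using fun_cong[OF eq, of i] i by (simp add: cell_def)
      have "\<bar>Z (p l) i / h - Z (p l') i / h\<bar> \<le> 1"
        using f by linarith
      then show "\<bar>(Z (p l) - Z (p l')) i\<bar> \<le> h"
        using h0 by (simp add: diff_divide_distrib[symmetric] abs_divide)
    qed
    then have "6 * C * vnorm N (Z (p l) - Z (p l')) \<le> 6 * C * (n * h)" using C by (intro mult_left_mono) auto
    moreover have "vnorm N (p l - p l') \<le> 6 * C * vnorm N (Z (p l) - Z (p l'))"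
      using C11_gradient_Lipschitz[OF W _ ZR(2,1)] C ZR by simp
    ultimately have "vnorm N (p l - p l') \<le> 6 * C * (n * h)" by linarith
    also have "\<dots> < s" using C n1 h0 by (simp add: s_def)
    finally have small: "vnorm N (p l - p l') < s" .
    have "l i = l' i" for i
    proof (cases "i < N")
      case True
      have "\<bar>(p l - p l') i\<bar> < s" using vnorm_coord[OF True, of "p l - p l'"] small by linarith
      then have "s * \<bar>real_of_int (l i) - real_of_int (l' i)\<bar> < s * 1"
        using s0 by (simp add: p_def right_diff_distrib[symmetric] abs_mult)
      then have "\<bar>real_of_int (l i) - real_of_int (l' i)\<bar> < 1" using s0 by simp
      then show ?thesis by linarith
    qed (use l in \<open>auto simp: lbox_def\<close>)
    then show "l = l'" by (simp add: fun_eq_iff)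
  qed
  \<comment> \<open>There are more slopes than bad cells.\<close>
  define w where "w = (\<lambda>k. W (vscale h (rv k)) / h\<^sup>2)"
  have "0 \<le> \<rho> / h" using \<rho> h0 by simp
  then have R0: "R \<ge> 0" unfolding R_def by linarith
  define R' where "R' = R + int J * (3 * (2 * int m + 1) ^ J)"
  have R'0: "R' \<ge> 0" using R0 by (simp add: R'_def)
  have "\<exists>j<J. \<tau>0\<^sup>2 * real J * real (card {k \<in> lbox N R. \<not> flat_at N m j \<tau>0 w k})
    \<le> (real N)\<^sup>2 * real (card (shifts N m)) * (6 * C)\<^sup>2 * real (card (lbox N R'))"
    unfolding R'_def
  proof (rule few_bad_points[OF J0 R0 \<tau>0(1)])
    fix a c k assume "a < N" "c < N" "\<forall>i\<ge>N. (k i :: int) = 0"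
    then show "\<bar>sdiff 1 a c w k\<bar> \<le> 6 * C"
      unfolding w_def by (intro C11_sdiff_bound[OF W]) (use C h0 in auto)
  qed
  then obtain j where j: "j < J" and few: "\<tau>0\<^sup>2 * real J * real (card {k \<in> lbox N R. \<not> flat_at N m j \<tau>0 w k})
    \<le> n\<^sup>2 * real (card (shifts N m)) * (6 * C)\<^sup>2 * real (card (lbox N R'))"
    by (auto simp: n_def)
  have "\<exists>l\<in>lbox N L. flat_at N m j \<tau>0 w (cell l)"
  proof (rule ccontr)
    assume "\<not> ?thesis"
    then have "cell ` lbox N L \<subseteq> {k \<in> lbox N R. \<not> flat_at N m j \<tau>0 w k}" using cellR by auto
    then have "card (cell ` lbox N L) \<le> card {k \<in> lbox N R. \<not> flat_at N m j \<tau>0 w k}"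
      by (rule card_mono[rotated]) (simp add: card_lbox(1)[OF R0])
    then have many: "real (card (lbox N L)) \<le> real (card {k \<in> lbox N R. \<not> flat_at N m j \<tau>0 w k})"
      by (simp add: card_image[OF inj])
    have "q / h = \<delta> / (s * n)" using n1 h0 C by (simp add: q_def s_def power2_eq_square field_simps)
    also have "\<dots> \<le> real_of_int (2 * L + 1)"
      using L0 unfolding L_def by linarith
    finally have "(q / h) ^ N \<le> real_of_int (2 * L + 1) ^ N" using q0 h0 by (intro power_mono) auto
    also have "\<dots> = real (card (lbox N L))" using L0 by (simp add: card_lbox)
    finally have 1: "(q / h) ^ N \<le> real (card {k \<in> lbox N R. \<not> flat_at N m j \<tau>0 w k})" using many by linarith
    have "real_of_int (2 * R' + 1) \<le> (2 * \<rho> + (5 + 6 * real J * b ^ J) * h) / h"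
    proof -
      have "real_of_int R \<le> \<rho> / h + 2" unfolding R_def by linarith
      moreover have "real_of_int R' = real_of_int R + real J * (3 * b ^ J)" by (simp add: R'_def b_def)
      ultimately have "real_of_int (2 * R' + 1) \<le> 2 * (\<rho> / h) + (5 + 6 * real J * b ^ J)" by simp
      also have "\<dots> = (2 * \<rho> + (5 + 6 * real J * b ^ J) * h) / h" using h0 by (simp add: field_simps)
      finally show ?thesis .
    qed
    also have "\<dots> \<le> (3 * \<rho>) / h"
      using hb[OF X(1)] h0 \<rho> by (intro divide_right_mono) auto
    finally have "real_of_int (2 * R' + 1) ^ N \<le> ((3 * \<rho>) / h) ^ N"
      using R'0 by (intro power_mono) auto
    then have 2: "real (card (lbox N R')) \<le> ((3 * \<rho>) / h) ^ N" using R'0 by (simp add: card_lbox)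
    have "\<tau>0\<^sup>2 * real J * (q / h) ^ N \<le> \<tau>0\<^sup>2 * real J * real (card {k \<in> lbox N R. \<not> flat_at N m j \<tau>0 w k})"
      using 1 by (intro mult_left_mono) auto
    also note few
    also have "n\<^sup>2 * real (card (shifts N m)) * (6 * C)\<^sup>2 * real (card (lbox N R'))
        \<le> n\<^sup>2 * real (card (shifts N m)) * (6 * C)\<^sup>2 * ((3 * \<rho>) / h) ^ N"
      using 2 by (intro mult_left_mono) auto
    also have "\<dots> = A / h ^ N" by (simp add: A_def power_divide)
    also have "\<dots> < \<tau>0\<^sup>2 * real J * q ^ N / h ^ N" using J1 h0 by (intro divide_strict_right_mono) auto
    finally show False by (simp add: power_divide)
  qed
  then obtain l where l: "l \<in> lbox N L" and flat: "flat_at N m j \<tau>0 w (cell l)" by blast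
  define z0 where "z0 = Z (p l)"
  have Zl: "z0 \<in> Rn N" "vnorm N z0 < \<rho> / 2" "G z0 = p l"
    "\<And>z'. z' \<in> Rn N \<Longrightarrow> vnorm N z' \<le> \<rho> \<Longrightarrow> W z' \<le> W z0 + vdot N (p l) (z' - z0)"
    using Z[OF pR[OF l] pn[OF l]] by (auto simp: z0_def)
  define T where "T = (\<lambda>z. W z - vdot N (p l) z)"
  have T: "C11 N T (\<lambda>z. G z - p l) C" unfolding T_def by (rule C11_minus_linear[OF W pR[OF l]])
  have k0: "\<forall>i\<ge>N. cell l i = 0" by (simp add: cell_def)
  have flatT: "flat_at N m j \<tau>0 (\<lambda>k. T (vscale h (rv k)) / h\<^sup>2) (cell l)"
    using flat unfolding T_def flat_at_minus_linear[OF pR[OF l] h0 k0] w_def .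
  define r where "r = (real m - 1) * ((2 * real m + 1) ^ j * h)"
  have g0: "(\<lambda>z. G z - p l) z0 = 0" using Zl(3) by simp
  have near: "\<bar>z0 i - h * real_of_int (cell l i)\<bar> \<le> h" if "i < N" for i
    using cell_near[OF that] by (simp add: z0_def)
  obtain d H where dH: "d \<in> Rn N" "vnorm N d \<le> 72 * C * n ^ 3 * r" "\<And>a c. H a c = H c a"
      "\<And>a c. a < N \<Longrightarrow> c < N \<Longrightarrow> \<bar>H a c\<bar> \<le> 6 * C"
      "\<And>y. y \<in> Rn N \<Longrightarrow> vnorm N y \<le> r \<Longrightarrow> \<bar>T (z0 + y) - T z0 - vdot N d y - qf N H y / 2\<bar>
          \<le> (720 * C * n ^ 3 / real m + 8 * \<tau>0 * n\<^sup>2) * r\<^sup>2"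
    using flat_imp_quadratic[OF N T C g0 Zl(1) h0 m(1) \<tau>0(1,2) k0 near flatT]
    unfolding r_def[symmetric] n_def[symmetric] by blast
  have r0: "r > 0" using m h0 by (simp add: r_def)
  have "r \<le> real m * (b ^ J * h)"
    unfolding r_def b_def
    by (intro mult_mono mult_right_mono power_increasing) (use j h0 in auto)
  then have rJ: "r \<le> real m * b ^ J * h" by (simp add: mult_ac)
  have r\<rho>: "r \<le> min (\<rho> / 2) \<tau>" using rJ hb[OF X(2)] by linarith
  have "72 * C * n ^ 3 * r \<le> 72 * C * n ^ 3 * (real m * b ^ J * h)"
    using rJ C n1 by (intro mult_left_mono) auto
  also have "\<dots> = 72 * C * n ^ 3 * (real m * b ^ J) * h" by (simp add: mult_ac)
  also have "\<dots> \<le> min (\<rho> / 2) \<tau>" by (rule hb[OF X(3)])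
  finally have d\<tau>: "vnorm N d \<le> \<tau>" using dH(2) by linarith
  have quad: "\<bar>W (z0 + y) - W z0 - vdot N (p l + d) y - qf N H y / 2\<bar> \<le> \<tau> / 2 * r\<^sup>2"
    if "y \<in> Rn N" "vnorm N y \<le> r" for y
  proof -
    have "\<bar>T (z0 + y) - T z0 - vdot N d y - qf N H y / 2\<bar> \<le> \<tau> / 2 * r\<^sup>2"
      by (rule order_trans[OF dH(5)[OF that] mult_right_mono[OF err]]) simp
    moreover have "T (z0 + y) - T z0 - vdot N d y - qf N H y / 2
        = W (z0 + y) - W z0 - vdot N (p l + d) y - qf N H y / 2"
      by (simp add: T_def vdot_simps)
    ultimately show ?thesis by simp
  qed
  have Hle: "qf N H y \<le> \<tau> * (vnorm N y)\<^sup>2" if y: "y \<in> Rn N" for y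
  proof (cases "vnorm N y = 0")
    case True
    then show ?thesis using vnorm_eq_0[OF y] by simp
  next
    case False
    then have y0: "vnorm N y > 0" using vnorm_ge_0[of N y] by linarith
    define x where "x = vscale (r / vnorm N y) y"
    have x: "x \<in> Rn N" "- x \<in> Rn N" "vnorm N x = r" using y y0 r0 by (auto simp: x_def)
    have "vnorm N (z0 + x) \<le> \<rho>" "vnorm N (z0 + - x) \<le> \<rho>"
      using vnorm_triangle[of N z0 x] vnorm_triangle[of N z0 "- x"] Zl(2) r\<rho> x by auto
    then have "W (z0 + x) \<le> W z0 + vdot N (p l) x" "W (z0 + - x) \<le> W z0 - vdot N (p l) x"
      using Zl(4)[of "z0 + x"] Zl(4)[of "z0 + - x"] Zl(1) x by (auto simp: vdot_simps)
    moreover have "\<bar>W (z0 + x) - W z0 - vdot N (p l + d) x - qf N H x / 2\<bar> \<le> \<tau> / 2 * r\<^sup>2"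
      "\<bar>W (z0 + - x) - W z0 - vdot N (p l + d) (- x) - qf N H (- x) / 2\<bar> \<le> \<tau> / 2 * r\<^sup>2"
      by (rule quad; use x in simp)+
    ultimately have "qf N H x \<le> \<tau> * r\<^sup>2"
      unfolding abs_le_iff qf_minus vdot_simps(6) by argo
    moreover have "qf N H x = (r / vnorm N y)\<^sup>2 * qf N H y" unfolding x_def by (rule qf_scale)
    ultimately have "r\<^sup>2 * qf N H y \<le> r\<^sup>2 * (\<tau> * (vnorm N y)\<^sup>2)"
      using y0 by (simp add: power_divide field_simps)
    then show ?thesis using r0 by simp
  qed
  have final: "\<bar>W (z0 + y) - W z0 - vdot N (p l + d) y - qf N H y / 2\<bar> \<le> \<tau> * r\<^sup>2"
    if "y \<in> Rn N" "vnorm N y \<le> r" for y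
  proof -
    have "\<tau> / 2 * r\<^sup>2 \<le> \<tau> * r\<^sup>2" using \<tau> by (intro mult_right_mono) auto
    then show ?thesis using quad[OF that] by linarith
  qed
  show ?thesis
    by (rule exI[of _ z0], rule exI[of _ "p l"], rule exI[of _ "p l + d"], rule exI[of _ H], rule exI[of _ r])
       (use Zl pR[OF l] pn[OF l] \<delta> dH d\<tau> r0 r\<rho> final Hle in auto)
qed

section \<open>Regularisation by sup- and inf-convolution\<close>

definition sconv :: "nat \<Rightarrow> point set \<Rightarrow> (point \<Rightarrow> real) \<Rightarrow> real \<Rightarrow> point \<Rightarrow> real" where
  "sconv n K u s x = (SUP \<xi>\<in>K. u \<xi> - (vnorm n (x - \<xi>))\<^sup>2 / (2 * s))"

definition siconv :: "nat \<Rightarrow> point set \<Rightarrow> (point \<Rightarrow> real) \<Rightarrow> real \<Rightarrow> point \<Rightarrow> real" where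
  "siconv n K u t x = (INF y\<in>Rn n. sconv n K u (2 * t) y + (vnorm n (x - y))\<^sup>2 / (2 * t))"

lemma sconv_attained:
  assumes K: "compact K" "K \<noteq> {}" and u: "continuous_on K u" and s: "s > 0"
  shows "\<exists>\<xi>\<in>K. sconv n K u s x = u \<xi> - (vnorm n (x - \<xi>))\<^sup>2 / (2 * s)
    \<and> (\<forall>\<eta>\<in>K. u \<eta> - (vnorm n (x - \<eta>))\<^sup>2 / (2 * s) \<le> sconv n K u s x)"
proof -
  let ?f = "\<lambda>\<xi>. u \<xi> - (vnorm n (x - \<xi>))\<^sup>2 / (2 * s)"
  have "continuous_on K ?f"
    unfolding vnorm_commute[of n x] using s u by (intro continuous_intros continuous_on_vnorm) auto
  then obtain \<xi> where \<xi>: "\<xi> \<in> K" "\<And>\<eta>. \<eta> \<in> K \<Longrightarrow> ?f \<eta> \<le> ?f \<xi>"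
    using continuous_attains_sup[OF K] by blast
  then have "sconv n K u s x = ?f \<xi>"
    unfolding sconv_def by (intro cSup_eq_maximum) auto
  then show ?thesis using \<xi> by auto
qed

lemma siconv_attained:
  assumes KR: "K \<subseteq> Rn n" and K: "compact K" "K \<noteq> {}" and u: "continuous_on K u" and t: "t > 0" and x: "x \<in> Rn n"
  shows "\<exists>y\<in>Rn n. siconv n K u t x = sconv n K u (2 * t) y + (vnorm n (x - y))\<^sup>2 / (2 * t)
    \<and> (\<forall>y\<in>Rn n. siconv n K u t x \<le> sconv n K u (2 * t) y + (vnorm n (x - y))\<^sup>2 / (2 * t))"
proof -
  define g where "g = (\<lambda>y. sconv n K u (2 * t) y + (vnorm n (x - y))\<^sup>2 / (2 * t))"
  note att = sconv_attained[OF K u, of "2 * t" n]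
  have t2: "2 * t > 0" using t by simp
  obtain \<xi>0 where \<xi>0: "\<xi>0 \<in> K" using K by blast
  have low: "sconv n K u (2 * t) y \<ge> u \<xi> - (vnorm n (y - \<xi>))\<^sup>2 / (4 * t)" if "\<xi> \<in> K" for \<xi> y
    using att[OF t2, of y] that by auto
  \<comment> \<open>The infimum may be restricted to a ball.\<close>
  define a where "a = vnorm n (x - \<xi>0)"
  define P where "P = 3 * a\<^sup>2 + 4 * t * (g x - u \<xi>0)"
  define \<rho> where "\<rho> = sqrt (2 * \<bar>P\<bar> + 1)"
  have \<rho>: "\<rho> > 0" "\<rho>\<^sup>2 = 2 * \<bar>P\<bar> + 1" by (auto simp: \<rho>_def)
  have far: "g x \<le> g y" if y: "y \<in> Rn n" "vnorm n (x - y) > \<rho>" for y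
  proof -
    define D where "D = vnorm n (x - y)"
    have "\<rho>\<^sup>2 \<le> D\<^sup>2" using y(2) \<rho> unfolding D_def by (intro power_mono) auto
    then have D2: "2 * P \<le> D\<^sup>2" using \<rho>(2) by linarith
    have "vnorm n (y - \<xi>0) \<le> D + a"
      using vnorm_triangle[of n "y - x" "x - \<xi>0"] by (simp add: D_def a_def vnorm_commute)
    then have "(vnorm n (y - \<xi>0))\<^sup>2 \<le> (D + a)\<^sup>2" by (intro power_mono) auto
    also have "\<dots> \<le> 3 / 2 * D\<^sup>2 + 3 * a\<^sup>2"
      using sum_squares_ge_zero[of "D - 2 * a" 0] by (simp add: power2_eq_square algebra_simps)
    finally have "(vnorm n (y - \<xi>0))\<^sup>2 / (4 * t) \<le> (3 / 2 * D\<^sup>2 + 3 * a\<^sup>2) / (4 * t)"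
      using t by (intro divide_right_mono) auto
    then have "g y \<ge> u \<xi>0 - (3 / 2 * D\<^sup>2 + 3 * a\<^sup>2) / (4 * t) + D\<^sup>2 / (2 * t)"
      using low[OF \<xi>0, of y] by (simp add: g_def D_def)
    also have "u \<xi>0 - (3 / 2 * D\<^sup>2 + 3 * a\<^sup>2) / (4 * t) + D\<^sup>2 / (2 * t) = u \<xi>0 + (D\<^sup>2 / 2 - 3 * a\<^sup>2) / (4 * t)"
      using t by (simp add: field_simps)
    also have "\<dots> \<ge> u \<xi>0 + (P - 3 * a\<^sup>2) / (4 * t)"
      using D2 t by (intro add_left_mono divide_right_mono) auto
    also have "u \<xi>0 + (P - 3 * a\<^sup>2) / (4 * t) = g x" using t by (simp add: P_def)
    finally show ?thesis .
  qed
  obtain M where M: "\<And>\<xi>. \<xi> \<in> K \<Longrightarrow> vnorm n (\<xi> - x) \<le> M"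
  proof -
    have "continuous_on K (\<lambda>\<xi>. vnorm n (\<xi> - x))" by (rule continuous_on_vnorm)
    then show ?thesis using continuous_attains_sup[OF K] that by blast
  qed
  define \<Lambda> where "\<Lambda> = (2 * \<rho> + 2 * M) / (4 * t) + 1"
  have M0: "M \<ge> 0" using M[OF \<xi>0] vnorm_ge_0 order_trans by blast
  have \<Lambda>: "\<Lambda> > 0" "\<Lambda> \<ge> (2 * \<rho> + 2 * M) / (4 * t)" using \<rho> M0 t by (auto simp: \<Lambda>_def add_nonneg_pos)
  have lip: "sconv n K u (2 * t) y - sconv n K u (2 * t) z \<le> \<Lambda> * vnorm n (z - y)"
    if y: "y \<in> cB n x \<rho>" "z \<in> cB n x \<rho>" for y z
  proof -
    obtain \<xi> where \<xi>: "\<xi> \<in> K" "sconv n K u (2 * t) y = u \<xi> - (vnorm n (y - \<xi>))\<^sup>2 / (4 * t)"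
      using att[OF t2, of y] by auto
    have dist: "vnorm n (v - \<xi>) \<le> \<rho> + M" if "v \<in> cB n x \<rho>" for v
      using vnorm_triangle[of n "v - x" "x - \<xi>"] that M[OF \<xi>(1)] by (simp add: cB_def vnorm_commute)
    have tri: "vnorm n (z - \<xi>) - vnorm n (y - \<xi>) \<le> vnorm n (z - y)"
      using vnorm_triangle[of n "z - y" "y - \<xi>"] by simp
    have "(vnorm n (z - \<xi>))\<^sup>2 - (vnorm n (y - \<xi>))\<^sup>2
        = (vnorm n (z - \<xi>) - vnorm n (y - \<xi>)) * (vnorm n (z - \<xi>) + vnorm n (y - \<xi>))"
      by (simp add: power2_eq_square algebra_simps)
    also have "\<dots> \<le> vnorm n (z - y) * (vnorm n (z - \<xi>) + vnorm n (y - \<xi>))"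
      using tri by (intro mult_right_mono) auto
    also have "\<dots> \<le> vnorm n (z - y) * (2 * \<rho> + 2 * M)"
      using dist[OF y(1)] dist[OF y(2)] by (intro mult_left_mono) auto
    finally have "((vnorm n (z - \<xi>))\<^sup>2 - (vnorm n (y - \<xi>))\<^sup>2) / (4 * t) \<le> vnorm n (z - y) * (2 * \<rho> + 2 * M) / (4 * t)"
      using t by (intro divide_right_mono) auto
    also have "\<dots> = (2 * \<rho> + 2 * M) / (4 * t) * vnorm n (z - y)" by simp
    also have "\<dots> \<le> \<Lambda> * vnorm n (z - y)" using \<Lambda> by (intro mult_right_mono) auto
    finally show ?thesis using low[OF \<xi>(1), of z] \<xi>(2) by (simp add: diff_divide_distrib)
  qed
  have "continuous_on (cB n x \<rho>) (sconv n K u (2 * t))"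
  proof (subst continuous_on_Rn_iff)
    show "cB n x \<rho> \<subseteq> Rn n" by (auto simp: cB_def)
    show "\<forall>y\<in>cB n x \<rho>. \<forall>e>0. \<exists>d>0. \<forall>z\<in>cB n x \<rho>. vnorm n (z - y) < d \<longrightarrow>
      dist (sconv n K u (2 * t) z) (sconv n K u (2 * t) y) < e"
    proof (intro ballI allI impI)
      fix y and e :: real assume y: "y \<in> cB n x \<rho>" and e: "e > 0"
      show "\<exists>d>0. \<forall>z\<in>cB n x \<rho>. vnorm n (z - y) < d \<longrightarrow> dist (sconv n K u (2 * t) z) (sconv n K u (2 * t) y) < e"
      proof (intro exI[of _ "e / \<Lambda>"] conjI ballI impI)
        fix z assume z: "z \<in> cB n x \<rho>" "vnorm n (z - y) < e / \<Lambda>"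
        have "\<Lambda> * vnorm n (z - y) < e" using z \<Lambda> by (simp add: field_simps)
        then show "dist (sconv n K u (2 * t) z) (sconv n K u (2 * t) y) < e"
          using lip[OF y z(1)] lip[OF z(1) y] by (simp add: dist_real_def vnorm_commute)
      qed (use e \<Lambda> in simp)
    qed
  qed
  then have cont: "continuous_on (cB n x \<rho>) g"
    unfolding g_def vnorm_commute[of n x] using t by (intro continuous_intros continuous_on_vnorm) auto
  have ne: "x \<in> cB n x \<rho>" using x \<rho> by (simp add: cB_def)
  obtain y where y: "y \<in> cB n x \<rho>" "\<And>z. z \<in> cB n x \<rho> \<Longrightarrow> g y \<le> g z"
    using continuous_attains_inf[OF compact_cB _ cont] ne by blast
  have yR: "y \<in> Rn n" using y by (simp add: cB_def)
  have min: "g y \<le> g z" if "z \<in> Rn n" for z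
  proof (cases "vnorm n (x - z) > \<rho>")
    case True
    then show ?thesis using far[OF that] y(2)[OF ne] by linarith
  next
    case False
    then show ?thesis using y(2)[of z] that by (simp add: cB_def vnorm_commute)
  qed
  have "siconv n K u t x = g y"
    unfolding siconv_def g_def[symmetric] by (rule cInf_eq_minimum) (use yR min in auto)
  then show ?thesis using yR min unfolding g_def by auto
qed

text \<open>The regularisation of Lasry and Lions.  The sup-convolution with parameter \<open>2 * t\<close> is semiconvex; the
  inf-convolution with parameter \<open>t\<close> makes it semiconcave and destroys only part of the semiconvexity,
  by the parallelogram law.  The result lies above the sup-convolution of \<open>u\<close> with parameter \<open>t\<close>, and
  agrees with it wherever a paraboloid of opening less than \<open>1 / t\<close> touches from above; there a test
  from above passes on to \<open>u\<close> at the point \<open>\<xi>\<close>.\<close>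

theorem C11_regularisation:
  assumes KR: "K \<subseteq> Rn n" and K: "compact K" "K \<noteq> {}" and u: "continuous_on K u" and t: "t > 0"
  defines "w \<equiv> siconv n K u t"
  shows "\<exists>G. C11 n w G (3 / (2 * t))
    \<and> (\<forall>x\<in>Rn n. \<forall>\<xi>\<in>K. u \<xi> - (vnorm n (x - \<xi>))\<^sup>2 / (2 * t) \<le> w x)
    \<and> (\<forall>x\<in>Rn n. \<exists>\<xi>\<in>K. w x \<le> u \<xi> - (vnorm n (x - \<xi>))\<^sup>2 / (4 * t))
    \<and> (\<forall>x\<in>Rn n. \<forall>p\<in>Rn n. \<forall>\<kappa> r. \<kappa> < 1 / t \<longrightarrow> r > 0 \<longrightarrow>
      (\<forall>y\<in>Rn n. vnorm n y \<le> r \<longrightarrow> w (x + y) \<le> w x + vdot n p y + \<kappa> / 2 * (vnorm n y)\<^sup>2) \<longrightarrow>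
      (\<exists>\<xi>\<in>K. w x = u \<xi> - (vnorm n (x - \<xi>))\<^sup>2 / (2 * t)))"
proof -
  define S where "S = sconv n K u (2 * t)"
  have t2: "2 * t > 0" using t by simp
  have S_att: "\<exists>\<xi>\<in>K. S y = u \<xi> - (vnorm n (y - \<xi>))\<^sup>2 / (4 * t)" for y
    using sconv_attained[OF K u t2, of n y] by (auto simp: S_def)
  have S_low: "u \<xi> - (vnorm n (y - \<xi>))\<^sup>2 / (4 * t) \<le> S y" if "\<xi> \<in> K" for \<xi> y
    using sconv_attained[OF K u t2, of n y] that by (auto simp: S_def)
  have "\<exists>Y. \<forall>x\<in>Rn n. Y x \<in> Rn n \<and> w x = S (Y x) + (vnorm n (x - Y x))\<^sup>2 / (2 * t)"
    unfolding w_def S_def using siconv_attained[OF KR K u t] by (intro bchoice) blast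
  then obtain Y where Y: "\<And>x. x \<in> Rn n \<Longrightarrow> Y x \<in> Rn n"
    "\<And>x. x \<in> Rn n \<Longrightarrow> w x = S (Y x) + (vnorm n (x - Y x))\<^sup>2 / (2 * t)" by blast
  have w_le: "w x \<le> S y + (vnorm n (x - y))\<^sup>2 / (2 * t)" if "x \<in> Rn n" "y \<in> Rn n" for x y
    using siconv_attained[OF KR K u t that(1)] that(2) by (auto simp: w_def S_def)
  define G where "G = (\<lambda>x. vscale (1 / t) (x - Y x))"
  have GR: "G x \<in> Rn n" if "x \<in> Rn n" for x using Y(1)[OF that] that by (auto simp: G_def)
  have expand: "(vnorm n (x + y - Y x))\<^sup>2 / (2 * t) = (vnorm n (x - Y x))\<^sup>2 / (2 * t) + vdot n (G x) y + (vnorm n y)\<^sup>2 / (2 * t)"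
    for x y
    using t by (simp add: vnorm_sq vdot_simps G_def vdot_commute field_simps)
  have upper: "w (x + y) \<le> w x + vdot n (G x) y + (vnorm n y)\<^sup>2 / (2 * t)" if "x \<in> Rn n" "y \<in> Rn n" for x y
    using w_le[of "x + y" "Y x"] that Y expand[of x y] by simp
  have mid: "w (x + h) + w (x - h) - 2 * w x \<ge> - (vnorm n h)\<^sup>2 / t" if x: "x \<in> Rn n" "h \<in> Rn n" for x h
  proof -
    define y1 where "y1 = Y (x + h)"
    define y2 where "y2 = Y (x - h)"
    define c where "c = vscale (1 / 2) (y1 + y2)"
    define d where "d = vscale (1 / 2) (y1 - y2)"
    have mem: "y1 \<in> Rn n" "y2 \<in> Rn n" "c \<in> Rn n" using Y(1) x by (auto simp: y1_def y2_def c_def)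
    have y12: "y1 = c + d" "y2 = c - d" by (auto simp: c_def d_def fun_eq_iff field_simps)
    obtain \<xi> where \<xi>: "\<xi> \<in> K" "S c = u \<xi> - (vnorm n (c - \<xi>))\<^sup>2 / (4 * t)" using S_att by blast
    have 1: "w (x + h) = S y1 + (vnorm n ((x - c) + (h - d)))\<^sup>2 / (2 * t)"
    proof -
      have e: "x + h - y1 = (x - c) + (h - d)" unfolding y12(1) by (simp add: algebra_simps)
      have "x + h \<in> Rn n" using x by auto
      then show ?thesis using Y(2)[of "x + h"] unfolding y1_def[symmetric] e by blast
    qed
    have 2: "w (x - h) = S y2 + (vnorm n ((x - c) - (h - d)))\<^sup>2 / (2 * t)"
    proof -
      have e: "x - h - y2 = (x - c) - (h - d)" unfolding y12(2) by (simp add: algebra_simps)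
      have "x - h \<in> Rn n" using x by auto
      then show ?thesis using Y(2)[of "x - h"] unfolding y2_def[symmetric] e by blast
    qed
    have 3: "S y1 \<ge> u \<xi> - (vnorm n ((c - \<xi>) + d))\<^sup>2 / (4 * t)"
    proof -
      have e: "y1 - \<xi> = (c - \<xi>) + d" unfolding y12(1) by (simp add: algebra_simps)
      show ?thesis using S_low[OF \<xi>(1), of y1] unfolding e .
    qed
    have 4: "S y2 \<ge> u \<xi> - (vnorm n ((c - \<xi>) - d))\<^sup>2 / (4 * t)"
    proof -
      have e: "y2 - \<xi> = (c - \<xi>) - d" unfolding y12(2) by (simp add: algebra_simps)
      show ?thesis using S_low[OF \<xi>(1), of y2] unfolding e .
    qed
    have 5: "w x \<le> S c + (vnorm n (x - c))\<^sup>2 / (2 * t)" using w_le x mem by blast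
    have A: "(vnorm n ((c - \<xi>) + d))\<^sup>2 / (4 * t) + (vnorm n ((c - \<xi>) - d))\<^sup>2 / (4 * t)
        = (vnorm n (c - \<xi>))\<^sup>2 / (2 * t) + (vnorm n d)\<^sup>2 / (2 * t)"
      unfolding add_divide_distrib[symmetric] vnorm_parallelogram using t by (simp add: field_simps)
    have B: "(vnorm n ((x - c) + (h - d)))\<^sup>2 / (2 * t) + (vnorm n ((x - c) - (h - d)))\<^sup>2 / (2 * t)
        = (vnorm n (x - c))\<^sup>2 / t + (vnorm n (h - d))\<^sup>2 / t"
      unfolding add_divide_distrib[symmetric] vnorm_parallelogram using t by (simp add: field_simps)
    have "(vnorm n d)\<^sup>2 \<le> 2 * (vnorm n (h - d))\<^sup>2 + 2 * (vnorm n h)\<^sup>2"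
      using vnorm_sq_diff_le[of n h "h - d"] by (simp add: algebra_simps)
    then have "(vnorm n d)\<^sup>2 / (2 * t) \<le> (2 * (vnorm n (h - d))\<^sup>2 + 2 * (vnorm n h)\<^sup>2) / (2 * t)"
      using t by (intro divide_right_mono) auto
    also have "\<dots> = (vnorm n (h - d))\<^sup>2 / t + (vnorm n h)\<^sup>2 / t" using t by (simp add: field_simps)
    finally have C: "(vnorm n d)\<^sup>2 / (2 * t) \<le> (vnorm n (h - d))\<^sup>2 / t + (vnorm n h)\<^sup>2 / t" .
    have D: "(vnorm n (c - \<xi>))\<^sup>2 / (2 * t) = 2 * ((vnorm n (c - \<xi>))\<^sup>2 / (4 * t))"
      "(vnorm n (x - c))\<^sup>2 / t = 2 * ((vnorm n (x - c))\<^sup>2 / (2 * t))" by simp_all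
    have "w (x + h) + w (x - h) - 2 * w x \<ge> - ((vnorm n h)\<^sup>2 / t)"
      using 1 2 3 4 5 A B C D \<xi>(2) by linarith
    then show ?thesis by simp
  qed
  have C11: "C11 n w G (3 / (2 * t))"
    unfolding C11_def
  proof (intro conjI ballI)
    fix x y assume x: "x \<in> Rn n" "y \<in> Rn n"
    have a: "w (x - y) \<le> w x - vdot n (G x) y + (vnorm n y)\<^sup>2 / (2 * t)"
      using upper[of x "- y"] x by (simp add: vdot_simps)
    have b: "(vnorm n y)\<^sup>2 / t = 2 * ((vnorm n y)\<^sup>2 / (2 * t))" by simp
    have c: "3 / (2 * t) * (vnorm n y)\<^sup>2 = 3 * ((vnorm n y)\<^sup>2 / (2 * t))" by simp
    have d: "(vnorm n y)\<^sup>2 / (2 * t) \<ge> 0" using t by simp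
    show "\<bar>w (x + y) - w x - vdot n (G x) y\<bar> \<le> 3 / (2 * t) * (vnorm n y)\<^sup>2"
      using upper[OF x] mid[OF x] a b d unfolding c abs_le_iff minus_divide_left[symmetric] by linarith
  qed (use GR in auto)
  have lower: "u \<xi> - (vnorm n (x - \<xi>))\<^sup>2 / (2 * t) \<le> w x" if x: "x \<in> Rn n" "\<xi> \<in> K" for x \<xi>
  proof -
    have "(vnorm n (Y x - \<xi>))\<^sup>2 \<le> 2 * (vnorm n (x - \<xi>))\<^sup>2 + 2 * (vnorm n (x - Y x))\<^sup>2"
      using vnorm_sq_diff_le[of n "x - \<xi>" "x - Y x"] by simp
    then have "(vnorm n (Y x - \<xi>))\<^sup>2 / (4 * t) \<le> (2 * (vnorm n (x - \<xi>))\<^sup>2 + 2 * (vnorm n (x - Y x))\<^sup>2) / (4 * t)"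
      using t by (intro divide_right_mono) auto
    also have "\<dots> = (vnorm n (x - \<xi>))\<^sup>2 / (2 * t) + (vnorm n (x - Y x))\<^sup>2 / (2 * t)" by (simp add: add_divide_distrib)
    finally show ?thesis using S_low[OF x(2), of "Y x"] Y(2)[OF x(1)] by linarith
  qed
  have near: "\<exists>\<xi>\<in>K. w x \<le> u \<xi> - (vnorm n (x - \<xi>))\<^sup>2 / (4 * t)" if x: "x \<in> Rn n" for x
    using S_att[of x] w_le[OF x x] by auto
  have touch: "\<exists>\<xi>\<in>K. w x = u \<xi> - (vnorm n (x - \<xi>))\<^sup>2 / (2 * t)"
    if x: "x \<in> Rn n" "p \<in> Rn n" and \<kappa>: "\<kappa> < 1 / t" and r: "r > 0"
      and test: "\<And>y. y \<in> Rn n \<Longrightarrow> vnorm n y \<le> r \<Longrightarrow> w (x + y) \<le> w x + vdot n p y + \<kappa> / 2 * (vnorm n y)\<^sup>2"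
    for x p \<kappa> r
  proof -
    define y0 where "y0 = Y x"
    obtain \<xi> where \<xi>: "\<xi> \<in> K" "S y0 = u \<xi> - (vnorm n (y0 - \<xi>))\<^sup>2 / (4 * t)" using S_att by blast
    have mem: "y0 \<in> Rn n" "\<xi> \<in> Rn n" using Y x \<xi> KR by (auto simp: y0_def)
    \<comment> \<open>The optimal paraboloid touches \<open>w\<close> also at the midpoint of \<open>y0\<close> and \<open>\<xi>\<close>, hence on the whole
      segment from \<open>x\<close> to that midpoint; its opening is too large for the test unless the segment is
      a point.\<close>
    define x' where "x' = vscale (1 / 2) (y0 + \<xi>)"
    have x': "x' \<in> Rn n" using mem by (auto simp: x'_def)
    define e where "e = x' - x"
    have eR: "e \<in> Rn n" using x x' by (auto simp: e_def)
    have h1: "x' - \<xi> = vscale (1 / 2) (y0 - \<xi>)" by (auto simp: x'_def fun_eq_iff field_simps)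
    have h2: "x' - y0 = vscale (1 / 2) (\<xi> - y0)" by (auto simp: x'_def fun_eq_iff field_simps)
    have n1: "(vnorm n (x' - \<xi>))\<^sup>2 = (vnorm n (y0 - \<xi>))\<^sup>2 / 4" unfolding h1 by (simp add: power2_eq_square)
    have n2: "(vnorm n (x' - y0))\<^sup>2 = (vnorm n (y0 - \<xi>))\<^sup>2 / 4"
      unfolding h2 by (simp add: power2_eq_square vnorm_commute)
    have Px': "w x' \<ge> S y0 + (vnorm n (x' - y0))\<^sup>2 / (2 * t)"
      using lower[OF x' \<xi>(1)] t unfolding \<xi>(2) n1 n2 by (simp add: field_simps)
    have "vnorm n e = 0"
    proof (rule ccontr)
      assume "vnorm n e \<noteq> 0"
      then have e0: "vnorm n e > 0" using vnorm_ge_0[of n e] by linarith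
      have seg: "w (x + vscale \<theta> e) \<ge> w x + \<theta> * vdot n (G x) e + \<theta>\<^sup>2 * ((vnorm n e)\<^sup>2 / (2 * t))"
        if \<theta>: "0 \<le> \<theta>" "\<theta> \<le> 1" for \<theta>
      proof -
        define z where "z = x + vscale \<theta> e"
        have z: "z \<in> Rn n" using x eR by (auto simp: z_def)
        define y where "y = Y z"
        have y: "y \<in> Rn n" using Y z by (simp add: y_def)
        have "(vnorm n (z - y))\<^sup>2 = (1 - \<theta>) * (vnorm n (x - y))\<^sup>2 + \<theta> * (vnorm n (x' - y))\<^sup>2 - \<theta> * (1 - \<theta>) * (vnorm n e)\<^sup>2"
        proof -
          have "z - y = (x - y) + vscale \<theta> e" "x' - y = (x - y) + e"
            by (auto simp: z_def e_def fun_eq_iff)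
          then show ?thesis by (simp add: vnorm_sq vdot_simps) (simp add: vdot_commute algebra_simps)
        qed
        then have "w z = S y + ((1 - \<theta>) * (vnorm n (x - y))\<^sup>2 + \<theta> * (vnorm n (x' - y))\<^sup>2
            - \<theta> * (1 - \<theta>) * (vnorm n e)\<^sup>2) / (2 * t)"
          using Y(2)[OF z] by (simp add: y_def[symmetric])
        also have "\<dots> = (1 - \<theta>) * (S y + (vnorm n (x - y))\<^sup>2 / (2 * t)) + \<theta> * (S y + (vnorm n (x' - y))\<^sup>2 / (2 * t))
            - \<theta> * (1 - \<theta>) * ((vnorm n e)\<^sup>2 / (2 * t))"
          by (simp only: add_divide_distrib diff_divide_distrib times_divide_eq_right[symmetric])
             (simp add: algebra_simps)
        also have "\<dots> \<ge> (1 - \<theta>) * w x + \<theta> * w x' - \<theta> * (1 - \<theta>) * ((vnorm n e)\<^sup>2 / (2 * t))"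
          using \<theta> w_le[OF x(1) y] w_le[OF x' y] by (intro diff_right_mono add_mono mult_left_mono) auto
        finally have 1: "w z \<ge> (1 - \<theta>) * w x + \<theta> * w x' - \<theta> * (1 - \<theta>) * ((vnorm n e)\<^sup>2 / (2 * t))" .
        have "w x' \<ge> w x + vdot n (G x) e + (vnorm n e)\<^sup>2 / (2 * t)"
          using Px' expand[of x e] Y(2)[OF x(1)] by (simp add: e_def y0_def)
        then have 2: "\<theta> * w x' \<ge> \<theta> * (w x + vdot n (G x) e + (vnorm n e)\<^sup>2 / (2 * t))"
          using \<theta> by (intro mult_left_mono) auto
        define E where "E = (vnorm n e)\<^sup>2 / (2 * t)"
        show ?thesis
          using 1 2 unfolding E_def[symmetric] z_def[symmetric]
          by (simp add: power2_eq_square algebra_simps)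
      qed
      have Gp: "vdot n (G x) e = vdot n p e"
      proof -
        define C where "C = 3 / (2 * t) + \<bar>\<kappa>\<bar> / 2 + 1"
        have C: "C > 0" using t by (simp add: C_def add_pos_nonneg)
        have "G x - vscale \<kappa> (x - x) = p"
        proof (rule C11_interior_max[of n "\<lambda>z. w z - \<kappa> / 2 * (vnorm n (z - x))\<^sup>2" "\<lambda>z. G z - vscale \<kappa> (z - x)" C x p r])
          show "C11 n (\<lambda>z. w z - \<kappa> / 2 * (vnorm n (z - x))\<^sup>2) (\<lambda>z. G z - vscale \<kappa> (z - x)) C"
            unfolding C11_def
          proof (intro conjI ballI)
            fix z y assume z: "z \<in> Rn n" "y \<in> Rn n"
            have s: "z + y - x = (z - x) + y" by simp
            have q: "(vnorm n (z + y - x))\<^sup>2 = (vnorm n (z - x))\<^sup>2 + 2 * vdot n (z - x) y + (vnorm n y)\<^sup>2"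
              unfolding s by (rule vnorm_sq_add)
            have "w (z + y) - \<kappa> / 2 * (vnorm n (z + y - x))\<^sup>2 - (w z - \<kappa> / 2 * (vnorm n (z - x))\<^sup>2) - vdot n (G z - vscale \<kappa> (z - x)) y
                = (w (z + y) - w z - vdot n (G z) y) - \<kappa> / 2 * (vnorm n y)\<^sup>2"
              unfolding q vdot_simps by (simp add: algebra_simps)
            moreover have "\<bar>w (z + y) - w z - vdot n (G z) y\<bar> \<le> 3 / (2 * t) * (vnorm n y)\<^sup>2"
              by (rule C11D[OF C11 z])
            moreover have "\<bar>\<kappa> / 2 * (vnorm n y)\<^sup>2\<bar> = \<bar>\<kappa>\<bar> / 2 * (vnorm n y)\<^sup>2" by (simp add: abs_mult)
            moreover have "C * (vnorm n y)\<^sup>2 = 3 / (2 * t) * (vnorm n y)\<^sup>2 + \<bar>\<kappa>\<bar> / 2 * (vnorm n y)\<^sup>2 + (vnorm n y)\<^sup>2"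
              by (simp add: C_def algebra_simps)
            moreover have "0 \<le> (vnorm n y)\<^sup>2" by simp
            ultimately show "\<bar>w (z + y) - \<kappa> / 2 * (vnorm n (z + y - x))\<^sup>2 - (w z - \<kappa> / 2 * (vnorm n (z - x))\<^sup>2)
                - vdot n (G z - vscale \<kappa> (z - x)) y\<bar> \<le> C * (vnorm n y)\<^sup>2" by linarith
          qed (use GR x in auto)
          show "0 < C" "x \<in> Rn n" "p \<in> Rn n" "0 < r" by fact+
          fix y assume "y \<in> Rn n" "vnorm n y \<le> r"
          from test[OF this] show "w (x + y) - \<kappa> / 2 * (vnorm n (x + y - x))\<^sup>2
              \<le> w x - \<kappa> / 2 * (vnorm n (x - x))\<^sup>2 + vdot n p y"
            by simp
        qed
        then show ?thesis by simp
      qed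
      define \<theta> where "\<theta> = min 1 (r / vnorm n e)"
      have \<theta>: "0 < \<theta>" "\<theta> \<le> 1" "\<theta> * vnorm n e \<le> r" using r e0 by (auto simp: \<theta>_def min_def field_simps)
      have u1: "w (x + vscale \<theta> e) \<le> w x + \<theta> * vdot n p e + \<kappa> / 2 * (\<theta>\<^sup>2 * (vnorm n e)\<^sup>2)"
        using test[of "vscale \<theta> e"] eR \<theta> by (simp add: vdot_simps power_mult_distrib)
      have "\<theta>\<^sup>2 * (vnorm n e)\<^sup>2 * (1 / t) \<le> \<theta>\<^sup>2 * (vnorm n e)\<^sup>2 * \<kappa>"
      proof -
        define Q where "Q = \<theta>\<^sup>2 * (vnorm n e)\<^sup>2"
        have "Q / (2 * t) \<le> \<kappa> / 2 * Q" using u1 seg[of \<theta>] \<theta> unfolding Gp Q_def by simp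
        moreover have "Q * (1 / t) = 2 * (Q / (2 * t))" by simp
        moreover have "Q * \<kappa> = 2 * (\<kappa> / 2 * Q)" by simp
        ultimately show ?thesis unfolding Q_def by linarith
      qed
      moreover have "\<theta>\<^sup>2 * (vnorm n e)\<^sup>2 > 0" using \<theta> e0 by simp
      ultimately have "1 / t \<le> \<kappa>" by (simp only: mult_le_cancel_left_pos)
      then show False using \<kappa> by simp
    qed
    then have "x' = x" using vnorm_eq_0[OF eR] by (simp add: e_def)
    then have "w x = u \<xi> - (vnorm n (x - \<xi>))\<^sup>2 / (2 * t)"
      using Y(2)[OF x(1)] n1 n2 t unfolding y0_def[symmetric] \<xi>(2) by (simp add: field_simps)
    then show ?thesis using \<xi> by blast
  qed
  show ?thesis
  proof (intro exI[of _ G] conjI ballI allI impI C11 lower near)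
    fix x p \<kappa> r
    assume "x \<in> Rn n" "p \<in> Rn n" "\<kappa> < 1 / t" "r > 0"
      and "\<forall>y\<in>Rn n. vnorm n y \<le> r \<longrightarrow> w (x + y) \<le> w x + vdot n p y + \<kappa> / 2 * (vnorm n y)\<^sup>2"
    then show "\<exists>\<xi>\<in>K. w x = u \<xi> - (vnorm n (x - \<xi>))\<^sup>2 / (2 * t)"
      by (intro touch[of x p \<kappa> r]) auto
  qed
qed

section \<open>The theorem on sums\<close>

definition mv :: "nat \<Rightarrow> (nat \<Rightarrow> nat \<Rightarrow> real) \<Rightarrow> point \<Rightarrow> point" where
  "mv n Q z = (\<lambda>i. if i < n then \<Sum>c<n. Q i c * z c else 0)"

definition plus_id :: "(nat \<Rightarrow> nat \<Rightarrow> real) \<Rightarrow> real \<Rightarrow> nat \<Rightarrow> nat \<Rightarrow> real" where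
  "plus_id Q e = (\<lambda>a c. Q a c + (if a = c then e else 0))"

lemma mv_Rn [simp]: "mv n Q z \<in> Rn n" by (simp add: mv_def Rn_iff)

lemma vdot_mv: "vdot n (mv n Q z) y = bf n Q y z"
  by (simp add: vdot_def mv_def bf_def sum_distrib_left sum_distrib_right mult_ac)

lemma bf_commute: "(\<And>a c. Q a c = Q c a) \<Longrightarrow> bf n Q x y = bf n Q y x"
  unfolding bf_def by (subst sum.swap) (simp add: mult_ac)

lemma bf_plus_id: "bf n (plus_id Q e) x y = bf n Q x y + e * vdot n x y"
proof -
  have "(\<Sum>c<n. (Q a c + (if a = c then e else 0)) * x a * y c) = (\<Sum>c<n. Q a c * x a * y c) + e * x a * y a"
    if "a < n" for a
  proof -
    have "(\<Sum>c<n. (Q a c + (if a = c then e else 0)) * x a * y c)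
        = (\<Sum>c<n. Q a c * x a * y c + (if c = a then e * x a * y a else 0))"
      by (rule sum.cong) (auto simp: algebra_simps)
    then show ?thesis using that by (simp add: sum.distrib)
  qed
  then show ?thesis by (simp add: bf_def plus_id_def vdot_def sum.distrib sum_distrib_left mult.assoc)
qed

lemma qf_plus_id: "qf n (plus_id Q e) z = qf n Q z + e * (vnorm n z)\<^sup>2"
  by (simp add: qf_bf bf_plus_id vnorm_sq)

lemma plus_id_sym: "(\<And>a c. Q a c = Q c a) \<Longrightarrow> plus_id Q e a c = plus_id Q e c a"
  by (simp add: plus_id_def)

lemma qf_add:
  assumes "\<And>a c. Q a c = Q c a"
  shows "qf n Q (z + y) = qf n Q z + 2 * vdot n (mv n Q z) y + qf n Q y"
  using bf_commute[of Q n z y, OF assms] by (simp add: qf_bf bf_simps vdot_mv)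

lemma mv_bound:
  assumes "\<And>a c. a < n \<Longrightarrow> c < n \<Longrightarrow> \<bar>Q a c\<bar> \<le> M" "M \<ge> 0"
  shows "vnorm n (mv n Q z) \<le> (real n)\<^sup>2 * M * vnorm n z"
proof -
  have "vnorm n (mv n Q z) \<le> real n * (real n * (M * vnorm n z))"
  proof (rule vnorm_le_bound)
    fix i assume i: "i < n"
    have "\<bar>\<Sum>c<n. Q i c * z c\<bar> \<le> (\<Sum>c<n. M * vnorm n z)"
      by (rule order_trans[OF sum_abs], rule sum_mono)
         (use assms i in \<open>auto simp: abs_mult vnorm_coord intro!: mult_mono\<close>)
    then show "\<bar>mv n Q z i\<bar> \<le> real n * (M * vnorm n z)" using i by (simp add: mv_def)
  qed
  then show ?thesis by (simp add: power2_eq_square mult_ac)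
qed

lemma continuous_on_qf: "continuous_on S (\<lambda>y. qf n X (y - a))"
  unfolding qf_def fun_diff_def by (intro continuous_intros continuous_on_coord)

text \<open>An upper bound by a quadratic polynomial up to an error \<open>\<tau> * r\<^sup>2\<close> on a single ball of radius
  \<open>r\<close> already yields a genuine test: enlarge the Hessian by \<open>4 * \<tau>\<close> and move to the maximum point.\<close>

lemma one_scale_test:
  assumes u: "continuous_on (cB n a \<rho>) u" and \<xi>: "\<xi> \<in> Rn n" "vnorm n (\<xi> - a) + r \<le> \<rho>"
    and r: "r > 0" and \<tau>: "\<tau> > 0" and X: "\<And>a c. X a c = X c a"
    and le: "\<And>h. h \<in> Rn n \<Longrightarrow> vnorm n h \<le> r \<Longrightarrow> u (\<xi> + h) \<le> u \<xi> + vdot n l h + qf n X h / 2 + \<tau> * r\<^sup>2"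
  shows "\<exists>k\<in>Rn n. vnorm n k < r \<and> (\<exists>s>0. \<forall>h\<in>Rn n. vnorm n h < s \<longrightarrow>
    u (\<xi> + k + h) \<le> u (\<xi> + k) + vdot n (l + mv n X k + vscale (4 * \<tau>) k) h + qf n (plus_id X (4 * \<tau>)) h / 2)"
proof -
  define f where "f = (\<lambda>y. u y - vdot n l (y - \<xi>) - qf n X (y - \<xi>) / 2 - 2 * \<tau> * (vnorm n (y - \<xi>))\<^sup>2)"
  have sub: "cB n \<xi> r \<subseteq> cB n a \<rho>"
  proof
    fix y assume y: "y \<in> cB n \<xi> r"
    have "vnorm n (y - a) \<le> vnorm n (y - \<xi>) + vnorm n (\<xi> - a)"
      using vnorm_triangle[of n "y - \<xi>" "\<xi> - a"] by simp
    then show "y \<in> cB n a \<rho>" using y \<xi> by (simp add: cB_def)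
  qed
  have "continuous_on (cB n \<xi> r) f"
    unfolding f_def
    by (intro continuous_intros continuous_on_vnorm continuous_on_vdot continuous_on_qf continuous_on_subset[OF u sub])
       simp
  moreover have ne: "\<xi> \<in> cB n \<xi> r" using \<xi> r by (simp add: cB_def)
  ultimately obtain y where y: "y \<in> cB n \<xi> r" and max: "\<And>y'. y' \<in> cB n \<xi> r \<Longrightarrow> f y' \<le> f y"
    using continuous_attains_sup[OF compact_cB, of n \<xi> r f] by blast
  define k where "k = y - \<xi>"
  have yk: "y = \<xi> + k" by (simp add: k_def)
  have k: "k \<in> Rn n" "vnorm n k \<le> r" using y \<xi> by (auto simp: k_def cB_def)
  have fk: "f (\<xi> + h) = u (\<xi> + h) - vdot n l h - qf n X h / 2 - 2 * \<tau> * (vnorm n h)\<^sup>2" for h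
    by (simp add: f_def)
  have "vnorm n k < r"
  proof (rule ccontr)
    assume "\<not> ?thesis"
    then have kr: "vnorm n k = r" using k by simp
    have "f (\<xi> + 0) \<le> f (\<xi> + k)" using max[OF ne] yk by simp
    then have "u \<xi> \<le> u (\<xi> + k) - vdot n l k - qf n X k / 2 - 2 * \<tau> * r\<^sup>2"
      unfolding fk kr by (simp add: vdot_simps)
    moreover have "\<tau> * r\<^sup>2 > 0" using \<tau> r by simp
    ultimately show False using le[OF k] by linarith
  qed
  moreover have "u (\<xi> + k + h) \<le> u (\<xi> + k) + vdot n (l + mv n X k + vscale (4 * \<tau>) k) h + qf n (plus_id X (4 * \<tau>)) h / 2"
    if h: "h \<in> Rn n" "vnorm n h < r - vnorm n k" for h
  proof -
    have "\<xi> + (k + h) \<in> cB n \<xi> r" using h k \<xi> vnorm_triangle[of n k h] by (auto simp: cB_def)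
    then have "f (\<xi> + (k + h)) \<le> f (\<xi> + k)" using max yk by blast
    then show ?thesis
      unfolding fk qf_plus_id using qf_add[of X n k h, OF X] vnorm_sq_add[of n k h]
      by (simp add: vdot_simps add.assoc algebra_simps add_divide_distrib)
  qed
  ultimately show ?thesis
    using k(1) by (intro bexI[of _ k] conjI exI[of _ "r - vnorm n k"]) auto
qed

subsection \<open>Pairs of points\<close>

text \<open>Vectors of \<open>Rn (2 * n)\<close> as pairs of vectors of \<open>Rn n\<close>, with the projections \<open>fs\<close> and \<open>sn\<close>.\<close>

definition pair :: "nat \<Rightarrow> point \<Rightarrow> point \<Rightarrow> point" where
  "pair n x y = (\<lambda>i. if i < n then x i else y (i - n))"

definition fs :: "nat \<Rightarrow> point \<Rightarrow> point" where "fs n z = (\<lambda>i. if i < n then z i else 0)"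

definition sn :: "nat \<Rightarrow> point \<Rightarrow> point" where "sn n z = (\<lambda>i. if i < n then z (n + i) else 0)"

lemma sum_pair: "(\<Sum>i<2 * n. f i) = (\<Sum>i<n. f i) + (\<Sum>i<n. f (n + i))" for f :: "nat \<Rightarrow> real"
proof -
  have "(\<Sum>i<n + m. f i) = (\<Sum>i<n. f i) + (\<Sum>i<m. f (n + i))" for m
    by (induction m) (simp_all add: add.assoc)
  from this[of n] show ?thesis by (simp add: mult_2)
qed

lemma pair_Rn [simp]: "y \<in> Rn n \<Longrightarrow> pair n x y \<in> Rn (2 * n)"
  by (auto simp: pair_def Rn_iff)

lemma fs_sn_Rn [simp]: "fs n z \<in> Rn n" "sn n z \<in> Rn n"
  by (auto simp: fs_def sn_def Rn_iff)

lemma pair_simps: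
  "pair n x y + pair n x' y' = pair n (x + x') (y + y')"
  "pair n x y - pair n x' y' = pair n (x - x') (y - y')"
  by (auto simp: pair_def fun_eq_iff)

lemma fs_sn_simps:
  "fs n (z + z') = fs n z + fs n z'" "sn n (z + z') = sn n z + sn n z'"
  "fs n 0 = 0" "sn n 0 = 0"
  by (auto simp: fs_def sn_def fun_eq_iff)

lemma fs_sn_pair: "x \<in> Rn n \<Longrightarrow> fs n (pair n x y) = x" "y \<in> Rn n \<Longrightarrow> sn n (pair n x y) = y"
  by (auto simp: fs_def sn_def pair_def fun_eq_iff Rn_iff)

lemma pair_fs_sn: "z \<in> Rn (2 * n) \<Longrightarrow> pair n (fs n z) (sn n z) = z"
  by (auto simp: fs_def sn_def pair_def fun_eq_iff Rn_iff)

lemma vdot_pair: "vdot (2 * n) z z' = vdot n (fs n z) (fs n z') + vdot n (sn n z) (sn n z')"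
  by (simp add: vdot_def sum_pair fs_def sn_def)

lemma vnorm_pair: "(vnorm (2 * n) z)\<^sup>2 = (vnorm n (fs n z))\<^sup>2 + (vnorm n (sn n z))\<^sup>2"
  by (simp add: vnorm_sq vdot_pair)

lemma vnorm_fs_sn: "vnorm n (fs n z) \<le> vnorm (2 * n) z" "vnorm n (sn n z) \<le> vnorm (2 * n) z"
  using vnorm_pair[of n z] by (auto intro: power2_le_imp_le)

lemma qf_pair:
  assumes "h \<in> Rn n" "k \<in> Rn n"
  shows "qf (2 * n) Q (pair n h 0) = qf n Q h"
    and "qf (2 * n) Q (pair n 0 k) = qf n (\<lambda>a c. Q (n + a) (n + c)) k"
  by (simp_all add: qf_def sum_pair pair_def)

lemma C11_pair:
  assumes "C11 n w G C" "C11 n w' G' C" and "a \<in> Rn n" "a' \<in> Rn n"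
  shows "C11 (2 * n) (\<lambda>z. w (a + fs n z) + w' (a' + sn n z)) (\<lambda>z. pair n (G (a + fs n z)) (G' (a' + sn n z))) C"
  unfolding C11_def
proof (intro conjI ballI)
  fix z y assume "z \<in> Rn (2 * n)" "y \<in> Rn (2 * n)"
  have m: "a + fs n z \<in> Rn n" "a' + sn n z \<in> Rn n" using assms by auto
  have "\<bar>w (a + fs n z + fs n y) - w (a + fs n z) - vdot n (G (a + fs n z)) (fs n y)\<bar> \<le> C * (vnorm n (fs n y))\<^sup>2"
    by (rule C11D[OF assms(1) m(1)]) simp
  moreover have "\<bar>w' (a' + sn n z + sn n y) - w' (a' + sn n z) - vdot n (G' (a' + sn n z)) (sn n y)\<bar> \<le> C * (vnorm n (sn n y))\<^sup>2"
    by (rule C11D[OF assms(2) m(2)]) simp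
  moreover have "vdot (2 * n) (pair n (G (a + fs n z)) (G' (a' + sn n z))) y
      = vdot n (G (a + fs n z)) (fs n y) + vdot n (G' (a' + sn n z)) (sn n y)"
    using C11_Rn[OF assms(1) m(1)] C11_Rn[OF assms(2) m(2)] by (simp add: vdot_pair fs_sn_pair)
  moreover have "C * (vnorm (2 * n) y)\<^sup>2 = C * (vnorm n (fs n y))\<^sup>2 + C * (vnorm n (sn n y))\<^sup>2"
    unfolding vnorm_pair by (simp add: algebra_simps)
  ultimately show "\<bar>w (a + fs n (z + y)) + w' (a' + sn n (z + y)) - (w (a + fs n z) + w' (a' + sn n z))
      - vdot (2 * n) (pair n (G (a + fs n z)) (G' (a' + sn n z))) y\<bar> \<le> C * (vnorm (2 * n) y)\<^sup>2"
    unfolding fs_sn_simps add.assoc[symmetric] abs_le_iff by linarith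
next
  fix z :: point
  have m: "a' + sn n z \<in> Rn n" using assms by auto
  show "pair n (G (a + fs n z)) (G' (a' + sn n z)) \<in> Rn (2 * n)"
    by (rule pair_Rn[OF C11_Rn[OF assms(2) m]])
qed

lemma C11_minus_quadratic:
  assumes "C11 N W G C" and Q: "\<And>a c. Q a c = Q c a" "\<And>a c. a < N \<Longrightarrow> c < N \<Longrightarrow> \<bar>Q a c\<bar> \<le> M" "M \<ge> 0"
  shows "C11 N (\<lambda>z. W z - qf N Q z / 2) (\<lambda>z. G z - mv N Q z) (C + (real N)\<^sup>2 * M)"
  unfolding C11_def
proof (intro conjI ballI)
  fix z y assume zy: "z \<in> Rn N" "y \<in> Rn N"
  have "\<bar>W (z + y) - W z - vdot N (G z) y\<bar> \<le> C * (vnorm N y)\<^sup>2" by (rule C11D[OF assms(1) zy])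
  moreover have "\<bar>qf N Q y\<bar> \<le> (real N)\<^sup>2 * M * (vnorm N y)\<^sup>2" by (rule qf_bound) (use Q in auto)
  ultimately show "\<bar>W (z + y) - qf N Q (z + y) / 2 - (W z - qf N Q z / 2) - vdot N (G z - mv N Q z) y\<bar>
      \<le> (C + (real N)\<^sup>2 * M) * (vnorm N y)\<^sup>2"
    unfolding qf_add[of Q N z y, OF Q(1)] vdot_simps distrib_right abs_le_iff add_divide_distrib
    by linarith
qed (use C11_Rn[OF assms(1)] in auto)

lemma uniform_modulus:
  assumes K: "compact K" "K \<subseteq> Rn n" and u: "continuous_on K u" and e: "e > (0::real)"
  shows "\<exists>d>0. \<forall>x\<in>K. \<forall>y\<in>K. vnorm n (y - x) < d \<longrightarrow> \<bar>u y - u x\<bar> < e"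
proof -
  define S where "S = (K \<times> K) \<inter> (\<lambda>z. \<bar>u (snd z) - u (fst z)\<bar>) -` {e..}"
  have cl: "closed (K \<times> K)" using K by (intro compact_imp_closed compact_Times)
  have "continuous_on (K \<times> K) (\<lambda>z. \<bar>u (snd z) - u (fst z)\<bar>)"
    by (intro continuous_intros continuous_on_compose2[OF u]) auto
  then have "closed S" unfolding S_def by (rule continuous_closed_preimage[OF _ cl]) simp
  then have "compact ((K \<times> K) \<inter> S)" using K by (intro compact_Int_closed compact_Times)
  moreover have "(K \<times> K) \<inter> S = S" by (auto simp: S_def)
  ultimately have S: "compact S" by simp
  show ?thesis
  proof (cases "S = {}")
    case True
    then show ?thesis by (intro exI[of _ 1]) (auto simp: S_def not_le)
  next
    case False
    have "continuous_on S (\<lambda>z. vnorm n (snd z - fst z))"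
    proof -
      have c: "continuous_on S (\<lambda>z. snd z i)" "continuous_on S (\<lambda>z. fst z i)" for i :: nat
      proof -
        show "continuous_on S (\<lambda>z. snd z i)"
          by (rule continuous_on_compose2[OF continuous_on_coord[of UNIV i] continuous_on_snd[OF continuous_on_id]]) simp
        show "continuous_on S (\<lambda>z. fst z i)"
          by (rule continuous_on_compose2[OF continuous_on_coord[of UNIV i] continuous_on_fst[OF continuous_on_id]]) simp
      qed
      show ?thesis unfolding vnorm_def L2_set_def fun_diff_def by (intro continuous_intros c)
    qed
    then obtain z where z: "z \<in> S" "\<And>z'. z' \<in> S \<Longrightarrow> vnorm n (snd z - fst z) \<le> vnorm n (snd z' - fst z')"
      using continuous_attains_inf[OF S False] by blast
    define d where "d = vnorm n (snd z - fst z)"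
    have zz: "snd z \<in> Rn n" "fst z \<in> Rn n" "snd z \<noteq> fst z" using z(1) e K(2) by (auto simp: S_def)
    then have "snd z - fst z \<in> Rn n" by blast
    with zz(3) have "d \<noteq> 0" unfolding d_def using vnorm_eq_0 by simp
    then have "d > 0" using vnorm_ge_0[of n "snd z - fst z"] unfolding d_def by linarith
    moreover have "\<bar>u y - u x\<bar> < e" if "x \<in> K" "y \<in> K" "vnorm n (y - x) < d" for x y
    proof (rule ccontr)
      assume "\<not> ?thesis"
      then have "(x, y) \<in> S" using that by (simp add: S_def)
      then show False using z(2)[of "(x, y)"] that by (simp add: d_def)
    qed
    ultimately show ?thesis by blast
  qed
qed

subsection \<open>Approximate second-order jets at a maximum\<close>

text \<open>A second-order jet without remainder: the remainder of a general jet is absorbed by adding a small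
  multiple of the identity to \<open>X\<close>.\<close>

definition jet_above :: "nat \<Rightarrow> (point \<Rightarrow> real) \<Rightarrow> point \<Rightarrow> point \<Rightarrow> (nat \<Rightarrow> nat \<Rightarrow> real) \<Rightarrow> bool" where
  "jet_above n u x z X \<longleftrightarrow>
    (\<exists>s>0. \<forall>h\<in>Rn n. vnorm n h < s \<longrightarrow> u (x + h) \<le> u x + vdot n z h + qf n X h / 2)"

text \<open>The theorem on sums of Crandall and Ishii, up to an arbitrarily small error.  Both functions are
  replaced by their regularisations; on the product space the sum of these minus the quadratic
  polynomial has a Lipschitz gradient.  Adding \<open>e * (vnorm N z)\<^sup>2 / 2\<close> to the polynomial makes it smaller
  away from the centre than at the centre, so there is a nearly quadratic contact point.  Its two diagonal
  blocks give \<open>X\<close> and \<open>Y\<close>; \<open>one_scale_test\<close> turns the approximation on a single ball into jets.\<close>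

theorem approximate_jets:
  assumes n: "n \<ge> 1" and x0: "x0 \<in> Rn n" "y0 \<in> Rn n" and \<rho>: "\<rho> > 0" and \<epsilon>: "\<epsilon> > 0"
    and u: "continuous_on (cB n x0 \<rho>) u" and v: "continuous_on (cB n y0 \<rho>) v"
    and PR: "P \<in> Rn n" "R \<in> Rn n" and Q': "\<forall>a c. Q a c = Q c a"
    and max': "\<forall>h\<in>Rn n. \<forall>k\<in>Rn n. vnorm n h \<le> \<rho> \<longrightarrow> vnorm n k \<le> \<rho> \<longrightarrow>
      u (x0 + h) + v (y0 + k) \<le> u x0 + v y0 + vdot n P h + vdot n R k + qf (2 * n) Q (pair n h k) / 2"
  shows "\<exists>x1 y1 z1 w1 X Y. x1 \<in> Rn n \<and> y1 \<in> Rn n \<and> z1 \<in> Rn n \<and> w1 \<in> Rn n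
    \<and> vnorm n (x1 - x0) \<le> \<epsilon> \<and> vnorm n (y1 - y0) \<le> \<epsilon> \<and> vnorm n (z1 - P) \<le> \<epsilon> \<and> vnorm n (w1 - R) \<le> \<epsilon>
    \<and> (\<forall>a c. X a c = X c a) \<and> (\<forall>a c. Y a c = Y c a)
    \<and> jet_above n u x1 z1 X \<and> jet_above n v y1 w1 Y
    \<and> (\<forall>h\<in>Rn n. \<forall>k\<in>Rn n. qf n X h + qf n Y k
        \<le> qf (2 * n) Q (pair n h k) + \<epsilon> * ((vnorm n h)\<^sup>2 + (vnorm n k)\<^sup>2))"
proof -
  note Q = Q'[rule_format] and max = max'[rule_format]
  define N where "N = 2 * n"
  define e where "e = \<epsilon> / 4"
  have e0: "e > 0" using \<epsilon> by (simp add: e_def)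
  define Q1 where "Q1 = plus_id Q e"
  have Q1: "Q1 a c = Q1 c a" for a c using Q by (simp add: Q1_def plus_id_sym)
  define M where "M = (\<Sum>a<N. \<Sum>c<N. \<bar>Q1 a c\<bar>) + 1"
  have Mb: "\<bar>Q1 a c\<bar> \<le> M" if "a < N" "c < N" for a c
  proof -
    have "\<bar>Q1 a c\<bar> \<le> (\<Sum>c<N. \<bar>Q1 a c\<bar>)" by (rule member_le_sum) (use that in auto)
    also have "\<dots> \<le> (\<Sum>a<N. \<Sum>c<N. \<bar>Q1 a c\<bar>)"
      by (rule member_le_sum[where f = "\<lambda>a. \<Sum>c<N. \<bar>Q1 a c\<bar>"]) (use that in \<open>auto intro!: sum_nonneg\<close>)
    finally show ?thesis by (simp add: M_def)
  qed
  have M1: "M \<ge> 1" by (simp add: M_def sum_nonneg)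
  define \<kappa> where "\<kappa> = (real N)\<^sup>2 * M"
  have N1: "real N \<ge> 1" using n by (simp add: N_def)
  have \<kappa>: "\<kappa> > 0" using M1 N1 by (simp add: \<kappa>_def)
  have Q1le: "qf N Q1 z \<le> \<kappa> * (vnorm N z)\<^sup>2" for z
    using qf_bound[of N Q1 M z] Mb M1 by (simp add: \<kappa>_def abs_le_iff)
  have mvQ: "vnorm N (mv N Q1 z) \<le> \<kappa> * vnorm N z" for z
    using mv_bound[of N Q1 M z] Mb M1 by (simp add: \<kappa>_def)
  \<comment> \<open>The radius in which everything happens.\<close>
  define \<rho>1 where "\<rho>1 = min (\<rho> / 2) (min (\<epsilon> / 4) (\<epsilon> / (4 * \<kappa>)))"
  have \<rho>1: "\<rho>1 > 0" "\<rho>1 \<le> \<rho> / 2" "\<rho>1 \<le> \<epsilon> / 4" "\<kappa> * \<rho>1 \<le> \<epsilon> / 4"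
  proof -
    show "\<rho>1 > 0" using \<rho> \<epsilon> \<kappa> by (simp add: \<rho>1_def)
    show "\<rho>1 \<le> \<rho> / 2" "\<rho>1 \<le> \<epsilon> / 4" by (auto simp: \<rho>1_def)
    have "\<rho>1 \<le> \<epsilon> / (4 * \<kappa>)" by (auto simp: \<rho>1_def)
    then show "\<kappa> * \<rho>1 \<le> \<epsilon> / 4" using \<kappa> by (simp add: field_simps)
  qed
  define K where "K = cB n x0 \<rho>"
  define K' where "K' = cB n y0 \<rho>"
  have K: "compact K" "K \<noteq> {}" "K \<subseteq> Rn n" "x0 \<in> K" and K': "compact K'" "K' \<noteq> {}" "K' \<subseteq> Rn n" "y0 \<in> K'"
    using x0 \<rho> by (auto simp: K_def K'_def compact_cB) (auto simp: cB_def intro!: exI[of _ x0] exI[of _ y0])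
  have uK: "continuous_on K u" "continuous_on K' v" using u v by (simp_all add: K_def K'_def)
  define \<eta> where "\<eta> = e * \<rho>1\<^sup>2 / 64"
  have \<eta>: "\<eta> > 0" using e0 \<rho>1 by (simp add: \<eta>_def)
  obtain \<theta>1 where \<theta>1: "\<theta>1 > 0" "\<And>x y. x \<in> K \<Longrightarrow> y \<in> K \<Longrightarrow> vnorm n (y - x) < \<theta>1 \<Longrightarrow> \<bar>u y - u x\<bar> < \<eta>"
    using uniform_modulus[OF K(1,3) uK(1) \<eta>] by blast
  obtain \<theta>2 where \<theta>2: "\<theta>2 > 0" "\<And>x y. x \<in> K' \<Longrightarrow> y \<in> K' \<Longrightarrow> vnorm n (y - x) < \<theta>2 \<Longrightarrow> \<bar>v y - v x\<bar> < \<eta>"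
    using uniform_modulus[OF K'(1,3) uK(2) \<eta>] by blast
  define \<theta> where "\<theta> = min (min \<theta>1 \<theta>2) (min (\<rho> / 4) (\<epsilon> / 4))"
  have \<theta>: "\<theta> > 0" "\<theta> \<le> \<theta>1" "\<theta> \<le> \<theta>2" "\<theta> \<le> \<rho> / 4" "\<theta> \<le> \<epsilon> / 4"
    using \<theta>1 \<theta>2 \<rho> \<epsilon> by (auto simp: \<theta>_def)
  obtain B where B: "B > 0" "\<And>x. x \<in> K \<Longrightarrow> \<bar>u x\<bar> \<le> B" "\<And>x. x \<in> K' \<Longrightarrow> \<bar>v x\<bar> \<le> B"
  proof -
    have "bounded (u ` K)" "bounded (v ` K')"
      using K K' uK by (auto intro!: compact_imp_bounded compact_continuous_image)
    then obtain B1 B2 where "\<forall>x\<in>K. \<bar>u x\<bar> \<le> B1" "\<forall>x\<in>K'. \<bar>v x\<bar> \<le> B2"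
      by (auto simp: bounded_iff)
    then show ?thesis by (intro that[of "\<bar>B1\<bar> + \<bar>B2\<bar> + 1"]) force+
  qed
  define t where "t = min (1 / (4 * \<kappa>)) (\<theta>\<^sup>2 / (16 * B))"
  have t: "t > 0" "\<kappa> < 1 / (2 * t)" "8 * t * B < \<theta>\<^sup>2"
  proof -
    show t0: "t > 0" using \<kappa> \<theta> B by (simp add: t_def)
    have "t \<le> 1 / (4 * \<kappa>)" "t \<le> \<theta>\<^sup>2 / (16 * B)" by (auto simp: t_def)
    then have "4 * t * \<kappa> \<le> 1" "16 * t * B \<le> \<theta>\<^sup>2" using \<kappa> B by (auto simp: field_simps)
    then show "\<kappa> < 1 / (2 * t)" "8 * t * B < \<theta>\<^sup>2" using t0 \<theta> \<kappa> by (auto simp: field_simps)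
       (use zero_less_power[OF \<theta>(1), of 2] in linarith)
  qed
  define w where "w = siconv n K u t"
  define w' where "w' = siconv n K' v t"
  from C11_regularisation[OF K(3,1,2) uK(1) t(1), folded w_def]
  obtain G where G: "C11 n w G (3 / (2 * t))"
    and wl: "\<forall>x\<in>Rn n. \<forall>\<xi>\<in>K. u \<xi> - (vnorm n (x - \<xi>))\<^sup>2 / (2 * t) \<le> w x"
    and wu: "\<forall>x\<in>Rn n. \<exists>\<xi>\<in>K. w x \<le> u \<xi> - (vnorm n (x - \<xi>))\<^sup>2 / (4 * t)"
    and wt: "\<forall>x\<in>Rn n. \<forall>p\<in>Rn n. \<forall>\<kappa> r. \<kappa> < 1 / t \<longrightarrow> r > 0 \<longrightarrow>
      (\<forall>y\<in>Rn n. vnorm n y \<le> r \<longrightarrow> w (x + y) \<le> w x + vdot n p y + \<kappa> / 2 * (vnorm n y)\<^sup>2) \<longrightarrow>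
      (\<exists>\<xi>\<in>K. w x = u \<xi> - (vnorm n (x - \<xi>))\<^sup>2 / (2 * t))"
    by (elim exE conjE)
  from C11_regularisation[OF K'(3,1,2) uK(2) t(1), folded w'_def]
  obtain G' where G': "C11 n w' G' (3 / (2 * t))"
    and wl': "\<forall>x\<in>Rn n. \<forall>\<xi>\<in>K'. v \<xi> - (vnorm n (x - \<xi>))\<^sup>2 / (2 * t) \<le> w' x"
    and wu': "\<forall>x\<in>Rn n. \<exists>\<xi>\<in>K'. w' x \<le> v \<xi> - (vnorm n (x - \<xi>))\<^sup>2 / (4 * t)"
    and wt': "\<forall>x\<in>Rn n. \<forall>p\<in>Rn n. \<forall>\<kappa> r. \<kappa> < 1 / t \<longrightarrow> r > 0 \<longrightarrow>
      (\<forall>y\<in>Rn n. vnorm n y \<le> r \<longrightarrow> w' (x + y) \<le> w' x + vdot n p y + \<kappa> / 2 * (vnorm n y)\<^sup>2) \<longrightarrow>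
      (\<exists>\<xi>\<in>K'. w' x = v \<xi> - (vnorm n (x - \<xi>))\<^sup>2 / (2 * t))"
    by (elim exE conjE)
  \<comment> \<open>The regularisations are close to \<open>u\<close> and \<open>v\<close>.\<close>
  have close: "vnorm n (x - \<xi>) < \<theta>"
    if "(vnorm n (x - \<xi>))\<^sup>2 / (4 * t) \<le> a - b" "\<bar>a\<bar> \<le> B" "\<bar>b\<bar> \<le> B" for x \<xi> a b
  proof -
    have "(vnorm n (x - \<xi>))\<^sup>2 / (4 * t) \<le> 2 * B" using that by linarith
    then have "(vnorm n (x - \<xi>))\<^sup>2 \<le> 8 * t * B" using t by (simp add: field_simps)
    then have "(vnorm n (x - \<xi>))\<^sup>2 < \<theta>\<^sup>2" using t by linarith
    then show ?thesis using less_imp_le[OF \<theta>(1)] by (rule power_less_imp_less_base)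
  qed
  have wge: "w x \<ge> u x" if "x \<in> K" for x using bspec[OF bspec[OF wl], of x x] that K(3) by auto
  have wge': "w' x \<ge> v x" if "x \<in> K'" for x using bspec[OF bspec[OF wl'], of x x] that K'(3) by auto
  have wle: "w x \<le> u x + \<eta>" if x: "x \<in> K" for x
  proof -
    have xR: "x \<in> Rn n" using x K by blast
    obtain \<xi> where \<xi>: "\<xi> \<in> K" "w x \<le> u \<xi> - (vnorm n (x - \<xi>))\<^sup>2 / (4 * t)" using wu xR by blast
    have "vnorm n (x - \<xi>) < \<theta>"
      by (rule close[of _ _ "u \<xi>" "u x"]) (use \<xi> wge[OF x] B x in auto)
    then have "\<bar>u x - u \<xi>\<bar> < \<eta>" using \<theta>1(2)[OF \<xi>(1) x] \<theta> by simp
    moreover have "(vnorm n (x - \<xi>))\<^sup>2 / (4 * t) \<ge> 0" using t by simp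
    ultimately show ?thesis using \<xi> by linarith
  qed
  have wle': "w' x \<le> v x + \<eta>" if x: "x \<in> K'" for x
  proof -
    have xR: "x \<in> Rn n" using x K' by blast
    obtain \<xi> where \<xi>: "\<xi> \<in> K'" "w' x \<le> v \<xi> - (vnorm n (x - \<xi>))\<^sup>2 / (4 * t)" using wu' xR by blast
    have "vnorm n (x - \<xi>) < \<theta>"
      by (rule close[of _ _ "v \<xi>" "v x"]) (use \<xi> wge'[OF x] B x in auto)
    then have "\<bar>v x - v \<xi>\<bar> < \<eta>" using \<theta>2(2)[OF \<xi>(1) x] \<theta> by simp
    moreover have "(vnorm n (x - \<xi>))\<^sup>2 / (4 * t) \<ge> 0" using t by simp
    ultimately show ?thesis using \<xi> by linarith
  qed
  \<comment> \<open>The function on the product space to which the contact theorem applies.\<close>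
  define W where "W = (\<lambda>z. w (x0 + fs n z) + w' (y0 + sn n z) - vdot N (pair n P R) z - qf N Q1 z / 2)"
  define C where "C = 3 / (2 * t) + (real N)\<^sup>2 * M"
  have C0: "C > 0" using t M1 by (simp add: C_def add_pos_nonneg)
  have "C11 N (\<lambda>z. w (x0 + fs n z) + w' (y0 + sn n z) - vdot N (pair n P R) z)
      (\<lambda>z. pair n (G (x0 + fs n z)) (G' (y0 + sn n z)) - pair n P R) (3 / (2 * t))"
    unfolding N_def by (intro C11_minus_linear C11_pair G G' x0 pair_Rn PR)
  from C11_minus_quadratic[OF this Q1 Mb]
  have WC: "C11 N W (\<lambda>z. pair n (G (x0 + fs n z)) (G' (y0 + sn n z)) - pair n P R - mv N Q1 z) C"
    using M1 by (simp add: W_def C_def)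
  have inK: "x0 + fs n z \<in> K" "y0 + sn n z \<in> K'" if "vnorm N z \<le> \<rho>" for z
    using vnorm_fs_sn[of n z] that x0 by (auto simp: K_def K'_def cB_def N_def)
  have W0: "W 0 \<ge> u x0 + v y0"
    using wge[OF K(4)] wge'[OF K'(4)] by (simp add: W_def vdot_simps fs_sn_simps)
  have ann: "W z \<le> W 0 - e * \<rho>1\<^sup>2 / 16" if z: "z \<in> Rn N" "\<rho>1 / 2 \<le> vnorm N z" "vnorm N z \<le> \<rho>1" for z
  proof -
    have zr: "vnorm N z \<le> \<rho>" using z \<rho>1 \<rho> by linarith
    have zp: "pair n (fs n z) (sn n z) = z" using z(1) by (simp add: N_def pair_fs_sn)
    have nz: "vnorm n (fs n z) \<le> \<rho>" "vnorm n (sn n z) \<le> \<rho>" using vnorm_fs_sn[of n z] zr by (auto simp: N_def)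
    have "u (x0 + fs n z) + v (y0 + sn n z) \<le> u x0 + v y0 + vdot n P (fs n z) + vdot n R (sn n z) + qf N Q z / 2"
      using max[OF fs_sn_Rn nz] unfolding zp N_def[symmetric] .
    moreover have "vdot N (pair n P R) z = vdot n P (fs n z) + vdot n R (sn n z)"
      using PR by (simp add: N_def vdot_pair fs_sn_pair)
    moreover have "qf N Q1 z = qf N Q z + e * (vnorm N z)\<^sup>2" by (simp add: Q1_def qf_plus_id)
    ultimately have "W z \<le> u x0 + v y0 + 2 * \<eta> - e * (vnorm N z)\<^sup>2 / 2"
      using wle[OF inK(1)[OF zr]] wle'[OF inK(2)[OF zr]] unfolding W_def by linarith
    moreover have "e * (\<rho>1 / 2)\<^sup>2 \<le> e * (vnorm N z)\<^sup>2"
      using z \<rho>1 e0 by (intro mult_left_mono power_mono) auto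
    moreover have "e * (\<rho>1 / 2)\<^sup>2 = e * \<rho>1\<^sup>2 / 4" by (simp add: power_divide)
    moreover have "e * \<rho>1\<^sup>2 \<ge> 0" using e0 by simp
    ultimately show ?thesis using W0 unfolding \<eta>_def by linarith
  qed
  have \<kappa>0: "e * \<rho>1\<^sup>2 / 16 > 0" using e0 \<rho>1 by simp
  define L where "L = (real n)\<^sup>2 * (6 * C + M)"
  have L0: "L > 0" using n C0 M1 by (simp add: L_def)
  define \<tau> where "\<tau> = min (min (\<epsilon> / 64) (\<rho> / 4)) (min (\<epsilon> / (16 * L)) 1)"
  have \<tau>: "\<tau> > 0" "\<tau> \<le> \<epsilon> / 64" "\<tau> \<le> \<rho> / 4" "L * \<tau> \<le> \<epsilon> / 16" "\<tau> \<le> 1"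
  proof -
    show \<tau>0: "\<tau> > 0" using \<epsilon> \<rho> L0 by (simp add: \<tau>_def)
    show "\<tau> \<le> \<epsilon> / 64" "\<tau> \<le> \<rho> / 4" "\<tau> \<le> 1" by (auto simp: \<tau>_def)
    have "\<tau> \<le> \<epsilon> / (16 * L)" by (auto simp: \<tau>_def)
    then show "L * \<tau> \<le> \<epsilon> / 16" using L0 by (simp add: field_simps)
  qed
  have Nn: "N \<ge> 1" using n by (simp add: N_def)
  have "\<forall>z\<in>Rn N. \<rho>1 / 2 \<le> vnorm N z \<longrightarrow> vnorm N z \<le> \<rho>1 \<longrightarrow> W z \<le> W 0 - e * \<rho>1\<^sup>2 / 16"
    using ann by simp
  from nearly_quadratic_contact_point[OF Nn WC C0 \<rho>1(1) \<kappa>0 \<tau>(1) this]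
  obtain z0 p d H r where z0: "z0 \<in> Rn N" "p \<in> Rn N" "d \<in> Rn N" "vnorm N z0 < \<rho>1 / 2"
    and contact': "\<forall>z\<in>Rn N. vnorm N z \<le> \<rho>1 \<longrightarrow> W z \<le> W z0 + vdot N p (z - z0)"
    and pd: "vnorm N p \<le> \<tau>" "vnorm N (d - p) \<le> \<tau>" and r: "0 < r" "r \<le> \<tau>"
    and H': "\<forall>a c. H a c = H c a" "\<forall>a<N. \<forall>c<N. \<bar>H a c\<bar> \<le> 6 * C"
    and quad': "\<forall>y\<in>Rn N. vnorm N y \<le> r \<longrightarrow> \<bar>W (z0 + y) - W z0 - vdot N d y - qf N H y / 2\<bar> \<le> \<tau> * r\<^sup>2"
    and Hle': "\<forall>y\<in>Rn N. qf N H y \<le> \<tau> * (vnorm N y)\<^sup>2"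
    by (elim exE conjE)
  note contact = contact'[rule_format] and H = H'[rule_format] and quad = quad'[rule_format] and Hle = Hle'[rule_format]
  define x' where "x' = x0 + fs n z0"
  define y' where "y' = y0 + sn n z0"
  have x'R: "x' \<in> Rn n" "y' \<in> Rn n" using x0 by (auto simp: x'_def y'_def)
  define q where "q = pair n P R + mv N Q1 z0"
  have qR: "q \<in> Rn N" unfolding q_def N_def by (intro Rn_closed pair_Rn PR mv_Rn)
  define S where "S = (\<lambda>a c. H a c + Q1 a c)"
  have S: "S a c = S c a" for a c using H Q1 by (simp add: S_def)
  have qfS: "qf N S y = qf N H y + qf N Q1 y" for y
    by (simp add: S_def qf_def distrib_right sum.distrib)
  define A where "A = (\<lambda>h. w (x' + h) - w x')"
  define A' where "A' = (\<lambda>k. w' (y' + k) - w' y')"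
  have A0: "A 0 = 0" "A' 0 = 0" by (simp_all add: A_def A'_def)
  have incr: "W (z0 + pair n h k) - W z0 = A h + A' k - vdot N q (pair n h k) - qf N Q1 (pair n h k) / 2"
    if "h \<in> Rn n" "k \<in> Rn n" for h k
    unfolding W_def A_def A'_def q_def x'_def y'_def using qf_add[of Q1 N z0 "pair n h k", OF Q1] that
    by (simp add: fs_sn_simps fs_sn_pair vdot_simps add.assoc add_divide_distrib)
  have npair: "vnorm N (pair n h 0) = vnorm n h" "vnorm N (pair n 0 h) = vnorm n h" if "h \<in> Rn n" for h
  proof -
    have "(vnorm N (pair n h 0))\<^sup>2 = (vnorm n h)\<^sup>2" "(vnorm N (pair n 0 h))\<^sup>2 = (vnorm n h)\<^sup>2"
      using that by (simp_all add: N_def vnorm_pair fs_sn_pair)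
    then show "vnorm N (pair n h 0) = vnorm n h" "vnorm N (pair n 0 h) = vnorm n h"
      by (simp_all add: power2_eq_iff_nonneg)
  qed
  have pR: "pair n h k \<in> Rn N" if "k \<in> Rn n" for h k using that by (simp add: N_def)
  have vd: "vdot N z (pair n h 0) = vdot n (fs n z) h" "vdot N z (pair n 0 h) = vdot n (sn n z) h"
    if "h \<in> Rn n" for z h
    using that by (simp_all add: N_def vdot_pair fs_sn_pair vdot_simps)
  \<comment> \<open>The regularisations are touched from above by paraboloids of moderate opening.\<close>
  have touch: "A h + A' k \<le> vdot N (p + q) (pair n h k) + \<kappa> / 2 * (vnorm N (pair n h k))\<^sup>2"
    if hk: "h \<in> Rn n" "k \<in> Rn n" "vnorm N (pair n h k) \<le> \<rho>1 / 2" for h k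
  proof -
    have "vnorm N (z0 + pair n h k) \<le> \<rho>1" using vnorm_triangle[of N z0 "pair n h k"] z0 hk by linarith
    then have "W (z0 + pair n h k) \<le> W z0 + vdot N p (pair n h k)"
      using contact[of "z0 + pair n h k"] z0 pR[OF hk(2)] by simp
    then show ?thesis using incr[OF hk(1,2)] Q1le[of "pair n h k"] by (simp add: vdot_simps)
  qed
  have \<kappa>t: "\<kappa> < 1 / t"
  proof -
    have "1 / (2 * t) \<le> 1 / t" using t by (intro divide_left_mono) auto
    then show ?thesis using t by linarith
  qed
  obtain \<xi> where \<xi>: "\<xi> \<in> K" "w x' = u \<xi> - (vnorm n (x' - \<xi>))\<^sup>2 / (2 * t)"
  proof -
    have "\<exists>\<xi>\<in>K. w x' = u \<xi> - (vnorm n (x' - \<xi>))\<^sup>2 / (2 * t)"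
    proof (rule wt[rule_format, of x' "fs n (p + q)" \<kappa> "\<rho>1 / 2"])
      show "\<rho>1 / 2 > 0" using \<rho>1 by simp
      fix h assume h: "h \<in> Rn n" "vnorm n h \<le> \<rho>1 / 2"
      then show "w (x' + h) \<le> w x' + vdot n (fs n (p + q)) h + \<kappa> / 2 * (vnorm n h)\<^sup>2"
        using touch[OF h(1) Rn_closed(1)] A0 by (simp add: npair vd) (simp add: A_def)
    qed (use x'R \<kappa>t in auto)
    then show ?thesis using that by blast
  qed
  obtain \<xi>' where \<xi>': "\<xi>' \<in> K'" "w' y' = v \<xi>' - (vnorm n (y' - \<xi>'))\<^sup>2 / (2 * t)"
  proof -
    have "\<exists>\<xi>\<in>K'. w' y' = v \<xi> - (vnorm n (y' - \<xi>))\<^sup>2 / (2 * t)"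
    proof (rule wt'[rule_format, of y' "sn n (p + q)" \<kappa> "\<rho>1 / 2"])
      show "\<rho>1 / 2 > 0" using \<rho>1 by simp
      fix h assume h: "h \<in> Rn n" "vnorm n h \<le> \<rho>1 / 2"
      then show "w' (y' + h) \<le> w' y' + vdot n (sn n (p + q)) h + \<kappa> / 2 * (vnorm n h)\<^sup>2"
        using touch[OF Rn_closed(1) h(1)] A0 by (simp add: npair vd) (simp add: A'_def)
    qed (use x'R \<kappa>t in auto)
    then show ?thesis using that by blast
  qed
  have \<xi>R: "\<xi> \<in> Rn n" "\<xi>' \<in> Rn n" using \<xi> \<xi>' K K' by auto
  have z0\<rho>: "vnorm N z0 \<le> \<rho>" using z0 \<rho>1 \<rho> by linarith
  have half: "a / (4 * t) \<le> a / (2 * t)" if "a \<ge> 0" for a using t that by (intro divide_left_mono) auto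
  have near: "vnorm n (x' - \<xi>) < \<theta>"
  proof (rule close[of _ _ "u \<xi>" "u x'"])
    show "(vnorm n (x' - \<xi>))\<^sup>2 / (4 * t) \<le> u \<xi> - u x'"
      using half[of "(vnorm n (x' - \<xi>))\<^sup>2"] \<xi>(2) wge[OF inK(1)[OF z0\<rho>]] by (simp add: x'_def)
  qed (use B \<xi> inK(1)[OF z0\<rho>] in \<open>auto simp: x'_def\<close>)
  have near': "vnorm n (y' - \<xi>') < \<theta>"
  proof (rule close[of _ _ "v \<xi>'" "v y'"])
    show "(vnorm n (y' - \<xi>'))\<^sup>2 / (4 * t) \<le> v \<xi>' - v y'"
      using half[of "(vnorm n (y' - \<xi>'))\<^sup>2"] \<xi>'(2) wge'[OF inK(2)[OF z0\<rho>]] by (simp add: y'_def)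
  qed (use B \<xi>' inK(2)[OF z0\<rho>] in \<open>auto simp: y'_def\<close>)
  have fsz: "vnorm n (fs n z0) \<le> \<rho>1 / 2" "vnorm n (sn n z0) \<le> \<rho>1 / 2"
    using vnorm_fs_sn[of n z0] z0(4) by (auto simp: N_def)
  have \<xi>x0: "vnorm n (\<xi> - x0) \<le> \<theta> + \<rho>1 / 2"
    using vnorm_triangle[of n "\<xi> - x'" "x' - x0"] near fsz by (simp add: x'_def vnorm_commute)
  have \<xi>y0: "vnorm n (\<xi>' - y0) \<le> \<theta> + \<rho>1 / 2"
    using vnorm_triangle[of n "\<xi>' - y'" "y' - y0"] near' fsz by (simp add: y'_def vnorm_commute)
  define l where "l = fs n (d + q)"
  define l' where "l' = sn n (d + q)"
  define Y0 where "Y0 = (\<lambda>a c. S (n + a) (n + c))"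
  have Y0: "Y0 a c = Y0 c a" for a c using S by (simp add: Y0_def)
  have quadA: "\<bar>A h + A' k - vdot N (d + q) (pair n h k) - qf N S (pair n h k) / 2\<bar> \<le> \<tau> * r\<^sup>2"
    if hk: "h \<in> Rn n" "k \<in> Rn n" "vnorm N (pair n h k) \<le> r" for h k
  proof -
    have "A h + A' k - vdot N (d + q) (pair n h k) - qf N S (pair n h k) / 2
        = W (z0 + pair n h k) - W z0 - vdot N d (pair n h k) - qf N H (pair n h k) / 2"
      using incr[OF hk(1,2)] by (simp add: qfS vdot_simps add_divide_distrib)
    then show ?thesis using quad[OF pR[OF hk(2)] hk(3)] by simp
  qed
  have quad1: "\<bar>A h - vdot n l h - qf n S h / 2\<bar> \<le> \<tau> * r\<^sup>2" if h: "h \<in> Rn n" "vnorm n h \<le> r" for h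
    using quadA[OF h(1) Rn_closed(1)] h qf_pair(1)[OF h(1) h(1), of S, folded N_def] by (simp add: npair vd A0 l_def)
  have quad2: "\<bar>A' h - vdot n l' h - qf n Y0 h / 2\<bar> \<le> \<tau> * r\<^sup>2" if h: "h \<in> Rn n" "vnorm n h \<le> r" for h
    using quadA[OF Rn_closed(1) h(1)] h qf_pair(2)[OF h(1) h(1), of S, folded N_def] by (simp add: npair vd A0 l'_def Y0_def)
  \<comment> \<open>The tests pass on to \<open>u\<close> and \<open>v\<close>.\<close>
  have room: "vnorm n (\<xi> - x0) + r \<le> \<rho>" "vnorm n (\<xi>' - y0) + r \<le> \<rho>"
    using \<xi>x0 \<xi>y0 \<theta> \<rho>1 r \<tau> \<rho> by linarith+
  have le: "u (\<xi> + h) \<le> u \<xi> + vdot n l h + qf n S h / 2 + \<tau> * r\<^sup>2" if h: "h \<in> Rn n" "vnorm n h \<le> r" for h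
  proof -
    have "vnorm n (\<xi> + h - x0) \<le> \<rho>"
      using vnorm_triangle[of n "\<xi> - x0" h] room h by (simp add: algebra_simps)
    then have "\<xi> + h \<in> K" using \<xi>R h by (simp add: K_def cB_def)
    with wl x'R h have "u (\<xi> + h) - (vnorm n (x' - \<xi>))\<^sup>2 / (2 * t) \<le> w (x' + h)"
      using bspec[OF bspec[OF wl], of "x' + h" "\<xi> + h"] by simp
    then show ?thesis using quad1[OF h] \<xi>(2) unfolding A_def by linarith
  qed
  have le': "v (\<xi>' + h) \<le> v \<xi>' + vdot n l' h + qf n Y0 h / 2 + \<tau> * r\<^sup>2" if h: "h \<in> Rn n" "vnorm n h \<le> r" for h
  proof -
    have "vnorm n (\<xi>' + h - y0) \<le> \<rho>"
      using vnorm_triangle[of n "\<xi>' - y0" h] room h by (simp add: algebra_simps)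
    then have "\<xi>' + h \<in> K'" using \<xi>R h by (simp add: K'_def cB_def)
    with wl' x'R h have "v (\<xi>' + h) - (vnorm n (y' - \<xi>'))\<^sup>2 / (2 * t) \<le> w' (y' + h)"
      using bspec[OF bspec[OF wl'], of "y' + h" "\<xi>' + h"] by simp
    then show ?thesis using quad2[OF h] \<xi>'(2) unfolding A'_def by linarith
  qed
  obtain k where k: "k \<in> Rn n" "vnorm n k < r" "\<exists>s>0. \<forall>h\<in>Rn n. vnorm n h < s \<longrightarrow>
    u (\<xi> + k + h) \<le> u (\<xi> + k) + vdot n (l + mv n S k + vscale (4 * \<tau>) k) h + qf n (plus_id S (4 * \<tau>)) h / 2"
    using one_scale_test[OF u \<xi>R(1) room(1) r(1) \<tau>(1) S le] by blast
  obtain k' where k': "k' \<in> Rn n" "vnorm n k' < r" "\<exists>s>0. \<forall>h\<in>Rn n. vnorm n h < s \<longrightarrow>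
    v (\<xi>' + k' + h) \<le> v (\<xi>' + k') + vdot n (l' + mv n Y0 k' + vscale (4 * \<tau>) k') h + qf n (plus_id Y0 (4 * \<tau>)) h / 2"
    using one_scale_test[OF v \<xi>R(2) room(2) r(1) \<tau>(1) Y0 le'] by blast
  \<comment> \<open>It remains to collect the estimates.\<close>
  have Sb: "\<bar>S a c\<bar> \<le> 6 * C + M" if "a < N" "c < N" for a c
    using H(2)[OF that] Mb[OF that] by (simp add: S_def)
  have lR: "l \<in> Rn n" "l' \<in> Rn n" by (simp_all add: l_def l'_def)
  have dn: "vnorm N (d + mv N Q1 z0) \<le> \<epsilon> / 2"
  proof -
    have "vnorm N d \<le> 2 * \<tau>" using vnorm_triangle_diff[of N d p] pd by linarith
    moreover have "vnorm N (mv N Q1 z0) \<le> \<kappa> * \<rho>1"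
      by (rule order_trans[OF mvQ]) (use \<kappa> z0 \<rho>1 in \<open>auto intro!: mult_left_mono\<close>)
    ultimately show ?thesis using vnorm_triangle[of N d "mv N Q1 z0"] \<rho>1 \<tau> \<epsilon> by linarith
  qed
  have lP: "l - P = fs n (d + mv N Q1 z0)" "l' - R = sn n (d + mv N Q1 z0)"
    unfolding l_def l'_def q_def by (simp_all only: fs_sn_simps fs_sn_pair[OF PR(1)] fs_sn_pair[OF PR(2)]) simp_all
  have small: "vnorm n (mv n T k + vscale (4 * \<tau>) k) \<le> \<epsilon> / 4"
    if T: "\<And>a c. a < n \<Longrightarrow> c < n \<Longrightarrow> \<bar>T a c\<bar> \<le> 6 * C + M" and k: "vnorm n k < r" for T k
  proof -
    have k\<tau>: "vnorm n k \<le> \<tau>" using k r by linarith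
    have "vnorm n (mv n T k) \<le> L * vnorm n k"
      unfolding L_def by (rule mv_bound) (use T C0 M1 in auto)
    also have "\<dots> \<le> L * \<tau>" using k\<tau> L0 by (intro mult_left_mono) auto
    also have "\<dots> \<le> \<epsilon> / 16" by (rule \<tau>)
    finally have "vnorm n (mv n T k) \<le> \<epsilon> / 16" .
    moreover have "vnorm n (vscale (4 * \<tau>) k) \<le> 4 * \<tau> * 1"
      using k\<tau> \<tau> by (simp add: mult_left_mono)
    ultimately show ?thesis
      using vnorm_triangle[of n "mv n T k" "vscale (4 * \<tau>) k"] \<tau> by linarith
  qed
  have zP: "vnorm n (l + mv n S k + vscale (4 * \<tau>) k - P) \<le> \<epsilon>"
  proof -
    have "l + mv n S k + vscale (4 * \<tau>) k - P = (l - P) + (mv n S k + vscale (4 * \<tau>) k)" by simp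
    then have "vnorm n (l + mv n S k + vscale (4 * \<tau>) k - P) \<le> vnorm n (l - P) + vnorm n (mv n S k + vscale (4 * \<tau>) k)"
      by (simp only: vnorm_triangle)
    moreover have "vnorm n (l - P) \<le> \<epsilon> / 2"
      unfolding lP using vnorm_fs_sn(1)[of n "d + mv N Q1 z0"] dn by (simp only: N_def)
    moreover have "vnorm n (mv n S k + vscale (4 * \<tau>) k) \<le> \<epsilon> / 4"
      by (rule small[OF _ k(2)]) (use Sb in \<open>auto simp: N_def\<close>)
    ultimately show ?thesis using \<epsilon> by linarith
  qed
  have wR: "vnorm n (l' + mv n Y0 k' + vscale (4 * \<tau>) k' - R) \<le> \<epsilon>"
  proof -
    have "l' + mv n Y0 k' + vscale (4 * \<tau>) k' - R = (l' - R) + (mv n Y0 k' + vscale (4 * \<tau>) k')" by simp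
    then have "vnorm n (l' + mv n Y0 k' + vscale (4 * \<tau>) k' - R) \<le> vnorm n (l' - R) + vnorm n (mv n Y0 k' + vscale (4 * \<tau>) k')"
      by (simp only: vnorm_triangle)
    moreover have "vnorm n (l' - R) \<le> \<epsilon> / 2"
      unfolding lP using vnorm_fs_sn(2)[of n "d + mv N Q1 z0"] dn by (simp only: N_def)
    moreover have "vnorm n (mv n Y0 k' + vscale (4 * \<tau>) k') \<le> \<epsilon> / 4"
      by (rule small[OF _ k'(2)]) (use Sb in \<open>auto simp: N_def Y0_def\<close>)
    ultimately show ?thesis using \<epsilon> by linarith
  qed
  have xx: "vnorm n (\<xi> + k - x0) \<le> \<epsilon>"
  proof -
    have "\<xi> + k - x0 = (\<xi> - x0) + k" by simp
    then have "vnorm n (\<xi> + k - x0) \<le> vnorm n (\<xi> - x0) + vnorm n k" by (simp only: vnorm_triangle)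
    then show ?thesis using \<xi>x0 \<theta> \<rho>1 k r \<tau> \<epsilon> by linarith
  qed
  have yy: "vnorm n (\<xi>' + k' - y0) \<le> \<epsilon>"
  proof -
    have "\<xi>' + k' - y0 = (\<xi>' - y0) + k'" by simp
    then have "vnorm n (\<xi>' + k' - y0) \<le> vnorm n (\<xi>' - y0) + vnorm n k'" by (simp only: vnorm_triangle)
    then show ?thesis using \<xi>y0 \<theta> \<rho>1 k' r \<tau> \<epsilon> by linarith
  qed
  have forms: "qf n S h + qf n Y0 k \<le> qf N S (pair n h k) + 6 * \<tau> * (vnorm N (pair n h k))\<^sup>2"
    if hk: "h \<in> Rn n" "k \<in> Rn n" for h k
  proof (cases "vnorm N (pair n h k) = 0")
    case True
    then have "pair n h k = 0" using vnorm_eq_0[OF pR[OF hk(2)]] by simp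
    then have "h = 0" "k = 0"
      using fs_sn_pair(1)[OF hk(1), of k] fs_sn_pair(2)[OF hk(2), of h] by (simp_all add: fs_sn_simps)
    then show ?thesis using True \<open>pair n h k = 0\<close> by simp
  next
    case False
    then have g0: "vnorm N (pair n h k) > 0" using vnorm_ge_0[of N "pair n h k"] by linarith
    define g where "g = r / vnorm N (pair n h k)"
    have g: "g > 0" using r g0 by (simp add: g_def)
    have hk': "vscale g h \<in> Rn n" "vscale g k \<in> Rn n" using hk by auto
    have pg: "pair n (vscale g h) (vscale g k) = vscale g (pair n h k)" by (auto simp: pair_def fun_eq_iff)
    have ng: "vnorm N (vscale g (pair n h k)) = r" using r g0 by (simp add: g_def)
    have "vnorm n (vscale g h) \<le> r" "vnorm n (vscale g k) \<le> r"
    proof -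
      have fg: "fs n (vscale g (pair n h k)) = vscale g h" "sn n (vscale g (pair n h k)) = vscale g k"
        unfolding pg[symmetric] using hk' by (simp_all only: fs_sn_pair)
      show "vnorm n (vscale g h) \<le> r" "vnorm n (vscale g k) \<le> r"
        using vnorm_fs_sn[of n "vscale g (pair n h k)"] unfolding fg N_def[symmetric] ng by auto
    qed
    then have 1: "\<bar>A (vscale g h) - vdot n l (vscale g h) - qf n S (vscale g h) / 2\<bar> \<le> \<tau> * r\<^sup>2"
      "\<bar>A' (vscale g k) - vdot n l' (vscale g k) - qf n Y0 (vscale g k) / 2\<bar> \<le> \<tau> * r\<^sup>2"
      using quad1[OF hk'(1)] quad2[OF hk'(2)] by auto
    have 2: "\<bar>A (vscale g h) + A' (vscale g k) - vdot N (d + q) (vscale g (pair n h k)) - qf N S (vscale g (pair n h k)) / 2\<bar> \<le> \<tau> * r\<^sup>2"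
      using quadA[OF hk'] ng unfolding pg by simp
    have 3: "vdot N (d + q) (vscale g (pair n h k)) = vdot n l (vscale g h) + vdot n l' (vscale g k)"
      using hk' unfolding pg[symmetric] by (simp add: N_def vdot_pair fs_sn_pair l_def l'_def)
    have "qf n S (vscale g h) + qf n Y0 (vscale g k) \<le> qf N S (vscale g (pair n h k)) + 6 * (\<tau> * r\<^sup>2)"
      using 1 2 unfolding 3 abs_le_iff by linarith
    also have "r\<^sup>2 = g\<^sup>2 * (vnorm N (pair n h k))\<^sup>2" using g0 by (simp add: g_def power_divide)
    finally have "g\<^sup>2 * (qf n S h + qf n Y0 k) \<le> g\<^sup>2 * (qf N S (pair n h k) + 6 * \<tau> * (vnorm N (pair n h k))\<^sup>2)"
      unfolding qf_scale by (simp add: algebra_simps)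
    then show ?thesis using g by simp
  qed
  have final: "qf n (plus_id S (4 * \<tau>)) h + qf n (plus_id Y0 (4 * \<tau>)) k
        \<le> qf (2 * n) Q (pair n h k) + \<epsilon> * ((vnorm n h)\<^sup>2 + (vnorm n k)\<^sup>2)"
    if hk: "h \<in> Rn n" "k \<in> Rn n" for h k
  proof -
    have np: "(vnorm N (pair n h k))\<^sup>2 = (vnorm n h)\<^sup>2 + (vnorm n k)\<^sup>2"
      using hk by (simp add: N_def vnorm_pair fs_sn_pair)
    define V where "V = (vnorm n h)\<^sup>2 + (vnorm n k)\<^sup>2"
    have "qf n (plus_id S (4 * \<tau>)) h + qf n (plus_id Y0 (4 * \<tau>)) k = qf n S h + qf n Y0 k + 4 * \<tau> * V"
      by (simp add: qf_plus_id V_def algebra_simps)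
    also have "\<dots> \<le> qf N H (pair n h k) + qf N Q (pair n h k) + e * V + 6 * \<tau> * V + 4 * \<tau> * V"
      using forms[OF hk] unfolding qfS np V_def[symmetric] Q1_def qf_plus_id by linarith
    also have "\<dots> \<le> qf N Q (pair n h k) + (e + 11 * \<tau>) * V"
      using Hle[OF pR[OF hk(2)], of h] unfolding np V_def[symmetric] by (simp add: algebra_simps)
    also have "\<dots> \<le> qf N Q (pair n h k) + \<epsilon> * V"
      using \<tau> \<epsilon> unfolding e_def by (intro add_left_mono mult_right_mono) (auto simp: V_def)
    finally show ?thesis by (simp add: N_def V_def)
  qed
  show ?thesis
    unfolding jet_above_def
    apply (rule exI[of _ "\<xi> + k"], rule exI[of _ "\<xi>' + k'"], rule exI[of _ "l + mv n S k + vscale (4 * \<tau>) k"],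
        rule exI[of _ "l' + mv n Y0 k' + vscale (4 * \<tau>) k'"], rule exI[of _ "plus_id S (4 * \<tau>)"],
        rule exI[of _ "plus_id Y0 (4 * \<tau>)"])
    by (intro conjI ballI allI plus_id_sym S Y0 xx yy zP wR k(3) k'(3) final Rn_closed \<xi>R k(1) k'(1) lR mv_Rn)
qed

section \<open>Quadratic test functions\<close>

definition quad :: "nat \<Rightarrow> point \<Rightarrow> real \<Rightarrow> point \<Rightarrow> (nat \<Rightarrow> nat \<Rightarrow> real) \<Rightarrow> point \<Rightarrow> real" where
  "quad n x1 c z X = (\<lambda>x. c + vdot n z (x - x1) + qf n X (x - x1) / 2)"

lemma quad_center [simp]: "quad n x1 c z X x1 = c"
  by (simp add: quad_def vdot_simps)

lemma quad_derivative:
  assumes X: "\<And>a c. X a c = X c a" and i: "i < n"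
  shows "((\<lambda>t. quad n x1 c z X (x(i := t))) has_field_derivative z i + mv n X (x - x1) i) (at (x i))"
proof -
  define e where "e = rv (unit_shift i 1)"
  have upd: "x(i := t) - x1 = (x - x1) + vscale (t - x i) e" for t
    by (auto simp: e_def unit_shift_def fun_eq_iff)
  have dot: "vdot n w e = w i" for w
  proof -
    have "(\<Sum>j<n. w j * rv (unit_shift i 1) j) = (\<Sum>j<n. if j = i then w i else 0)"
      by (rule sum.cong) (auto simp: unit_shift_def)
    then show ?thesis using i by (simp add: e_def vdot_def)
  qed
  have "quad n x1 c z X (x(i := t)) = quad n x1 c z X x + (t - x i) * (z i + mv n X (x - x1) i) + (t - x i)\<^sup>2 * (qf n X e / 2)" for t
    unfolding quad_def upd qf_add[of X n "x - x1", OF X] qf_scale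
    by (simp add: vdot_simps dot add_divide_distrib) (simp add: algebra_simps)
  then have "(\<lambda>t. quad n x1 c z X (x(i := t)))
      = (\<lambda>t. quad n x1 c z X x + (t - x i) * (z i + mv n X (x - x1) i) + (t - x i)\<^sup>2 * (qf n X e / 2))"
    by (rule ext)
  then show ?thesis by (auto intro!: derivative_eq_intros)
qed

lemma partial_quad:
  assumes X: "\<And>a c. X a c = X c a" and i: "i < n"
  shows "partial i (quad n x1 c z X) = quad n x1 (z i) (X i) (\<lambda>_ _. 0)"
proof
  fix x
  have "partial i (quad n x1 c z X) x = z i + mv n X (x - x1) i"
    unfolding partial_def by (rule DERIV_imp_deriv[OF quad_derivative[OF X i]])
  also have "\<dots> = quad n x1 (z i) (X i) (\<lambda>_ _. 0) x"
    using i by (simp add: quad_def mv_def vdot_def qf_def)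
  finally show "partial i (quad n x1 c z X) x = quad n x1 (z i) (X i) (\<lambda>_ _. 0) x" .
qed

lemma continuous_on_quad: "continuous_on S (quad n x1 c z X)"
  unfolding quad_def by (intro continuous_intros continuous_on_vdot continuous_on_qf) simp

lemma C1_on_quad:
  assumes X: "\<And>a c. X a c = X c a"
  shows "C1_on n \<Omega> (quad n x1 c z X)"
  unfolding C1_on_def
proof (intro conjI allI impI ballI)
  show "continuous_on \<Omega> (quad n x1 c z X)" by (rule continuous_on_quad)
  fix i assume i: "i < n"
  show "continuous_on \<Omega> (partial i (quad n x1 c z X))"
    unfolding partial_quad[where X = X, OF X i] by (rule continuous_on_quad)
  fix x
  show "(\<lambda>t. quad n x1 c z X (x(i := t))) differentiable at (x i)"
    unfolding real_differentiable_def using quad_derivative[where X = X, OF X i] by blast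
qed

lemma C2_on_quad:
  assumes X: "\<And>a c. X a c = X c a"
  shows "C2_on n \<Omega> (quad n x1 c z X)"
  unfolding C2_on_def using C1_on_quad[where X = X, OF X] C1_on_quad[of "\<lambda>_ _. 0"] partial_quad[where X = X, OF X] by auto

definition Mat :: "nat \<Rightarrow> (nat \<Rightarrow> nat \<Rightarrow> real) \<Rightarrow> real mat" where
  "Mat n X = Matrix.mat n n (\<lambda>(i, j). X i j)"

lemma grad_quad:
  assumes X: "\<And>a c. X a c = X c a" and z: "z \<in> Rn n"
  shows "grad n (quad n x1 c z X) x1 = z"
  using z by (auto simp: grad_def partial_quad[where X = X, OF X] fun_eq_iff Rn_iff)

lemma hess_quad:
  assumes X: "\<And>a c. X a c = X c a"
  shows "hess n (quad n x1 c z X) x1 = Mat n X"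
  unfolding hess_def Mat_def
  by (rule eq_matI) (auto simp: partial_quad[where X = X, OF X] partial_quad[of "\<lambda>_ _. 0"] X)

text \<open>Quadratic polynomials are admissible test functions, with the expected gradient and Hessian.\<close>

lemma visc_ge_jet:
  assumes u: "visc_ge n \<Omega> F f u" and x1: "x1 \<in> \<Omega>" and \<Omega>: "\<Omega> \<subseteq> Rn n" and z: "z \<in> Rn n" and X: "\<And>a c. X a c = X c a"
    and le: "jet_above n u x1 z X"
  shows "f x1 z \<le> F (Mat n X) z x1"
proof -
  let ?\<psi> = "quad n x1 0 z X"
  obtain s where s: "s > 0" "\<And>h. h \<in> Rn n \<Longrightarrow> vnorm n h < s \<Longrightarrow> u (x1 + h) \<le> u x1 + vdot n z h + qf n X h / 2"
    using le unfolding jet_above_def by blast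
  have "local_max n \<Omega> (\<lambda>x. u x - ?\<psi> x) x1"
    unfolding local_max_def
  proof (intro exI[of _ s] conjI ballI impI s)
    fix x assume x: "x \<in> \<Omega>" "vnorm n (x - x1) < s"
    have "x - x1 \<in> Rn n" using x x1 \<Omega> by blast
    from s(2)[OF this x(2)] show "u x - ?\<psi> x \<le> u x1 - ?\<psi> x1" by (simp add: quad_def vdot_simps)
  qed
  then have "f x1 (grad n ?\<psi> x1) \<le> F (hess n ?\<psi> x1) (grad n ?\<psi> x1) x1"
    using u x1 C2_on_quad[of X n \<Omega> x1 0 z, OF X] by (simp add: visc_ge_def)
  then show ?thesis by (simp add: grad_quad[OF X z] hess_quad[OF X])
qed

lemma visc_le_jet:
  assumes u: "visc_le n \<Omega> F f u" and x1: "x1 \<in> \<Omega>" and \<Omega>: "\<Omega> \<subseteq> Rn n" and z: "z \<in> Rn n" and X: "\<And>a c. X a c = X c a"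
    and le: "\<exists>s>0. \<forall>h\<in>Rn n. vnorm n h < s \<longrightarrow> u x1 + vdot n z h + qf n X h / 2 \<le> u (x1 + h)"
  shows "F (Mat n X) z x1 \<le> f x1 z"
proof -
  let ?\<psi> = "quad n x1 0 z X"
  obtain s where s: "s > 0" "\<And>h. h \<in> Rn n \<Longrightarrow> vnorm n h < s \<Longrightarrow> u x1 + vdot n z h + qf n X h / 2 \<le> u (x1 + h)"
    using le by blast
  have "local_min n \<Omega> (\<lambda>x. u x - ?\<psi> x) x1"
    unfolding local_min_def
  proof (intro exI[of _ s] conjI ballI impI s)
    fix x assume x: "x \<in> \<Omega>" "vnorm n (x - x1) < s"
    have "x - x1 \<in> Rn n" using x x1 \<Omega> by blast
    from s(2)[OF this x(2)] show "u x1 - ?\<psi> x1 \<le> u x - ?\<psi> x" by (simp add: quad_def vdot_simps)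
  qed
  then have "F (hess n ?\<psi> x1) (grad n ?\<psi> x1) x1 \<le> f x1 (grad n ?\<psi> x1)"
    using u x1 C2_on_quad[of X n \<Omega> x1 0 z, OF X] by (simp add: visc_le_def)
  then show ?thesis by (simp add: grad_quad[OF X z] hess_quad[OF X])
qed

section \<open>Pucci operators and the operator norm in terms of quadratic forms\<close>

lemma Mat_Sym: "(\<And>a c. X a c = X c a) \<Longrightarrow> Mat n X \<in> Sym n"
  by (auto simp: Sym_def Mat_def)

lemma compact_sphere: "compact {v \<in> Rn n. vnorm n v = 1}"
proof -
  have "closed {x. vnorm n (x - 0) = 1}"
    by (intro closed_Collect_eq continuous_on_vnorm continuous_on_const)
  then have "compact (cB n 0 1 \<inter> {x. vnorm n (x - 0) = 1})" by (intro compact_Int_closed compact_cB)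
  also have "cB n 0 1 \<inter> {x. vnorm n (x - 0) = 1} = {v \<in> Rn n. vnorm n v = 1}" by (auto simp: cB_def)
  finally show ?thesis .
qed

lemma unit_vector: "n \<ge> 1 \<Longrightarrow> rv (unit_shift 0 1) \<in> {v \<in> Rn n. vnorm n v = 1}"
  using vnorm_unit[of 0 n 1] by (auto intro!: rv_Rn simp: unit_shift_def)

lemma mnorm_Mat_le:
  assumes X: "\<And>a c. X a c = X c a" and s: "s \<ge> 0" and le: "\<And>v. v \<in> Rn n \<Longrightarrow> \<bar>qf n X v\<bar> \<le> s * (vnorm n v)\<^sup>2"
  shows "mnorm n (Mat n X) \<le> s"
  unfolding mnorm_def
proof (rule cSUP_least)
  show "{v \<in> Rn n. vnorm n v \<le> 1} \<noteq> {}" by (auto intro: exI[of _ 0])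
  fix v assume v: "v \<in> {v \<in> Rn n. vnorm n v \<le> 1}"
  define y where "y = mv n X v"
  have y_eq: "(\<lambda>i. if i < n then \<Sum>j<n. Mat n X $$ (i, j) * v j else 0) = y"
    by (auto simp: y_def mv_def Mat_def fun_eq_iff)
  have "vnorm n y \<le> s"
  proof (cases "vnorm n y = 0")
    case False
    then have y0: "vnorm n y > 0" using vnorm_ge_0[of n y] by linarith
    define w where "w = vscale (1 / vnorm n y) y"
    have w: "w \<in> Rn n" "vnorm n w = 1" using y0 by (auto simp: w_def y_def)
    have "bf n X w v = vdot n y w" by (simp add: y_def vdot_mv)
    also have "\<dots> = vnorm n y" using y0 by (simp add: w_def vdot_simps vnorm_sq[symmetric] power2_eq_square)
    finally have b: "bf n X w v = vnorm n y" .
    have "4 * bf n X w v = qf n X (v + w) - qf n X (v - w)"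
      using bf_commute[of X n v w, OF X] by (simp add: qf_bf bf_simps)
    also have "\<dots> \<le> s * (vnorm n (v + w))\<^sup>2 + s * (vnorm n (v - w))\<^sup>2"
      using le[of "v + w"] le[of "v - w"] v w by (auto simp: abs_le_iff)
    also have "\<dots> = s * (2 * (vnorm n v)\<^sup>2 + 2 * (vnorm n w)\<^sup>2)"
      by (simp only: distrib_left[symmetric] vnorm_parallelogram)
    also have "\<dots> \<le> s * (2 * 1 + 2 * 1)"
      using s v w by (intro mult_left_mono add_mono) (auto intro!: power_le_one)
    finally show ?thesis using b by simp
  qed (use s in simp)
  then show "vnorm n (\<lambda>i. if i < n then \<Sum>j<n. Mat n X $$ (i, j) * v j else 0) \<le> s" by (simp add: y_eq)
qed

lemma eigs_Mat_iff:
  "e \<in># eigs (Mat n X) \<longleftrightarrow> (\<exists>v\<in>Rn n. v \<noteq> 0 \<and> mv n X v = vscale e v)"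
proof -
  have M: "Mat n X \<in> carrier_mat n n" by (simp add: Mat_def)
  have "char_poly (Mat n X) \<noteq> 0" using degree_monic_char_poly[OF M] by auto
  then have "e \<in># eigs (Mat n X) \<longleftrightarrow> eigenvalue (Mat n X) e"
    unfolding eigs_def eigenvalue_root_char_poly[OF M] by (simp add: set_count_proots)
  also have "\<dots> \<longleftrightarrow> (\<exists>v\<in>Rn n. v \<noteq> 0 \<and> mv n X v = vscale e v)"
  proof
    assume "eigenvalue (Mat n X) e"
    then obtain v where v: "v \<in> carrier_vec n" "v \<noteq> 0\<^sub>v n" "Mat n X *\<^sub>v v = e \<cdot>\<^sub>v v"
      unfolding eigenvalue_def eigenvector_def using M by auto
    define w where "w = (\<lambda>i. if i < n then v $ i else 0)"
    have "(\<Sum>c<n. X i c * w c) = e * w i" if "i < n" for i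
    proof -
      have "(Mat n X *\<^sub>v v) $ i = (e \<cdot>\<^sub>v v) $ i" using v by simp
      then show ?thesis using that v
        by (simp add: Mat_def scalar_prod_def w_def atLeast0LessThan)
    qed
    then have "mv n X w = vscale e w" by (auto simp: mv_def fun_eq_iff w_def)
    moreover have "w \<noteq> 0"
    proof
      assume "w = 0"
      then have "w i = 0" for i by simp
      then have "v $ i = 0" if "i < n" for i using that by (metis w_def)
      then have "v = 0\<^sub>v n" using v by (intro eq_vecI) auto
      then show False using v by simp
    qed
    moreover have "w \<in> Rn n" by (simp add: w_def Rn_iff)
    ultimately show "\<exists>v\<in>Rn n. v \<noteq> 0 \<and> mv n X v = vscale e v" by blast
  next
    assume "\<exists>v\<in>Rn n. v \<noteq> 0 \<and> mv n X v = vscale e v"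
    then obtain w where w: "w \<in> Rn n" "w \<noteq> 0" "mv n X w = vscale e w" by blast
    define v where "v = Matrix.vec n w"
    have "v \<noteq> 0\<^sub>v n"
    proof
      assume "v = 0\<^sub>v n"
      then have "w i = 0" if "i < n" for i using that by (metis v_def index_vec index_zero_vec(1))
      then show False using w by (auto simp: Rn_iff fun_eq_iff) (metis not_less)
    qed
    moreover have "Mat n X *\<^sub>v v = e \<cdot>\<^sub>v v"
    proof (rule eq_vecI)
      fix i assume "i < dim_vec (e \<cdot>\<^sub>v v)"
      then have i: "i < n" by (simp add: v_def)
      then show "(Mat n X *\<^sub>v v) $ i = (e \<cdot>\<^sub>v v) $ i"
        using fun_cong[OF w(3), of i] by (simp add: Mat_def scalar_prod_def v_def mv_def atLeast0LessThan)
    qed (simp_all add: v_def Mat_def)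
    ultimately show "eigenvalue (Mat n X) e"
      unfolding eigenvalue_def eigenvector_def using M by (intro exI[of _ v]) (auto simp: v_def Mat_def)
  qed
  finally show ?thesis .
qed

text \<open>A minimiser of the quadratic form on the unit sphere is an eigenvector.\<close>

lemma minimal_eigenvalue:
  assumes X: "\<And>a c. X a c = X c a" and v0: "v0 \<in> Rn n" "vnorm n v0 = 1"
  shows "\<exists>e. e \<in># eigs (Mat n X) \<and> e \<le> qf n X v0"
proof -
  let ?S = "{v \<in> Rn n. vnorm n v = 1}"
  have "continuous_on ?S (\<lambda>v. qf n X (v - 0))" by (rule continuous_on_qf)
  then obtain v where v: "v \<in> ?S" and min: "\<And>w. w \<in> ?S \<Longrightarrow> qf n X v \<le> qf n X w"
    using continuous_attains_inf[OF compact_sphere, of n "qf n X"] v0 by auto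
  define e where "e = qf n X v"
  have ray: "qf n X w \<ge> e * (vnorm n w)\<^sup>2" if w: "w \<in> Rn n" for w
  proof (cases "vnorm n w = 0")
    case True
    then show ?thesis using vnorm_eq_0[OF w] by simp
  next
    case False
    then have w0: "vnorm n w > 0" using vnorm_ge_0[of n w] by linarith
    have "vscale (1 / vnorm n w) w \<in> ?S" using w w0 by auto
    from min[OF this] have "e \<le> (1 / vnorm n w)\<^sup>2 * qf n X w" by (simp only: e_def qf_scale)
    then show ?thesis using w0 by (simp add: power_divide pos_le_divide_eq)
  qed
  define g where "g = mv n X v - vscale e v"
  have vR: "v \<in> Rn n" "vnorm n v = 1" using v by auto
  have gR: "g \<in> Rn n" using vR by (auto simp: g_def)
  have "vnorm n g = 0"
  proof (rule ccontr)
    assume "vnorm n g \<noteq> 0"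
    then have g0: "(vnorm n g)\<^sup>2 > 0" by simp
    define k where "k = qf n X g - e * (vnorm n g)\<^sup>2"
    have k0: "k \<ge> 0" using ray[OF gR] by (simp add: k_def)
    have ineq: "0 \<le> - 2 * s * (vnorm n g)\<^sup>2 + s\<^sup>2 * k" for s
    proof -
      have "e * (vnorm n (v + vscale (- s) g))\<^sup>2 \<le> qf n X (v + vscale (- s) g)"
        using ray[of "v + vscale (- s) g"] vR gR by blast
      moreover have "qf n X (v + vscale (- s) g) = e - 2 * s * vdot n (mv n X v) g + s\<^sup>2 * qf n X g"
        unfolding qf_add[of X n v, OF X] by (simp add: qf_scale vdot_simps e_def)
      moreover have "(vnorm n (v + vscale (- s) g))\<^sup>2 = 1 - 2 * s * vdot n v g + s\<^sup>2 * (vnorm n g)\<^sup>2"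
        unfolding vnorm_sq_add by (simp add: vR vdot_simps power_mult_distrib)
      moreover have "(vnorm n g)\<^sup>2 = vdot n (mv n X v) g - e * vdot n v g"
      proof -
        have "(vnorm n g)\<^sup>2 = vdot n (mv n X v - vscale e v) g" by (simp add: vnorm_sq g_def)
        then show ?thesis by (simp add: vdot_simps)
      qed
      ultimately have *: "e * (1 - 2 * s * vdot n v g + s\<^sup>2 * (vnorm n g)\<^sup>2)
          \<le> e - 2 * s * vdot n (mv n X v) g + s\<^sup>2 * qf n X g"
        and "s * (vnorm n g)\<^sup>2 = s * (vdot n (mv n X v) g - e * vdot n v g)" by simp_all
      then show ?thesis unfolding k_def by (simp add: algebra_simps)
    qed
    define s where "s = (vnorm n g)\<^sup>2 / (k + 1)"
    have s: "s > 0" "s * k \<le> (vnorm n g)\<^sup>2" using k0 g0 by (auto simp: s_def field_simps)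
    have "s\<^sup>2 * k \<le> s * (vnorm n g)\<^sup>2"
      using mult_left_mono[OF s(2), of s] s(1) by (simp add: power2_eq_square mult.assoc)
    moreover have "0 < s * (vnorm n g)\<^sup>2" using s(1) g0 by simp
    ultimately show False using ineq[of s] by linarith
  qed
  then have "mv n X v = vscale e v" using vnorm_eq_0[OF gR] by (simp add: g_def)
  moreover have "v \<noteq> 0" using vR by auto
  ultimately have "e \<in># eigs (Mat n X)" using vR by (auto simp: eigs_Mat_iff)
  then show ?thesis using min[of v0] v0 by (auto simp: e_def)
qed

text \<open>All eigenvalues are at most \<open>\<kappa>\<close>, and by \<open>minimal_eigenvalue\<close> the sum of the negative ones is at most
  the value of the form at any unit vector.\<close>

lemma pucci_max_le:
  assumes X: "\<And>a c. X a c = X c a" and \<kappa>: "\<kappa> \<ge> 0" and le: "\<And>v. v \<in> Rn n \<Longrightarrow> qf n X v \<le> \<kappa> * (vnorm n v)\<^sup>2"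
    and v0: "v0 \<in> Rn n" "vnorm n v0 = 1" and l: "0 \<le> l" "0 \<le> L"
  shows "pucci_max l L (Mat n X) \<le> L * (real n * \<kappa>) + l * min 0 (qf n X v0)"
proof -
  define E where "E = eigs (Mat n X)"
  have M: "Mat n X \<in> carrier_mat n n" by (simp add: Mat_def)
  have upper: "e \<le> \<kappa>" if e: "e \<in># E" for e
  proof -
    obtain v where v: "v \<in> Rn n" "v \<noteq> 0" "mv n X v = vscale e v"
      using e unfolding E_def eigs_Mat_iff by blast
    have "qf n X v = e * (vnorm n v)\<^sup>2"
      unfolding qf_bf vdot_mv[symmetric] v(3) by (simp add: vdot_simps vnorm_sq)
    moreover have "vnorm n v > 0" using vnorm_eq_0[OF v(1)] v(2) vnorm_ge_0[of n v] by linarith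
    ultimately show ?thesis using le[OF v(1)] by simp
  qed
  have size: "size E \<le> n"
  proof -
    have "size (proots (char_poly (Mat n X))) \<le> degree (char_poly (Mat n X))"
      by (rule size_proots_le)
    then show ?thesis using degree_monic_char_poly[OF M] by (simp add: E_def eigs_def)
  qed
  have pos: "(\<Sum>e\<in>#filter_mset (\<lambda>e. e > 0) E. e) \<le> real n * \<kappa>"
  proof -
    have "(\<Sum>e\<in>#filter_mset (\<lambda>e. e > 0) E. e) \<le> (\<Sum>e\<in>#filter_mset (\<lambda>e. e > 0) E. \<kappa>)"
      by (rule sum_mset_mono) (use upper in auto)
    also have "\<dots> = real (size (filter_mset (\<lambda>e. e > 0) E)) * \<kappa>" by simp
    also have "\<dots> \<le> real n * \<kappa>"
    proof (rule mult_right_mono[OF _ \<kappa>])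
      show "real (size (filter_mset (\<lambda>e. e > 0) E)) \<le> real n"
        using order_trans[OF size_filter_mset_lesseq size] by simp
    qed
    finally show ?thesis .
  qed
  have neg: "(\<Sum>e\<in>#filter_mset (\<lambda>e. e < 0) E. e) \<le> min 0 (qf n X v0)"
  proof -
    have nonpos: "(\<Sum>e\<in>#A. e) \<le> 0" if "\<And>e. e \<in># A \<Longrightarrow> e < 0" for A :: "real multiset"
      using sum_mset_mono[of A "\<lambda>e. e" "\<lambda>_. 0"] that by (auto intro: less_imp_le)
    have 0: "(\<Sum>e\<in>#filter_mset (\<lambda>e. e < 0) E. e) \<le> 0" by (rule nonpos) auto
    moreover have "(\<Sum>e\<in>#filter_mset (\<lambda>e. e < 0) E. e) \<le> qf n X v0" if neg: "qf n X v0 < 0"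
    proof -
      obtain e where e: "e \<in># E" "e \<le> qf n X v0"
        using minimal_eigenvalue[where X = X, OF X v0] unfolding E_def by blast
      then have "e \<in># filter_mset (\<lambda>e. e < 0) E" using neg by simp
      then obtain A where A: "filter_mset (\<lambda>e. e < 0) E = add_mset e A" by (metis multi_member_split)
      have "(\<Sum>e\<in>#A. e) \<le> 0"
      proof (rule nonpos)
        fix e' assume "e' \<in># A"
        then have "e' \<in># filter_mset (\<lambda>e. e < 0) E" unfolding A by simp
        then show "e' < 0" by simp
      qed
      then show ?thesis using e unfolding A by simp
    qed
    ultimately show ?thesis by (cases "qf n X v0 < 0") auto
  qed
  show ?thesis
    unfolding pucci_max_def E_def[symmetric]
    using mult_left_mono[OF pos l(2)] mult_left_mono[OF neg l(1)] by linarith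
qed

section \<open>The differential inequality at a maximum of the doubled function\<close>

text \<open>The quadratic form of \<open>h - k\<close> as a form of the pair of \<open>h\<close> and \<open>k\<close>.\<close>

definition dbl :: "nat \<Rightarrow> (nat \<Rightarrow> nat \<Rightarrow> real) \<Rightarrow> nat \<Rightarrow> nat \<Rightarrow> real" where
  "dbl n Z A C = (if A < n then 1 else - 1) * (if C < n then 1 else - 1)
     * Z (if A < n then A else A - n) (if C < n then C else C - n)"

lemma qf_dbl: "qf (2 * n) (dbl n Z) (pair n h k) = qf n Z (h - k)"
  unfolding qf_bf bf_simps by (simp add: bf_def sum_pair dbl_def pair_def sum.distrib sum_subtractf sum_negf)

lemma dbl_sym: "(\<And>i j. Z i j = Z j i) \<Longrightarrow> dbl n Z A C = dbl n Z C A"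
  by (simp add: dbl_def)

lemma qf_first: "qf (2 * n) (\<lambda>A C. if A = C \<and> A < n then \<kappa> else 0) (pair n h k) = \<kappa> * (vnorm n h)\<^sup>2"
proof -
  have "(\<Sum>c<n. (if a = c then \<kappa> else 0) * h a * h c) = \<kappa> * (h a * h a)" if "a < n" for a
  proof -
    have "(\<Sum>c<n. (if a = c then \<kappa> else 0) * h a * h c) = (\<Sum>c<n. if c = a then \<kappa> * (h a * h a) else 0)"
      by (rule sum.cong) auto
    then show ?thesis using that by simp
  qed
  then show ?thesis
    by (simp add: qf_def sum_pair pair_def vnorm_sq vdot_def sum_distrib_left)
qed

lemma qf_plus: "qf n (\<lambda>a c. P a c + Q a c) z = qf n P z + qf n Q z"
  by (simp add: qf_def distrib_right sum.distrib)

lemma qf_rank_one: "qf n (\<lambda>i j. s * e i * e j) v = s * (vdot n e v)\<^sup>2"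
  by (simp add: qf_def vdot_def power2_eq_square sum_distrib_left sum_distrib_right mult_ac)

lemma qf_uminus_coeff: "qf n (\<lambda>i j. - X i j) v = - qf n X v"
  by (simp add: qf_def sum_negf)

text \<open>Second-order contact from above at a maximum of the doubled function.  The touching function has
  slope \<open>a\<close> in the direction \<open>e\<close> of \<open>x0 - y0\<close>; as a function of the difference its Hessian is \<open>b\<close> across
  \<open>e\<close> and \<open>- c\<close> along \<open>e\<close>.  The vector \<open>kv\<close> and the number \<open>K\<close> come from a penalisation of the first
  variable alone, and \<open>\<iota>\<close> is the remainder of the Taylor expansion.\<close>

definition touched ::
  "nat \<Rightarrow> (point \<Rightarrow> real) \<Rightarrow> point \<Rightarrow> point \<Rightarrow> point \<Rightarrow> point \<Rightarrow> real \<Rightarrow> real \<Rightarrow> real \<Rightarrow> real \<Rightarrow> bool" where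
  "touched n u x0 y0 kv e a b c K \<longleftrightarrow> (\<forall>\<iota>>0. \<exists>\<rho>>0. \<forall>h\<in>Rn n. \<forall>k\<in>Rn n. vnorm n h \<le> \<rho> \<longrightarrow> vnorm n k \<le> \<rho> \<longrightarrow>
     u (x0 + h) - u (y0 + k) \<le> u x0 - u y0 + vdot n kv h + a * vdot n e (h - k)
       + (b * (vnorm n (h - k))\<^sup>2 - (b + c) * (vdot n e (h - k))\<^sup>2) / 2
       + K * (vnorm n h)\<^sup>2 + \<iota> * ((vnorm n h)\<^sup>2 + (vnorm n k)\<^sup>2))"

lemma cB_subset_B:
  assumes "vnorm n x + r < 1"
  shows "cB n x r \<subseteq> B n 1"
proof
  fix y assume y: "y \<in> cB n x r"
  have "vnorm n y \<le> vnorm n (y - x) + vnorm n x" by (rule vnorm_triangle_diff)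
  then show "y \<in> B n 1" using y assms by (simp add: cB_def B_def)
qed

text \<open>Apply \<open>approximate_jets\<close> to \<open>u\<close> and \<open>- u\<close>, and use the equation as a subsolution at the first point
  and as a supersolution at the second.\<close>

lemma doubling_jets:
  assumes n: "n \<ge> 1" and sol: "visc_solution n (B n 1) F f u" and xy: "x0 \<in> B n 1" "y0 \<in> B n 1"
    and vec: "kv \<in> Rn n" "e \<in> Rn n" and touch: "touched n u x0 y0 kv e a b c K" and \<epsilon>: "\<epsilon> > 0"
  shows "\<exists>x1 y1 z w X Y. x1 \<in> B n 1 \<and> y1 \<in> B n 1 \<and> z \<in> Rn n \<and> w \<in> Rn n
    \<and> vnorm n (x1 - x0) \<le> \<epsilon> \<and> vnorm n (y1 - y0) \<le> \<epsilon>
    \<and> vnorm n (z - (kv + vscale a e)) \<le> \<epsilon> \<and> vnorm n (w - vscale a e) \<le> \<epsilon>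
    \<and> (\<forall>i j. X i j = X j i) \<and> (\<forall>i j. Y i j = Y j i)
    \<and> f x1 z \<le> F (Mat n X) z x1 \<and> F (Mat n Y) w y1 \<le> f y1 w
    \<and> (\<forall>h\<in>Rn n. \<forall>k\<in>Rn n. qf n X h - qf n Y k \<le> b * (vnorm n (h - k))\<^sup>2 - (b + c) * (vdot n e (h - k))\<^sup>2
         + 2 * K * (vnorm n h)\<^sup>2 + \<epsilon> * ((vnorm n h)\<^sup>2 + (vnorm n k)\<^sup>2))"
proof -
  define \<iota> where "\<iota> = \<epsilon> / 4"
  have \<iota>: "\<iota> > 0" using \<epsilon> by (simp add: \<iota>_def)
  obtain \<rho>0 where \<rho>0: "\<rho>0 > 0" and t: "\<And>h k. h \<in> Rn n \<Longrightarrow> k \<in> Rn n \<Longrightarrow> vnorm n h \<le> \<rho>0 \<Longrightarrow> vnorm n k \<le> \<rho>0 \<Longrightarrow>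
     u (x0 + h) - u (y0 + k) \<le> u x0 - u y0 + vdot n kv h + a * vdot n e (h - k)
       + (b * (vnorm n (h - k))\<^sup>2 - (b + c) * (vdot n e (h - k))\<^sup>2) / 2
       + K * (vnorm n h)\<^sup>2 + \<iota> * ((vnorm n h)\<^sup>2 + (vnorm n k)\<^sup>2)"
    using touch \<iota> unfolding touched_def by blast
  define m where "m = min (1 - vnorm n x0) (1 - vnorm n y0) / 2"
  have xyR: "x0 \<in> Rn n" "y0 \<in> Rn n" using xy by (auto simp: B_def)
  have m: "m > 0" "vnorm n x0 + m < 1" "vnorm n y0 + m < 1"
  proof -
    have "vnorm n x0 < 1" "vnorm n y0 < 1" using xy by (auto simp: B_def)
    moreover have "m \<le> (1 - vnorm n x0) / 2" "m \<le> (1 - vnorm n y0) / 2" by (auto simp: m_def)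
    ultimately show "vnorm n x0 + m < 1" "vnorm n y0 + m < 1" by argo+
    show "m > 0" using \<open>vnorm n x0 < 1\<close> \<open>vnorm n y0 < 1\<close> by (simp add: m_def)
  qed
  define \<rho> where "\<rho> = min \<rho>0 m"
  have \<rho>: "\<rho> > 0" "\<rho> \<le> \<rho>0" "vnorm n x0 + \<rho> < 1" "vnorm n y0 + \<rho> < 1" using \<rho>0 m by (auto simp: \<rho>_def)
  define \<epsilon>1 where "\<epsilon>1 = min (\<epsilon> / 2) m"
  have \<epsilon>1: "\<epsilon>1 > 0" "\<epsilon>1 \<le> \<epsilon> / 2" "\<epsilon>1 \<le> m" using \<epsilon> m by (auto simp: \<epsilon>1_def)
  have uc: "continuous_on (B n 1) u" and ge: "visc_ge n (B n 1) F f u" and le: "visc_le n (B n 1) F f u"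
    using sol by (auto simp: visc_solution_def visc_le_def)
  have cu: "continuous_on (cB n x0 \<rho>) u" "continuous_on (cB n y0 \<rho>) (\<lambda>y. - u y)"
    using \<rho> by (auto intro!: continuous_intros continuous_on_subset[OF uc cB_subset_B])
  define Z where "Z = plus_id (\<lambda>i j. - (b + c) * e i * e j) b"
  define Q where "Q = plus_id (\<lambda>A C. dbl n Z A C + (if A = C \<and> A < n then 2 * K else 0)) (2 * \<iota>)"
  have Zs: "Z i j = Z j i" for i j unfolding Z_def by (rule plus_id_sym) simp
  have Qs: "Q i j = Q j i" for i j unfolding Q_def by (rule plus_id_sym) (use dbl_sym[of Z, OF Zs] in auto)
  have Qf: "qf (2 * n) Q (pair n h k) = b * (vnorm n (h - k))\<^sup>2 - (b + c) * (vdot n e (h - k))\<^sup>2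
       + 2 * K * (vnorm n h)\<^sup>2 + 2 * \<iota> * ((vnorm n h)\<^sup>2 + (vnorm n k)\<^sup>2)" if "h \<in> Rn n" "k \<in> Rn n" for h k
    using that unfolding Q_def qf_plus_id qf_plus qf_dbl qf_first Z_def qf_rank_one vnorm_pair
    by (simp add: fs_sn_pair left_diff_distrib distrib_right)
  have ae: "vscale a e \<in> Rn n" "kv + vscale a e \<in> Rn n" "- vscale a e \<in> Rn n" using vec by auto
  have max: "u (x0 + h) + - u (y0 + k) \<le> u x0 + - u y0 + vdot n (kv + vscale a e) h + vdot n (- vscale a e) k
      + qf (2 * n) Q (pair n h k) / 2"
    if hk: "h \<in> Rn n" "k \<in> Rn n" "vnorm n h \<le> \<rho>" "vnorm n k \<le> \<rho>" for h k
    using t[OF hk(1,2)] hk \<rho> unfolding Qf[OF hk(1,2)]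
    by (simp add: vdot_simps add_divide_distrib right_diff_distrib)
  have "\<forall>i j. Q i j = Q j i" using Qs by blast
  moreover have "\<forall>h\<in>Rn n. \<forall>k\<in>Rn n. vnorm n h \<le> \<rho> \<longrightarrow> vnorm n k \<le> \<rho> \<longrightarrow>
      u (x0 + h) + - u (y0 + k) \<le> u x0 + - u y0 + vdot n (kv + vscale a e) h + vdot n (- vscale a e) k
      + qf (2 * n) Q (pair n h k) / 2" using max by blast
  ultimately have "\<exists>x1 y1 z1 w1 X Y. x1 \<in> Rn n \<and> y1 \<in> Rn n \<and> z1 \<in> Rn n \<and> w1 \<in> Rn n
    \<and> vnorm n (x1 - x0) \<le> \<epsilon>1 \<and> vnorm n (y1 - y0) \<le> \<epsilon>1
    \<and> vnorm n (z1 - (kv + vscale a e)) \<le> \<epsilon>1 \<and> vnorm n (w1 - - vscale a e) \<le> \<epsilon>1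
    \<and> (\<forall>a c. X a c = X c a) \<and> (\<forall>a c. Y a c = Y c a)
    \<and> jet_above n u x1 z1 X \<and> jet_above n (\<lambda>y. - u y) y1 w1 Y
    \<and> (\<forall>h\<in>Rn n. \<forall>k\<in>Rn n. qf n X h + qf n Y k
        \<le> qf (2 * n) Q (pair n h k) + \<epsilon>1 * ((vnorm n h)\<^sup>2 + (vnorm n k)\<^sup>2))"
    by (rule approximate_jets[OF n xyR \<rho>(1) \<epsilon>1(1) cu ae(2,3)])
  then obtain x1 y1 z w X Y where j: "x1 \<in> Rn n" "y1 \<in> Rn n" "z \<in> Rn n" "w \<in> Rn n"
      "vnorm n (x1 - x0) \<le> \<epsilon>1" "vnorm n (y1 - y0) \<le> \<epsilon>1" "vnorm n (z - (kv + vscale a e)) \<le> \<epsilon>1"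
      "vnorm n (w - - vscale a e) \<le> \<epsilon>1" "\<forall>i j. X i j = X j i" "\<forall>i j. Y i j = Y j i"
      "jet_above n u x1 z X" "jet_above n (\<lambda>y. - u y) y1 w Y"
      "\<forall>h\<in>Rn n. \<forall>k\<in>Rn n. qf n X h + qf n Y k \<le> qf (2 * n) Q (pair n h k) + \<epsilon>1 * ((vnorm n h)\<^sup>2 + (vnorm n k)\<^sup>2)"
    by (elim exE conjE)
  have "x1 \<in> cB n x0 m" "y1 \<in> cB n y0 m"
    using j(1,2,5,6) \<epsilon>1 by (simp_all add: cB_def)
  then have inB: "x1 \<in> B n 1" "y1 \<in> B n 1"
    using cB_subset_B[OF m(2)] cB_subset_B[OF m(3)] by blast+
  have BR: "B n 1 \<subseteq> Rn n" by (auto simp: B_def)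
  have 1: "f x1 z \<le> F (Mat n X) z x1"
    by (rule visc_ge_jet[OF ge inB(1) BR j(3)]) (use j in auto)
  have wR: "- w \<in> Rn n" using j by auto
  have "\<exists>s>0. \<forall>h\<in>Rn n. vnorm n h < s \<longrightarrow> u y1 + vdot n (- w) h + qf n (\<lambda>i j. - Y i j) h / 2 \<le> u (y1 + h)"
  proof -
    obtain s where s: "s > 0" "\<forall>h\<in>Rn n. vnorm n h < s \<longrightarrow> - u (y1 + h) \<le> - u y1 + vdot n w h + qf n Y h / 2"
      using j(12) unfolding jet_above_def by blast
    have "u y1 + vdot n (- w) h + qf n (\<lambda>i j. - Y i j) h / 2 \<le> u (y1 + h)" if "h \<in> Rn n" "vnorm n h < s" for h
      using bspec[OF s(2) that(1)] that(2) by (simp add: vdot_simps qf_uminus_coeff)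
    with s(1) show ?thesis by blast
  qed
  then have 2: "F (Mat n (\<lambda>i j. - Y i j)) (- w) y1 \<le> f y1 (- w)"
    by (intro visc_le_jet[OF le inB(2) BR wR]) (use j(10) in auto)
  have 3: "vnorm n (- w - vscale a e) \<le> \<epsilon>"
  proof -
    have "- w - vscale a e = - (w - - vscale a e)" by simp
    then have "vnorm n (- w - vscale a e) = vnorm n (w - - vscale a e)" by (simp only: vnorm_minus)
    then show ?thesis using j(8) \<epsilon>1 \<epsilon> by linarith
  qed
  have 4: "qf n X h - qf n (\<lambda>i j. - Y i j) k \<le> b * (vnorm n (h - k))\<^sup>2 - (b + c) * (vdot n e (h - k))\<^sup>2
         + 2 * K * (vnorm n h)\<^sup>2 + \<epsilon> * ((vnorm n h)\<^sup>2 + (vnorm n k)\<^sup>2)" if hk: "h \<in> Rn n" "k \<in> Rn n" for h k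
  proof -
    have "(2 * \<iota> + \<epsilon>1) * ((vnorm n h)\<^sup>2 + (vnorm n k)\<^sup>2) \<le> \<epsilon> * ((vnorm n h)\<^sup>2 + (vnorm n k)\<^sup>2)"
      using \<epsilon>1 by (intro mult_right_mono) (auto simp: \<iota>_def)
    moreover have "(2 * \<iota> + \<epsilon>1) * ((vnorm n h)\<^sup>2 + (vnorm n k)\<^sup>2)
        = 2 * \<iota> * ((vnorm n h)\<^sup>2 + (vnorm n k)\<^sup>2) + \<epsilon>1 * ((vnorm n h)\<^sup>2 + (vnorm n k)\<^sup>2)"
      by (rule distrib_right)
    moreover have "qf n X h + qf n Y k \<le> qf (2 * n) Q (pair n h k) + \<epsilon>1 * ((vnorm n h)\<^sup>2 + (vnorm n k)\<^sup>2)"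
      using j(13) hk by blast
    ultimately show ?thesis unfolding Qf[OF hk] qf_uminus_coeff by linarith
  qed
  show ?thesis
    by (rule exI[of _ x1], rule exI[of _ y1], rule exI[of _ z], rule exI[of _ "- w"], rule exI[of _ X],
        rule exI[of _ "\<lambda>i j. - Y i j"])
       (use inB j wR \<epsilon>1 1 2 3 4 \<epsilon> in auto)
qed

lemma powr_comparable:
  fixes a r s S :: real
  assumes a: "a > 0" and r: "a / 2 \<le> r" "r \<le> 2 * a" and s: "\<bar>s\<bar> \<le> S"
  shows "r powr s \<le> 2 powr S * a powr s" and "a powr s \<le> 2 powr S * r powr s"
proof -
  have *: "\<theta> powr s \<le> 2 powr S" if \<theta>: "1 / 2 \<le> \<theta>" "\<theta> \<le> 2" for \<theta> :: real
  proof (cases "s \<ge> 0")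
    case True
    then have "\<theta> powr s \<le> 2 powr s" using \<theta> by (intro powr_mono2) auto
    also have "\<dots> \<le> 2 powr S" using s by (intro powr_mono) auto
    finally show ?thesis .
  next
    case False
    have "\<theta> powr s = (1 / \<theta>) powr (- s)" using \<theta> by (simp add: powr_minus powr_divide)
    also have "\<dots> \<le> 2 powr (- s)" using False \<theta> by (intro powr_mono2) (auto simp: field_simps)
    also have "\<dots> \<le> 2 powr S" using s by (intro powr_mono) auto
    finally show ?thesis .
  qed
  have r0: "r > 0" using a r by simp
  have "r powr s = (r / a) powr s * a powr s" using a r0 by (simp add: powr_mult[symmetric])
  also have "\<dots> \<le> 2 powr S * a powr s"
    using a r by (intro mult_right_mono *) (auto simp: field_simps)
  finally show "r powr s \<le> 2 powr S * a powr s" .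
  have "a powr s = (a / r) powr s * r powr s" using a r0 by (simp add: powr_mult[symmetric])
  also have "\<dots> \<le> 2 powr S * r powr s"
    using a r r0 by (intro mult_right_mono *) (auto simp: field_simps)
  finally show "a powr s \<le> 2 powr S * r powr s" .
qed

text \<open>Subtract the two inequalities of the equation.  Passing from \<open>Y\<close>, \<open>w\<close>, \<open>y1\<close> to \<open>Y\<close>, \<open>z\<close>, \<open>x1\<close> costs
  the moduli of continuity of \<open>F\<close>, of order \<open>a powr q\<close> and proportional to the size of \<open>Y\<close>; passing
  from \<open>Y\<close> to \<open>X\<close> is controlled by ellipticity, whose lower constant has order \<open>a powr p\<close>.  The terms
  with \<open>f\<close> have order \<open>a powr (q + 1)\<close>.  Division by \<open>a powr p\<close> bounds how negative the form \<open>X - Y\<close> can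
  be in the direction \<open>v\<close>.\<close>

lemma ellipticity_bound:
  fixes lam Lam p q \<alpha> C0 Cf :: real
  assumes par: "p \<le> q" "-1 < p" "0 < lam" "lam < Lam" "0 < \<alpha>" "\<alpha> \<le> 1" "Cf > 0"
    and st: "structural n (B n 1) lam Lam p q \<alpha> C0 Cf F f"
    and xy: "x1 \<in> B n 1" "y1 \<in> B n 1" and zw: "z \<in> Rn n" "w \<in> Rn n"
    and a: "a \<ge> 1" "a \<ge> 2 * C0"
    and z: "3 / 5 * a \<le> vnorm n z" "vnorm n z \<le> 3 / 2 * a" and w: "7 / 8 * a \<le> vnorm n w" "vnorm n w \<le> 9 / 8 * a"
    and X: "\<And>i j. X i j = X j i" and Y: "\<And>i j. Y i j = Y j i"
    and jets: "f x1 z \<le> F (Mat n X) z x1" "F (Mat n Y) w y1 \<le> f y1 w"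
    and \<kappa>: "\<kappa> \<ge> 0" "\<And>v. v \<in> Rn n \<Longrightarrow> qf n X v - qf n Y v \<le> \<kappa> * (vnorm n v)\<^sup>2"
    and \<nu>: "\<nu> \<ge> 0" "\<And>v. v \<in> Rn n \<Longrightarrow> \<bar>qf n Y v\<bar> \<le> \<nu> * (vnorm n v)\<^sup>2"
    and k: "vnorm n (z - w) \<le> k'" and d: "vnorm n (x1 - y1) powr \<alpha> \<le> 2 * D"
    and v: "v \<in> Rn n" "vnorm n v = 1"
  defines "B0 \<equiv> 2 powr (\<bar>p\<bar> + \<bar>q\<bar> + 1)"
  shows "qf n Y v - qf n X v \<le> B0\<^sup>2 / lam * (2 * Lam * real n + 2 * Lam + 4 * Cf) * a powr (q - p) * (\<kappa> + (k' / a + D) * (\<nu> + 1) + a)"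
proof -
  define P1 where "P1 = vnorm n z"
  define P2 where "P2 = vnorm n w"
  have a0: "a > 0" using a by simp
  have P1: "a / 2 \<le> P1" "P1 \<le> 2 * a" "C0 \<le> P1" and P2: "a / 2 \<le> P2" "P2 \<le> 2 * a" "C0 \<le> P2"
    using z w a by (auto simp: P1_def P2_def)
  have P12: "1 / 2 * P2 \<le> P1" "P1 \<le> 2 * P2" using z w by (auto simp: P1_def P2_def)
  have B1: "B0 \<ge> 1" unfolding B0_def by (rule ge_one_powr_ge_zero) auto
  have comp: "r powr s \<le> B0 * a powr s" "a powr s \<le> B0 * r powr s"
    if "a / 2 \<le> r" "r \<le> 2 * a" "\<bar>s\<bar> \<le> \<bar>p\<bar> + \<bar>q\<bar> + 1" for r s
    unfolding B0_def using powr_comparable[OF a0 that] by auto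
  have ex: "\<bar>q - 1\<bar> \<le> \<bar>p\<bar> + \<bar>q\<bar> + 1" "\<bar>q + 1\<bar> \<le> \<bar>p\<bar> + \<bar>q\<bar> + 1" by linarith+
  define T where "T = a powr q"
  have T: "T > 0" using a0 by (simp add: T_def)
  have Tm: "a powr (q - 1) = T / a" "a powr (q + 1) = T * a" "a powr p = T / a powr (q - p)"
    using a0 by (simp_all add: T_def powr_diff powr_add)
  have ap: "a powr p \<le> T" unfolding T_def using par a by (intro powr_mono) auto
  have aq1: "1 \<le> T * a"
  proof -
    have "1 \<le> a powr (q + 1)" using a par by (intro ge_one_powr_ge_zero) auto
    then show ?thesis by (simp add: Tm)
  qed
  define N where "N = (\<lambda>i j. X i j - Y i j)"
  have N: "N i j = N j i" for i j using X Y by (simp add: N_def)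
  have qN: "qf n N v = qf n X v - qf n Y v" for v
    by (simp add: N_def qf_def left_diff_distrib sum_subtractf)
  have sum: "Mat n Y + Mat n N = Mat n X" by (auto simp: Mat_def N_def)
  define l where "l = lam * P1 powr p"
  define L where "L = Lam * (P1 powr p + P1 powr q)"
  have l0: "0 \<le> l" "0 \<le> L" using par by (auto simp: l_def L_def)
  have A1: "F (Mat n X) z x1 - F (Mat n Y) z x1 \<le> pucci_max l L (Mat n N)"
  proof -
    have "Mat n Y \<in> Sym n" "Mat n N \<in> Sym n" using Mat_Sym[of Y, OF Y] Mat_Sym[of N, OF N] by auto
    then show ?thesis
      using st xy(1) zw(1) P1(3) unfolding structural_def A1_def l_def L_def P1_def sum[symmetric] by blast
  qed
  have YS: "Mat n Y \<in> Sym n" using Mat_Sym[of Y, OF Y] .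
  define mn where "mn = mnorm n (Mat n Y)"
  have mn: "mn \<le> \<nu>" unfolding mn_def by (rule mnorm_Mat_le[of Y]) (use Y \<nu> in auto)
  have A2: "\<bar>F (Mat n Y) z x1 - F (Mat n Y) w x1\<bar> \<le> Lam * vnorm n (z - w) * (P1 powr (q - 1) + P2 powr (q - 1)) * (mn + 1)"
    using st xy(1) zw P1(3) P2(3) P12 YS unfolding structural_def A2_def P1_def P2_def mn_def by blast
  have A3: "\<bar>F (Mat n Y) w x1 - F (Mat n Y) w y1\<bar> \<le> Lam * vnorm n (x1 - y1) powr \<alpha> * P2 powr q * (mn + 1)"
    using st xy zw P2(3) YS unfolding structural_def A3_def P2_def mn_def by blast
  have A4: "\<bar>f x1 z\<bar> \<le> Cf * (1 + P1 powr (q + 1))" "\<bar>f y1 w\<bar> \<le> Cf * (1 + P2 powr (q + 1))"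
    using st xy zw P1(3) P2(3) unfolding structural_def A4_def P1_def P2_def by blast+
  have pm: "pucci_max l L (Mat n N) \<le> L * (real n * \<kappa>) + l * min 0 (qf n N v)"
    by (rule pucci_max_le[of N]) (use N \<kappa> v l0 qN in auto)
  \<comment> \<open>Each error term, compared with \<open>T = a powr q\<close>.\<close>
  have k0: "k' \<ge> 0" using k vnorm_ge_0 order_trans by blast
  have D0: "D \<ge> 0" using d powr_ge_zero[of "vnorm n (x1 - y1)" \<alpha>] by linarith
  have E1: "L * (real n * \<kappa>) \<le> T * B0 * (2 * Lam * real n) * \<kappa>"
  proof -
    have "P1 powr p \<le> B0 * T"
      using comp(1)[OF P1(1,2), of p] ap B1 mult_left_mono[OF ap, of B0] by linarith
    moreover have "P1 powr q \<le> B0 * T" using comp(1)[OF P1(1,2), of q] by (simp add: T_def)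
    ultimately have "L \<le> Lam * (2 * (B0 * T))" unfolding L_def using par by (intro mult_left_mono) auto
    then have "L * (real n * \<kappa>) \<le> Lam * (2 * (B0 * T)) * (real n * \<kappa>)" using \<kappa> by (intro mult_right_mono) auto
    then show ?thesis by (simp add: mult_ac)
  qed
  have E2: "Lam * vnorm n (z - w) * (P1 powr (q - 1) + P2 powr (q - 1)) * (mn + 1) \<le> T * B0 * (2 * Lam) * (k' / a * (\<nu> + 1))"
  proof (cases "mn + 1 \<ge> 0")
    case True
    have "P1 powr (q - 1) + P2 powr (q - 1) \<le> 2 * (B0 * (T / a))"
      using comp(1)[OF P1(1,2) ex(1)] comp(1)[OF P2(1,2) ex(1)] unfolding Tm by linarith
    then have "Lam * vnorm n (z - w) * (P1 powr (q - 1) + P2 powr (q - 1)) * (mn + 1) \<le> Lam * k' * (2 * (B0 * (T / a))) * (\<nu> + 1)"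
      using par k k0 True mn T B1 a0 by (intro mult_mono) auto
    also have "\<dots> = T * B0 * (2 * Lam) * (k' / a * (\<nu> + 1))" by simp
    finally show ?thesis .
  next
    case False
    have "Lam * vnorm n (z - w) * (P1 powr (q - 1) + P2 powr (q - 1)) * (mn + 1) \<le> 0"
      using False par by (intro mult_nonneg_nonpos) auto
    moreover have "0 \<le> T * B0 * (2 * Lam) * (k' / a * (\<nu> + 1))" using T B1 par k0 a0 \<nu> by simp
    ultimately show ?thesis by linarith
  qed
  have E3: "Lam * vnorm n (x1 - y1) powr \<alpha> * P2 powr q * (mn + 1) \<le> T * B0 * (2 * Lam) * (D * (\<nu> + 1))"
  proof (cases "mn + 1 \<ge> 0")
    case True
    have "P2 powr q \<le> B0 * T" using comp(1)[OF P2(1,2), of q] by (simp add: T_def)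
    then have "Lam * vnorm n (x1 - y1) powr \<alpha> * P2 powr q * (mn + 1) \<le> Lam * (2 * D) * (B0 * T) * (\<nu> + 1)"
      using par d D0 True mn T B1 by (intro mult_mono) auto
    then show ?thesis by (simp add: mult_ac)
  next
    case False
    have "Lam * vnorm n (x1 - y1) powr \<alpha> * P2 powr q * (mn + 1) \<le> 0"
      using False par by (intro mult_nonneg_nonpos) auto
    moreover have "0 \<le> T * B0 * (2 * Lam) * (D * (\<nu> + 1))" using T B1 par D0 \<nu> by simp
    ultimately show ?thesis by linarith
  qed
  have E4: "Cf * (1 + P1 powr (q + 1)) + Cf * (1 + P2 powr (q + 1)) \<le> T * B0 * (4 * Cf) * a"
  proof -
    have b: "1 \<le> B0 * (T * a)" using B1 aq1 mult_mono[of 1 B0 1 "T * a"] by simp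
    have "P1 powr (q + 1) \<le> B0 * (T * a)" "P2 powr (q + 1) \<le> B0 * (T * a)"
      using comp(1)[OF P1(1,2) ex(2)] comp(1)[OF P2(1,2) ex(2)] unfolding Tm by auto
    then have "Cf * (1 + P1 powr (q + 1)) + Cf * (1 + P2 powr (q + 1)) \<le> Cf * (2 * (B0 * (T * a))) + Cf * (2 * (B0 * (T * a)))"
      using b par by (intro add_mono mult_left_mono) auto
    then show ?thesis by (simp add: mult_ac)
  qed
  define R where "R = \<kappa> + (k' / a + D) * (\<nu> + 1) + a"
  have parts: "0 \<le> \<kappa>" "0 \<le> (k' / a + D) * (\<nu> + 1)" using \<kappa> k0 D0 a0 \<nu> by auto
  have R0: "R \<ge> 0" using parts a0 by (simp add: R_def)
  define S where "S = 2 * Lam * real n + 2 * Lam + 4 * Cf"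
  have S0: "S \<ge> 0" using par by (simp add: S_def)
  have TB: "T * B0 \<ge> 0" using T B1 by simp
  have split: "T * B0 * (2 * Lam) * (k' / a * (\<nu> + 1)) + T * B0 * (2 * Lam) * (D * (\<nu> + 1))
      = T * B0 * (2 * Lam) * ((k' / a + D) * (\<nu> + 1))"
    by (simp only: distrib_left distrib_right)
  have "- (l * min 0 (qf n N v)) \<le> T * B0 * (2 * Lam * real n) * \<kappa> + T * B0 * (2 * Lam) * ((k' / a + D) * (\<nu> + 1)) + T * B0 * (4 * Cf) * a"
    using A1 A2 A3 A4 pm E1 E2 E3 E4 jets unfolding split[symmetric] abs_le_iff by linarith
  also have "\<dots> \<le> T * B0 * (2 * Lam * real n) * R + T * B0 * (2 * Lam) * R + T * B0 * (4 * Cf) * R"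
    using TB par parts a0 by (intro add_mono mult_left_mono) (auto simp: R_def)
  also have "\<dots> = T * B0 * S * R" by (simp only: S_def distrib_left distrib_right)
  finally have main: "- (l * min 0 (qf n N v)) \<le> T * B0 * S * R" .
  have "T / a powr (q - p) \<le> B0 * P1 powr p" using comp(2)[OF P1(1,2), of p] by (simp add: Tm)
  then have "lam * (T / a powr (q - p)) \<le> B0 * l" using par mult_left_mono[of "T / a powr (q - p)" "B0 * P1 powr p" lam] by (simp add: l_def mult_ac)
  then have "lam * (T / a powr (q - p)) * (- min 0 (qf n N v)) \<le> B0 * l * (- min 0 (qf n N v))"
    by (intro mult_right_mono) auto
  also have "\<dots> = B0 * (- (l * min 0 (qf n N v)))" by simp
  also have "\<dots> \<le> B0 * (T * B0 * S * R)" using main B1 by (intro mult_left_mono) auto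
  finally have fin: "lam * (T / a powr (q - p)) * (- min 0 (qf n N v)) \<le> B0 * (T * B0 * S * R)" .
  have apos: "a powr (q - p) > 0" using a0 by simp
  have "T * (lam * (- min 0 (qf n N v))) \<le> T * (B0\<^sup>2 * S * R * a powr (q - p))"
    using fin apos by (simp add: field_simps power2_eq_square)
  then have "lam * (- min 0 (qf n N v)) \<le> B0\<^sup>2 * S * R * a powr (q - p)"
    using T by (simp only: mult_le_cancel_left_pos)
  then have "- min 0 (qf n N v) \<le> B0\<^sup>2 * S * R * a powr (q - p) / lam"
    using par by (simp add: field_simps)
  also have "\<dots> = B0\<^sup>2 / lam * S * a powr (q - p) * R" by simp
  finally have "- qf n N v \<le> B0\<^sup>2 / lam * S * a powr (q - p) * R" by linarith
  then show ?thesis by (simp add: qN S_def R_def)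
qed

text \<open>At a contact the concavity \<open>c\<close> in the direction of \<open>x0 - y0\<close> is limited by the equation.  The matrix
  inequality, evaluated at \<open>e\<close> and \<open>- e\<close>, makes \<open>X - Y\<close> at most \<open>- 4 * c\<close> in the direction \<open>e\<close>, up to the
  penalisation, and \<open>ellipticity_bound\<close> limits this.  The size of \<open>Y\<close>, which enters the bound, is either
  comparable with \<open>a\<close> divided by the distance, or large; then it is attained with a positive sign, because
  \<open>Y\<close> is bounded below by the matrix inequality, while \<open>X\<close> is bounded above by it, and ellipticity in
  that direction bounds it, unless the coefficient of this bound is so large that \<open>c \<le> a / \<delta>\<close> for the
  distance \<open>\<delta>\<close> suffices.\<close>

theorem concavity_bound:
  fixes n :: nat and lam Lam p q \<alpha> C0 Cf :: real
  assumes par: "n \<ge> 1" "p \<le> q" "-1 < p" "0 < lam" "lam < Lam" "0 < \<alpha>" "\<alpha> \<le> 1" "Cf > 0"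
  shows "\<exists>A\<ge>1. \<forall>F f u x0 y0 kv a c K. structural n (B n 1) lam Lam p q \<alpha> C0 Cf F f \<longrightarrow>
    visc_solution n (B n 1) F f u \<longrightarrow> x0 \<in> B n 1 \<longrightarrow> y0 \<in> B n 1 \<longrightarrow> x0 \<noteq> y0 \<longrightarrow> kv \<in> Rn n \<longrightarrow>
    1 \<le> a \<longrightarrow> 2 * C0 \<le> a \<longrightarrow> vnorm n kv \<le> a / 4 \<longrightarrow> 0 \<le> K \<longrightarrow> 0 \<le> c \<longrightarrow> c \<le> a / vnorm n (x0 - y0) \<longrightarrow>
    touched n u x0 y0 kv (vscale (1 / vnorm n (x0 - y0)) (x0 - y0)) a (a / vnorm n (x0 - y0)) c K \<longrightarrow>
    c \<le> A * a powr (q - p) * (K + a + (vnorm n kv / a + vnorm n (x0 - y0) powr \<alpha>) * (a / vnorm n (x0 - y0)))"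
proof -
  define B0 :: real where "B0 = 2 powr (\<bar>p\<bar> + \<bar>q\<bar> + 1)"
  define C5 where "C5 = B0\<^sup>2 / lam * (2 * Lam * real n + 2 * Lam + 4 * Cf)"
  have C5: "C5 \<ge> 0" using par by (simp add: C5_def)
  define C6 where "C6 = 4 * C5"
  define A where "A = 12 * (C6 + 1)"
  have A1: "A \<ge> 1" using C5 by (simp add: A_def C6_def)
  have main: "c \<le> A * a powr (q - p) * (K + a + (vnorm n kv / a + vnorm n (x0 - y0) powr \<alpha>) * (a / vnorm n (x0 - y0)))"
    if st: "structural n (B n 1) lam Lam p q \<alpha> C0 Cf F f"
      and sol: "visc_solution n (B n 1) F f u" and xy: "x0 \<in> B n 1" "y0 \<in> B n 1" "x0 \<noteq> y0"
      and kv: "kv \<in> Rn n" and a: "1 \<le> a" "2 * C0 \<le> a" and k4: "vnorm n kv \<le> a / 4" and K: "0 \<le> K"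
      and c: "0 \<le> c" "c \<le> a / vnorm n (x0 - y0)"
      and touch: "touched n u x0 y0 kv (vscale (1 / vnorm n (x0 - y0)) (x0 - y0)) a (a / vnorm n (x0 - y0)) c K"
    for F f u x0 y0 kv a c K
  proof -
    define \<delta> where "\<delta> = vnorm n (x0 - y0)"
    define e where "e = vscale (1 / \<delta>) (x0 - y0)"
    have xyR: "x0 \<in> Rn n" "y0 \<in> Rn n" "x0 - y0 \<in> Rn n" and xyn: "vnorm n x0 < 1" "vnorm n y0 < 1"
      using xy by (auto simp: B_def)
    have "\<delta> \<noteq> 0" unfolding \<delta>_def using vnorm_eq_0[OF xyR(3)] xy(3) by simp
    then have \<delta>: "\<delta> > 0" using vnorm_ge_0[of n "x0 - y0"] unfolding \<delta>_def by linarith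
    have \<delta>2: "\<delta> \<le> 2" using vnorm_triangle_minus[of n x0 y0] xyn unfolding \<delta>_def by linarith
    have e: "e \<in> Rn n" "vnorm n e = 1" using xyR \<delta> by (auto simp: e_def \<delta>_def)
    define b where "b = a / \<delta>"
    have b: "b \<ge> 1 / 2" "c \<le> b" using \<delta> \<delta>2 a c by (auto simp: b_def field_simps \<delta>_def[symmetric])
    define \<epsilon> where "\<epsilon> = min (1 / 16) (\<delta> / 4)"
    have \<epsilon>: "\<epsilon> > 0" "\<epsilon> \<le> 1 / 16" "\<epsilon> \<le> \<delta> / 4" using \<delta> by (auto simp: \<epsilon>_def)
    have tch: "touched n u x0 y0 kv e a b c K" using touch by (simp add: e_def \<delta>_def b_def)
    obtain x1 y1 z w X Y where j: "x1 \<in> B n 1" "y1 \<in> B n 1" "z \<in> Rn n" "w \<in> Rn n"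
        "vnorm n (x1 - x0) \<le> \<epsilon>" "vnorm n (y1 - y0) \<le> \<epsilon>"
        "vnorm n (z - (kv + vscale a e)) \<le> \<epsilon>" "vnorm n (w - vscale a e) \<le> \<epsilon>"
      and X: "\<forall>i j. X i j = X j i" and Y: "\<forall>i j. Y i j = Y j i"
      and jets: "f x1 z \<le> F (Mat n X) z x1" "F (Mat n Y) w y1 \<le> f y1 w"
      and block': "\<forall>h\<in>Rn n. \<forall>k\<in>Rn n. qf n X h - qf n Y k \<le> b * (vnorm n (h - k))\<^sup>2 - (b + c) * (vdot n e (h - k))\<^sup>2
         + 2 * K * (vnorm n h)\<^sup>2 + \<epsilon> * ((vnorm n h)\<^sup>2 + (vnorm n k)\<^sup>2)"
      using doubling_jets[OF par(1) sol xy(1,2) kv e(1) tch \<epsilon>(1)] by (elim exE conjE)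
    note block = block'[rule_format]
    define \<kappa> where "\<kappa> = 2 * K + 2 * \<epsilon>"
    have \<kappa>: "\<kappa> \<ge> 0" "\<kappa> \<le> 2 * K + a" using K \<epsilon> a by (auto simp: \<kappa>_def)
    have N\<kappa>: "qf n X v - qf n Y v \<le> \<kappa> * (vnorm n v)\<^sup>2" if "v \<in> Rn n" for v
      using block[OF that that] by (simp add: \<kappa>_def vdot_simps algebra_simps)
    \<comment> \<open>The unit vector at which the form \<open>Y\<close> is largest in absolute value.\<close>
    let ?S = "{v \<in> Rn n. vnorm n v = 1}"
    have "continuous_on ?S (\<lambda>v. \<bar>qf n Y (v - 0)\<bar>)" by (intro continuous_intros continuous_on_qf)
    then obtain v0 where v0: "v0 \<in> ?S" and max: "\<And>v. v \<in> ?S \<Longrightarrow> \<bar>qf n Y v\<bar> \<le> \<bar>qf n Y v0\<bar>"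
      using continuous_attains_sup[OF compact_sphere, of n "\<lambda>v. \<bar>qf n Y v\<bar>"] unit_vector[OF par(1)] by auto
    have v0R: "v0 \<in> Rn n" "vnorm n v0 = 1" using v0 by auto
    define \<nu> where "\<nu> = \<bar>qf n Y v0\<bar>"
    have \<nu>0: "\<nu> \<ge> 0" by (simp add: \<nu>_def)
    have \<nu>: "\<bar>qf n Y v\<bar> \<le> \<nu> * (vnorm n v)\<^sup>2" if v: "v \<in> Rn n" for v
    proof (cases "vnorm n v = 0")
      case True
      then show ?thesis using vnorm_eq_0[OF v] by simp
    next
      case False
      then have w0: "vnorm n v > 0" using vnorm_ge_0[of n v] by linarith
      have "vscale (1 / vnorm n v) v \<in> ?S" using v w0 by auto
      from max[OF this] have "(1 / vnorm n v)\<^sup>2 * \<bar>qf n Y v\<bar> \<le> \<nu>" by (simp add: qf_scale \<nu>_def abs_mult)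
      then show ?thesis using w0 by (simp add: power_divide pos_divide_le_eq)
    qed
    have na: "vnorm n (vscale a e) = a" using e a by simp
    have zn: "3 / 5 * a \<le> vnorm n z" "vnorm n z \<le> 3 / 2 * a"
    proof -
      have "vnorm n z \<le> vnorm n (z - (kv + vscale a e)) + vnorm n (kv + vscale a e)" by (rule vnorm_triangle_diff)
      moreover have "vnorm n (kv + vscale a e) \<le> vnorm n kv + a" using vnorm_triangle[of n kv "vscale a e"] na by simp
      ultimately show "vnorm n z \<le> 3 / 2 * a" using j(7) \<epsilon> k4 a by linarith
      have "vscale a e = z - (z - (kv + vscale a e)) - kv" by simp
      then have "a = vnorm n (z - (z - (kv + vscale a e)) - kv)" using na by metis
      also have "\<dots> \<le> vnorm n (z - (z - (kv + vscale a e))) + vnorm n kv" by (rule vnorm_triangle_minus)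
      also have "vnorm n (z - (z - (kv + vscale a e))) \<le> vnorm n z + vnorm n (z - (kv + vscale a e))"
        by (rule vnorm_triangle_minus)
      finally show "3 / 5 * a \<le> vnorm n z" using j(7) \<epsilon> k4 a by linarith
    qed
    have wn: "7 / 8 * a \<le> vnorm n w" "vnorm n w \<le> 9 / 8 * a"
      using vnorm_triangle_diff[of n w "vscale a e"] vnorm_triangle_diff[of n "vscale a e" w] j(8) na \<epsilon> a
      by (auto simp: vnorm_commute)
    have zw: "vnorm n (z - w) \<le> vnorm n kv + 2 * \<epsilon>"
    proof -
      have "z - w = (z - (kv + vscale a e)) + kv - (w - vscale a e)" by simp
      then have "vnorm n (z - w) \<le> vnorm n ((z - (kv + vscale a e)) + kv) + vnorm n (w - vscale a e)"
        by (metis vnorm_triangle_minus)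
      also have "vnorm n ((z - (kv + vscale a e)) + kv) \<le> vnorm n (z - (kv + vscale a e)) + vnorm n kv"
        by (rule vnorm_triangle)
      finally show ?thesis using j(7,8) by linarith
    qed
    have dist: "vnorm n (x1 - y1) powr \<alpha> \<le> 2 * \<delta> powr \<alpha>"
    proof -
      have "x1 - y1 = (x1 - x0) + (x0 - y0) - (y1 - y0)" by simp
      then have "vnorm n (x1 - y1) \<le> vnorm n ((x1 - x0) + (x0 - y0)) + vnorm n (y1 - y0)"
        by (metis vnorm_triangle_minus)
      also have "vnorm n ((x1 - x0) + (x0 - y0)) \<le> vnorm n (x1 - x0) + \<delta>"
        unfolding \<delta>_def by (rule vnorm_triangle)
      finally have "vnorm n (x1 - y1) \<le> 2 * \<delta>" using j(5,6) \<epsilon> \<delta> by linarith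
      then have "vnorm n (x1 - y1) powr \<alpha> \<le> (2 * \<delta>) powr \<alpha>" using par by (intro powr_mono2) auto
      also have "\<dots> = 2 powr \<alpha> * \<delta> powr \<alpha>" using \<delta> by (simp add: powr_mult)
      also have "\<dots> \<le> 2 powr 1 * \<delta> powr \<alpha>" using par by (intro mult_right_mono powr_mono) auto
      finally show ?thesis by simp
    qed
    define T where "T = a powr (q - p)"
    have T: "T \<ge> 1" unfolding T_def using a par by (intro ge_one_powr_ge_zero) auto
    define D where "D = (vnorm n kv + 2 * \<epsilon>) / a + \<delta> powr \<alpha>"
    have D0: "D \<ge> 0" using a \<epsilon> by (simp add: D_def)
    have D3: "D \<le> 3 * a"
    proof -
      have "(vnorm n kv + 2 * \<epsilon>) / a \<le> 1" using k4 \<epsilon> a by (simp add: field_simps)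
      moreover have "\<delta> powr \<alpha> \<le> 2"
      proof -
        have "\<delta> powr \<alpha> \<le> 2 powr \<alpha>" using \<delta> \<delta>2 par by (intro powr_mono2) auto
        also have "\<dots> \<le> 2 powr 1" using par by (intro powr_mono) auto
        finally show ?thesis by simp
      qed
      ultimately show ?thesis using a unfolding D_def by linarith
    qed
    have ell: "qf n Y v - qf n X v \<le> C6 * T * (\<kappa> + a + D * \<nu>)" if v: "v \<in> Rn n" "vnorm n v = 1" for v
    proof -
      have "qf n Y v - qf n X v \<le> C5 * T * (\<kappa> + D * (\<nu> + 1) + a)"
        unfolding C5_def B0_def T_def D_def
        by (rule ellipticity_bound[OF par(2-8) st j(1-4) a zn wn _ _ jets \<kappa>(1) N\<kappa> \<nu>0 \<nu> zw dist v])
           (use X Y in blast)+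
      also have "\<dots> \<le> C5 * T * (4 * (\<kappa> + a + D * \<nu>))"
      proof (rule mult_left_mono)
        have "0 \<le> D * \<nu>" using D0 \<nu>0 by simp
        then show "\<kappa> + D * (\<nu> + 1) + a \<le> 4 * (\<kappa> + a + D * \<nu>)" using D3 \<kappa> by (simp add: algebra_simps)
      qed (use C5 T in simp)
      finally show ?thesis by (simp add: C6_def mult_ac)
    qed
    have C60: "C6 \<ge> 0" using C5 by (simp add: C6_def)
    have T\<kappa>: "\<kappa> + a \<le> T * (\<kappa> + a)" using T \<kappa> a mult_right_mono[of 1 T "\<kappa> + a"] by simp
    have b0: "b \<ge> 0" using b by simp
    \<comment> \<open>The number \<open>\<nu>\<close> measures the size of \<open>Y\<close>.\<close>
    have key: "c \<le> 4 * (C6 + 1) * T * (\<kappa> + a + D * b)"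
    proof (cases "\<nu> \<le> 4 * b")
      case True
      \<comment> \<open>The vectors \<open>e\<close> and \<open>- e\<close> have the difference \<open>2 * e\<close>, which produces the factor \<open>4\<close>.\<close>
      have "qf n X e - qf n Y (- e) \<le> - 4 * c + \<kappa>"
      proof -
        have "e - - e = vscale 2 e" by (auto simp: fun_eq_iff)
        then have "vnorm n (e - - e) = 2" "vdot n e (e - - e) = 2"
          using e by (simp_all add: vdot_simps vnorm_sq[symmetric])
        moreover have "- e \<in> Rn n" using e by blast
        ultimately show ?thesis using block[OF e(1), of "- e"] e by (simp add: \<kappa>_def algebra_simps)
      qed
      then have "4 * c \<le> \<kappa> + C6 * T * (\<kappa> + a + D * \<nu>)" using ell[OF e] by simp
      also have "\<dots> \<le> T * (\<kappa> + a) + C6 * T * (\<kappa> + a + D * (4 * b))"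
        using T\<kappa> a True C60 T D0 by (intro add_mono mult_left_mono) auto
      also have "\<dots> \<le> 4 * (C6 + 1) * T * (\<kappa> + a + D * b)"
      proof -
        have "0 \<le> T * (\<kappa> + a)" "0 \<le> C6 * (T * (\<kappa> + a))" "0 \<le> T * (D * b)" using T \<kappa> a C60 D0 b0 by simp_all
        then show ?thesis by (simp add: algebra_simps)
      qed
      finally show ?thesis using c by linarith
    next
      case False
      \<comment> \<open>Here \<open>\<nu>\<close> exceeds \<open>4 * b\<close>, so \<open>Y\<close> is large in the direction \<open>v0\<close> and \<open>X\<close> is not.\<close>
      have up: "qf n X v0 - qf n Y 0 \<le> b + 2 * K + \<epsilon>" "qf n X 0 - qf n Y v0 \<le> b + \<epsilon>"
      proof -
        have "0 \<le> (b + c) * (vdot n e v0)\<^sup>2" "0 \<le> (b + c) * (vdot n e (- v0))\<^sup>2" using b0 c by simp_all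
        then show "qf n X v0 - qf n Y 0 \<le> b + 2 * K + \<epsilon>" "qf n X 0 - qf n Y v0 \<le> b + \<epsilon>"
          using block[OF v0R(1) Rn_closed(1)] block[OF Rn_closed(1) v0R(1)] v0R by simp_all
      qed
      have "qf n Y v0 = \<nu>"
      proof (rule ccontr)
        assume "qf n Y v0 \<noteq> \<nu>"
        then have "\<nu> = - qf n Y v0" by (auto simp: \<nu>_def)
        then show False using up(2) False b \<epsilon> by simp
      qed
      then have "\<nu> - b - \<kappa> \<le> qf n Y v0 - qf n X v0" using up(1) \<epsilon> by (simp add: \<kappa>_def)
      then have 1: "\<nu> - b - \<kappa> \<le> C6 * T * (\<kappa> + a + D * \<nu>)" using ell[OF v0R] by linarith
      show ?thesis
      proof (cases "C6 * T * D \<le> 1 / 4")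
        case True
        have "C6 * T * (\<kappa> + a + D * \<nu>) = C6 * T * (\<kappa> + a) + (C6 * T * D) * \<nu>" by (simp add: algebra_simps)
        also have "\<dots> \<le> C6 * T * (\<kappa> + a) + 1 / 4 * \<nu>" using True \<nu>0 by (intro add_left_mono mult_right_mono) auto
        finally have "\<nu> / 2 \<le> \<kappa> + C6 * T * (\<kappa> + a)" using 1 False by argo
        also have "\<dots> \<le> T * (\<kappa> + a) + C6 * T * (\<kappa> + a)" using T\<kappa> a by simp
        finally have "c \<le> (T * (\<kappa> + a) + C6 * T * (\<kappa> + a)) / 2" using False b c by argo
        also have "\<dots> \<le> 4 * (C6 + 1) * T * (\<kappa> + a + D * b)"
        proof -
          have "0 \<le> T * (\<kappa> + a)" "0 \<le> C6 * (T * (\<kappa> + a))" "0 \<le> T * (D * b)" "0 \<le> C6 * (T * (D * b))"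
            using T \<kappa> a C60 D0 b0 by simp_all
          then show ?thesis by (simp add: algebra_simps)
        qed
        finally show ?thesis .
      next
        case False
        have "c \<le> 1 * b" using b by simp
        also have "\<dots> \<le> (4 * (C6 * T * D)) * b" using False b0 by (intro mult_right_mono) auto
        also have "\<dots> \<le> 4 * (C6 + 1) * T * (\<kappa> + a + D * b)"
        proof -
          have "0 \<le> T * (\<kappa> + a)" "0 \<le> C6 * (T * (\<kappa> + a))" "0 \<le> T * (D * b)"
            using T \<kappa> a C60 D0 b0 by simp_all
          then show ?thesis by (simp add: algebra_simps)
        qed
        finally show ?thesis .
      qed
    qed
    have "D * b \<le> (vnorm n kv / a + \<delta> powr \<alpha>) * b + a"
    proof -
      have "D * b = (vnorm n kv / a + \<delta> powr \<alpha>) * b + 2 * \<epsilon> / a * b"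
        by (simp add: D_def add_divide_distrib algebra_simps)
      moreover have "2 * \<epsilon> / a * b \<le> 1" using \<epsilon> \<delta> a by (simp add: b_def field_simps)
      ultimately show ?thesis using a by linarith
    qed
    moreover have "0 \<le> (vnorm n kv / a + \<delta> powr \<alpha>) * b" using a b0 by simp
    moreover have "\<kappa> + a + s \<le> 3 * (K + a + M)" if "s \<le> M + a" "0 \<le> M" for s M
      using that \<kappa> K by (simp add: algebra_simps)
    ultimately have "\<kappa> + a + D * b \<le> 3 * (K + a + (vnorm n kv / a + \<delta> powr \<alpha>) * b)" by blast
    then have "4 * (C6 + 1) * T * (\<kappa> + a + D * b) \<le> 4 * (C6 + 1) * T * (3 * (K + a + (vnorm n kv / a + \<delta> powr \<alpha>) * b))"
      using C60 T by (intro mult_left_mono) auto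
    also have "\<dots> = A * T * (K + a + (vnorm n kv / a + \<delta> powr \<alpha>) * b)"
    proof -
      have "4 * (C6 + 1) * T * (3 * W) = 12 * (C6 + 1) * T * W" for W by simp
      then show ?thesis unfolding A_def .
    qed
    finally show ?thesis using key unfolding T_def \<delta>_def b_def by linarith
  qed
  show ?thesis
    by (intro exI[of _ A] conjI A1 allI impI main)
qed

section \<open>Doubling of variables\<close>

lemma second_order_upper_bound:
  fixes G G' :: "real \<Rightarrow> real"
  assumes s0: "s0 > 0" and G: "\<And>s. s > 0 \<Longrightarrow> (G has_real_derivative G' s) (at s)"
    and G2: "(G' has_real_derivative G2) (at s0)" and \<iota>: "\<iota> > 0"
  shows "\<exists>r>0. \<forall>x. \<bar>x\<bar> \<le> r \<longrightarrow> G (s0 + x) \<le> G s0 + G' s0 * x + (G2 + \<iota>) / 2 * x\<^sup>2"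
proof -
  have "(\<lambda>h. (G' (s0 + h) - G' s0) / h) \<midarrow>0\<rightarrow> G2" using G2 by (simp add: DERIV_def)
  from LIM_D[OF this \<iota>] obtain r0 where r0: "r0 > 0"
    and q: "\<And>h. h \<noteq> 0 \<Longrightarrow> \<bar>h\<bar> < r0 \<Longrightarrow> \<bar>(G' (s0 + h) - G' s0) / h - G2\<bar> < \<iota>" by auto
  define r where "r = min (r0 / 2) (s0 / 2)"
  have r: "r > 0" "r < r0" "r < s0" using r0 s0 by (auto simp: r_def)
  define H where "H = (\<lambda>x. G (s0 + x) - G s0 - G' s0 * x - (G2 + \<iota>) / 2 * x\<^sup>2)"
  define H' where "H' = (\<lambda>x. G' (s0 + x) - G' s0 - (G2 + \<iota>) * x)"
  have DH: "(H has_real_derivative H' x) (at x)" if "\<bar>x\<bar> \<le> r" for x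
  proof -
    have "((\<lambda>x. G (s0 + x)) has_real_derivative G' (s0 + x)) (at x)"
      using DERIV_shift[of G "G' (s0 + x)" x s0] G[of "s0 + x"] that r by (simp add: add.commute abs_le_iff)
    then show ?thesis unfolding H_def H'_def
      by (auto intro!: derivative_eq_intros simp: algebra_simps)
  qed
  have neg: "H' x \<le> 0" if "0 \<le> x" "x \<le> r" for x
  proof (cases "x = 0")
    case False
    then have "x > 0" using that by simp
    then have "(G' (s0 + x) - G' s0) / x < G2 + \<iota>" using q[of x] that r by (auto simp: abs_less_iff)
    then show ?thesis using \<open>x > 0\<close> by (simp add: H'_def field_simps)
  qed (simp add: H'_def)
  have pos: "H' x \<ge> 0" if "x \<le> 0" "- r \<le> x" for x
  proof (cases "x = 0")
    case False
    then have "x < 0" using that by simp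
    then have "(G' (s0 + x) - G' s0) / x < G2 + \<iota>" using q[of x] that r by (auto simp: abs_less_iff)
    then show ?thesis using \<open>x < 0\<close> by (simp add: H'_def field_simps)
  qed (simp add: H'_def)
  have "H x \<le> H 0" if x: "\<bar>x\<bar> \<le> r" for x
  proof (cases "x \<ge> 0")
    case True
    show ?thesis
      by (rule DERIV_nonpos_imp_nonincreasing[OF True]) (use DH neg x in force)
  next
    case False
    then have "x \<le> 0" by simp
    then show ?thesis
      by (rule DERIV_nonneg_imp_nondecreasing) (use DH pos x in force)
  qed
  then show ?thesis using r(1) by (intro exI[of _ r]) (auto simp: H_def algebra_simps)
qed

text \<open>The profile is a function of the squared distance, which is a polynomial: its second-order
  expansion needs no differentiation of the norm.\<close>

lemma profile_upper_bound:
  fixes G G' :: "real \<Rightarrow> real"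
  assumes v: "v \<in> Rn n" and \<delta>: "\<delta> = vnorm n v" "\<delta> > 0"
    and G: "\<And>s. s > 0 \<Longrightarrow> (G has_real_derivative G' s) (at s)"
    and G2: "(G' has_real_derivative G2) (at (\<delta>\<^sup>2))" and \<iota>: "\<iota> > 0"
  defines "b \<equiv> 2 * G' (\<delta>\<^sup>2)" and "c \<equiv> - (4 * \<delta>\<^sup>2 * G2 + 2 * G' (\<delta>\<^sup>2))"
  shows "\<exists>\<rho>>0. \<forall>w\<in>Rn n. vnorm n w \<le> \<rho> \<longrightarrow>
    G ((vnorm n (v + w))\<^sup>2) \<le> G (\<delta>\<^sup>2) + \<delta> * b * vdot n (vscale (1 / \<delta>) v) w
      + (b * (vnorm n w)\<^sup>2 - (b + c) * (vdot n (vscale (1 / \<delta>) v) w)\<^sup>2) / 2 + \<iota> * (vnorm n w)\<^sup>2"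
proof -
  define \<iota>1 where "\<iota>1 = \<iota> / (2 * \<delta> + 1)\<^sup>2"
  have \<iota>1: "\<iota>1 > 0" using \<iota> \<delta> by (simp add: \<iota>1_def)
  have "\<delta>\<^sup>2 > 0" using \<delta> by simp
  from second_order_upper_bound[OF this G G2 \<iota>1] obtain r where r: "r > 0"
    and up: "\<And>x. \<bar>x\<bar> \<le> r \<Longrightarrow> G (\<delta>\<^sup>2 + x) \<le> G (\<delta>\<^sup>2) + G' (\<delta>\<^sup>2) * x + (G2 + \<iota>1) / 2 * x\<^sup>2" by blast
  define \<rho> where "\<rho> = min 1 (min (r / (2 * \<delta> + 1)) (\<iota> / ((\<bar>G2\<bar> + 1) * (4 * \<delta> + 1))))"
  have \<rho>: "\<rho> > 0" "\<rho> \<le> 1" "\<rho> * (2 * \<delta> + 1) \<le> r" "\<rho> * ((\<bar>G2\<bar> + 1) * (4 * \<delta> + 1)) \<le> \<iota>"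
  proof -
    have p: "(\<bar>G2\<bar> + 1) * (4 * \<delta> + 1) > 0" "2 * \<delta> + 1 > 0" using \<delta> by (auto intro!: mult_pos_pos)
    show "\<rho> > 0" using r \<iota> p by (simp add: \<rho>_def)
    show "\<rho> \<le> 1" by (simp add: \<rho>_def)
    have "\<rho> \<le> r / (2 * \<delta> + 1)" "\<rho> \<le> \<iota> / ((\<bar>G2\<bar> + 1) * (4 * \<delta> + 1))" by (auto simp: \<rho>_def)
    then show "\<rho> * (2 * \<delta> + 1) \<le> r" "\<rho> * ((\<bar>G2\<bar> + 1) * (4 * \<delta> + 1)) \<le> \<iota>"
      using p by (simp_all only: pos_le_divide_eq)
  qed
  have "G ((vnorm n (v + w))\<^sup>2) \<le> G (\<delta>\<^sup>2) + \<delta> * b * vdot n (vscale (1 / \<delta>) v) w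
      + (b * (vnorm n w)\<^sup>2 - (b + c) * (vdot n (vscale (1 / \<delta>) v) w)\<^sup>2) / 2 + \<iota> * (vnorm n w)\<^sup>2"
    if w: "w \<in> Rn n" "vnorm n w \<le> \<rho>" for w
  proof -
    define t where "t = vnorm n w"
    define z where "z = vdot n v w"
    define x where "x = 2 * z + t\<^sup>2"
    have t: "0 \<le> t" "t \<le> 1" "t \<le> \<rho>" using w \<rho> by (auto simp: t_def)
    have z: "\<bar>z\<bar> \<le> \<delta> * t" using vdot_le[of n v w] by (simp add: z_def \<delta> t_def)
    have tt: "t\<^sup>2 \<le> t" using t by (simp add: power2_eq_square mult_left_le)
    have t2: "0 \<le> t\<^sup>2" by simp
    have xt: "\<bar>x\<bar> \<le> (2 * \<delta> + 1) * t"
      unfolding x_def distrib_right abs_le_iff using z[unfolded abs_le_iff] tt t(1) t2 by linarith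
    also have "\<dots> \<le> \<rho> * (2 * \<delta> + 1)" using t \<delta> by (simp add: mult.commute mult_left_mono)
    finally have "\<bar>x\<bar> \<le> r" using \<rho> by linarith
    from up[OF this] have 1: "G ((vnorm n (v + w))\<^sup>2) \<le> G (\<delta>\<^sup>2) + G' (\<delta>\<^sup>2) * x + G2 / 2 * x\<^sup>2 + \<iota>1 / 2 * x\<^sup>2"
      by (simp add: vnorm_sq_add x_def z_def t_def \<delta>(1) add_divide_distrib distrib_right add.assoc)
    have "x\<^sup>2 \<le> ((2 * \<delta> + 1) * t)\<^sup>2" using xt t \<delta> by (simp add: abs_le_square_iff[symmetric])
    then have "\<iota>1 / 2 * x\<^sup>2 \<le> \<iota>1 / 2 * ((2 * \<delta> + 1) * t)\<^sup>2" using \<iota>1 by (intro mult_left_mono) auto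
    also have "\<dots> = \<iota> / 2 * t\<^sup>2" using \<delta> by (simp add: \<iota>1_def power_mult_distrib)
    finally have 2: "\<iota>1 / 2 * x\<^sup>2 \<le> \<iota> / 2 * t\<^sup>2" .
    have "\<bar>x\<^sup>2 - 4 * z\<^sup>2\<bar> = \<bar>4 * z + t\<^sup>2\<bar> * t\<^sup>2"
    proof -
      have "x\<^sup>2 - 4 * z\<^sup>2 = (4 * z + t\<^sup>2) * t\<^sup>2" by (simp add: x_def power2_eq_square algebra_simps)
      then show ?thesis by (simp add: abs_mult)
    qed
    also have "\<dots> \<le> ((4 * \<delta> + 1) * t) * t\<^sup>2"
    proof (rule mult_right_mono[OF _ t2])
      show "\<bar>4 * z + t\<^sup>2\<bar> \<le> (4 * \<delta> + 1) * t"
        unfolding distrib_right abs_le_iff using z[unfolded abs_le_iff] tt t(1) t2 by linarith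
    qed
    also have "\<dots> \<le> ((4 * \<delta> + 1) * \<rho>) * t\<^sup>2" using t \<delta> by (intro mult_right_mono mult_left_mono) auto
    finally have x4: "\<bar>x\<^sup>2 - 4 * z\<^sup>2\<bar> \<le> ((4 * \<delta> + 1) * \<rho>) * t\<^sup>2" .
    have "G2 / 2 * (x\<^sup>2 - 4 * z\<^sup>2) \<le> \<bar>G2 / 2\<bar> * \<bar>x\<^sup>2 - 4 * z\<^sup>2\<bar>"
      by (simp only: abs_mult[symmetric] abs_ge_self)
    also have "\<dots> \<le> ((\<bar>G2\<bar> + 1) / 2) * (((4 * \<delta> + 1) * \<rho>) * t\<^sup>2)" using x4 by (intro mult_mono) auto
    also have "\<dots> = (\<rho> * ((\<bar>G2\<bar> + 1) * (4 * \<delta> + 1))) / 2 * t\<^sup>2" by simp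
    also have "\<dots> \<le> \<iota> / 2 * t\<^sup>2" using \<rho>(4) by (intro mult_right_mono divide_right_mono) auto
    finally have 3: "G2 / 2 * x\<^sup>2 \<le> 2 * G2 * z\<^sup>2 + \<iota> / 2 * t\<^sup>2" by (simp add: algebra_simps)
    have ez: "vdot n (vscale (1 / \<delta>) v) w = z / \<delta>" by (simp add: vdot_simps z_def)
    have "\<delta> \<noteq> 0" using \<delta>(2) by simp
    then have "\<delta> * b * (z / \<delta>) = b * z" by simp
    also have "\<dots> = G' (\<delta>\<^sup>2) * (2 * z)" unfolding b_def by (rule mult.assoc[of 2, THEN trans]) (rule mult.left_commute)
    finally have 4: "\<delta> * b * (z / \<delta>) = G' (\<delta>\<^sup>2) * (2 * z)" .
    have bc: "b + c = - (4 * \<delta>\<^sup>2 * G2)" unfolding b_def c_def by linarith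
    have "\<delta>\<^sup>2 \<noteq> 0" using \<delta>(2) by simp
    then have 5: "- (b + c) * (z / \<delta>)\<^sup>2 / 2 = 2 * G2 * z\<^sup>2"
      unfolding bc power_divide by (simp add: field_simps)
    have 6: "G' (\<delta>\<^sup>2) * x = G' (\<delta>\<^sup>2) * (2 * z) + b * t\<^sup>2 / 2"
      unfolding x_def b_def distrib_left by simp
    have "(b * t\<^sup>2 - (b + c) * (z / \<delta>)\<^sup>2) / 2 = b * t\<^sup>2 / 2 + - (b + c) * (z / \<delta>)\<^sup>2 / 2"
      unfolding diff_divide_distrib minus_mult_left[symmetric] by simp
    then show ?thesis using 1 2 3 unfolding ez t_def[symmetric] 4 5 6 by linarith
  qed
  then show ?thesis using \<rho>(1) by blast
qed

lemma touched_at_max: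
  fixes G G' :: "real \<Rightarrow> real"
  assumes xy: "x \<in> Rn n" "y \<in> Rn n" "vnorm n x < R" "vnorm n y < R" and x0: "x0 \<in> Rn n"
    and \<delta>: "\<delta> = vnorm n (x - y)" "\<delta> > 0"
    and G: "\<And>s. s > 0 \<Longrightarrow> (G has_real_derivative G' s) (at s)"
    and G2: "(G' has_real_derivative G2) (at (\<delta>\<^sup>2))"
    and max: "\<And>x' y'. x' \<in> cB n 0 R \<Longrightarrow> y' \<in> cB n 0 R \<Longrightarrow>
       u x' - u y' - G ((vnorm n (x' - y'))\<^sup>2) - K * (vnorm n (x' - x0))\<^sup>2
       \<le> u x - u y - G ((vnorm n (x - y))\<^sup>2) - K * (vnorm n (x - x0))\<^sup>2"
    and a: "a = 2 * \<delta> * G' (\<delta>\<^sup>2)" and c: "c = - (4 * \<delta>\<^sup>2 * G2 + 2 * G' (\<delta>\<^sup>2))"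
  shows "touched n u x y (vscale (2 * K) (x - x0)) (vscale (1 / \<delta>) (x - y)) a (a / \<delta>) c K"
  unfolding touched_def
proof (intro allI impI)
  fix \<iota> :: real assume \<iota>: "\<iota> > 0"
  define v where "v = x - y"
  define e where "e = vscale (1 / \<delta>) v"
  have v: "v \<in> Rn n" using xy by (auto simp: v_def)
  have b: "a / \<delta> = 2 * G' (\<delta>\<^sup>2)" using a \<delta> by simp
  have \<iota>2: "\<iota> / 2 > 0" using \<iota> by simp
  from profile_upper_bound[OF v \<delta>[folded v_def] G G2 \<iota>2]
  obtain \<rho>0 where \<rho>0: "\<rho>0 > 0" and up: "\<And>w. w \<in> Rn n \<Longrightarrow> vnorm n w \<le> \<rho>0 \<Longrightarrow>
    G ((vnorm n (v + w))\<^sup>2) \<le> G (\<delta>\<^sup>2) + a * vdot n e w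
      + (a / \<delta> * (vnorm n w)\<^sup>2 - (a / \<delta> + c) * (vdot n e w)\<^sup>2) / 2 + \<iota> / 2 * (vnorm n w)\<^sup>2"
    unfolding b c[symmetric] e_def[symmetric] using a by (auto simp: mult_ac)
  define \<rho> where "\<rho> = min (\<rho>0 / 2) (min (R - vnorm n x) (R - vnorm n y))"
  have \<rho>: "\<rho> > 0" "\<rho> \<le> \<rho>0 / 2" "\<rho> \<le> R - vnorm n x" "\<rho> \<le> R - vnorm n y"
    using \<rho>0 xy unfolding \<rho>_def by (auto simp: min.coboundedI1 min.coboundedI2 simp del: le_divide_eq_numeral1)
  show "\<exists>\<rho>>0. \<forall>h\<in>Rn n. \<forall>k\<in>Rn n. vnorm n h \<le> \<rho> \<longrightarrow> vnorm n k \<le> \<rho> \<longrightarrow>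
     u (x + h) - u (y + k) \<le> u x - u y + vdot n (vscale (2 * K) (x - x0)) h + a * vdot n (vscale (1 / \<delta>) (x - y)) (h - k)
       + (a / \<delta> * (vnorm n (h - k))\<^sup>2 - (a / \<delta> + c) * (vdot n (vscale (1 / \<delta>) (x - y)) (h - k))\<^sup>2) / 2
       + K * (vnorm n h)\<^sup>2 + \<iota> * ((vnorm n h)\<^sup>2 + (vnorm n k)\<^sup>2)"
  proof (intro exI[of _ \<rho>] conjI ballI impI \<rho>(1))
    fix h k assume hk: "h \<in> Rn n" "k \<in> Rn n" "vnorm n h \<le> \<rho>" "vnorm n k \<le> \<rho>"
    have "x + h \<in> cB n 0 R" "y + k \<in> cB n 0 R"
      using vnorm_triangle[of n x h] vnorm_triangle[of n y k] hk xy \<rho> by (auto simp: cB_def)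
    note mx = max[OF this]
    have 1: "u (x + h) - u (y + k) \<le> u x - u y + G ((vnorm n (v + (h - k)))\<^sup>2) - G (\<delta>\<^sup>2)
        + K * (vnorm n (x + h - x0))\<^sup>2 - K * (vnorm n (x - x0))\<^sup>2"
    proof -
      have e1: "x + h - (y + k) = v + (h - k)" by (simp add: v_def)
      show ?thesis using mx unfolding e1 \<delta>(1) by linarith
    qed
    have "x + h - x0 = (x - x0) + h" by simp
    then have "(vnorm n (x + h - x0))\<^sup>2 = (vnorm n (x - x0))\<^sup>2 + 2 * vdot n (x - x0) h + (vnorm n h)\<^sup>2"
      by (simp only: vnorm_sq_add)
    then have 2: "K * (vnorm n (x + h - x0))\<^sup>2 - K * (vnorm n (x - x0))\<^sup>2 = vdot n (vscale (2 * K) (x - x0)) h + K * (vnorm n h)\<^sup>2"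
      by (simp add: vdot_simps(7) algebra_simps)
    have "vnorm n (h - k) \<le> \<rho>0" using vnorm_triangle_minus[of n h k] hk \<rho> by linarith
    then have 3: "G ((vnorm n (v + (h - k)))\<^sup>2) \<le> G (\<delta>\<^sup>2) + a * vdot n e (h - k)
      + (a / \<delta> * (vnorm n (h - k))\<^sup>2 - (a / \<delta> + c) * (vdot n e (h - k))\<^sup>2) / 2 + \<iota> / 2 * (vnorm n (h - k))\<^sup>2"
      using up[of "h - k"] hk by blast
    have "\<iota> / 2 * (vnorm n (h - k))\<^sup>2 \<le> \<iota> / 2 * (2 * (vnorm n h)\<^sup>2 + 2 * (vnorm n k)\<^sup>2)"
      using \<iota> vnorm_sq_diff_le by (intro mult_left_mono) auto
    also have "\<dots> = \<iota> * ((vnorm n h)\<^sup>2 + (vnorm n k)\<^sup>2)" by (simp add: algebra_simps)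
    finally show "u (x + h) - u (y + k) \<le> u x - u y + vdot n (vscale (2 * K) (x - x0)) h + a * vdot n (vscale (1 / \<delta>) (x - y)) (h - k)
       + (a / \<delta> * (vnorm n (h - k))\<^sup>2 - (a / \<delta> + c) * (vdot n (vscale (1 / \<delta>) (x - y)) (h - k))\<^sup>2) / 2
       + K * (vnorm n h)\<^sup>2 + \<iota> * ((vnorm n h)\<^sup>2 + (vnorm n k)\<^sup>2)"
      using 1 2 3 unfolding v_def[symmetric] e_def[symmetric] by linarith
  qed
qed

text \<open>The difference exceeds the profile at \<open>(x0, y0)\<close>, so the maximum of the doubled function is positive and
  is not attained on the diagonal.\<close>

lemma doubling_max:
  fixes G :: "real \<Rightarrow> real"
  assumes u: "continuous_on (B n 1) u" and R: "R < 1" and G: "continuous_on {0..} G" "G 0 = 0" and K: "K \<ge> 0"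
    and x0: "x0 \<in> cB n 0 R" "y0 \<in> cB n 0 R" and gt: "G ((vnorm n (x0 - y0))\<^sup>2) < u x0 - u y0"
  shows "\<exists>x y. x \<in> cB n 0 R \<and> y \<in> cB n 0 R \<and> x \<noteq> y
    \<and> G ((vnorm n (x - y))\<^sup>2) + K * (vnorm n (x - x0))\<^sup>2 < u x - u y
    \<and> (\<forall>x'\<in>cB n 0 R. \<forall>y'\<in>cB n 0 R. u x' - u y' - G ((vnorm n (x' - y'))\<^sup>2) - K * (vnorm n (x' - x0))\<^sup>2
       \<le> u x - u y - G ((vnorm n (x - y))\<^sup>2) - K * (vnorm n (x - x0))\<^sup>2)"
proof -
  let ?S = "cB n 0 R \<times> cB n 0 R"
  let ?\<Phi> = "\<lambda>z. u (fst z) - u (snd z) - G ((vnorm n (fst z - snd z))\<^sup>2) - K * (vnorm n (fst z - x0))\<^sup>2"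
  have sub: "cB n 0 R \<subseteq> B n 1" using cB_subset_B[of n 0 R] R by simp
  have c: "continuous_on ?S (\<lambda>z. snd z i)" "continuous_on ?S (\<lambda>z. fst z i)" for i :: nat
  proof -
    show "continuous_on ?S (\<lambda>z. snd z i)"
      by (rule continuous_on_compose2[OF continuous_on_coord[of UNIV i] continuous_on_snd[OF continuous_on_id]]) simp
    show "continuous_on ?S (\<lambda>z. fst z i)"
      by (rule continuous_on_compose2[OF continuous_on_coord[of UNIV i] continuous_on_fst[OF continuous_on_id]]) simp
  qed
  have d: "continuous_on ?S (\<lambda>z. vnorm n (fst z - snd z))" "continuous_on ?S (\<lambda>z. vnorm n (fst z - x0))"
    unfolding vnorm_def L2_set_def fun_diff_def by (intro continuous_intros c)+
  have f: "continuous_on ?S (\<lambda>z. u (fst z))" "continuous_on ?S (\<lambda>z. u (snd z))"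
    by (rule continuous_on_compose2[OF u], (intro continuous_intros), use sub in force)+
  have g: "continuous_on ?S (\<lambda>z. G ((vnorm n (fst z - snd z))\<^sup>2))"
    by (rule continuous_on_compose2[OF G(1)]) (auto intro!: continuous_intros d)
  have "continuous_on ?S ?\<Phi>" by (intro continuous_intros d f g)
  moreover have "?S \<noteq> {}" using x0 by auto
  moreover have "compact ?S" by (intro compact_Times compact_cB)
  ultimately obtain z where z: "z \<in> ?S" and max: "\<And>z'. z' \<in> ?S \<Longrightarrow> ?\<Phi> z' \<le> ?\<Phi> z"
    using continuous_attains_sup[of ?S ?\<Phi>] by blast
  have "?\<Phi> (x0, y0) \<le> ?\<Phi> z" by (rule max) (use x0 in simp)
  then have pos: "?\<Phi> z > 0" using gt by simp
  have "fst z \<noteq> snd z"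
  proof
    assume eq: "fst z = snd z"
    have "0 \<le> K * (vnorm n (fst z - x0))\<^sup>2" using K by simp
    then show False using pos G(2) unfolding eq by simp
  qed
  moreover have "u x' - u y' - G ((vnorm n (x' - y'))\<^sup>2) - K * (vnorm n (x' - x0))\<^sup>2 \<le> ?\<Phi> z"
    if "x' \<in> cB n 0 R" "y' \<in> cB n 0 R" for x' y' using max[of "(x', y')"] that by simp
  ultimately show ?thesis
    using z pos by (intro exI[of _ "fst z"] exI[of _ "snd z"]) auto
qed

text \<open>What the equation yields at contacts of the doubled function, separated from the equation: the
  estimates below use nothing else about \<open>u\<close>, so that their constants depend only on \<open>A\<close>, \<open>C0\<close>, \<open>d\<close> and
  \<open>\<alpha>\<close>.\<close>

definition concavity_estimate ::
  "nat \<Rightarrow> real \<Rightarrow> real \<Rightarrow> real \<Rightarrow> real \<Rightarrow> (point \<Rightarrow> real) \<Rightarrow> bool" where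
  "concavity_estimate n A C0 d \<alpha> u \<longleftrightarrow> (\<forall>x\<in>B n 1. \<forall>y\<in>B n 1. \<forall>kv\<in>Rn n. \<forall>a c K. x \<noteq> y \<longrightarrow>
    1 \<le> a \<longrightarrow> 2 * C0 \<le> a \<longrightarrow> vnorm n kv \<le> a / 4 \<longrightarrow> 0 \<le> K \<longrightarrow> 0 \<le> c \<longrightarrow> c \<le> a / vnorm n (x - y) \<longrightarrow>
    touched n u x y kv (vscale (1 / vnorm n (x - y)) (x - y)) a (a / vnorm n (x - y)) c K \<longrightarrow>
    c \<le> A * a powr d * (K + a + (vnorm n kv / a + vnorm n (x - y) powr \<alpha>) * (a / vnorm n (x - y))))"

text \<open>One run of the doubling argument for a profile \<open>G\<close> of the squared distance, with the slope and the
  concavity of the profile written as functions \<open>a\<close> and \<open>c\<close> of the distance.  The last hypothesis collects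
  what depends on the profile: pairs at which the difference of the values exceeds the profile lie in the
  interior of the ball, and the slope there is large.\<close>

lemma doubling_inequality:
  fixes G G' G2 :: "real \<Rightarrow> real"
  assumes ce: "concavity_estimate n A C0 d \<alpha> u" and u: "continuous_on (B n 1) u" and R: "R < 1"
    and G: "continuous_on {0..} G" "G 0 = 0" "\<And>s. s > 0 \<Longrightarrow> (G has_real_derivative G' s) (at s)"
      "\<And>s. s > 0 \<Longrightarrow> (G' has_real_derivative G2 s) (at s)"
    and K: "K \<ge> 0" and x0: "x0 \<in> cB n 0 R" "y0 \<in> cB n 0 R" and gt: "G ((vnorm n (x0 - y0))\<^sup>2) < u x0 - u y0"
    and a: "\<And>\<delta>. \<delta> > 0 \<Longrightarrow> a \<delta> = 2 * \<delta> * G' (\<delta>\<^sup>2)"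
    and c: "\<And>\<delta>. \<delta> > 0 \<Longrightarrow> c \<delta> = - (4 * \<delta>\<^sup>2 * G2 (\<delta>\<^sup>2) + 2 * G' (\<delta>\<^sup>2))"
    and adm: "\<And>x y \<delta>. x \<in> cB n 0 R \<Longrightarrow> y \<in> cB n 0 R \<Longrightarrow> \<delta> = vnorm n (x - y) \<Longrightarrow> \<delta> > 0 \<Longrightarrow>
      G (\<delta>\<^sup>2) + K * (vnorm n (x - x0))\<^sup>2 < u x - u y \<Longrightarrow>
      vnorm n x < R \<and> vnorm n y < R \<and> 1 \<le> a \<delta> \<and> 2 * C0 \<le> a \<delta> \<and> 2 * K * vnorm n (x - x0) \<le> a \<delta> / 4
      \<and> 0 \<le> c \<delta> \<and> c \<delta> \<le> a \<delta> / \<delta>"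
  shows "\<exists>x y \<delta>. x \<in> cB n 0 R \<and> y \<in> cB n 0 R \<and> \<delta> = vnorm n (x - y) \<and> \<delta> > 0
    \<and> G (\<delta>\<^sup>2) + K * (vnorm n (x - x0))\<^sup>2 < u x - u y
    \<and> c \<delta> \<le> A * a \<delta> powr d * (K + a \<delta> + (2 * K * vnorm n (x - x0) / a \<delta> + \<delta> powr \<alpha>) * (a \<delta> / \<delta>))"
proof -
  obtain x y where xy: "x \<in> cB n 0 R" "y \<in> cB n 0 R" "x \<noteq> y"
    and gt': "G ((vnorm n (x - y))\<^sup>2) + K * (vnorm n (x - x0))\<^sup>2 < u x - u y"
    and max: "\<forall>x'\<in>cB n 0 R. \<forall>y'\<in>cB n 0 R. u x' - u y' - G ((vnorm n (x' - y'))\<^sup>2) - K * (vnorm n (x' - x0))\<^sup>2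
       \<le> u x - u y - G ((vnorm n (x - y))\<^sup>2) - K * (vnorm n (x - x0))\<^sup>2"
    using doubling_max[OF u R G(1,2) K x0 gt] by (elim exE conjE)
  define \<delta> where "\<delta> = vnorm n (x - y)"
  have xyR: "x \<in> Rn n" "y \<in> Rn n" "x - y \<in> Rn n" "x0 \<in> Rn n" using xy x0 by (auto simp: cB_def)
  have "\<delta> \<noteq> 0" unfolding \<delta>_def using vnorm_eq_0[OF xyR(3)] xy(3) by simp
  then have \<delta>: "\<delta> > 0" using vnorm_ge_0[of n "x - y"] unfolding \<delta>_def by linarith
  have \<delta>2: "\<delta>\<^sup>2 > 0" using \<delta> by simp
  have ad: "vnorm n x < R \<and> vnorm n y < R \<and> 1 \<le> a \<delta> \<and> 2 * C0 \<le> a \<delta> \<and> 2 * K * vnorm n (x - x0) \<le> a \<delta> / 4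
      \<and> 0 \<le> c \<delta> \<and> c \<delta> \<le> a \<delta> / \<delta>"
    by (rule adm[OF xy(1,2) \<delta>_def \<delta>]) (use gt' in \<open>simp add: \<delta>_def\<close>)
  have sub: "cB n 0 R \<subseteq> B n 1" using cB_subset_B[of n 0 R] R by simp
  have t: "touched n u x y (vscale (2 * K) (x - x0)) (vscale (1 / \<delta>) (x - y)) (a \<delta>) (a \<delta> / \<delta>) (c \<delta>) K"
    by (rule touched_at_max[OF xyR(1,2) _ _ xyR(4) \<delta>_def \<delta> G(3) G(4)[OF \<delta>2] _ a[OF \<delta>] c[OF \<delta>]])
       (use ad max in auto)
  have k: "vscale (2 * K) (x - x0) \<in> Rn n" "vnorm n (vscale (2 * K) (x - x0)) = 2 * K * vnorm n (x - x0)"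
    using xyR K by (auto simp: abs_mult)
  have "c \<delta> \<le> A * a \<delta> powr d * (K + a \<delta> + (vnorm n (vscale (2 * K) (x - x0)) / a \<delta> + \<delta> powr \<alpha>) * (a \<delta> / \<delta>))"
    unfolding \<delta>_def
    by (rule ce[unfolded concavity_estimate_def, rule_format, of x y])
       (use xy sub k ad K t in \<open>auto simp: \<delta>_def\<close>)
  then show ?thesis unfolding k(2) using xy(1,2) \<delta> gt' unfolding \<delta>_def by blast
qed

lemma powr_profile:
  fixes L \<mu> \<kappa> \<nu> :: real
  assumes "\<mu> > 0" "\<nu> > 0"
  defines "G \<equiv> \<lambda>s. L * (s powr \<mu> - \<kappa> * s powr \<nu>)"
    and "G' \<equiv> \<lambda>s. L * (\<mu> * s powr (\<mu> - 1) - \<kappa> * \<nu> * s powr (\<nu> - 1))"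
    and "G2 \<equiv> \<lambda>s. L * (\<mu> * (\<mu> - 1) * s powr (\<mu> - 2) - \<kappa> * \<nu> * (\<nu> - 1) * s powr (\<nu> - 2))"
  shows "continuous_on {0..} G" "G 0 = 0"
    "\<And>s. s > 0 \<Longrightarrow> (G has_real_derivative G' s) (at s)" "\<And>s. s > 0 \<Longrightarrow> (G' has_real_derivative G2 s) (at s)"
proof -
  show "continuous_on {0..} G"
    unfolding G_def using assms(1,2) by (intro continuous_intros continuous_on_powr') auto
  show "G 0 = 0" by (simp add: G_def)
  show "(G has_real_derivative G' s) (at s)" if "s > 0" for s
    unfolding G_def G'_def using that
    by (auto intro!: derivative_eq_intros has_real_derivative_powr simp: algebra_simps)
  show "(G' has_real_derivative G2 s) (at s)" if "s > 0" for s
  proof -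
    have e: "\<mu> - 1 - 1 = \<mu> - 2" "\<nu> - 1 - 1 = \<nu> - 2" by simp_all
    have "((\<lambda>s. s powr (\<mu> - 1)) has_real_derivative (\<mu> - 1) * s powr (\<mu> - 2)) (at s)"
      "((\<lambda>s. s powr (\<nu> - 1)) has_real_derivative (\<nu> - 1) * s powr (\<nu> - 2)) (at s)"
      using has_real_derivative_powr[OF that, of "\<mu> - 1"] has_real_derivative_powr[OF that, of "\<nu> - 1"]
      unfolding e by auto
    then show ?thesis unfolding G'_def G2_def using that
      by (auto intro!: derivative_eq_intros simp: algebra_simps)
  qed
qed

lemma square_powr: "x > 0 \<Longrightarrow> (x\<^sup>2) powr \<mu> = x powr (2 * \<mu>)" for x :: real
  by (simp add: powr_powr[symmetric])

lemma ball_interior: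
  assumes "vnorm n x0 \<le> r" "vnorm n (x - x0) < s" "vnorm n (x - y) < s"
  shows "vnorm n x < r + s" "vnorm n y < r + 2 * s"
  using assms vnorm_triangle_diff[of n x x0] vnorm_triangle_diff[of n y x] vnorm_commute[of n x y] by linarith+

subsection \<open>A first Hoelder estimate\<close>

text \<open>For the profile \<open>L * \<delta> powr (1 / 2)\<close> of the distance the concavity is half of the slope divided by the
  distance.  Boundedness of \<open>u\<close> makes \<open>a * \<delta>\<close> at most \<open>M + 1\<close>, and the concavity estimate becomes
  \<open>a powr (\<alpha> - d) \<le> 1156 * A * (M + 1)\<close>; this fails if \<open>L\<close> is large enough.\<close>

lemma Hoelder_half_estimate:
  fixes d \<alpha> A C0 :: real
  assumes d: "0 \<le> d" "d < \<alpha>" "\<alpha> \<le> 1" and A: "A \<ge> 1" and C0: "C0 > 0"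
  shows "\<exists>C\<ge>1. \<forall>n u M. concavity_estimate n A C0 d \<alpha> u \<longrightarrow> continuous_on (B n 1) u \<longrightarrow>
    (\<forall>x\<in>cB n 0 (7/8). \<bar>u x\<bar> \<le> M) \<longrightarrow> (\<forall>x\<in>cB n 0 (3/4). \<forall>y\<in>cB n 0 (7/8).
      u x - u y \<le> C * (M + 1) powr (1 / (\<alpha> - d)) * vnorm n (x - y) powr (1/2))"
proof -
  define \<theta> where "\<theta> = 1 / (\<alpha> - d)"
  have \<theta>: "\<theta> \<ge> 1" "\<theta> * (\<alpha> - d) = 1" using d by (auto simp: \<theta>_def)
  define C where "C = max (4 * C0 + 512) (4 * (1156 * A) powr \<theta>)"
  have C: "C \<ge> 512" "C \<ge> 4 * C0" "C \<ge> 4 * (1156 * A) powr \<theta>" using C0 by (auto simp: C_def)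
  have main: "u x0 - u y0 \<le> C * (M + 1) powr \<theta> * vnorm n (x0 - y0) powr (1/2)"
    if ce: "concavity_estimate n A C0 d \<alpha> u" and u: "continuous_on (B n 1) u"
      and M: "\<forall>x\<in>cB n 0 (7/8). \<bar>u x\<bar> \<le> M" and x0: "x0 \<in> cB n 0 (3/4)" and y0: "y0 \<in> cB n 0 (7/8)"
    for n u M x0 y0
  proof (rule ccontr)
    assume neg: "\<not> ?thesis"
    define m where "m = M + 1"
    have x0': "x0 \<in> cB n 0 (7/8)" and x0n: "vnorm n x0 \<le> 3/4" using x0 by (auto simp: cB_def)
    have "0 \<le> \<bar>u x0\<bar>" by simp
    also have "\<dots> \<le> M" using M x0' by blast
    finally have M0: "M \<ge> 0" .
    have m1: "m \<ge> 1" using M0 by (simp add: m_def)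
    have mm: "m \<le> m powr \<theta>" using powr_mono[OF \<theta>(1) m1] m1 by simp
    define L where "L = C * m powr \<theta>"
    have L: "L \<ge> 512 * m" "L \<ge> 4 * C0" "L > 0"
    proof -
      have "512 * m \<le> C * m powr \<theta>" using C mm m1 by (intro mult_mono) auto
      then show "L \<ge> 512 * m" by (simp add: L_def)
      then show "L > 0" using m1 by linarith
      have "4 * C0 * 1 \<le> C * m powr \<theta>" using C mm m1 C0 by (intro mult_mono) auto
      then show "L \<ge> 4 * C0" by (simp add: L_def)
    qed
    define G where "G = (\<lambda>s::real. L * (s powr (1/4) - 0 * s powr 1))"
    define G' where "G' = (\<lambda>s::real. L * (1/4 * s powr (1/4 - 1) - 0 * 1 * s powr (1 - 1)))"
    define G2 where "G2 = (\<lambda>s::real. L * (1/4 * (1/4 - 1) * s powr (1/4 - 2) - 0 * 1 * (1 - 1) * s powr (1 - 2)))"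
    have Gp: "continuous_on {0..} G" "G 0 = 0" "\<And>s. s > 0 \<Longrightarrow> (G has_real_derivative G' s) (at s)"
      "\<And>s. s > 0 \<Longrightarrow> (G' has_real_derivative G2 s) (at s)"
    proof -
      note pp = powr_profile[where \<mu> = "1/4" and \<nu> = 1 and L = L and \<kappa> = 0]
      show "continuous_on {0..} G" unfolding G_def by (rule pp(1)) auto
      show "G 0 = 0" unfolding G_def by (rule pp(2)) auto
      show "\<And>s. s > 0 \<Longrightarrow> (G has_real_derivative G' s) (at s)" unfolding G_def G'_def by (rule pp(3)) auto
      show "\<And>s. s > 0 \<Longrightarrow> (G' has_real_derivative G2 s) (at s)" unfolding G'_def G2_def by (rule pp(4)) auto
    qed
    have Gs: "G (\<delta>\<^sup>2) = L * \<delta> powr (1/2)" if "\<delta> > 0" for \<delta>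
      using that by (simp add: G_def square_powr)
    define a where "a = (\<lambda>\<delta>::real. L / 2 * \<delta> powr (- 1/2))"
    define c where "c = (\<lambda>\<delta>::real. a \<delta> / (2 * \<delta>))"
    have pw: "\<delta> * \<delta> powr (- 3/2) = \<delta> powr (- 1/2)" "\<delta>\<^sup>2 * \<delta> powr (- 7/2) = \<delta> powr (- 3/2)" if "\<delta> > 0" for \<delta> :: real
    proof -
      have "\<delta> * \<delta> powr (- 3/2) = \<delta> powr 1 * \<delta> powr (- 3/2)" using that by simp
      then show "\<delta> * \<delta> powr (- 3/2) = \<delta> powr (- 1/2)" unfolding powr_add[symmetric] by simp
      have "\<delta>\<^sup>2 * \<delta> powr (- 7/2) = \<delta> powr 2 * \<delta> powr (- 7/2)" using that by simp
      then show "\<delta>\<^sup>2 * \<delta> powr (- 7/2) = \<delta> powr (- 3/2)" unfolding powr_add[symmetric] by simp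
    qed
    have G's: "G' (\<delta>\<^sup>2) = L / 4 * \<delta> powr (- 3/2)" and G2s: "G2 (\<delta>\<^sup>2) = - 3/16 * L * \<delta> powr (- 7/2)" if "\<delta> > 0" for \<delta>
      using that by (simp_all add: G'_def G2_def square_powr)
    have aG: "a \<delta> = 2 * \<delta> * G' (\<delta>\<^sup>2)" if "\<delta> > 0" for \<delta>
      using pw(1)[OF that] by (simp add: a_def G's[OF that])
    have cG: "c \<delta> = - (4 * \<delta>\<^sup>2 * G2 (\<delta>\<^sup>2) + 2 * G' (\<delta>\<^sup>2))" if "\<delta> > 0" for \<delta>
    proof -
      have "c \<delta> = L / 4 * \<delta> powr (- 3/2)"
        using pw(1)[OF that] that by (simp add: c_def a_def field_simps)
      moreover have "4 * \<delta>\<^sup>2 * G2 (\<delta>\<^sup>2) = - 3/4 * L * (\<delta>\<^sup>2 * \<delta> powr (- 7/2))" by (simp add: G2s[OF that])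
      ultimately show ?thesis unfolding pw(2)[OF that] G's[OF that] by simp
    qed
    \<comment> \<open>The factor \<open>512\<close> forces the first contact point into the ball of radius \<open>1 / 16\<close> around \<open>x0\<close>.\<close>
    define K where "K = 512 * m"
    have K0: "K \<ge> 0" using m1 by (simp add: K_def)
    have y_ne: "vnorm n (x0 - y0) > 0"
    proof (rule ccontr)
      assume "\<not> ?thesis"
      then have z: "vnorm n (x0 - y0) = 0" using vnorm_ge_0[of n "x0 - y0"] by linarith
      have "x0 - y0 \<in> Rn n" using x0 y0 by (auto simp: cB_def)
      then have "x0 = y0" using vnorm_eq_0 z by fastforce
      then show False using neg by simp
    qed
    have gt: "G ((vnorm n (x0 - y0))\<^sup>2) < u x0 - u y0"
      using neg unfolding Gs[OF y_ne] by (simp add: L_def m_def)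
    have small: "vnorm n (x - x0) < 1/16 \<and> \<delta> < 1/16 \<and> L * \<delta> powr (1/2) < 2 * m \<and> a \<delta> \<ge> L / 2"
      if "x \<in> cB n 0 (7/8)" "y \<in> cB n 0 (7/8)" "\<delta> > 0" and g: "G (\<delta>\<^sup>2) + K * (vnorm n (x - x0))\<^sup>2 < u x - u y" for x y \<delta>
    proof -
      have "\<bar>u x\<bar> \<le> M" "\<bar>u y\<bar> \<le> M" using M that by auto
      then have uM: "u x - u y \<le> 2 * M" by linarith
      have "0 \<le> K * (vnorm n (x - x0))\<^sup>2" "0 \<le> G (\<delta>\<^sup>2)" using K0 L by (auto simp: Gs[OF that(3)])
      then have 1: "K * (vnorm n (x - x0))\<^sup>2 < 2 * m" "L * \<delta> powr (1/2) < 2 * m"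
        using g uM unfolding Gs[OF that(3)] m_def by simp_all
      have "2 * m * (256 * (vnorm n (x - x0))\<^sup>2) < 2 * m * 1" using 1 by (simp add: K_def)
      then have "256 * (vnorm n (x - x0))\<^sup>2 < 1" using m1 by (simp only: mult_less_cancel_left_pos)
      then have "(vnorm n (x - x0))\<^sup>2 < (1/16)\<^sup>2" by (simp add: power2_eq_square)
      then have A: "vnorm n (x - x0) < 1/16" by (rule power_less_imp_less_base) simp
      have "512 * m * \<delta> powr (1/2) \<le> L * \<delta> powr (1/2)" using L by (intro mult_right_mono) auto
      then have "m * (256 * \<delta> powr (1/2)) < m * 1" using 1 by simp
      then have "256 * \<delta> powr (1/2) < 1" using m1 by (simp only: mult_less_cancel_left_pos)
      then have s: "sqrt \<delta> < 1/16" using that(3) by (simp add: powr_half_sqrt)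
      have "\<delta> = sqrt \<delta> * sqrt \<delta>" using that(3) by simp
      also have "\<dots> < 1/16 * (1/16)" using s that(3) by (intro mult_strict_mono) auto
      finally have B: "\<delta> < 1/16" by simp
      have "1 \<le> \<delta> powr (- 1/2)"
      proof -
        have "1 powr (- 1/2) \<le> \<delta> powr (- 1/2)" using that(3) B by (intro powr_mono2') auto
        then show ?thesis by simp
      qed
      then have "L / 2 * 1 \<le> a \<delta>" unfolding a_def using L by (intro mult_left_mono) auto
      then show ?thesis using A B 1 by simp
    qed
    obtain x y \<delta> where xy: "x \<in> cB n 0 (7/8)" "y \<in> cB n 0 (7/8)" "\<delta> > 0"
      and g: "G (\<delta>\<^sup>2) + K * (vnorm n (x - x0))\<^sup>2 < u x - u y"
      and est: "c \<delta> \<le> A * a \<delta> powr d * (K + a \<delta> + (2 * K * vnorm n (x - x0) / a \<delta> + \<delta> powr \<alpha>) * (a \<delta> / \<delta>))"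
    proof -
      have "\<exists>x y \<delta>. x \<in> cB n 0 (7/8) \<and> y \<in> cB n 0 (7/8) \<and> \<delta> = vnorm n (x - y) \<and> \<delta> > 0
        \<and> G (\<delta>\<^sup>2) + K * (vnorm n (x - x0))\<^sup>2 < u x - u y
        \<and> c \<delta> \<le> A * a \<delta> powr d * (K + a \<delta> + (2 * K * vnorm n (x - x0) / a \<delta> + \<delta> powr \<alpha>) * (a \<delta> / \<delta>))"
      proof (rule doubling_inequality[OF ce u _ Gp K0 x0' y0 gt aG cG])
        fix x y \<delta> assume h: "x \<in> cB n 0 (7/8)" "y \<in> cB n 0 (7/8)" "\<delta> = vnorm n (x - y)" "\<delta> > 0"
          "G (\<delta>\<^sup>2) + K * (vnorm n (x - x0))\<^sup>2 < u x - u y"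
        note s = small[OF h(1,2,4,5)]
        have "vnorm n x < 3/4 + 1/16" "vnorm n y < 3/4 + 2 * (1/16)"
          using ball_interior[OF x0n, of x "1/16" y] s h(3) by auto
        moreover have "1 \<le> a \<delta>" "2 * C0 \<le> a \<delta>" using s L m1 by linarith+
        moreover have "2 * K * vnorm n (x - x0) \<le> a \<delta> / 4"
        proof -
          have "2 * K * vnorm n (x - x0) \<le> 2 * K * (1/16)" using s K0 by (intro mult_left_mono) auto
          also have "\<dots> = 64 * m" by (simp add: K_def)
          finally show ?thesis using s L by linarith
        qed
        moreover have "0 \<le> c \<delta>" "c \<delta> \<le> a \<delta> / \<delta>"
          using h(4) \<open>1 \<le> a \<delta>\<close> by (auto simp: c_def intro!: divide_left_mono)
        ultimately show "vnorm n x < 7/8 \<and> vnorm n y < 7/8 \<and> 1 \<le> a \<delta> \<and> 2 * C0 \<le> a \<delta> \<and> 2 * K * vnorm n (x - x0) \<le> a \<delta> / 4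
          \<and> 0 \<le> c \<delta> \<and> c \<delta> \<le> a \<delta> / \<delta>" by auto
      qed auto
      then show ?thesis using that by blast
    qed
    note s = small[OF xy g]
    define b where "b = a \<delta>"
    have b: "b \<ge> L / 2" "b \<ge> 1" "b > 0" using s L m1 by (auto simp: b_def)
    have bd: "\<delta> \<le> m / b"
    proof -
      have "b * \<delta> = L / 2 * \<delta> powr (1/2)"
      proof -
        have "\<delta> powr (- 1/2) * \<delta> powr 1 = \<delta> powr (1/2)" unfolding powr_add[symmetric] by simp
        then show ?thesis using xy(3) by (simp add: b_def a_def)
      qed
      then have "b * \<delta> \<le> m" using s by simp
      then show ?thesis using b by (simp add: field_simps)
    qed
    have ba: "1 / b \<le> b powr (- \<alpha>)"
    proof -
      have "b powr (- 1) \<le> b powr (- \<alpha>)" using b d by (intro powr_mono) auto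
      then show ?thesis using b by (simp add: powr_minus_divide)
    qed
    have mb: "m / b \<le> m * b powr (- \<alpha>)" using mult_left_mono[OF ba, of m] m1 by simp
    have t1: "K * \<delta> / b \<le> 512 * (m * b powr (- \<alpha>))"
    proof -
      have "K * \<delta> \<le> K * 1" using s K0 by (intro mult_left_mono) auto
      then have "K * \<delta> / b \<le> K / b" using b by (intro divide_right_mono) auto
      then show ?thesis using mb by (simp add: K_def)
    qed
    have t2: "\<delta> \<le> m * b powr (- \<alpha>)" using bd mb by linarith
    have t3: "2 * K * vnorm n (x - x0) / b \<le> 64 * (m * b powr (- \<alpha>))"
    proof -
      have "2 * K * vnorm n (x - x0) \<le> 2 * K * (1/16)" using s K0 by (intro mult_left_mono) auto
      then have "2 * K * vnorm n (x - x0) / b \<le> 64 * m / b" using b by (intro divide_right_mono) (auto simp: K_def)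
      then show ?thesis using mb by simp
    qed
    have t4: "\<delta> powr \<alpha> \<le> m * b powr (- \<alpha>)"
    proof -
      have "\<delta> powr \<alpha> \<le> (m / b) powr \<alpha>" using bd xy(3) d by (intro powr_mono2) auto
      also have "\<dots> = m powr \<alpha> * b powr (- \<alpha>)" using m1 b by (simp add: powr_divide powr_minus_divide)
      also have "\<dots> \<le> m powr 1 * b powr (- \<alpha>)" using m1 d by (intro mult_right_mono powr_mono) auto
      finally show ?thesis using m1 by simp
    qed
    have e1: "c \<delta> * (\<delta> / b) \<le> (A * b powr d * (K + b + (2 * K * vnorm n (x - x0) / b + \<delta> powr \<alpha>) * (b / \<delta>))) * (\<delta> / b)"
      using est b xy(3) unfolding b_def[symmetric] by (intro mult_right_mono) auto
    have e2: "c \<delta> * (\<delta> / b) = 1/2" using b xy(3) by (simp add: c_def b_def[symmetric])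
    have e3: "(A * b powr d * (K + b + (2 * K * vnorm n (x - x0) / b + \<delta> powr \<alpha>) * (b / \<delta>))) * (\<delta> / b)
        = A * b powr d * (K * \<delta> / b + \<delta> + 2 * K * vnorm n (x - x0) / b + \<delta> powr \<alpha>)"
      using b xy(3) by (simp add: field_simps)
    have "1/2 \<le> A * b powr d * (K * \<delta> / b + \<delta> + 2 * K * vnorm n (x - x0) / b + \<delta> powr \<alpha>)"
      using e1 unfolding e2 e3 .
    also have "\<dots> \<le> A * b powr d * (578 * (m * b powr (- \<alpha>)))"
      using t1 t2 t3 t4 A by (intro mult_left_mono) auto
    also have "\<dots> = 578 * A * m * (b powr d * b powr (- \<alpha>))" by simp
    also have "b powr d * b powr (- \<alpha>) = b powr (- (\<alpha> - d))" by (simp add: powr_add[symmetric])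
    finally have "1/2 \<le> 578 * A * m * b powr (- (\<alpha> - d))" .
    then have "1/2 \<le> 578 * A * m / b powr (\<alpha> - d)" unfolding powr_minus_divide by simp
    moreover have "b powr (\<alpha> - d) > 0" using b by simp
    ultimately have up: "b powr (\<alpha> - d) \<le> 1156 * A * m" by (simp add: pos_le_divide_eq)
    have "1156 * A * m < (L / 2) powr (\<alpha> - d)"
    proof -
      have C2: "C / 2 > (1156 * A) powr \<theta>"
      proof -
        have "(1156 * A) powr \<theta> > 0" using A by simp
        then show ?thesis using C(3) by linarith
      qed
      have "1156 * A = ((1156 * A) powr \<theta>) powr (\<alpha> - d)" using A \<theta> by (simp add: powr_powr)
      also have "\<dots> < (C / 2) powr (\<alpha> - d)" using C2 d by (intro powr_less_mono2) auto
      finally have "1156 * A * m < (C / 2) powr (\<alpha> - d) * m" using m1 by simp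
      also have "\<dots> = (C / 2) powr (\<alpha> - d) * (m powr \<theta>) powr (\<alpha> - d)"
      proof -
        have "(m powr \<theta>) powr (\<alpha> - d) = m" using m1 \<theta> by (simp add: powr_powr)
        then show ?thesis by simp
      qed
      also have "\<dots> = (C / 2 * m powr \<theta>) powr (\<alpha> - d)" by (rule powr_mult[symmetric])
      finally show ?thesis by (simp add: L_def)
    qed
    also have "\<dots> \<le> b powr (\<alpha> - d)" using b L d by (intro powr_mono2) auto
    finally show False using up by simp
  qed
  show ?thesis
    using C main unfolding \<theta>_def by (intro exI[of _ C]) auto
qed

subsection \<open>The Lipschitz estimate\<close>

text \<open>The exponent \<open>\<gamma>\<close> in the profile \<open>\<delta> - \<delta> powr (1 + \<gamma>) / 4\<close>.  Its concavity is of order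
  \<open>\<delta> powr (\<gamma> - 1)\<close>, and \<open>\<gamma>\<close> must be smaller than the margins left by the hypotheses on \<open>d\<close>.\<close>

definition gain_exponent :: "real \<Rightarrow> real \<Rightarrow> real \<Rightarrow> real" where
  "gain_exponent d \<alpha> \<beta> =
    min (min \<alpha> (\<beta> / 2)) (min (\<alpha> - d * (1 - \<beta>)) (\<beta> / 2 - (d - 1) * (1 - \<beta>))) / 2"

text \<open>With \<open>\<delta>\<close> bounded by a multiple of \<open>a powr (- 1 / (1 - \<beta>))\<close>, the two parts of the concavity estimate,
  from the modulus in \<open>x\<close> and from the penalisation, decay like a power of the slope, whose exponent is
  minus this number or less.\<close>

definition decay_exponent :: "real \<Rightarrow> real \<Rightarrow> real \<Rightarrow> real" where
  "decay_exponent d \<alpha> \<beta> = min ((\<alpha> - gain_exponent d \<alpha> \<beta>) / (1 - \<beta>) - d)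
    (1 - d + (\<beta> / 2 - gain_exponent d \<alpha> \<beta>) / (1 - \<beta>))"

definition Lipschitz_exponent :: "real \<Rightarrow> real \<Rightarrow> real \<Rightarrow> real" where
  "Lipschitz_exponent d \<alpha> \<beta> = max 1 ((1 + 1 / (1 - \<beta>)) / decay_exponent d \<alpha> \<beta>)"

text \<open>The given modulus enters twice: the distance of the contact points is at most
  \<open>(2 * m / a) powr (1 / (1 - \<beta>))\<close>, and the penalisation gradient is at most \<open>64 * m * \<delta> powr (\<beta> / 2)\<close>.
  After multiplication by \<open>\<delta> powr (1 - \<gamma>) / a\<close> the left-hand side of the concavity estimate is bounded
  below, while the right-hand side is at most a constant times
  \<open>m powr (1 + 1 / (1 - \<beta>)) * a powr (- decay_exponent d \<alpha> \<beta>)\<close>; so the slope is bounded.\<close>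

lemma Lipschitz_estimate:
  fixes d \<alpha> \<beta> A C0 :: real
  assumes d: "0 \<le> d" "d < 1 + \<beta> / (2 * (1 - \<beta>))" "d < \<alpha> / (1 - \<beta>)" and \<alpha>: "0 < \<alpha>" "\<alpha> \<le> 1"
    and \<beta>: "0 < \<beta>" "\<beta> < 1" and A: "A \<ge> 1" and C0: "C0 > 0"
  defines "\<theta> \<equiv> Lipschitz_exponent d \<alpha> \<beta>"
  shows "\<exists>C\<ge>1. \<forall>n u m. concavity_estimate n A C0 d \<alpha> u \<longrightarrow> continuous_on (B n 1) u \<longrightarrow> m \<ge> 1 \<longrightarrow>
    (\<forall>x\<in>cB n 0 (3/4). \<bar>u x\<bar> \<le> m) \<longrightarrow>
    (\<forall>x\<in>cB n 0 (3/4). \<forall>y\<in>cB n 0 (3/4). u x - u y \<le> m * vnorm n (x - y) powr \<beta>) \<longrightarrow>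
    (\<forall>x\<in>cB n 0 (1/2). \<forall>y\<in>cB n 0 (3/4). u x - u y \<le> C * m powr \<theta> * vnorm n (x - y))"
proof -
  define \<gamma> where "\<gamma> = gain_exponent d \<alpha> \<beta>"
  define \<mu> where "\<mu> = decay_exponent d \<alpha> \<beta>"
  have \<theta>_def: "\<theta> = max 1 ((1 + 1 / (1 - \<beta>)) / \<mu>)"
    unfolding \<theta>_def Lipschitz_exponent_def \<mu>_def ..
  have \<mu>_def: "\<mu> = min ((\<alpha> - \<gamma>) / (1 - \<beta>) - d) (1 - d + (\<beta> / 2 - \<gamma>) / (1 - \<beta>))"
    unfolding \<mu>_def decay_exponent_def \<gamma>_def ..
  note \<gamma>_def = \<gamma>_def[unfolded gain_exponent_def]
  have b1: "1 - \<beta> > 0" using \<beta> by simp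
  have d1: "\<alpha> - d * (1 - \<beta>) > 0" using d(3) b1 by (simp add: pos_less_divide_eq)
  have d2: "\<beta> / 2 - (d - 1) * (1 - \<beta>) > 0"
  proof -
    have "\<beta> / (2 * (1 - \<beta>)) = \<beta> / 2 / (1 - \<beta>)" by simp
    then have "d - 1 < \<beta> / 2 / (1 - \<beta>)" using d(2) by (simp only: less_diff_eq diff_less_eq add.commute)
    then have "(d - 1) * (1 - \<beta>) < \<beta> / 2" unfolding pos_less_divide_eq[OF b1] .
    then show ?thesis by linarith
  qed
  have \<gamma>0: "\<gamma> > 0" using \<alpha> \<beta> d1 d2 by (simp add: \<gamma>_def)
  have \<gamma>s: "2 * \<gamma> \<le> \<alpha>" "2 * \<gamma> \<le> \<beta> / 2" "2 * \<gamma> \<le> \<alpha> - d * (1 - \<beta>)" "2 * \<gamma> \<le> \<beta> / 2 - (d - 1) * (1 - \<beta>)"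
  proof -
    have e: "2 * \<gamma> = min (min \<alpha> (\<beta> / 2)) (min (\<alpha> - d * (1 - \<beta>)) (\<beta> / 2 - (d - 1) * (1 - \<beta>)))"
      unfolding \<gamma>_def by (simp only: times_divide_eq_right nonzero_mult_div_cancel_left[of 2] zero_neq_numeral[symmetric] not_False_eq_True)
    show "2 * \<gamma> \<le> \<alpha>" "2 * \<gamma> \<le> \<beta> / 2" "2 * \<gamma> \<le> \<alpha> - d * (1 - \<beta>)" "2 * \<gamma> \<le> \<beta> / 2 - (d - 1) * (1 - \<beta>)"
      unfolding e by (meson min.cobounded1 min.cobounded2 order_trans)+
  qed
  have \<gamma>1: "\<gamma> \<le> 1" using \<gamma>s \<alpha> \<gamma>0 by linarith
  define s1 where "s1 = (\<alpha> - \<gamma>) / (1 - \<beta>)"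
  define s2 where "s2 = (\<beta> / 2 - \<gamma>) / (1 - \<beta>)"
  have \<mu>: "\<mu> > 0" "\<mu> \<le> s1 - d" "\<mu> \<le> 1 - d + s2"
  proof -
    have "d * (1 - \<beta>) < \<alpha> - \<gamma>" using \<gamma>s(3) \<gamma>0 by linarith
    then have p1: "d < s1" using b1 by (simp add: s1_def pos_less_divide_eq)
    have "(d - 1) * (1 - \<beta>) < \<beta> / 2 - \<gamma>" using \<gamma>s(4) \<gamma>0 by linarith
    then have p2: "d - 1 < s2" using b1 by (simp add: s2_def pos_less_divide_eq)
    show "\<mu> > 0" using p1 p2 by (simp add: \<mu>_def s1_def s2_def)
    show "\<mu> \<le> s1 - d" "\<mu> \<le> 1 - d + s2" by (simp_all add: \<mu>_def s1_def s2_def)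
  qed
  define e1 where "e1 = 1 + 1 / (1 - \<beta>)"
  have \<theta>: "\<theta> \<ge> 1" "\<theta> * \<mu> \<ge> e1"
  proof -
    show "\<theta> \<ge> 1" by (simp add: \<theta>_def)
    have "e1 / \<mu> \<le> \<theta>" by (simp add: \<theta>_def e1_def)
    then show "\<theta> * \<mu> \<ge> e1" using \<mu>(1) by (simp add: pos_divide_le_eq)
  qed
  define C7 where "C7 = 4624 * A * 2 powr (1 / (1 - \<beta>)) / \<gamma>"
  have C7: "C7 > 0" using A \<gamma>0 by (simp add: C7_def)
  define C where "C = max (4 * C0 + 512) (4 * C7 powr (1 / \<mu>))"
  have C: "C \<ge> 512" "C \<ge> 4 * C0" "C \<ge> 4 * C7 powr (1 / \<mu>)" using C0 by (auto simp: C_def)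
  have main: "u x0 - u y0 \<le> C * m powr \<theta> * vnorm n (x0 - y0)"
    if ce: "concavity_estimate n A C0 d \<alpha> u" and u: "continuous_on (B n 1) u" and m1: "m \<ge> 1"
      and M: "\<forall>x\<in>cB n 0 (3/4). \<bar>u x\<bar> \<le> m"
      and Ho: "\<forall>x\<in>cB n 0 (3/4). \<forall>y\<in>cB n 0 (3/4). u x - u y \<le> m * vnorm n (x - y) powr \<beta>"
      and x0: "x0 \<in> cB n 0 (1/2)" and y0: "y0 \<in> cB n 0 (3/4)"
    for n u m x0 y0
  proof (rule ccontr)
    assume neg: "\<not> ?thesis"
    have x0': "x0 \<in> cB n 0 (3/4)" and x0n: "vnorm n x0 \<le> 1/2" using x0 by (auto simp: cB_def)
    have mm: "m \<le> m powr \<theta>" using powr_mono[OF \<theta>(1) m1] m1 by simp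
    define L where "L = C * m powr \<theta>"
    have L: "L \<ge> 512 * m" "L \<ge> 4 * C0" "L > 0"
    proof -
      have "512 * m \<le> C * m powr \<theta>" using C mm m1 by (intro mult_mono) auto
      then show "L \<ge> 512 * m" by (simp add: L_def)
      then show "L > 0" using m1 by linarith
      have "4 * C0 * 1 \<le> C * m powr \<theta>" using C mm m1 C0 by (intro mult_mono) auto
      then show "L \<ge> 4 * C0" by (simp add: L_def)
    qed
    define \<nu> where "\<nu> = (1 + \<gamma>) / 2"
    have \<nu>0: "\<nu> > 0" using \<gamma>0 by (simp add: \<nu>_def)
    define G where "G = (\<lambda>s::real. L * (s powr (1/2) - 1/4 * s powr \<nu>))"
    define G' where "G' = (\<lambda>s::real. L * (1/2 * s powr (1/2 - 1) - 1/4 * \<nu> * s powr (\<nu> - 1)))"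
    define G2 where "G2 = (\<lambda>s::real. L * (1/2 * (1/2 - 1) * s powr (1/2 - 2) - 1/4 * \<nu> * (\<nu> - 1) * s powr (\<nu> - 2)))"
    have Gp: "continuous_on {0..} G" "G 0 = 0" "\<And>s. s > 0 \<Longrightarrow> (G has_real_derivative G' s) (at s)"
      "\<And>s. s > 0 \<Longrightarrow> (G' has_real_derivative G2 s) (at s)"
    proof -
      note pp = powr_profile[where \<mu> = "1/2" and \<nu> = \<nu> and L = L and \<kappa> = "1/4"]
      show "continuous_on {0..} G" unfolding G_def by (rule pp(1)) (use \<nu>0 in auto)
      show "G 0 = 0" unfolding G_def by (rule pp(2)) (use \<nu>0 in auto)
      show "\<And>s. s > 0 \<Longrightarrow> (G has_real_derivative G' s) (at s)" unfolding G_def G'_def by (rule pp(3)) (use \<nu>0 in auto)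
      show "\<And>s. s > 0 \<Longrightarrow> (G' has_real_derivative G2 s) (at s)" unfolding G'_def G2_def by (rule pp(4)) (use \<nu>0 in auto)
    qed
    \<comment> \<open>In terms of the distance the profile is \<open>\<delta> - \<delta> powr (1 + \<gamma>) / 4\<close>.\<close>
    have Gs: "G (\<delta>\<^sup>2) = L * (\<delta> - 1/4 * (\<delta> powr \<gamma> * \<delta>))" if "\<delta> > 0" for \<delta>
    proof -
      have "\<delta> powr (2 * \<nu>) = \<delta> powr \<gamma> * \<delta> powr 1" unfolding powr_add[symmetric] by (rule arg_cong2[where f = "(powr)"]) (simp_all add: \<nu>_def)
      then show ?thesis using that by (simp add: G_def square_powr)
    qed
    define a where "a = (\<lambda>\<delta>::real. L * (1 - (1 + \<gamma>) / 4 * \<delta> powr \<gamma>))"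
    define c where "c = (\<lambda>\<delta>::real. L * (\<gamma> * (1 + \<gamma>) / 4) * (\<delta> powr \<gamma> / \<delta>))"
    have pw: "(\<delta>\<^sup>2) powr (1/2 - 1) = 1 / \<delta>" "(\<delta>\<^sup>2) powr (\<nu> - 1) = \<delta> powr \<gamma> / \<delta>"
      "\<delta>\<^sup>2 * (\<delta>\<^sup>2) powr (1/2 - 2) = 1 / \<delta>" "\<delta>\<^sup>2 * (\<delta>\<^sup>2) powr (\<nu> - 2) = \<delta> powr \<gamma> / \<delta>"
      if "\<delta> > 0" for \<delta> :: real
    proof -
      have e: "2 * (\<nu> - 1) = \<gamma> - 1" by (simp add: \<nu>_def field_simps)
      show 1: "(\<delta>\<^sup>2) powr (1/2 - 1) = 1 / \<delta>" using that by (simp add: square_powr powr_minus_divide)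
      show 2: "(\<delta>\<^sup>2) powr (\<nu> - 1) = \<delta> powr \<gamma> / \<delta>" unfolding square_powr[OF that] e using that by (simp add: powr_diff)
      have p: "x * x powr r = x powr (r + 1)" if "x > 0" for x r :: real
        using that by (simp add: powr_add)
      have d2: "\<delta>\<^sup>2 > 0" using that by simp
      show "\<delta>\<^sup>2 * (\<delta>\<^sup>2) powr (1/2 - 2) = 1 / \<delta>" unfolding p[OF d2] using 1 by simp
      show "\<delta>\<^sup>2 * (\<delta>\<^sup>2) powr (\<nu> - 2) = \<delta> powr \<gamma> / \<delta>"
      proof -
        have "\<nu> - 2 + 1 = \<nu> - 1" by simp
        then show ?thesis unfolding p[OF d2] using 2 by simp
      qed
    qed
    have G's: "G' (\<delta>\<^sup>2) = L * (1/2 * (1 / \<delta>) - 1/4 * \<nu> * (\<delta> powr \<gamma> / \<delta>))" if "\<delta> > 0" for \<delta>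
      unfolding G'_def pw(1,2)[OF that] ..
    have aG: "a \<delta> = 2 * \<delta> * G' (\<delta>\<^sup>2)" if "\<delta> > 0" for \<delta>
      unfolding G's[OF that] using that by (simp add: a_def \<nu>_def field_simps)
    have cG: "c \<delta> = - (4 * \<delta>\<^sup>2 * G2 (\<delta>\<^sup>2) + 2 * G' (\<delta>\<^sup>2))" if "\<delta> > 0" for \<delta>
    proof -
      have "\<delta>\<^sup>2 * G2 (\<delta>\<^sup>2) = L * (1/2 * (1/2 - 1) * (\<delta>\<^sup>2 * (\<delta>\<^sup>2) powr (1/2 - 2)) - 1/4 * \<nu> * (\<nu> - 1) * (\<delta>\<^sup>2 * (\<delta>\<^sup>2) powr (\<nu> - 2)))"
        by (simp add: G2_def algebra_simps)
      then have e: "4 * \<delta>\<^sup>2 * G2 (\<delta>\<^sup>2) = 4 * (L * (1/2 * (1/2 - 1) * (1 / \<delta>) - 1/4 * \<nu> * (\<nu> - 1) * (\<delta> powr \<gamma> / \<delta>)))"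
        unfolding pw(3,4)[OF that] by simp
      define T where "T = \<delta> powr \<gamma> / \<delta>"
      define S where "S = 1 / \<delta>"
      show ?thesis
        unfolding e G's[OF that] c_def T_def[symmetric] S_def[symmetric] \<nu>_def
        by (simp add: field_simps)
    qed
    \<comment> \<open>The factor \<open>512\<close> forces the first contact point into the ball of radius \<open>1 / 16\<close> around \<open>x0\<close>.\<close>
    define K where "K = 512 * m"
    have K0: "K \<ge> 0" using m1 by (simp add: K_def)
    have y_ne: "vnorm n (x0 - y0) > 0"
    proof (rule ccontr)
      assume "\<not> ?thesis"
      then have z: "vnorm n (x0 - y0) = 0" using vnorm_ge_0[of n "x0 - y0"] by linarith
      have "x0 - y0 \<in> Rn n" using x0 y0 by (auto simp: cB_def)
      then have "x0 = y0" using vnorm_eq_0 z by fastforce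
      then show False using neg by simp
    qed
    have gt: "G ((vnorm n (x0 - y0))\<^sup>2) < u x0 - u y0"
    proof -
      have "G ((vnorm n (x0 - y0))\<^sup>2) \<le> L * vnorm n (x0 - y0)"
        unfolding Gs[OF y_ne] using L y_ne by (intro mult_left_mono) auto
      then show ?thesis using neg unfolding L_def by linarith
    qed
    have small: "vnorm n (x - x0) < 1/16 \<and> \<delta> < 1/16 \<and> L / 2 * \<delta> < m * \<delta> powr \<beta>
        \<and> K * (vnorm n (x - x0))\<^sup>2 < m * \<delta> powr \<beta> \<and> a \<delta> \<ge> L / 2 \<and> a \<delta> \<le> L"
      if "x \<in> cB n 0 (3/4)" "y \<in> cB n 0 (3/4)" "\<delta> > 0" and \<delta>: "\<delta> = vnorm n (x - y)"
        and g: "G (\<delta>\<^sup>2) + K * (vnorm n (x - x0))\<^sup>2 < u x - u y" for x y \<delta>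
    proof -
      have "\<bar>u x\<bar> \<le> m" "\<bar>u y\<bar> \<le> m" using M that by auto
      then have um: "u x - u y \<le> 2 * m" by linarith
      have uh: "u x - u y \<le> m * \<delta> powr \<beta>" using Ho that(1,2) \<delta> by blast
      have "\<delta> \<le> 3/2" using vnorm_triangle_minus[of n x y] that(1,2) \<delta> by (simp add: cB_def)
      then have "\<delta> powr \<gamma> \<le> 2 powr \<gamma>" using that(3) \<gamma>0 by (intro powr_mono2) auto
      also have "\<dots> \<le> 2 powr 1" using \<gamma>1 by (intro powr_mono) auto
      finally have \<delta>\<gamma>: "\<delta> powr \<gamma> \<le> 2" by simp
      have Gl: "L / 2 * \<delta> \<le> G (\<delta>\<^sup>2)"
      proof -
        have "1/2 * \<delta> \<le> \<delta> - 1/4 * (\<delta> powr \<gamma> * \<delta>)"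
          using mult_right_mono[OF \<delta>\<gamma>, of \<delta>] that(3) by simp
        then have "L * (1/2 * \<delta>) \<le> L * (\<delta> - 1/4 * (\<delta> powr \<gamma> * \<delta>))" using L by (intro mult_left_mono) auto
        then show ?thesis by (simp add: Gs[OF that(3)])
      qed
      have nn: "0 \<le> K * (vnorm n (x - x0))\<^sup>2" "0 \<le> L / 2 * \<delta>" using K0 L that(3) by auto
      have 1: "K * (vnorm n (x - x0))\<^sup>2 < 2 * m" "L / 2 * \<delta> < 2 * m"
        "K * (vnorm n (x - x0))\<^sup>2 < m * \<delta> powr \<beta>" "L / 2 * \<delta> < m * \<delta> powr \<beta>"
        using g um uh Gl nn by argo+
      have "2 * m * (256 * (vnorm n (x - x0))\<^sup>2) < 2 * m * 1" using 1(1) by (simp add: K_def)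
      then have "256 * (vnorm n (x - x0))\<^sup>2 < 1" using m1 by (simp only: mult_less_cancel_left_pos)
      then have "(vnorm n (x - x0))\<^sup>2 < (1/16)\<^sup>2" by (simp add: power2_eq_square)
      then have A: "vnorm n (x - x0) < 1/16" by (rule power_less_imp_less_base) simp
      have "512 * m * \<delta> \<le> L * \<delta>" using L that(3) by (intro mult_right_mono) auto
      then have "m * (128 * \<delta>) < m * 1" using 1(2) by simp
      then have "128 * \<delta> < 1" using m1 by (simp only: mult_less_cancel_left_pos)
      then have B: "\<delta> < 1/16" by simp
      have "\<delta> powr \<gamma> \<le> 1 powr \<gamma>" using B that(3) \<gamma>0 by (intro powr_mono2) auto
      then have \<delta>1: "\<delta> powr \<gamma> \<le> 1" by simp
      have r: "0 \<le> (1 + \<gamma>) / 4 * \<delta> powr \<gamma>" "(1 + \<gamma>) / 4 * \<delta> powr \<gamma> \<le> 1/2 * 1"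
        using \<gamma>0 \<gamma>1 \<delta>1 by (simp, intro mult_mono) auto
      have "L * (1/2) \<le> a \<delta>" "a \<delta> \<le> L * 1" unfolding a_def using r L by (auto intro!: mult_left_mono)
      then show ?thesis using A B 1 by simp
    qed
    have kb: "2 * K * vnorm n (x - x0) \<le> 64 * m * \<delta> powr (\<beta> / 2)"
      if "K * (vnorm n (x - x0))\<^sup>2 < m * \<delta> powr \<beta>" "\<delta> > 0" for x \<delta>
    proof -
      have e: "(\<delta> powr (\<beta> / 2))\<^sup>2 = \<delta> powr \<beta>" by (simp add: power2_eq_square powr_add[symmetric])
      have "(2 * K * vnorm n (x - x0))\<^sup>2 = 4 * K * (K * (vnorm n (x - x0))\<^sup>2)" by (simp add: power2_eq_square)
      also have "\<dots> \<le> 4 * K * (m * \<delta> powr \<beta>)" using that K0 by (intro mult_left_mono) auto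
      also have "\<dots> = 2048 * (m\<^sup>2 * \<delta> powr \<beta>)" by (simp add: K_def power2_eq_square)
      also have "\<dots> \<le> 4096 * (m\<^sup>2 * \<delta> powr \<beta>)" by (intro mult_right_mono) auto
      also have "\<dots> = (64 * m * \<delta> powr (\<beta> / 2))\<^sup>2" unfolding power_mult_distrib e by simp
      finally have "(2 * K * vnorm n (x - x0))\<^sup>2 \<le> (64 * m * \<delta> powr (\<beta> / 2))\<^sup>2" .
      then show ?thesis by (rule power2_le_imp_le) (use m1 in simp)
    qed
    obtain x y \<delta> where xy: "x \<in> cB n 0 (3/4)" "y \<in> cB n 0 (3/4)" "\<delta> > 0" "\<delta> = vnorm n (x - y)"
      and g: "G (\<delta>\<^sup>2) + K * (vnorm n (x - x0))\<^sup>2 < u x - u y"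
      and est: "c \<delta> \<le> A * a \<delta> powr d * (K + a \<delta> + (2 * K * vnorm n (x - x0) / a \<delta> + \<delta> powr \<alpha>) * (a \<delta> / \<delta>))"
    proof -
      have "\<exists>x y \<delta>. x \<in> cB n 0 (3/4) \<and> y \<in> cB n 0 (3/4) \<and> \<delta> = vnorm n (x - y) \<and> \<delta> > 0
        \<and> G (\<delta>\<^sup>2) + K * (vnorm n (x - x0))\<^sup>2 < u x - u y
        \<and> c \<delta> \<le> A * a \<delta> powr d * (K + a \<delta> + (2 * K * vnorm n (x - x0) / a \<delta> + \<delta> powr \<alpha>) * (a \<delta> / \<delta>))"
      proof (rule doubling_inequality[OF ce u _ Gp K0 x0' y0 gt aG cG])
        fix x y \<delta> assume h: "x \<in> cB n 0 (3/4)" "y \<in> cB n 0 (3/4)" "\<delta> = vnorm n (x - y)" "\<delta> > 0"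
          "G (\<delta>\<^sup>2) + K * (vnorm n (x - x0))\<^sup>2 < u x - u y"
        note s = small[OF h(1,2,4,3,5)]
        have "vnorm n x < 1/2 + 1/16" "vnorm n y < 1/2 + 2 * (1/16)"
          using ball_interior[OF x0n, of x "1/16" y] s h(3) by auto
        moreover have a1: "1 \<le> a \<delta>" "2 * C0 \<le> a \<delta>" using s L m1 by linarith+
        moreover have "2 * K * vnorm n (x - x0) \<le> a \<delta> / 4"
        proof -
          have "2 * K * vnorm n (x - x0) \<le> 2 * K * (1/16)" using s K0 by (intro mult_left_mono) auto
          also have "\<dots> = 64 * m" by (simp add: K_def)
          finally show ?thesis using s L by linarith
        qed
        moreover have "0 \<le> c \<delta>" using L \<gamma>0 h(4) by (simp add: c_def)
        moreover have "c \<delta> \<le> a \<delta> / \<delta>"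
        proof -
          have "\<delta> powr \<gamma> \<le> 1 powr \<gamma>" using s h(4) \<gamma>0 by (intro powr_mono2) auto
          then have p1: "\<delta> powr \<gamma> \<le> 1" by simp
          have "\<gamma> * (1 + \<gamma>) \<le> 1 * 2" using \<gamma>0 \<gamma>1 by (intro mult_mono) auto
          then have "L * (\<gamma> * (1 + \<gamma>) / 4) * \<delta> powr \<gamma> \<le> L * (1/2) * 1"
            using p1 L \<gamma>0 by (intro mult_mono) auto
          then have "L * (\<gamma> * (1 + \<gamma>) / 4) * \<delta> powr \<gamma> / \<delta> \<le> a \<delta> / \<delta>" using s h(4) by (intro divide_right_mono) auto
          then show ?thesis by (simp add: c_def)
        qed
        ultimately show "vnorm n x < 3/4 \<and> vnorm n y < 3/4 \<and> 1 \<le> a \<delta> \<and> 2 * C0 \<le> a \<delta> \<and> 2 * K * vnorm n (x - x0) \<le> a \<delta> / 4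
          \<and> 0 \<le> c \<delta> \<and> c \<delta> \<le> a \<delta> / \<delta>" by auto
      qed auto
      then show ?thesis using that by blast
    qed
    note s = small[OF xy g]
    define b where "b = a \<delta>"
    have b: "b \<ge> L / 2" "b \<ge> 1" "b > 0" "b \<le> L" using s L m1 by (auto simp: b_def)
    \<comment> \<open>The Hoelder bound makes the distance small in terms of the slope.\<close>
    have bd: "\<delta> \<le> (2 * m / b) powr (1 / (1 - \<beta>))"
    proof -
      have "b / 2 * \<delta> \<le> L / 2 * \<delta>" using b xy(3) by (intro mult_right_mono) auto
      then have "b / 2 * \<delta> \<le> m * \<delta> powr \<beta>" using s by linarith
      moreover have "\<delta> = \<delta> powr (1 - \<beta>) * \<delta> powr \<beta>" using xy(3) by (simp add: powr_add[symmetric])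
      ultimately have "b / 2 * \<delta> powr (1 - \<beta>) * \<delta> powr \<beta> \<le> m * \<delta> powr \<beta>" by (metis mult.assoc)
      then have "b / 2 * \<delta> powr (1 - \<beta>) \<le> m" using xy(3) by simp
      then have "\<delta> powr (1 - \<beta>) \<le> 2 * m / b" using b by (simp add: field_simps)
      then have "(\<delta> powr (1 - \<beta>)) powr (1 / (1 - \<beta>)) \<le> (2 * m / b) powr (1 / (1 - \<beta>))"
        using b1 by (intro powr_mono2) auto
      then show ?thesis using b1 xy(3) by (simp add: powr_powr)
    qed
    define Q where "Q = (2 * m) powr (1 / (1 - \<beta>))"
    have \<delta>s: "\<delta> powr t \<le> Q * b powr (- (t / (1 - \<beta>)))" if t: "0 \<le> t" "t \<le> 1" for t
    proof -
      have "\<delta> powr t \<le> ((2 * m / b) powr (1 / (1 - \<beta>))) powr t" using bd xy(3) t by (intro powr_mono2) auto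
      also have "\<dots> = (2 * m / b) powr (t / (1 - \<beta>))" by (simp add: powr_powr)
      also have "\<dots> = (2 * m) powr (t / (1 - \<beta>)) * b powr (- (t / (1 - \<beta>)))"
        using m1 b by (simp add: powr_divide powr_minus_divide)
      also have "\<dots> \<le> Q * b powr (- (t / (1 - \<beta>)))"
        unfolding Q_def using m1 t b1 by (intro mult_right_mono powr_mono divide_right_mono) auto
      finally show ?thesis .
    qed
    have Q0: "Q > 0" using m1 by (simp add: Q_def)
    define W where "W = Q * b powr (- \<mu>)"
    have W1: "b powr d * \<delta> powr (\<alpha> - \<gamma>) \<le> W"
    proof -
      have "\<delta> powr (\<alpha> - \<gamma>) \<le> Q * b powr (- s1)" unfolding s1_def using \<gamma>s \<gamma>0 \<alpha> by (intro \<delta>s) auto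
      then have "b powr d * \<delta> powr (\<alpha> - \<gamma>) \<le> b powr d * (Q * b powr (- s1))" by (intro mult_left_mono) auto
      also have "\<dots> = Q * b powr (d - s1)" by (simp add: powr_add[symmetric])
      also have "\<dots> \<le> Q * b powr (- \<mu>)" using \<mu> b Q0 by (intro mult_left_mono powr_mono) auto
      finally show ?thesis by (simp add: W_def)
    qed
    have W2: "b powr d * (\<delta> powr (\<beta> / 2 - \<gamma>) / b) \<le> W"
    proof -
      have "\<delta> powr (\<beta> / 2 - \<gamma>) \<le> Q * b powr (- s2)" unfolding s2_def using \<gamma>s \<gamma>0 \<beta> by (intro \<delta>s) auto
      then have "b powr d * (\<delta> powr (\<beta> / 2 - \<gamma>) / b) \<le> b powr d * (Q * b powr (- s2) / b)"
        using b by (intro mult_left_mono divide_right_mono) auto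
      also have "\<dots> = Q * (b powr d * b powr (- s2) * b powr (- 1))" using b by (simp add: powr_minus_divide)
      also have "\<dots> = Q * b powr (d - s2 - 1)"
      proof -
        have "d - s2 - 1 = d + - s2 + - 1" by simp
        then show ?thesis unfolding powr_add[symmetric] by (simp only:)
      qed
      also have "\<dots> \<le> Q * b powr (- \<mu>)" using \<mu> b Q0 by (intro mult_left_mono powr_mono) auto
      finally show ?thesis by (simp add: W_def)
    qed
    have W3: "b powr d * \<delta> powr (1 - \<gamma>) \<le> W"
    proof -
      have "\<delta> powr (1 - \<gamma>) \<le> \<delta> powr (\<alpha> - \<gamma>)" using s xy(3) \<alpha> by (intro powr_mono') auto
      then have "b powr d * \<delta> powr (1 - \<gamma>) \<le> b powr d * \<delta> powr (\<alpha> - \<gamma>)" by (intro mult_left_mono) auto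
      then show ?thesis using W1 by linarith
    qed
    \<comment> \<open>Multiply the concavity estimate by \<open>\<delta> powr (1 - \<gamma>) / b\<close>.\<close>
    define f where "f = \<delta> powr (1 - \<gamma>) / b"
    have f0: "f \<ge> 0" using b by (simp add: f_def)
    have \<delta>p: "\<delta> powr (1 - \<gamma>) = \<delta> / \<delta> powr \<gamma>" "\<delta> powr (\<alpha> - \<gamma>) = \<delta> powr \<alpha> / \<delta> powr \<gamma>"
      "\<delta> powr (\<beta> / 2 - \<gamma>) = \<delta> powr (\<beta> / 2) / \<delta> powr \<gamma>"
      using xy(3) by (simp_all add: powr_diff)
    have \<delta>g: "\<delta> powr \<gamma> > 0" using xy(3) by simp
    have lower: "\<gamma> / 4 \<le> c \<delta> * f"
    proof -
      have "c \<delta> * f = L * (\<gamma> * (1 + \<gamma>) / 4) / b" using xy(3) \<delta>g by (simp add: c_def f_def \<delta>p)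
      moreover have "L * (\<gamma> * (1 + \<gamma>) / 4) / b \<ge> \<gamma> / 4"
      proof -
        have "\<gamma> / 4 * b \<le> \<gamma> * (1 + \<gamma>) / 4 * L" using b \<gamma>0 by (intro mult_mono) (auto simp: algebra_simps)
        then have "\<gamma> / 4 * b \<le> L * (\<gamma> * (1 + \<gamma>) / 4)" by (simp only: mult.commute[of L])
        then show ?thesis unfolding pos_le_divide_eq[OF b(3)] .
      qed
      ultimately show ?thesis by simp
    qed
    define k where "k = 2 * K * vnorm n (x - x0)"
    have k: "k \<le> 64 * m * \<delta> powr (\<beta> / 2)" unfolding k_def by (rule kb) (use s xy in auto)
    have s1: "c \<delta> * f \<le> (A * b powr d * (K + b + (k / b + \<delta> powr \<alpha>) * (b / \<delta>))) * f"
      using est f0 unfolding b_def[symmetric] k_def[symmetric] by (intro mult_right_mono) auto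
    have s2: "(A * b powr d * (K + b + (k / b + \<delta> powr \<alpha>) * (b / \<delta>))) * f
        = A * (b powr d * ((K + b) * f + (k / \<delta> powr \<gamma> / b + \<delta> powr (\<alpha> - \<gamma>))))"
    proof -
      have 1: "b / \<delta> * f = 1 / \<delta> powr \<gamma>" using b xy(3) \<delta>g by (simp add: f_def \<delta>p)
      have "(k / b + \<delta> powr \<alpha>) * (b / \<delta>) * f = (k / b + \<delta> powr \<alpha>) * (1 / \<delta> powr \<gamma>)"
        unfolding mult.assoc 1 ..
      also have "\<dots> = k / \<delta> powr \<gamma> / b + \<delta> powr (\<alpha> - \<gamma>)" unfolding \<delta>p by (simp add: add_divide_distrib mult.commute)
      finally have 2: "(k / b + \<delta> powr \<alpha>) * (b / \<delta>) * f = k / \<delta> powr \<gamma> / b + \<delta> powr (\<alpha> - \<gamma>)" .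
      have "A * b powr d * (K + b + Z) * f = A * (b powr d * ((K + b) * f + Z * f))" for Z :: real
        by (simp add: distrib_right)
      then show ?thesis unfolding 2[symmetric] .
    qed
    have s3: "A * (b powr d * ((K + b) * f + (k / \<delta> powr \<gamma> / b + \<delta> powr (\<alpha> - \<gamma>))))
        \<le> A * (b powr d * (513 * m * \<delta> powr (1 - \<gamma>) + (64 * m * (\<delta> powr (\<beta> / 2 - \<gamma>) / b) + \<delta> powr (\<alpha> - \<gamma>))))"
    proof -
      have "K + b \<le> 513 * m * b"
      proof -
        have "512 * m * 1 \<le> 512 * m * b" "1 * b \<le> m * b" using m1 b by (intro mult_mono; simp)+
        then show ?thesis unfolding K_def by linarith
      qed
      then have "(K + b) * f \<le> 513 * m * b * f" using f0 by (intro mult_right_mono) simp_all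
      also have "\<dots> = 513 * m * \<delta> powr (1 - \<gamma>)" using b by (simp add: f_def)
      finally have i1: "(K + b) * f \<le> 513 * m * \<delta> powr (1 - \<gamma>)" .
      have "k / \<delta> powr \<gamma> / b \<le> 64 * m * \<delta> powr (\<beta> / 2) / \<delta> powr \<gamma> / b"
        using k \<delta>g b by (intro divide_right_mono) simp_all
      also have "\<dots> = 64 * m * (\<delta> powr (\<beta> / 2 - \<gamma>) / b)" unfolding \<delta>p(3) times_divide_eq_right ..
      finally have i2: "k / \<delta> powr \<gamma> / b \<le> 64 * m * (\<delta> powr (\<beta> / 2 - \<gamma>) / b)" .
      show ?thesis using A by (intro mult_left_mono add_mono order_refl i1 i2) simp_all
    qed
    have "c \<delta> * f \<le> A * (b powr d * (513 * m * \<delta> powr (1 - \<gamma>) + (64 * m * (\<delta> powr (\<beta> / 2 - \<gamma>) / b) + \<delta> powr (\<alpha> - \<gamma>))))"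
      by (rule order_trans[OF order_trans[OF s1 eq_refl[OF s2]] s3])
    moreover have "A * (P * (513 * m * R + (64 * m * S + T))) \<le> 578 * A * m * W"
      if "P * R \<le> W" "P * S \<le> W" "P * T \<le> W" for P R S T
    proof -
      have "W > 0" using Q0 b by (simp add: W_def)
      then have "1 * W \<le> m * W" using m1 by (intro mult_right_mono) simp_all
      then have "P * T \<le> m * W" using that(3) by linarith
      moreover have "m * (P * R) \<le> m * W" "m * (P * S) \<le> m * W" using that m1 by (intro mult_left_mono; simp)+
      ultimately have "513 * (m * (P * R)) + 64 * (m * (P * S)) + P * T \<le> 578 * (m * W)" by linarith
      then have "A * (513 * (m * (P * R)) + 64 * (m * (P * S)) + P * T) \<le> A * (578 * (m * W))"
        using A by (intro mult_left_mono) simp_all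
      then show ?thesis by (simp only: distrib_left mult_ac add_ac)
    qed
    ultimately have "c \<delta> * f \<le> 578 * A * m * W" using W1 W2 W3 order_trans by blast
    then have "\<gamma> / 4 \<le> 578 * A * m * W" using lower by linarith
    then have "\<gamma> / 4 \<le> 578 * A * m * Q / b powr \<mu>" unfolding W_def powr_minus_divide by simp
    moreover have "b powr \<mu> > 0" using b by simp
    ultimately have "\<gamma> / 4 * b powr \<mu> \<le> 578 * A * m * Q" by (simp add: pos_le_divide_eq)
    then have "b powr \<mu> \<le> 2312 * A / \<gamma> * (m * Q)" using \<gamma>0 by (simp add: field_simps)
    also have "m * Q = 2 powr (1 / (1 - \<beta>)) * m powr e1"
      using m1 by (simp add: Q_def e1_def powr_mult powr_add)
    finally have up: "b powr \<mu> \<le> C7 / 2 * m powr e1" by (simp add: C7_def mult_ac)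
    have "C7 * m powr e1 \<le> (L / 2) powr \<mu>"
    proof -
      have C2: "C / 2 \<ge> C7 powr (1 / \<mu>)"
      proof -
        have "C7 powr (1 / \<mu>) > 0" using C7 by simp
        then show ?thesis using C(3) by linarith
      qed
      have "C7 = (C7 powr (1 / \<mu>)) powr \<mu>" using C7 \<mu> by (simp add: powr_powr)
      also have "\<dots> \<le> (C / 2) powr \<mu>" using C2 \<mu> by (intro powr_mono2) auto
      finally have "C7 * m powr e1 \<le> (C / 2) powr \<mu> * m powr (\<theta> * \<mu>)"
        using \<theta> m1 by (intro mult_mono powr_mono) auto
      also have "\<dots> = (C / 2 * m powr \<theta>) powr \<mu>" unfolding powr_mult powr_powr ..
      finally show ?thesis by (simp add: L_def)
    qed
    also have "\<dots> \<le> b powr \<mu>" using b L \<mu> by (intro powr_mono2) auto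
    finally have "C7 * m powr e1 \<le> C7 / 2 * m powr e1" using up by linarith
    moreover have "C7 * m powr e1 > 0" using C7 m1 by simp
    ultimately show False by simp
  qed
  show ?thesis
    using C main by (intro exI[of _ C]) auto
qed

section \<open>Norms and conclusion\<close>

lemma concavity_estimate_solution:
  assumes par: "n \<ge> 1" "p \<le> q" "-1 < p" "0 < lam" "lam < Lam" "0 < \<alpha>" "\<alpha> \<le> 1" "Cf > 0"
  shows "\<exists>A\<ge>1. \<forall>F f u. structural n (B n 1) lam Lam p q \<alpha> C0 Cf F f \<longrightarrow>
    visc_solution n (B n 1) F f u \<longrightarrow> concavity_estimate n A C0 (q - p) \<alpha> u"
proof -
  note b = concavity_bound[OF par, of C0]
  from b obtain A where A1: "A \<ge> 1" and A: "\<forall>F f u x0 y0 kv a c K. structural n (B n 1) lam Lam p q \<alpha> C0 Cf F f \<longrightarrow>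
    visc_solution n (B n 1) F f u \<longrightarrow> x0 \<in> B n 1 \<longrightarrow> y0 \<in> B n 1 \<longrightarrow> x0 \<noteq> y0 \<longrightarrow> kv \<in> Rn n \<longrightarrow>
    1 \<le> a \<longrightarrow> 2 * C0 \<le> a \<longrightarrow> vnorm n kv \<le> a / 4 \<longrightarrow> 0 \<le> K \<longrightarrow> 0 \<le> c \<longrightarrow> c \<le> a / vnorm n (x0 - y0) \<longrightarrow>
    touched n u x0 y0 kv (vscale (1 / vnorm n (x0 - y0)) (x0 - y0)) a (a / vnorm n (x0 - y0)) c K \<longrightarrow>
    c \<le> A * a powr (q - p) * (K + a + (vnorm n kv / a + vnorm n (x0 - y0) powr \<alpha>) * (a / vnorm n (x0 - y0)))"
    by (elim exE conjE)
  have "concavity_estimate n A C0 (q - p) \<alpha> u"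
    if "structural n (B n 1) lam Lam p q \<alpha> C0 Cf F f" "visc_solution n (B n 1) F f u" for F f u
    unfolding concavity_estimate_def
    by (intro ballI allI impI) (rule A[rule_format, OF that]; assumption)
  then show ?thesis using A1 by (intro exI[of _ A] conjI allI impI)
qed

lemma ball_two_points:
  assumes "n \<ge> 1" "r > 0"
  shows "0 \<in> B n r" "\<exists>x\<in>B n r. x \<noteq> 0"
proof -
  show "0 \<in> B n r" using assms by (simp add: B_def)
  define c where "c = r / (2 * real n)"
  define x :: point where "x = (\<lambda>i. if i = 0 then c else 0)"
  have c: "c > 0" using assms by (simp add: c_def)
  have "vnorm n x \<le> real n * c" by (rule vnorm_le_bound) (use c in \<open>auto simp: x_def\<close>)
  also have "\<dots> < r" using assms by (simp add: c_def)
  finally have "x \<in> B n r" using assms by (simp add: B_def Rn_iff x_def)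
  moreover have "x 0 \<noteq> 0" using c by (simp add: x_def)
  then have "x \<noteq> 0" by auto
  ultimately show "\<exists>x\<in>B n r. x \<noteq> 0" by blast
qed

lemma holder_quotients_nonempty:
  assumes "n \<ge> 1" "r > 0"
  shows "holder_quotients n \<beta> (B n r) u \<noteq> {}"
  using ball_two_points[OF assms] unfolding holder_quotients_def by blast

lemma vnorm_diff_pos:
  assumes "x \<in> Rn n" "y \<in> Rn n" "x \<noteq> y"
  shows "vnorm n (x - y) > 0"
proof -
  have "x - y \<in> Rn n" using assms by simp
  then have "vnorm n (x - y) \<noteq> 0" using vnorm_eq_0[of "x - y" n] assms by simp
  then show ?thesis using vnorm_ge_0[of n "x - y"] by linarith
qed

lemma Lip_norm_le:
  assumes n: "n \<ge> 1" and r: "r > 0" and N: "\<And>x. x \<in> B n r \<Longrightarrow> \<bar>u x\<bar> \<le> N"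
    and L: "\<And>x y. x \<in> B n r \<Longrightarrow> y \<in> B n r \<Longrightarrow> u x - u y \<le> L * vnorm n (x - y)"
  shows "u \<in> Lip n (B n r)" "Lip_norm n (B n r) u \<le> N + L"
proof -
  have q: "t \<le> L" if "t \<in> holder_quotients n 1 (B n r) u" for t
  proof -
    from that obtain x y where xy: "x \<in> B n r" "y \<in> B n r" "x \<noteq> y" and t: "t = \<bar>u x - u y\<bar> / vnorm n (x - y) powr 1"
      unfolding holder_quotients_def by blast
    have p: "vnorm n (x - y) > 0" using xy by (intro vnorm_diff_pos) (auto simp: B_def)
    have "u x - u y \<le> L * vnorm n (x - y)" "u y - u x \<le> L * vnorm n (x - y)"
      using L[OF xy(1,2)] L[OF xy(2,1)] vnorm_commute[of n x y] by simp_all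
    then have "\<bar>u x - u y\<bar> \<le> L * vnorm n (x - y)" by linarith
    then show ?thesis using p by (simp add: t pos_divide_le_eq)
  qed
  have "bounded (u ` B n r)" using N by (auto intro!: boundedI[where B = N])
  moreover have "bdd_above (holder_quotients n 1 (B n r) u)" using q by (rule bdd_aboveI)
  ultimately show "u \<in> Lip n (B n r)" by (simp add: holder_space_def)
  have "B n r \<noteq> {}" using ball_two_points[OF n r] by blast
  then have "sup_norm (B n r) u \<le> N" unfolding sup_norm_def using N by (intro cSUP_least)
  moreover have "Sup (holder_quotients n 1 (B n r) u) \<le> L"
    using holder_quotients_nonempty[OF n r] q by (rule cSup_least)
  ultimately show "Lip_norm n (B n r) u \<le> N + L" unfolding holder_norm_def by linarith
qed

lemma abs_le_sup_norm:
  assumes "bounded (u ` S)" "x \<in> S"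
  shows "\<bar>u x\<bar> \<le> sup_norm S u"
proof -
  obtain b where "\<forall>y\<in>u ` S. norm y \<le> b" using assms(1) unfolding bounded_iff by blast
  then have "bdd_above ((\<lambda>x. \<bar>u x\<bar>) ` S)" by (intro bdd_aboveI[where M = b]) auto
  then show ?thesis unfolding sup_norm_def using assms(2) by (rule cSUP_upper[rotated])
qed

lemma holder_norm_bounds:
  assumes n: "n \<ge> 1" and r: "r > 0" and u: "u \<in> holder_space n \<beta> (B n r)"
  shows "holder_norm n \<beta> (B n r) u \<ge> 0"
    and "x \<in> B n r \<Longrightarrow> \<bar>u x\<bar> \<le> holder_norm n \<beta> (B n r) u"
    and "x \<in> B n r \<Longrightarrow> y \<in> B n r \<Longrightarrow> u x - u y \<le> holder_norm n \<beta> (B n r) u * vnorm n (x - y) powr \<beta>"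
proof -
  define H where "H = Sup (holder_quotients n \<beta> (B n r) u)"
  have bu: "bounded (u ` B n r)" and bq: "bdd_above (holder_quotients n \<beta> (B n r) u)"
    using u by (auto simp: holder_space_def)
  have H0: "H \<ge> 0"
  proof -
    obtain t where t: "t \<in> holder_quotients n \<beta> (B n r) u" using holder_quotients_nonempty[OF n r] by blast
    then have "t \<ge> 0" unfolding holder_quotients_def by auto
    moreover have "t \<le> H" unfolding H_def using t bq by (rule cSup_upper)
    ultimately show ?thesis by linarith
  qed
  have s0: "sup_norm (B n r) u \<ge> 0" using abs_le_sup_norm[OF bu ball_two_points(1)[OF n r]] by linarith
  show "holder_norm n \<beta> (B n r) u \<ge> 0" using H0 s0 by (simp add: holder_norm_def H_def)
  show "\<bar>u x\<bar> \<le> holder_norm n \<beta> (B n r) u" if "x \<in> B n r"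
    using abs_le_sup_norm[OF bu that] H0 by (simp add: holder_norm_def H_def)
  show "u x - u y \<le> holder_norm n \<beta> (B n r) u * vnorm n (x - y) powr \<beta>" if xy: "x \<in> B n r" "y \<in> B n r"
  proof (cases "x = y")
    case False
    have p: "vnorm n (x - y) powr \<beta> > 0" using vnorm_diff_pos[of x n y] xy False by (auto simp: B_def)
    have "\<bar>u x - u y\<bar> / vnorm n (x - y) powr \<beta> \<in> holder_quotients n \<beta> (B n r) u"
      using xy False unfolding holder_quotients_def by blast
    then have "\<bar>u x - u y\<bar> / vnorm n (x - y) powr \<beta> \<le> H" unfolding H_def using bq by (rule cSup_upper)
    then have "\<bar>u x - u y\<bar> \<le> H * vnorm n (x - y) powr \<beta>" using p by (simp only: pos_divide_le_eq)
    also have "\<dots> \<le> holder_norm n \<beta> (B n r) u * vnorm n (x - y) powr \<beta>"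
      using s0 p by (intro mult_right_mono) (simp_all add: holder_norm_def H_def)
    finally show ?thesis by linarith
  qed (use s0 H0 in \<open>simp add: holder_norm_def H_def\<close>)
qed

text \<open>Since \<open>q - p < \<alpha> \<le> 1\<close>, the conditions of \<open>Lipschitz_estimate\<close> hold for the exponent \<open>1 / 2\<close>, for which
  \<open>Hoelder_half_estimate\<close> provides the modulus from the supremum alone.  Only the supremum over a smaller
  ball enters, so the solution may be unbounded near the boundary.\<close>

lemma Lipschitz_of_bounded:
  assumes par: "n \<ge> 1" "p \<le> q" "-1 < p" "0 < lam" "lam < Lam" "0 < \<alpha>" "\<alpha> \<le> 1" "Cf > 0"
    and C0: "C0 > 0" and d: "q - p < \<alpha>"
  defines "\<theta> \<equiv> max 1 (Lipschitz_exponent (q - p) \<alpha> (1/2) / (\<alpha> - (q - p)))"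
  shows "\<exists>C>0. \<forall>F f u M. structural n (B n 1) lam Lam p q \<alpha> C0 Cf F f \<longrightarrow> continuous_on (B n 1) u \<longrightarrow>
    visc_solution n (B n 1) F f u \<longrightarrow> M \<ge> 0 \<longrightarrow> (\<forall>x\<in>cB n 0 (7/8). \<bar>u x\<bar> \<le> M) \<longrightarrow>
    u \<in> Lip n (B n (1/2)) \<and> Lip_norm n (B n (1/2)) u \<le> C * (M + 1) powr \<theta>"
proof -
  define \<theta>2 where "\<theta>2 = Lipschitz_exponent (q - p) \<alpha> (1/2)"
  define \<theta>1 where "\<theta>1 = 1 / (\<alpha> - (q - p))"
  have \<theta>: "\<theta> \<ge> 1" "\<theta>1 * \<theta>2 \<le> \<theta>" by (simp_all add: \<theta>_def \<theta>1_def \<theta>2_def)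
  have \<theta>1: "\<theta>1 \<ge> 1" using d par by (simp add: \<theta>1_def)
  from concavity_estimate_solution[OF par, of C0]
  obtain A where A: "A \<ge> 1" and ce: "\<forall>F f u. structural n (B n 1) lam Lam p q \<alpha> C0 Cf F f \<longrightarrow>
    visc_solution n (B n 1) F f u \<longrightarrow> concavity_estimate n A C0 (q - p) \<alpha> u" by (elim exE conjE)
  from Hoelder_half_estimate[of "q - p" \<alpha> A C0] par d A C0
  obtain C1 where C1: "C1 \<ge> 1" and H: "\<forall>n u M. concavity_estimate n A C0 (q - p) \<alpha> u \<longrightarrow> continuous_on (B n 1) u \<longrightarrow>
    (\<forall>x\<in>cB n 0 (7/8). \<bar>u x\<bar> \<le> M) \<longrightarrow> (\<forall>x\<in>cB n 0 (3/4). \<forall>y\<in>cB n 0 (7/8).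
      u x - u y \<le> C1 * (M + 1) powr \<theta>1 * vnorm n (x - y) powr (1/2))"
    unfolding \<theta>1_def by auto
  have "\<exists>C\<ge>1. \<forall>n u m. concavity_estimate n A C0 (q - p) \<alpha> u \<longrightarrow> continuous_on (B n 1) u \<longrightarrow> m \<ge> 1 \<longrightarrow>
    (\<forall>x\<in>cB n 0 (3/4). \<bar>u x\<bar> \<le> m) \<longrightarrow>
    (\<forall>x\<in>cB n 0 (3/4). \<forall>y\<in>cB n 0 (3/4). u x - u y \<le> m * vnorm n (x - y) powr (1/2)) \<longrightarrow>
    (\<forall>x\<in>cB n 0 (1/2). \<forall>y\<in>cB n 0 (3/4). u x - u y \<le> C * m powr \<theta>2 * vnorm n (x - y))"
    unfolding \<theta>2_def by (rule Lipschitz_estimate) (use par d A C0 in auto)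
  then obtain C2 where C2: "C2 \<ge> 1" and L: "\<forall>n u m. concavity_estimate n A C0 (q - p) \<alpha> u \<longrightarrow> continuous_on (B n 1) u \<longrightarrow> m \<ge> 1 \<longrightarrow>
    (\<forall>x\<in>cB n 0 (3/4). \<bar>u x\<bar> \<le> m) \<longrightarrow>
    (\<forall>x\<in>cB n 0 (3/4). \<forall>y\<in>cB n 0 (3/4). u x - u y \<le> m * vnorm n (x - y) powr (1/2)) \<longrightarrow>
    (\<forall>x\<in>cB n 0 (1/2). \<forall>y\<in>cB n 0 (3/4). u x - u y \<le> C2 * m powr \<theta>2 * vnorm n (x - y))"
    by (elim exE conjE)
  define C3 where "C3 = C2 * C1 powr \<theta>2"
  have C3: "C3 \<ge> 0" using C2 by (simp add: C3_def)
  have main: "u \<in> Lip n (B n (1/2)) \<and> Lip_norm n (B n (1/2)) u \<le> (1 + C3) * (M + 1) powr \<theta>"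
    if st: "structural n (B n 1) lam Lam p q \<alpha> C0 Cf F f" and u: "continuous_on (B n 1) u"
      and sol: "visc_solution n (B n 1) F f u" and M0: "M \<ge> 0" and M: "\<forall>x\<in>cB n 0 (7/8). \<bar>u x\<bar> \<le> M" for F f u M
  proof -
    note e = ce[rule_format, OF st sol]
    define m where "m = C1 * (M + 1) powr \<theta>1"
    have "1 * (M + 1) powr 1 \<le> m" unfolding m_def using C1 \<theta>1 M0 by (intro mult_mono powr_mono) simp_all
    then have m: "M + 1 \<le> m" using M0 by simp
    have sub: "cB n 0 (3/4) \<subseteq> cB n 0 (7/8)" "B n (1/2) \<subseteq> cB n 0 (1/2)" "B n (1/2) \<subseteq> cB n 0 (3/4)"
      by (auto simp: cB_def B_def)
    have h: "\<forall>x\<in>cB n 0 (3/4). \<forall>y\<in>cB n 0 (3/4). u x - u y \<le> m * vnorm n (x - y) powr (1/2)"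
      unfolding m_def by (intro ballI H[rule_format, OF e u M[rule_format]]) (use sub in auto)
    have ml: "\<forall>x\<in>cB n 0 (3/4). \<bar>u x\<bar> \<le> m"
    proof
      fix x assume "x \<in> cB n 0 (3/4)"
      then have "\<bar>u x\<bar> \<le> M" using M sub(1) by (meson subsetD)
      then show "\<bar>u x\<bar> \<le> m" using m by linarith
    qed
    have m1: "m \<ge> 1" using m M0 by linarith
    note l = L[rule_format, OF e u m1 ml[rule_format] h[rule_format]]
    define D where "D = C2 * m powr \<theta>2"
    have D: "D \<le> C3 * (M + 1) powr \<theta>"
    proof -
      have "D = C3 * (M + 1) powr (\<theta>1 * \<theta>2)" unfolding D_def m_def C3_def powr_mult powr_powr by simp
      also have "\<dots> \<le> C3 * (M + 1) powr \<theta>" using C3 \<theta> M0 by (intro mult_left_mono powr_mono) simp_all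
      finally show ?thesis .
    qed
    have MB: "\<bar>u x\<bar> \<le> M" if "x \<in> B n (1/2)" for x using M sub that by (meson subsetD)
    have LB: "u x - u y \<le> D * vnorm n (x - y)" if "x \<in> B n (1/2)" "y \<in> B n (1/2)" for x y
      unfolding D_def by (rule l) (use that sub in auto)
    have half: "(0::real) < 1 / 2" by simp
    note nl = Lip_norm_le[OF par(1) half MB LB]
    have "M + 1 \<le> (M + 1) powr \<theta>" using powr_mono[OF \<theta>(1), of "M + 1"] M0 by simp
    then have "M + D \<le> (1 + C3) * (M + 1) powr \<theta>" using D by (simp add: distrib_right)
    then show ?thesis using nl by linarith
  qed
  have "1 + C3 > 0" using C3 by linarith
  then show ?thesis by (rule exI[of _ "1 + C3", OF conjI]) (intro allI impI, rule main)
qed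

lemma Lipschitz_of_Hoelder:
  assumes par: "n \<ge> 1" "p \<le> q" "-1 < p" "0 < lam" "lam < Lam" "0 < \<alpha>" "\<alpha> \<le> 1" "Cf > 0"
    and C0: "C0 > 0" and \<beta>: "0 < \<beta>" "\<beta> < 1"
    and d: "q - p < 1 + \<beta> / (2 * (1 - \<beta>))" "q - p < \<alpha> / (1 - \<beta>)"
  defines "\<theta> \<equiv> Lipschitz_exponent (q - p) \<alpha> \<beta>"
  shows "\<exists>C>0. \<forall>F f u. structural n (B n 1) lam Lam p q \<alpha> C0 Cf F f \<longrightarrow> continuous_on (B n 1) u \<longrightarrow>
    visc_solution n (B n 1) F f u \<longrightarrow> u \<in> holder_space n \<beta> (B n 1) \<longrightarrow>
    u \<in> Lip n (B n (1/2)) \<and> Lip_norm n (B n (1/2)) u \<le> C * (holder_norm n \<beta> (B n 1) u + 1) powr \<theta>"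
proof -
  have \<theta>: "\<theta> \<ge> 1" by (simp add: \<theta>_def Lipschitz_exponent_def)
  from concavity_estimate_solution[OF par, of C0]
  obtain A where A: "A \<ge> 1" and ce: "\<forall>F f u. structural n (B n 1) lam Lam p q \<alpha> C0 Cf F f \<longrightarrow>
    visc_solution n (B n 1) F f u \<longrightarrow> concavity_estimate n A C0 (q - p) \<alpha> u" by (elim exE conjE)
  have "\<exists>C\<ge>1. \<forall>n u m. concavity_estimate n A C0 (q - p) \<alpha> u \<longrightarrow> continuous_on (B n 1) u \<longrightarrow> m \<ge> 1 \<longrightarrow>
    (\<forall>x\<in>cB n 0 (3/4). \<bar>u x\<bar> \<le> m) \<longrightarrow>
    (\<forall>x\<in>cB n 0 (3/4). \<forall>y\<in>cB n 0 (3/4). u x - u y \<le> m * vnorm n (x - y) powr \<beta>) \<longrightarrow>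
    (\<forall>x\<in>cB n 0 (1/2). \<forall>y\<in>cB n 0 (3/4). u x - u y \<le> C * m powr \<theta> * vnorm n (x - y))"
    unfolding \<theta>_def by (rule Lipschitz_estimate) (use par d \<beta> A C0 in auto)
  then obtain C2 where C2: "C2 \<ge> 1" and L: "\<forall>n u m. concavity_estimate n A C0 (q - p) \<alpha> u \<longrightarrow> continuous_on (B n 1) u \<longrightarrow> m \<ge> 1 \<longrightarrow>
    (\<forall>x\<in>cB n 0 (3/4). \<bar>u x\<bar> \<le> m) \<longrightarrow>
    (\<forall>x\<in>cB n 0 (3/4). \<forall>y\<in>cB n 0 (3/4). u x - u y \<le> m * vnorm n (x - y) powr \<beta>) \<longrightarrow>
    (\<forall>x\<in>cB n 0 (1/2). \<forall>y\<in>cB n 0 (3/4). u x - u y \<le> C2 * m powr \<theta> * vnorm n (x - y))"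
    by (elim exE conjE)
  have main: "u \<in> Lip n (B n (1/2)) \<and> Lip_norm n (B n (1/2)) u \<le> (1 + C2) * (holder_norm n \<beta> (B n 1) u + 1) powr \<theta>"
    if st: "structural n (B n 1) lam Lam p q \<alpha> C0 Cf F f" and u: "continuous_on (B n 1) u"
      and sol: "visc_solution n (B n 1) F f u" and us: "u \<in> holder_space n \<beta> (B n 1)" for F f u
  proof -
    note e = ce[rule_format, OF st sol]
    have one: "(0::real) < 1" by simp
    note hb = holder_norm_bounds[OF par(1) one us]
    define m where "m = holder_norm n \<beta> (B n 1) u + 1"
    have m1: "m \<ge> 1" using hb(1) by (simp add: m_def)
    have sub: "cB n 0 (3/4) \<subseteq> B n 1" "B n (1/2) \<subseteq> cB n 0 (1/2)" "B n (1/2) \<subseteq> cB n 0 (3/4)"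
      by (auto simp: cB_def B_def)
    have ml: "\<bar>u x\<bar> \<le> m" if "x \<in> cB n 0 (3/4)" for x
      using hb(2)[OF subsetD[OF sub(1) that]] by (simp add: m_def)
    have h: "u x - u y \<le> m * vnorm n (x - y) powr \<beta>" if "x \<in> cB n 0 (3/4)" "y \<in> cB n 0 (3/4)" for x y
    proof -
      have "u x - u y \<le> holder_norm n \<beta> (B n 1) u * vnorm n (x - y) powr \<beta>"
        by (rule hb(3)) (use that sub in auto)
      also have "\<dots> \<le> m * vnorm n (x - y) powr \<beta>" unfolding m_def by (intro mult_right_mono) simp_all
      finally show ?thesis .
    qed
    note l = L[rule_format, OF e u m1 ml h]
    have MB: "\<bar>u x\<bar> \<le> m" if "x \<in> B n (1/2)" for x by (rule ml) (use that sub in auto)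
    have LB: "u x - u y \<le> C2 * m powr \<theta> * vnorm n (x - y)" if "x \<in> B n (1/2)" "y \<in> B n (1/2)" for x y
      by (rule l) (use that sub in auto)
    have half: "(0::real) < 1 / 2" by simp
    note nl = Lip_norm_le[OF par(1) half MB LB]
    have "m \<le> m powr \<theta>" using powr_mono[OF \<theta> m1] m1 by simp
    then have "m + C2 * m powr \<theta> \<le> (1 + C2) * m powr \<theta>" by (simp add: distrib_right)
    then show ?thesis using nl unfolding m_def[symmetric] by linarith
  qed
  have "1 + C2 > 0" using C2 by linarith
  then show ?thesis by (rule exI[of _ "1 + C2", OF conjI]) (intro allI impI, rule main)
qed

theorem theorem1p1:
  shows
  "(\<exists>\<theta> :: real \<Rightarrow> real \<Rightarrow> real. (\<forall>d \<alpha>. \<theta> d \<alpha> \<ge> 1) \<and>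
     (\<forall>(n::nat) (lam::real) (Lam::real) (p::real) (q::real) (\<alpha>::real) (C0::real) (Cf::real).
        n \<ge> 1 \<and> -1 < p \<and> p \<le> q \<and> 0 < lam \<and> lam < Lam \<and> 0 < \<alpha> \<and> \<alpha> \<le> 1 \<and> C0 > 0 \<and> Cf > 0 \<and>
        q - p < \<alpha> \<longrightarrow>
        (\<exists>C>0. \<forall>F f u.
           structural n (B n 1) lam Lam p q \<alpha> C0 Cf F f \<and>
           continuous_on (B n 1) u \<and> visc_solution n (B n 1) F f u \<longrightarrow>
             u \<in> Lip n (B n (1/2)) \<and>
             (bounded (u ` B n 1) \<longrightarrow>
                Lip_norm n (B n (1/2)) u \<le> C * (sup_norm (B n 1) u + 1) powr \<theta> (q - p) \<alpha>))))
   \<and>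
   (\<exists>\<theta> :: real \<Rightarrow> real \<Rightarrow> real \<Rightarrow> real. (\<forall>d \<alpha> \<beta>. \<theta> d \<alpha> \<beta> \<ge> 1) \<and>
     (\<forall>(n::nat) (lam::real) (Lam::real) (p::real) (q::real) (\<alpha>::real) (\<beta>::real) (C0::real) (Cf::real).
        n \<ge> 1 \<and> -1 < p \<and> p \<le> q \<and> 0 < lam \<and> lam < Lam \<and> 0 < \<alpha> \<and> \<alpha> \<le> 1 \<and> C0 > 0 \<and> Cf > 0 \<and>
        0 < \<beta> \<and> \<beta> < 1 \<and> q - p < min (1 + \<beta> / (2 * (1 - \<beta>))) (\<alpha> / (1 - \<beta>)) \<longrightarrow>
        (\<exists>C>0. \<forall>F f u.
           structural n (B n 1) lam Lam p q \<alpha> C0 Cf F f \<and>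
           continuous_on (B n 1) u \<and> visc_solution n (B n 1) F f u \<and>
           u \<in> holder_space n \<beta> (B n 1) \<longrightarrow>
             u \<in> Lip n (B n (1/2)) \<and>
             Lip_norm n (B n (1/2)) u \<le> C * (holder_norm n \<beta> (B n 1) u + 1) powr \<theta> (q - p) \<alpha> \<beta>)))"
proof (intro conjI)
  define \<theta>1 where "\<theta>1 = (\<lambda>d \<alpha>. max 1 (Lipschitz_exponent d \<alpha> (1/2) / (\<alpha> - d)))"
  show "\<exists>\<theta> :: real \<Rightarrow> real \<Rightarrow> real. (\<forall>d \<alpha>. \<theta> d \<alpha> \<ge> 1) \<and>
     (\<forall>(n::nat) (lam::real) (Lam::real) (p::real) (q::real) (\<alpha>::real) (C0::real) (Cf::real).
        n \<ge> 1 \<and> -1 < p \<and> p \<le> q \<and> 0 < lam \<and> lam < Lam \<and> 0 < \<alpha> \<and> \<alpha> \<le> 1 \<and> C0 > 0 \<and> Cf > 0 \<and>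
        q - p < \<alpha> \<longrightarrow>
        (\<exists>C>0. \<forall>F f u.
           structural n (B n 1) lam Lam p q \<alpha> C0 Cf F f \<and>
           continuous_on (B n 1) u \<and> visc_solution n (B n 1) F f u \<longrightarrow>
             u \<in> Lip n (B n (1/2)) \<and>
             (bounded (u ` B n 1) \<longrightarrow>
                Lip_norm n (B n (1/2)) u \<le> C * (sup_norm (B n 1) u + 1) powr \<theta> (q - p) \<alpha>)))"
  proof (rule exI[of _ \<theta>1], intro conjI allI impI)
    show "\<theta>1 d \<alpha> \<ge> 1" for d \<alpha> by (simp add: \<theta>1_def)
    fix n :: nat and lam Lam p q \<alpha> C0 Cf :: real
    assume "n \<ge> 1 \<and> -1 < p \<and> p \<le> q \<and> 0 < lam \<and> lam < Lam \<and> 0 < \<alpha> \<and> \<alpha> \<le> 1 \<and> C0 > 0 \<and> Cf > 0 \<and> q - p < \<alpha>"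
    then have par: "n \<ge> 1" "p \<le> q" "-1 < p" "0 < lam" "lam < Lam" "0 < \<alpha>" "\<alpha> \<le> 1" "Cf > 0" "C0 > 0" "q - p < \<alpha>"
      by simp_all
    from Lipschitz_of_bounded[OF par]
    obtain C where C: "C > 0" and est: "\<forall>F f u M. structural n (B n 1) lam Lam p q \<alpha> C0 Cf F f \<longrightarrow> continuous_on (B n 1) u \<longrightarrow>
      visc_solution n (B n 1) F f u \<longrightarrow> M \<ge> 0 \<longrightarrow> (\<forall>x\<in>cB n 0 (7/8). \<bar>u x\<bar> \<le> M) \<longrightarrow>
      u \<in> Lip n (B n (1/2)) \<and> Lip_norm n (B n (1/2)) u \<le> C * (M + 1) powr \<theta>1 (q - p) \<alpha>"
      unfolding \<theta>1_def by (elim exE conjE)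
    have sub: "cB n 0 (7/8) \<subseteq> B n 1" by (auto simp: cB_def B_def)
    have main: "u \<in> Lip n (B n (1/2)) \<and> (bounded (u ` B n 1) \<longrightarrow>
        Lip_norm n (B n (1/2)) u \<le> C * (sup_norm (B n 1) u + 1) powr \<theta>1 (q - p) \<alpha>)"
      if st: "structural n (B n 1) lam Lam p q \<alpha> C0 Cf F f" and u: "continuous_on (B n 1) u"
        and sol: "visc_solution n (B n 1) F f u" for F f u
    proof (intro conjI impI)
      have "compact (u ` cB n 0 (7/8))"
        by (rule compact_continuous_image[OF continuous_on_subset[OF u sub] compact_cB])
      then have "bounded (u ` cB n 0 (7/8))" by (rule compact_imp_bounded)
      then obtain M where "M > 0" "\<forall>y\<in>u ` cB n 0 (7/8). norm y \<le> M" unfolding bounded_pos by (elim exE conjE)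
      then have M: "M \<ge> 0" "\<forall>x\<in>cB n 0 (7/8). \<bar>u x\<bar> \<le> M" by simp_all
      show "u \<in> Lip n (B n (1/2))" using est[rule_format, OF st u sol M(1)] M(2) by simp
      assume b: "bounded (u ` B n 1)"
      have N: "\<bar>u x\<bar> \<le> sup_norm (B n 1) u" if "x \<in> cB n 0 (7/8)" for x
        using b subsetD[OF sub that] by (rule abs_le_sup_norm)
      have N0: "sup_norm (B n 1) u \<ge> 0"
      proof -
        have "0 \<in> B n 1" using par(1) by (rule ball_two_points) simp
        then show ?thesis using abs_le_sup_norm[OF b, of 0] by linarith
      qed
      show "Lip_norm n (B n (1/2)) u \<le> C * (sup_norm (B n 1) u + 1) powr \<theta>1 (q - p) \<alpha>"
        using est[rule_format, OF st u sol N0 N] by (rule conjunct2)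
    qed
    show "\<exists>C>0. \<forall>F f u.
           structural n (B n 1) lam Lam p q \<alpha> C0 Cf F f \<and>
           continuous_on (B n 1) u \<and> visc_solution n (B n 1) F f u \<longrightarrow>
             u \<in> Lip n (B n (1/2)) \<and>
             (bounded (u ` B n 1) \<longrightarrow>
                Lip_norm n (B n (1/2)) u \<le> C * (sup_norm (B n 1) u + 1) powr \<theta>1 (q - p) \<alpha>)"
      by (rule exI[of _ C], rule conjI[OF C], intro allI impI, elim conjE, rule main)
  qed
next
  show "\<exists>\<theta> :: real \<Rightarrow> real \<Rightarrow> real \<Rightarrow> real. (\<forall>d \<alpha> \<beta>. \<theta> d \<alpha> \<beta> \<ge> 1) \<and>
     (\<forall>(n::nat) (lam::real) (Lam::real) (p::real) (q::real) (\<alpha>::real) (\<beta>::real) (C0::real) (Cf::real).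
        n \<ge> 1 \<and> -1 < p \<and> p \<le> q \<and> 0 < lam \<and> lam < Lam \<and> 0 < \<alpha> \<and> \<alpha> \<le> 1 \<and> C0 > 0 \<and> Cf > 0 \<and>
        0 < \<beta> \<and> \<beta> < 1 \<and> q - p < min (1 + \<beta> / (2 * (1 - \<beta>))) (\<alpha> / (1 - \<beta>)) \<longrightarrow>
        (\<exists>C>0. \<forall>F f u.
           structural n (B n 1) lam Lam p q \<alpha> C0 Cf F f \<and>
           continuous_on (B n 1) u \<and> visc_solution n (B n 1) F f u \<and>
           u \<in> holder_space n \<beta> (B n 1) \<longrightarrow>
             u \<in> Lip n (B n (1/2)) \<and>
             Lip_norm n (B n (1/2)) u \<le> C * (holder_norm n \<beta> (B n 1) u + 1) powr \<theta> (q - p) \<alpha> \<beta>))"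
  proof (rule exI[of _ Lipschitz_exponent], intro conjI allI impI)
    show "Lipschitz_exponent d \<alpha> \<beta> \<ge> 1" for d \<alpha> \<beta> by (simp add: Lipschitz_exponent_def)
    fix n :: nat and lam Lam p q \<alpha> \<beta> C0 Cf :: real
    assume h: "n \<ge> 1 \<and> -1 < p \<and> p \<le> q \<and> 0 < lam \<and> lam < Lam \<and> 0 < \<alpha> \<and> \<alpha> \<le> 1 \<and> C0 > 0 \<and> Cf > 0 \<and>
        0 < \<beta> \<and> \<beta> < 1 \<and> q - p < min (1 + \<beta> / (2 * (1 - \<beta>))) (\<alpha> / (1 - \<beta>))"
    then have par: "n \<ge> 1" "p \<le> q" "-1 < p" "0 < lam" "lam < Lam" "0 < \<alpha>" "\<alpha> \<le> 1" "Cf > 0" "C0 > 0"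
      "0 < \<beta>" "\<beta> < 1"
      by simp_all
    have d: "q - p < 1 + \<beta> / (2 * (1 - \<beta>))" "q - p < \<alpha> / (1 - \<beta>)"
      using h unfolding min_less_iff_conj by argo+
    from Lipschitz_of_Hoelder[OF par d]
    obtain C where C: "C > 0" and est: "\<forall>F f u. structural n (B n 1) lam Lam p q \<alpha> C0 Cf F f \<longrightarrow> continuous_on (B n 1) u \<longrightarrow>
      visc_solution n (B n 1) F f u \<longrightarrow> u \<in> holder_space n \<beta> (B n 1) \<longrightarrow>
      u \<in> Lip n (B n (1/2)) \<and> Lip_norm n (B n (1/2)) u \<le> C * (holder_norm n \<beta> (B n 1) u + 1) powr Lipschitz_exponent (q - p) \<alpha> \<beta>"
      by (elim exE conjE)
    show "\<exists>C>0. \<forall>F f u.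
           structural n (B n 1) lam Lam p q \<alpha> C0 Cf F f \<and>
           continuous_on (B n 1) u \<and> visc_solution n (B n 1) F f u \<and>
           u \<in> holder_space n \<beta> (B n 1) \<longrightarrow>
             u \<in> Lip n (B n (1/2)) \<and>
             Lip_norm n (B n (1/2)) u \<le> C * (holder_norm n \<beta> (B n 1) u + 1) powr Lipschitz_exponent (q - p) \<alpha> \<beta>"
      by (rule exI[of _ C], rule conjI[OF C], intro allI impI, elim conjE, rule est[rule_format])
  qed
qed

end
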